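(* Let $S_{1,0},S_{2,0},S_{3,0},S_{4,0}$ be real irreducible modules over $C\ell_{1,0},\dots,C\ell_{4,0}$, with Clifford maps $c_{i,0}:\mathbb{R}^i\to\mathrm{End}_{\mathbb{R}}(S_{i,0})$, and with intertwiner algebras identified with $\mathbb{R},\mathbb{R},\mathbb{C},\mathbb{H}$ respectively. Define $$S_{8,0}:=S_{4,0}\hat\otimes_{\mathbb{H}}S_{4,0},\qquad c_{8,0}(u,v):=c^R_{4,0}(u)\hat\otimes I+I\hat\otimes c^L_{4,0}(v)\quad(u,v\in\mathbb{R}^4),$$ and for $k\ge0$ $$S_{8k,0}:=(S_{8,0})^{\hat\otimes_{\mathbb{R}}^k},\quad S_{8k+r,0}:=S_{8k,0}\otimes_{\mathbb{R}}S_{r,0}\ (1\le r\le3),\quad S_{8k+4,0}:=S_{8k,0}\hat\otimes_{\mathbb{R}}S_{4,0},$$ $$S_{8k+5,0}:=S_{8k+4,0}\otimes_{\mathbb{R}}S_{1,0},\quad S_{8k+6,0}:=S_{8k+4,0}\otimes_{\mathbb{R}}S_{2,0},\quad S_{8k+7,0}:=S_{8k+4,0}\otimes_{\mathbb{C}}S_{3,0},$$ with Clifford maps given by the graded sum formulas in the context. Then for every $n\ge1$ the Clifford condition holds and $S_{n,0}$ is an irreducible $C\ell_{n,0}$-module. Whenever a factor $S_{1,0}$ occurs, replacing it by $-S_{1,0}:=(S_{1,0},-c_{1,0})$ gives the distinct (non-isomorphic) irreducible $C\ell_{n,0}$-module.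
   Context: $C\ell_{n,0}$ is the unital real Clifford algebra of $\mathbb{R}^n$ with the negative definite form $g_{n,0}=-\langle\cdot,\cdot\rangle$ and relations $v\cdot w+w\cdot v=-2g_{n,0}(v,w)=2\langle v,w\rangle$. The Clifford condition for a linear map $c:\mathbb{R}^n\to\mathrm{End}_{\mathbb{R}}(S)$ is $c(v)c(w)+c(w)c(v)=-2g_{n,0}(v,w)$. $S_{i,0}$ is regarded as a right module (Clifford map denoted $c^R_{i,0}$) or left module (Clifford map $c^L_{i,0}$) over its intertwiner algebra $\mathbb{K}_{i,0}$, using $\mathbb{K}_{i,0}\cong\mathbb{K}_{i,0}^{op}$. For $n\equiv0\pmod4$ the volume element $\boldsymbol\nu=e_1\cdots e_n$ squares to $1$, and a module $M$ is $\mathbb{Z}_2$-graded by $M^\pm=(1\pm\boldsymbol\nu)M$. Graded tensor products carry the total grading, with $(T\hat\otimes S)(m\otimes n)=(-1)^{\deg S\deg m}Tm\otimes Sn$. If the second factor is ungraded, $I\hat\otimes c(v)$ denotes $\pm I\otimes c(v)$ on $M^\pm\otimes N$. $S_{0,0}=\mathbb{R}$, purely even, with zero Clifford map. The Clifford maps are: - $c_{8k,0}(u_1,\dots,u_k)=\sum_jI^{\hat\otimes(j-1)}\hat\otimes c_{8,0}(u_j)\hat\otimes I^{\hat\otimes(k-j)}$; - $c_{8k+r,0}(u,v)=c_{8k,0}(u)\otimes I+I\hat\otimes c^R_{r,0}(v)$ for $1\le r\le4$; - $c_{8k+r,0}(u,v)=c_{8k+4,0}(u)\otimes I+I\hat\otimes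 c^L_{r-4,0}(v)$ for $5\le r\le7$. $S_{8k+4,0}$ has the right $\mathbb{H}$-action inherited from $S_{4,0}$, restricted along a fixed unital embedding $\mathbb{C}\subset\mathbb{H}$ for $r=7$. *)

theory Defs
  imports "Jordan_Normal_Form.VS_Connect" "HOL-Algebra.QuotRing" Complex_Main
begin

section \<open>Quaternions\<close>

datatype quat = Quat (qRe: real) (qI: real) (qJ: real) (qK: real)

instantiation quat :: real_algebra_1
begin

definition "0 = Quat 0 0 0 0"
definition "1 = Quat 1 0 0 0"
definition "p + q = Quat (qRe p + qRe q) (qI p + qI q) (qJ p + qJ q) (qK p + qK q)"
definition "- p = Quat (- qRe p) (- qI p) (- qJ p) (- qK p)"
definition "p - q = Quat (qRe p - qRe q) (qI p - qI q) (qJ p - qJ q) (qK p - qK q)"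
definition "scaleR a p = Quat (a * qRe p) (a * qI p) (a * qJ p) (a * qK p)"
definition "p * q = Quat
  (qRe p * qRe q - qI p * qI q - qJ p * qJ q - qK p * qK q)
  (qRe p * qI q + qI p * qRe q + qJ p * qK q - qK p * qJ q)
  (qRe p * qJ q - qI p * qK q + qJ p * qRe q + qK p * qI q)
  (qRe p * qK q + qI p * qJ q - qJ p * qI q + qK p * qRe q)"

instance
  by standard
    (auto simp: zero_quat_def one_quat_def plus_quat_def uminus_quat_def minus_quat_def
      scaleR_quat_def times_quat_def algebra_simps intro: quat.expand)

end

definition real_algebra_hom :: "('k::real_algebra_1 \<Rightarrow> 'l::real_algebra_1) \<Rightarrow> bool" where
  "real_algebra_hom f \<longleftrightarrow> linear f \<and> f 1 = 1 \<and> (\<forall>p q. f (p * q) = f p * f q)"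

definition anti_automorphism :: "('k::real_algebra_1 \<Rightarrow> 'k) \<Rightarrow> bool" where
  "anti_automorphism f \<longleftrightarrow> linear f \<and> bij f \<and> f 1 = 1 \<and> (\<forall>p q. f (p * q) = f q * f p)"


section \<open>Free and quotient vector spaces\<close>

text \<open>A real vector space is a module record \<open>V\<close> with \<open>vectorspace class_ring V\<close>. The fields
  \<open>mult\<close> and \<open>one\<close>, which such a record inherits from rings, play no role.\<close>

definition free_space :: "'x set \<Rightarrow> (real, 'x \<Rightarrow> real) module" where
  "free_space X =
    \<lparr> carrier = {f. finite {x. f x \<noteq> 0} \<and> {x. f x \<noteq> 0} \<subseteq> X},
      mult = undefined, one = undefined,
      zero = (\<lambda>_. 0), add = (\<lambda>f g x. f x + g x), smult = (\<lambda>a f x. a * f x) \<rparr>"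

definition gen :: "'x \<Rightarrow> 'x \<Rightarrow> real" where
  "gen x = (\<lambda>y. if y = x then 1 else 0)"

definition free_map :: "('x \<Rightarrow> 'y) \<Rightarrow> ('x \<Rightarrow> real) \<Rightarrow> 'y \<Rightarrow> real" where
  "free_map h f = (\<lambda>y. \<Sum>x | f x \<noteq> 0 \<and> h x = y. f x)"

definition quotient_space :: "(real, 'a) module \<Rightarrow> 'a set \<Rightarrow> (real, 'a set) module" where
  "quotient_space V W =
    \<lparr> carrier = a_rcosets\<^bsub>V\<^esub> W,
      mult = undefined, one = undefined,
      zero = W, add = (<+>\<^bsub>V\<^esub>), smult = (\<lambda>a A. \<Union>x\<in>A. W +>\<^bsub>V\<^esub> (a \<odot>\<^bsub>V\<^esub> x)) \<rparr>"

definition quotient_map :: "(real, 'a) module \<Rightarrow> 'a set \<Rightarrow> ('a \<Rightarrow> 'a) \<Rightarrow> 'a set \<Rightarrow> 'a set" where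
  "quotient_map V W f A = (\<Union>x\<in>A. W +>\<^bsub>V\<^esub> f x)"


section \<open>Tensor products\<close>

text \<open>In \<open>M \<otimes>\<^sub>K N\<close> the algebra \<open>K\<close> acts on \<open>M\<close> from the right by \<open>r\<close>
  (\<open>r q m\<close> is \<open>m q\<close>) and on \<open>N\<close> from the left by \<open>l\<close>.\<close>

definition tensor_rels ::
  "(real, 'm) module \<Rightarrow> ('k \<Rightarrow> 'm \<Rightarrow> 'm) \<Rightarrow> (real, 'n) module \<Rightarrow> ('k \<Rightarrow> 'n \<Rightarrow> 'n)
    \<Rightarrow> ('m \<times> 'n \<Rightarrow> real) set" where
  "tensor_rels M r N l =
    {(\<lambda>p. gen (m \<oplus>\<^bsub>M\<^esub> m', n) p - gen (m, n) p - gen (m', n) p) | m m' n.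
      m \<in> carrier M \<and> m' \<in> carrier M \<and> n \<in> carrier N} \<union>
    {(\<lambda>p. gen (m, n \<oplus>\<^bsub>N\<^esub> n') p - gen (m, n) p - gen (m, n') p) | m n n'.
      m \<in> carrier M \<and> n \<in> carrier N \<and> n' \<in> carrier N} \<union>
    {(\<lambda>p. gen (a \<odot>\<^bsub>M\<^esub> m, n) p - a * gen (m, n) p) | a m n.
      m \<in> carrier M \<and> n \<in> carrier N} \<union>
    {(\<lambda>p. gen (m, a \<odot>\<^bsub>N\<^esub> n) p - a * gen (m, n) p) | a m n.
      m \<in> carrier M \<and> n \<in> carrier N} \<union>
    {(\<lambda>p. gen (r q m, n) p - gen (m, l q n) p) | q m n.
      m \<in> carrier M \<and> n \<in> carrier N}"

definition tensor_kernel where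
  "tensor_kernel M r N l =
    LinearCombinations.module.span class_ring (free_space (carrier M \<times> carrier N)) (tensor_rels M r N l)"

definition tensor ::
  "(real, 'm) module \<Rightarrow> ('k \<Rightarrow> 'm \<Rightarrow> 'm) \<Rightarrow> (real, 'n) module \<Rightarrow> ('k \<Rightarrow> 'n \<Rightarrow> 'n)
    \<Rightarrow> (real, ('m \<times> 'n \<Rightarrow> real) set) module" where
  "tensor M r N l =
    quotient_space (free_space (carrier M \<times> carrier N)) (tensor_kernel M r N l)"

definition tensor_map where
  "tensor_map M r N l f g =
    quotient_map (free_space (carrier M \<times> carrier N)) (tensor_kernel M r N l)
      (free_map (map_prod f g))"

text \<open>The \<open>k\<close>-fold tensor power over \<open>\<real>\<close>; for \<open>k = 0\<close> it is the line spanned by the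
  empty tensor.\<close>

definition power_rels :: "nat \<Rightarrow> (real, 'a) module \<Rightarrow> ('a list \<Rightarrow> real) set" where
  "power_rels k V =
    {(\<lambda>p. gen (xs[i := x \<oplus>\<^bsub>V\<^esub> y]) p - gen (xs[i := x]) p - gen (xs[i := y]) p) | xs i x y.
      length xs = k \<and> set xs \<subseteq> carrier V \<and> i < k \<and> x \<in> carrier V \<and> y \<in> carrier V} \<union>
    {(\<lambda>p. gen (xs[i := a \<odot>\<^bsub>V\<^esub> x]) p - a * gen (xs[i := x]) p) | xs i a x.
      length xs = k \<and> set xs \<subseteq> carrier V \<and> i < k \<and> x \<in> carrier V}"

definition power_free :: "nat \<Rightarrow> (real, 'a) module \<Rightarrow> (real, 'a list \<Rightarrow> real) module" where
  "power_free k V = free_space {xs. length xs = k \<and> set xs \<subseteq> carrier V}"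

definition power_kernel :: "nat \<Rightarrow> (real, 'a) module \<Rightarrow> ('a list \<Rightarrow> real) set" where
  "power_kernel k V = LinearCombinations.module.span class_ring (power_free k V) (power_rels k V)"

definition tensor_power ::
  "nat \<Rightarrow> (real, 'a) module \<Rightarrow> (real, ('a list \<Rightarrow> real) set) module" where
  "tensor_power k V = quotient_space (power_free k V) (power_kernel k V)"

text \<open>The operator \<open>f 0 \<otimes> \<dots> \<otimes> f (k - 1)\<close>.\<close>

definition tensor_power_map ::
  "nat \<Rightarrow> (real, 'a) module \<Rightarrow> (nat \<Rightarrow> 'a \<Rightarrow> 'a)
    \<Rightarrow> ('a list \<Rightarrow> real) set \<Rightarrow> ('a list \<Rightarrow> real) set" where
  "tensor_power_map k V f =
    quotient_map (power_free k V) (power_kernel k V)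
      (free_map (\<lambda>xs. map (\<lambda>i. f i (xs ! i)) [0..<k]))"


section \<open>The Clifford algebra and its modules\<close>

text \<open>The free unital real algebra on the set \<open>\<real>\<^sup>n\<close>: words with concatenation.\<close>

definition word_algebra :: "nat \<Rightarrow> (real vec list \<Rightarrow> real) ring" where
  "word_algebra n =
    \<lparr> carrier = {f. finite {w. f w \<noteq> 0} \<and> {w. f w \<noteq> 0} \<subseteq> lists (carrier_vec n)},
      mult = (\<lambda>f g w. \<Sum>i\<le>length w. f (take i w) * g (drop i w)),
      one = gen [],
      zero = (\<lambda>_. 0), add = (\<lambda>f g w. f w + g w) \<rparr>"

definition cform :: "real vec \<Rightarrow> real vec \<Rightarrow> real" where
  "cform v w = - (v \<bullet> w)"

definition clifford_rels :: "nat \<Rightarrow> (real vec list \<Rightarrow> real) set" where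
  "clifford_rels n =
    {(\<lambda>p. gen [v + w] p - gen [v] p - gen [w] p) | v w.
      v \<in> carrier_vec n \<and> w \<in> carrier_vec n} \<union>
    {(\<lambda>p. gen [a \<cdot>\<^sub>v v] p - a * gen [v] p) | a v. v \<in> carrier_vec n} \<union>
    {(\<lambda>p. gen [v, w] p + gen [w, v] p - (- 2 * cform v w) * gen [] p) | v w.
      v \<in> carrier_vec n \<and> w \<in> carrier_vec n}"

definition clifford_ideal :: "nat \<Rightarrow> (real vec list \<Rightarrow> real) set" where
  "clifford_ideal n = genideal (word_algebra n) (clifford_rels n)"

definition Cl :: "nat \<Rightarrow> (real vec list \<Rightarrow> real) set ring" where
  "Cl n = word_algebra n Quot clifford_ideal n"

definition Cl_of_real :: "nat \<Rightarrow> real \<Rightarrow> (real vec list \<Rightarrow> real) set" where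
  "Cl_of_real n a = clifford_ideal n +>\<^bsub>word_algebra n\<^esub> (\<lambda>w. a * gen [] w)"

definition Cl_module ::
  "nat \<Rightarrow> (real, 'a) module \<Rightarrow> ((real vec list \<Rightarrow> real) set \<Rightarrow> 'a \<Rightarrow> 'a) \<Rightarrow> bool" where
  "Cl_module n V act \<longleftrightarrow>
    vectorspace class_ring V \<and>
    (\<forall>X\<in>carrier (Cl n). linear_map class_ring V V (act X)) \<and>
    (\<forall>X\<in>carrier (Cl n). \<forall>Y\<in>carrier (Cl n). \<forall>s\<in>carrier V.
      act (X \<oplus>\<^bsub>Cl n\<^esub> Y) s = act X s \<oplus>\<^bsub>V\<^esub> act Y s \<and>
      act (X \<otimes>\<^bsub>Cl n\<^esub> Y) s = act X (act Y s)) \<and>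
    (\<forall>s\<in>carrier V. act \<one>\<^bsub>Cl n\<^esub> s = s) \<and>
    (\<forall>a. \<forall>s\<in>carrier V. act (Cl_of_real n a) s = a \<odot>\<^bsub>V\<^esub> s)"

definition Cl_submodule where
  "Cl_submodule n V act W \<longleftrightarrow>
    subspace class_ring W V \<and> (\<forall>X\<in>carrier (Cl n). \<forall>s\<in>W. act X s \<in> W)"

definition irreducible_Cl_module where
  "irreducible_Cl_module n V act \<longleftrightarrow>
    Cl_module n V act \<and> carrier V \<noteq> {\<zero>\<^bsub>V\<^esub>} \<and>
    (\<forall>W. Cl_submodule n V act W \<longrightarrow> W = {\<zero>\<^bsub>V\<^esub>} \<or> W = carrier V)"

definition intertwiners where
  "intertwiners n V act V' act' =
    {T. linear_map class_ring V V' T \<and>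
      (\<forall>X\<in>carrier (Cl n). \<forall>s\<in>carrier V. T (act X s) = act' X (T s))}"


section \<open>Clifford maps\<close>

record 'a rep =
  space :: "(real, 'a) module"
  cmap :: "real vec \<Rightarrow> 'a \<Rightarrow> 'a"

definition clifford_condition :: "nat \<Rightarrow> ('a, 'z) rep_scheme \<Rightarrow> bool" where
  "clifford_condition n M \<longleftrightarrow>
    (\<forall>v\<in>carrier_vec n. \<forall>w\<in>carrier_vec n. \<forall>s\<in>carrier (space M).
      cmap M v (cmap M w s) \<oplus>\<^bsub>space M\<^esub> cmap M w (cmap M v s)
        = (- 2 * cform v w) \<odot>\<^bsub>space M\<^esub> s)"

definition clifford_map :: "nat \<Rightarrow> ('a, 'z) rep_scheme \<Rightarrow> bool" where
  "clifford_map n M \<longleftrightarrow>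
    vectorspace class_ring (space M) \<and>
    (\<forall>v\<in>carrier_vec n. linear_map class_ring (space M) (space M) (cmap M v)) \<and>
    (\<forall>v\<in>carrier_vec n. \<forall>w\<in>carrier_vec n. \<forall>s\<in>carrier (space M).
      cmap M (v + w) s = cmap M v s \<oplus>\<^bsub>space M\<^esub> cmap M w s) \<and>
    (\<forall>a. \<forall>v\<in>carrier_vec n. \<forall>s\<in>carrier (space M).
      cmap M (a \<cdot>\<^sub>v v) s = a \<odot>\<^bsub>space M\<^esub> cmap M v s) \<and>
    clifford_condition n M"

text \<open>The action of \<open>Cl n\<close> induced by a Clifford map \<open>c\<close>: the class of a word
  \<open>[v\<^sub>1, \<dots>, v\<^sub>m]\<close> acts as \<open>c v\<^sub>1 \<circ> \<dots> \<circ> c v\<^sub>m\<close>. If \<open>c\<close> is a Clifford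
  map, all representatives of a class act alike.\<close>

definition word_act :: "('a, 'z) rep_scheme \<Rightarrow> (real vec list \<Rightarrow> real) \<Rightarrow> 'a \<Rightarrow> 'a" where
  "word_act M x s =
    (\<Oplus>\<^bsub>space M\<^esub>w\<in>{w. x w \<noteq> 0}. x w \<odot>\<^bsub>space M\<^esub> foldr (cmap M) w s)"

definition Cl_act :: "('a, 'z) rep_scheme \<Rightarrow> (real vec list \<Rightarrow> real) set \<Rightarrow> 'a \<Rightarrow> 'a" where
  "Cl_act M X s = the_elem ((\<lambda>x. word_act M x s) ` X)"

definition irreducible_rep :: "nat \<Rightarrow> ('a, 'z) rep_scheme \<Rightarrow> bool" where
  "irreducible_rep n M \<longleftrightarrow> clifford_map n M \<and> irreducible_Cl_module n (space M) (Cl_act M)"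

definition isomorphic_reps :: "nat \<Rightarrow> ('a, 'y) rep_scheme \<Rightarrow> ('b, 'z) rep_scheme \<Rightarrow> bool" where
  "isomorphic_reps n M N \<longleftrightarrow>
    (\<exists>T\<in>intertwiners n (space M) (Cl_act M) (space N) (Cl_act N).
      bij_betw T (carrier (space M)) (carrier (space N)))"

text \<open>\<open>\<phi>\<close> is an isomorphism of real algebras from \<open>K\<close> to the intertwiner algebra of
  \<open>M\<close>, whose elements are compared on the carrier.\<close>

definition intertwiner_algebra_iso ::
  "nat \<Rightarrow> ('a, 'z) rep_scheme \<Rightarrow> ('k::real_algebra_1 \<Rightarrow> 'a \<Rightarrow> 'a) \<Rightarrow> bool" where
  "intertwiner_algebra_iso n M \<phi> \<longleftrightarrow>
    (let E = intertwiners n (space M) (Cl_act M) (space M) (Cl_act M) in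
      (\<forall>q. \<phi> q \<in> E) \<and>
      (\<forall>T\<in>E. \<exists>!q. \<forall>s\<in>carrier (space M). T s = \<phi> q s)) \<and>
    (\<forall>s\<in>carrier (space M).
      \<phi> 1 s = s \<and>
      (\<forall>a q. \<phi> (a *\<^sub>R q) s = a \<odot>\<^bsub>space M\<^esub> \<phi> q s) \<and>
      (\<forall>p q. \<phi> (p + q) s = \<phi> p s \<oplus>\<^bsub>space M\<^esub> \<phi> q s \<and> \<phi> (p * q) s = \<phi> p (\<phi> q s)))"

definition neg_rep :: "'a rep \<Rightarrow> 'a rep" where
  "neg_rep M = M\<lparr>cmap := \<lambda>v s. \<ominus>\<^bsub>space M\<^esub> cmap M v s\<rparr>"


section \<open>Graded tensor products of Clifford modules\<close>

text \<open>A \<open>\<int>\<^sub>2\<close>-grading is recorded by its parity operator \<open>m \<mapsto> (-1)\<^bsup>deg m\<^esup> m\<close>.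
  For \<open>M\<^sup>\<plusminus> = (1 \<plusminus> \<nu>) M\<close> with \<open>\<nu>\<^sup>2 = 1\<close> this is \<open>\<nu>\<close>; for the total
  grading of a tensor product it is the tensor product of the parity operators.\<close>

record 'a graded_rep = "'a rep" +
  parity :: "'a \<Rightarrow> 'a"

definition volume :: "nat \<Rightarrow> ('a, 'z) rep_scheme \<Rightarrow> 'a \<Rightarrow> 'a" where
  "volume n M = foldr (cmap M) (map (unit_vec n) [0..<n])"

definition graded_by_volume :: "nat \<Rightarrow> 'a rep \<Rightarrow> 'a graded_rep" where
  "graded_by_volume n M = \<lparr> space = space M, cmap = cmap M, parity = volume n M \<rparr>"

definition ungraded :: "'a rep \<Rightarrow> 'a graded_rep" where
  "ungraded M = \<lparr> space = space M, cmap = cmap M, parity = id \<rparr>"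

text \<open>\<open>T \<otimes> S\<close> in the graded sense, with \<open>S\<close> of degree \<open>d\<close>:
  \<open>m \<otimes> n \<mapsto> (-1)\<^bsup>d deg m\<^esup> T m \<otimes> S n\<close>. The grading of the second factor does not
  enter.\<close>

definition graded_tensor_map where
  "graded_tensor_map M r N l T d S =
    tensor_map (space M) r (space N) l (T \<circ> (parity M ^^ d)) S"

text \<open>\<open>M \<otimes>\<^sub>K N\<close> with Clifford map
  \<open>c (u, v) = c\<^sub>M u \<otimes> I + I \<otimes> c\<^sub>N v\<close> on \<open>\<real>\<^sup>p \<times> \<real>\<^sup>q\<close>.\<close>

definition rep_tensor ::
  "nat \<Rightarrow> nat \<Rightarrow> 'm graded_rep \<Rightarrow> ('k \<Rightarrow> 'm \<Rightarrow> 'm) \<Rightarrow> 'n graded_rep \<Rightarrow> ('k \<Rightarrow> 'n \<Rightarrow> 'n)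
    \<Rightarrow> ('m \<times> 'n \<Rightarrow> real) set graded_rep" where
  "rep_tensor p q M r N l =
    \<lparr> space = tensor (space M) r (space N) l,
      cmap = (\<lambda>w t.
        graded_tensor_map M r N l (cmap M (vec_first w p)) 0 id t
        \<oplus>\<^bsub>tensor (space M) r (space N) l\<^esub>
        graded_tensor_map M r N l id 1 (cmap N (vec_last w q)) t),
      parity = tensor_map (space M) r (space N) l (parity M) (parity N) \<rparr>"

definition rep_tensor_real ::
  "nat \<Rightarrow> nat \<Rightarrow> 'm graded_rep \<Rightarrow> 'n graded_rep \<Rightarrow> ('m \<times> 'n \<Rightarrow> real) set graded_rep" where
  "rep_tensor_real p q M N = rep_tensor p q M (smult (space M)) N (smult (space N))"

text \<open>\<open>j\<close>-th summand of the Clifford map below: the odd operator \<open>c u\<^sub>j\<close> in position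
  \<open>j\<close> contributes the sign \<open>(-1)\<^bsup>deg m\<^esup>\<close> for each factor \<open>m\<close> to its left.\<close>

definition rep_power :: "nat \<Rightarrow> nat \<Rightarrow> 'a graded_rep \<Rightarrow> ('a list \<Rightarrow> real) set graded_rep" where
  "rep_power p k M =
    \<lparr> space = tensor_power k (space M),
      cmap = (\<lambda>u t. \<Oplus>\<^bsub>tensor_power k (space M)\<^esub>j\<in>{..<k}.
        tensor_power_map k (space M)
          (\<lambda>i. if i < j then parity M
               else if i = j then cmap M (vec p (\<lambda>m. u $ (p * j + m)))
               else id) t),
      parity = tensor_power_map k (space M) (\<lambda>_. parity M) \<rparr>"


section \<open>The spinor modules\<close>

text \<open>Throughout, \<open>M\<close> is the module for \<open>n = 4\<close>, graded by its volume element, \<open>r\<close> is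
  its right and \<open>l\<close> its left \<open>\<H>\<close>-action.\<close>

type_synonym 'a spinor8 = "('a \<times> 'a \<Rightarrow> real) set"
type_synonym 'a spinor8k = "('a spinor8 list \<Rightarrow> real) set"
type_synonym ('a, 'b) spinor8k_plus = "('a spinor8k \<times> 'b \<Rightarrow> real) set"

definition S8 ::
  "'d graded_rep \<Rightarrow> (quat \<Rightarrow> 'd \<Rightarrow> 'd) \<Rightarrow> (quat \<Rightarrow> 'd \<Rightarrow> 'd) \<Rightarrow> 'd spinor8 graded_rep" where
  "S8 M r l = rep_tensor 4 4 M r M l"

definition S8k ::
  "nat \<Rightarrow> 'd graded_rep \<Rightarrow> (quat \<Rightarrow> 'd \<Rightarrow> 'd) \<Rightarrow> (quat \<Rightarrow> 'd \<Rightarrow> 'd)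
    \<Rightarrow> 'd spinor8k graded_rep" where
  "S8k k M r l = rep_power 8 k (S8 M r l)"

text \<open>For \<open>n = 8 k + i\<close> with \<open>1 \<le> i \<le> 4\<close>; \<open>N\<close> is the module for \<open>i\<close>.\<close>

definition S8k_plus ::
  "nat \<Rightarrow> nat \<Rightarrow> 'd graded_rep \<Rightarrow> (quat \<Rightarrow> 'd \<Rightarrow> 'd) \<Rightarrow> (quat \<Rightarrow> 'd \<Rightarrow> 'd)
    \<Rightarrow> 'n graded_rep \<Rightarrow> ('d, 'n) spinor8k_plus graded_rep" where
  "S8k_plus k i M r l N = rep_tensor_real (8 * k) i (S8k k M r l) N"

text \<open>For \<open>n = 8 k + 4 + i\<close> with \<open>i = 1, 2\<close>.\<close>

definition S8k4_plus ::
  "nat \<Rightarrow> nat \<Rightarrow> 'd graded_rep \<Rightarrow> (quat \<Rightarrow> 'd \<Rightarrow> 'd) \<Rightarrow> (quat \<Rightarrow> 'd \<Rightarrow> 'd)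
    \<Rightarrow> 'n graded_rep \<Rightarrow> (('d, 'd) spinor8k_plus \<times> 'n \<Rightarrow> real) set graded_rep" where
  "S8k4_plus k i M r l N = rep_tensor_real (8 * k + 4) i (S8k_plus k 4 M r l M) N"

definition right_H_action ::
  "nat \<Rightarrow> 'd graded_rep \<Rightarrow> (quat \<Rightarrow> 'd \<Rightarrow> 'd) \<Rightarrow> (quat \<Rightarrow> 'd \<Rightarrow> 'd)
    \<Rightarrow> quat \<Rightarrow> ('d, 'd) spinor8k_plus \<Rightarrow> ('d, 'd) spinor8k_plus" where
  "right_H_action k M r l q =
    tensor_map (space (S8k k M r l)) (smult (space (S8k k M r l)))
      (space M) (smult (space M)) id (r q)"

text \<open>For \<open>n = 8 k + 7\<close>: \<open>\<iota>\<close> embeds \<open>\<complex>\<close> into \<open>\<H>\<close>, and \<open>\<phi>\<close> is the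
  \<open>\<complex>\<close>-action on the module \<open>N\<close> for \<open>n = 3\<close>.\<close>

definition S8k7 ::
  "nat \<Rightarrow> 'd graded_rep \<Rightarrow> (quat \<Rightarrow> 'd \<Rightarrow> 'd) \<Rightarrow> (quat \<Rightarrow> 'd \<Rightarrow> 'd)
    \<Rightarrow> (complex \<Rightarrow> quat) \<Rightarrow> 'c graded_rep \<Rightarrow> (complex \<Rightarrow> 'c \<Rightarrow> 'c)
    \<Rightarrow> (('d, 'd) spinor8k_plus \<times> 'c \<Rightarrow> real) set graded_rep" where
  "S8k7 k M r l \<iota> N \<phi> =
    rep_tensor (8 * k + 4) 3 (S8k_plus k 4 M r l M)
      (\<lambda>z. right_H_action k M r l (\<iota> z)) N \<phi>"

end

theory Submission
  imports Defs "HOL-Library.Function_Algebras"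
begin

text \<open>A Clifford map for \<open>\<real>\<^sup>n\<close> is the same as \<open>n\<close> anticommuting involutions
  \<open>\<gamma> 0, \<dots>, \<gamma> (n - 1)\<close>, the images of the unit vectors, and irreducibility of the Clifford
  module means that no proper nonzero subspace is stable under all of them
  (\<open>irreducible_iff\<close>). Everything is proved for such systems of involutions, over vector
  spaces of any dimension.

  The source of all commutation facts is the extended Hamming code. In each block of eight generators
  the four products \<open>0123\<close>, \<open>0145\<close>, \<open>0167\<close>, \<open>0246\<close> are commuting involutions, because the
  code words have even overlaps and weight 4. For each of the products some further word
  anticommutes with it and commutes with the others, so their joint \<open>+1\<close> eigenspace is nonzero
  in every nonzero stable subspace (\<open>code_fixed_exists\<close>); call its elements minimal vectors. The
  code is self-dual: a word that commutes with all code words is itself a code word up to sign, and acts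
  on a minimal vector \<open>z\<close> by \<open>\<plusminus>1\<close>. Every other word moves \<open>z\<close> to a different joint
  eigenspace. Hence for \<open>n = 8 k\<close> the projection to the joint \<open>+1\<close> eigenspace maps the
  subspace generated by \<open>z\<close> onto the line \<open>\<real> z\<close>. For \<open>8 k < n \<le> 8 k + 4\<close> one adds the
  involution \<open>\<gamma> (8 k)\<close> to the commuting family, and the even words in the remaining generators, at
  most three in number, turn the line into one over \<open>\<real>\<close>, \<open>\<real>\<close>, \<open>\<complex>\<close>, \<open>\<H>\<close>
  for \<open>n - 8 k = 1, 2, 3, 4\<close> (\<open>projs_cyc\<close>).

  Two consequences drive the rest. A system for \<open>n = 8 k\<close> generated by a minimal vector is
  irreducible (\<open>cyclic_minimal_irr\<close>). And two irreducible systems with minimal vectors \<open>x\<close> and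
  \<open>x'\<close> are isomorphic by a map that takes \<open>x\<close> to \<open>x'\<close>: the subspace of the direct sum
  generated by \<open>(x, x')\<close> is its graph (\<open>minimal_vector_iso\<close>). In particular, for
  \<open>2 \<le> n \<le> 4\<close> the \<open>+1\<close> eigenspace of \<open>\<gamma> 0\<close> on an irreducible module is a line over
  the intertwiner algebra (\<open>eigenline\<close>).

  A graded tensor product \<open>M \<otimes> N\<close> of irreducible modules is irreducible in two situations. If
  \<open>M\<close> is a module for \<open>n = 8 k\<close>, projecting to the minimal vectors of \<open>M\<close> turns a vector
  of a stable subspace into a pure tensor \<open>z \<otimes> n\<close> (\<open>irr_left\<close>). If a generator projects
  \<open>N\<close> onto a line \<open>K n\<^sub>0\<close> over the algebra \<open>K\<close> of the tensor product, the same generator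
  yields a pure tensor \<open>m \<otimes> n\<^sub>0\<close> (\<open>irr_right\<close>). From a pure tensor, irreducibility of the
  factors gives everything. The second criterion covers \<open>8\<close> and \<open>8 k + 5\<close>,
  \<open>8 k + 6\<close>, \<open>8 k + 7\<close>, the first \<open>8 k + 2\<close>, \<open>8 k + 3\<close>, \<open>8 k + 4\<close>;
  \<open>8 k + 1\<close> goes along with \<open>8 k + 5\<close>. For the tensor powers, the power of a minimal
  vector is minimal and generates (\<open>irr_power\<close>). The tensor products over \<open>\<H>\<close> and
  \<open>\<complex>\<close> are nonzero because products of quaternion-valued functionals on the two factors
  detect pure tensors (\<open>carrier_nonzero_quat\<close>).

  For \<open>n = p + 1\<close> with \<open>p\<close> divisible by 4, the last generator times the product of
  the others is a central involution, so on an irreducible module it is a sign. The sign distinguishes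
  the two modules built from \<open>S\<^sub>1\<close> and \<open>- S\<^sub>1\<close>; given the sign, \<open>minimal_vector_iso\<close> applied to
  the first \<open>p\<close> generators shows that the module is unique (\<open>two_irreducibles\<close>).\<close>

section \<open>Real vector spaces given by records\<close>

abbreviation rvs :: "(real, 'a) module \<Rightarrow> bool" where
  "rvs V \<equiv> vectorspace (class_ring :: real ring) V"

definition lin :: "(real, 'a) module \<Rightarrow> (real, 'b) module \<Rightarrow> ('a \<Rightarrow> 'b) \<Rightarrow> bool" where
  "lin V V' T \<longleftrightarrow>
    (\<forall>x\<in>carrier V. T x \<in> carrier V') \<and>
    (\<forall>x\<in>carrier V. \<forall>y\<in>carrier V. T (x \<oplus>\<^bsub>V\<^esub> y) = T x \<oplus>\<^bsub>V'\<^esub> T y) \<and>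
    (\<forall>a. \<forall>x\<in>carrier V. T (a \<odot>\<^bsub>V\<^esub> x) = a \<odot>\<^bsub>V'\<^esub> T x)"

definition subsp :: "'a set \<Rightarrow> (real, 'a) module \<Rightarrow> bool" where
  "subsp W V \<longleftrightarrow> W \<subseteq> carrier V \<and> \<zero>\<^bsub>V\<^esub> \<in> W \<and>
    (\<forall>x\<in>W. \<forall>y\<in>W. x \<oplus>\<^bsub>V\<^esub> y \<in> W) \<and> (\<forall>a. \<forall>x\<in>W. a \<odot>\<^bsub>V\<^esub> x \<in> W)"

lemma rvs_module: "rvs V \<Longrightarrow> Module.module class_ring V"
  by (simp add: vectorspace_def)

lemma rvs_abelian_group: "rvs V \<Longrightarrow> abelian_group V"
  by (rule module.axioms(2)[OF rvs_module])

lemma linear_map_iff_lin: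
  assumes "rvs V" "rvs V'"
  shows "linear_map class_ring V V' T \<longleftrightarrow> lin V V' T"
  using assms rvs_module[OF assms(1)] rvs_module[OF assms(2)]
  by (auto simp: linear_map_def mod_hom_def mod_hom_axioms_def LinearCombinations.module_hom_def lin_def)

lemma subspace_iff_subsp:
  assumes "rvs V"
  shows "subspace class_ring W V \<longleftrightarrow> subsp W V"
  using assms rvs_module[OF assms(1)]
  by (auto simp: subspace_def submodule_def subsp_def)

text \<open>The axioms in a form that needs no inverse operation: the negative of \<open>x\<close> is
  \<open>(-1) x\<close>, and the record has no field for it.\<close>

lemma rvsI:
  assumes "\<zero>\<^bsub>V\<^esub> \<in> carrier V"
    and "\<And>x y. x \<in> carrier V \<Longrightarrow> y \<in> carrier V \<Longrightarrow> x \<oplus>\<^bsub>V\<^esub> y \<in> carrier V"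
    and "\<And>a x. x \<in> carrier V \<Longrightarrow> a \<odot>\<^bsub>V\<^esub> x \<in> carrier V"
    and "\<And>x y. x \<in> carrier V \<Longrightarrow> y \<in> carrier V \<Longrightarrow> x \<oplus>\<^bsub>V\<^esub> y = y \<oplus>\<^bsub>V\<^esub> x"
    and "\<And>x y z. x \<in> carrier V \<Longrightarrow> y \<in> carrier V \<Longrightarrow> z \<in> carrier V \<Longrightarrow>
      (x \<oplus>\<^bsub>V\<^esub> y) \<oplus>\<^bsub>V\<^esub> z = x \<oplus>\<^bsub>V\<^esub> (y \<oplus>\<^bsub>V\<^esub> z)"
    and "\<And>x. x \<in> carrier V \<Longrightarrow> x \<oplus>\<^bsub>V\<^esub> \<zero>\<^bsub>V\<^esub> = x"
    and "\<And>x. x \<in> carrier V \<Longrightarrow> x \<oplus>\<^bsub>V\<^esub> ((-1) \<odot>\<^bsub>V\<^esub> x) = \<zero>\<^bsub>V\<^esub>"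
    and "\<And>a b x. x \<in> carrier V \<Longrightarrow> (a * b) \<odot>\<^bsub>V\<^esub> x = a \<odot>\<^bsub>V\<^esub> (b \<odot>\<^bsub>V\<^esub> x)"
    and "\<And>x. x \<in> carrier V \<Longrightarrow> 1 \<odot>\<^bsub>V\<^esub> x = x"
    and "\<And>a b x. x \<in> carrier V \<Longrightarrow> (a + b) \<odot>\<^bsub>V\<^esub> x = a \<odot>\<^bsub>V\<^esub> x \<oplus>\<^bsub>V\<^esub> b \<odot>\<^bsub>V\<^esub> x"
    and "\<And>a x y. x \<in> carrier V \<Longrightarrow> y \<in> carrier V \<Longrightarrow>
      a \<odot>\<^bsub>V\<^esub> (x \<oplus>\<^bsub>V\<^esub> y) = a \<odot>\<^bsub>V\<^esub> x \<oplus>\<^bsub>V\<^esub> a \<odot>\<^bsub>V\<^esub> y"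
  shows "rvs V"
proof (rule vs_criteria)
  show "field (class_ring :: real ring)"
    by (rule class_field.field_axioms)
  show "\<forall>v\<in>carrier V. \<exists>neg_v\<in>carrier V. v \<oplus>\<^bsub>V\<^esub> neg_v = \<zero>\<^bsub>V\<^esub>"
    using assms(3,7) by blast
qed (use assms in auto)

context
  fixes V :: "(real, 'a) module"
  assumes V: "rvs V"
begin

interpretation M: Module.module class_ring V
  by (rule rvs_module[OF V])

lemma rvs_zero [simp]: "\<zero>\<^bsub>V\<^esub> \<in> carrier V"
  by simp

lemma rvs_add [simp]: "x \<in> carrier V \<Longrightarrow> y \<in> carrier V \<Longrightarrow> x \<oplus>\<^bsub>V\<^esub> y \<in> carrier V"
  by simp

lemma rvs_smult [simp]: "x \<in> carrier V \<Longrightarrow> a \<odot>\<^bsub>V\<^esub> x \<in> carrier V"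
  by simp

lemma rvs_lmult_0 [simp]: "x \<in> carrier V \<Longrightarrow> 0 \<odot>\<^bsub>V\<^esub> x = \<zero>\<^bsub>V\<^esub>"
  using M.lmult_0[of x] by simp

lemma rvs_rmult_0 [simp]: "a \<odot>\<^bsub>V\<^esub> \<zero>\<^bsub>V\<^esub> = \<zero>\<^bsub>V\<^esub>"
  using M.rmult_0[of a] by simp

lemma rvs_one [simp]: "x \<in> carrier V \<Longrightarrow> 1 \<odot>\<^bsub>V\<^esub> x = x"
  using M.smult_one[of x] by simp

lemma rvs_minus [simp]: "x \<in> carrier V \<Longrightarrow> \<ominus>\<^bsub>V\<^esub> x = (-1) \<odot>\<^bsub>V\<^esub> x"
  using M.smult_minus_1[of x] by (simp add: class_ring_simps)

lemma rvs_diff_eq_zero: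
  assumes "x \<in> carrier V" "y \<in> carrier V"
  shows "x \<oplus>\<^bsub>V\<^esub> (-1) \<odot>\<^bsub>V\<^esub> y = \<zero>\<^bsub>V\<^esub> \<longleftrightarrow> x = y"
proof
  assume "x \<oplus>\<^bsub>V\<^esub> (-1) \<odot>\<^bsub>V\<^esub> y = \<zero>\<^bsub>V\<^esub>"
  then have "x \<oplus>\<^bsub>V\<^esub> \<ominus>\<^bsub>V\<^esub> y = \<zero>\<^bsub>V\<^esub>" using assms by simp
  then have "\<ominus>\<^bsub>V\<^esub> (\<ominus>\<^bsub>V\<^esub> y) = x"
    by (rule M.M.minus_equality) (use assms in \<open>simp_all add: M.M.a_inv_closed del: rvs_minus\<close>)
  moreover have "\<ominus>\<^bsub>V\<^esub> (\<ominus>\<^bsub>V\<^esub> y) = y" by (rule M.M.minus_minus[OF assms(2)])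
  ultimately show "x = y" by metis
next
  assume "x = y"
  then show "x \<oplus>\<^bsub>V\<^esub> (-1) \<odot>\<^bsub>V\<^esub> y = \<zero>\<^bsub>V\<^esub>"
    using M.M.r_neg[OF assms(2)] assms(2) by simp
qed

lemma rvs_finsum [simp]:
  "(\<And>i. i \<in> I \<Longrightarrow> f i \<in> carrier V) \<Longrightarrow> finsum V f I \<in> carrier V"
  by (rule M.finsum_closed) auto

end


section \<open>Finitely supported functions\<close>

definition fs :: "('x \<Rightarrow> real) \<Rightarrow> bool" where
  "fs f \<longleftrightarrow> finite {x. f x \<noteq> 0}"

text \<open>The value at \<open>f\<close> of the linear extension of \<open>b\<close>.\<close>

definition ev :: "('x \<Rightarrow> 'v::real_vector) \<Rightarrow> ('x \<Rightarrow> real) \<Rightarrow> 'v" where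
  "ev b f = (\<Sum>x | f x \<noteq> 0. f x *\<^sub>R b x)"

lemma fs_gen [simp]: "fs (gen x)"
  unfolding fs_def gen_def by (rule finite_subset[of _ "{x}"]) auto

lemma fs_zero [simp]: "fs (\<lambda>_. 0)"
  by (simp add: fs_def)

lemma fs_add [simp]: "fs f \<Longrightarrow> fs g \<Longrightarrow> fs (\<lambda>x. f x + g x)"
  unfolding fs_def by (erule (1) finite_subset[OF _ finite_UnI, rotated]) auto

lemma fs_diff [simp]: "fs f \<Longrightarrow> fs g \<Longrightarrow> fs (\<lambda>x. f x - g x)"
  unfolding fs_def by (erule (1) finite_subset[OF _ finite_UnI, rotated]) auto

lemma fs_smult [simp]: "fs f \<Longrightarrow> fs (\<lambda>x. a * f x)"
  unfolding fs_def by (erule finite_subset[rotated]) auto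

lemma ev_superset: "finite A \<Longrightarrow> {x. f x \<noteq> 0} \<subseteq> A \<Longrightarrow> ev b f = (\<Sum>x\<in>A. f x *\<^sub>R b x)"
  unfolding ev_def by (rule sum.mono_neutral_left) auto

lemma ev_add: 
  assumes "fs f" "fs g" shows "ev b (\<lambda>x. f x + g x) = ev b f + ev b g"
proof -
  let ?A = "{x. f x \<noteq> 0} \<union> {x. g x \<noteq> 0}"
  have "finite ?A" using assms by (simp add: fs_def)
  then show ?thesis
    by (subst (1 2 3) ev_superset[of ?A]) (auto simp: scaleR_add_left sum.distrib)
qed

lemma ev_smult: 
  assumes "fs f" shows "ev b (\<lambda>x. a * f x) = a *\<^sub>R ev b f"
  using assms
  by (subst (1 2) ev_superset[of "{x. f x \<noteq> 0}"]) (auto simp: fs_def scaleR_sum_right)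

lemma ev_diff: 
  assumes "fs f" "fs g" shows "ev b (\<lambda>x. f x - g x) = ev b f - ev b g"
  using ev_add[OF assms(1) fs_smult[OF assms(2)], of b "-1"] ev_smult[OF assms(2), of b "-1"]
  by simp

lemma ev_gen [simp]: "ev b (gen x) = b x"
  by (subst ev_superset[of "{x}"]) (auto simp: gen_def)

lemma ev_zero [simp]: "ev b (\<lambda>_. 0) = 0"
  by (simp add: ev_def)

lemma fs_induct [consumes 2, case_names zero gen]:
  assumes "fs f" "{x. f x \<noteq> 0} \<subseteq> X" "P (\<lambda>_. 0)"
    and "\<And>f a x. fs f \<Longrightarrow> {x. f x \<noteq> 0} \<subseteq> X \<Longrightarrow> x \<in> X \<Longrightarrow> P f \<Longrightarrow> P (\<lambda>y. f y + a * gen x y)"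
  shows "P f"
proof -
  have "finite A \<Longrightarrow> {x. f x \<noteq> 0} \<subseteq> A \<Longrightarrow> A \<subseteq> X \<Longrightarrow> P f" for A and f :: "'a \<Rightarrow> real"
  proof (induction A arbitrary: f rule: finite_induct)
    case empty
    then have "f = (\<lambda>_. 0)" by auto
    then show ?case using assms(3) by simp
  next
    case (insert x A)
    define g where "g = f(x := 0)"
    have g: "{y. g y \<noteq> 0} \<subseteq> A" "fs g"
      using insert.prems insert.hyps by (auto simp: g_def fs_def intro: finite_subset[of _ A])
    have "P g"
      using insert.IH g insert.prems by auto
    then have "P (\<lambda>y. g y + f x * gen x y)"
      using g insert.prems by (intro assms(4)) auto
    also have "(\<lambda>y. g y + f x * gen x y) = f"
      by (auto simp: gen_def g_def)
    finally show ?case .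
  qed
  from this[of "{x. f x \<noteq> 0}" f] show ?thesis
    using assms(1,2) by (simp add: fs_def)
qed


section \<open>Coordinates\<close>

text \<open>Addition and scaling in a record are awkward to calculate with. An injective linear map to a
  space of real functions turns identities between vectors into identities between real numbers, one
  for each coordinate.\<close>

interpretation fun_space: Vector_Spaces.vector_space "\<lambda>a (f :: 'a \<Rightarrow> real) x. a * f x"
  by unfold_locales (auto simp: algebra_simps fun_eq_iff)

interpretation fun_space_pair: Vector_Spaces.vector_space_pair
  "\<lambda>a (f :: 'a \<Rightarrow> real) x. a * f x" "\<lambda>a (f :: 'a \<Rightarrow> real) x. a * f x"
  by unfold_locales

text \<open>Extend a basis of \<open>N\<close> to one of the whole space, and send the basis of \<open>N\<close> to zero and
  every other basis vector to itself.\<close>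

lemma linear_with_kernel:
  assumes "fun_space.subspace N"
  obtains p :: "('a \<Rightarrow> real) \<Rightarrow> 'a \<Rightarrow> real" where
    "\<And>f g. p (\<lambda>x. f x + g x) = (\<lambda>x. p f x + p g x)"
    "\<And>a f. p (\<lambda>x. a * f x) = (\<lambda>x. a * p f x)"
    "\<And>f. f \<in> N \<Longrightarrow> p f = (\<lambda>_. 0)"
    "\<And>f. p f = (\<lambda>_. 0) \<Longrightarrow> f \<in> N"
proof -
  let ?s = "\<lambda>a (f :: 'a \<Rightarrow> real) x. a * f x"
  obtain B0 where B0: "B0 \<subseteq> N" "fun_space.independent B0" "N \<subseteq> fun_space.span B0"
    using fun_space.basis_exists[of N] by metis
  define B where "B = fun_space.extend_basis B0"
  have B: "B0 \<subseteq> B" "fun_space.independent B" "fun_space.span B = UNIV"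
    unfolding B_def using fun_space.extend_basis_superset[OF B0(2)]
      fun_space.independent_extend_basis[OF B0(2)] fun_space.span_extend_basis[OF B0(2)] by auto
  obtain p where p: "Vector_Spaces.linear ?s ?s p"
      "\<And>b. b \<in> B \<Longrightarrow> p b = (if b \<in> B0 then 0 else b)"
    using fun_space_pair.linear_independent_extend[OF B(2), of "\<lambda>b. if b \<in> B0 then 0 else b"]
    by auto
  interpret p: Vector_Spaces.linear ?s ?s p by (rule p(1))
  have add: "p (f + g) = p f + p g" for f g by (rule p.add)
  have sc: "p (?s a f) = ?s a (p f)" for a f by (rule p.scale)
  have zero: "f \<in> N \<Longrightarrow> p f = 0" for f
  proof -
    assume "f \<in> N"
    then have "f \<in> fun_space.span B0" using B0 by auto
    then show "p f = 0"
    proof (induction rule: fun_space.span_induct_alt)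
      case base
      show ?case using sc[of 0 0] by (simp add: fun_eq_iff zero_fun_def)
    next
      case (step c x y)
      have "p (?s c x + y) = ?s c (p x) + p y"
        by (simp only: add sc)
      moreover have "p x = 0"
        using B(1) p(2)[of x] step(1) by auto
      ultimately show ?case using step(2) by (simp add: zero_fun_def plus_fun_def)
    qed
  qed
  have diff: "f - p f \<in> N" for f
  proof -
    have "f \<in> fun_space.span B" using B by auto
    then show ?thesis
    proof (induction rule: fun_space.span_induct_alt)
      case base
      show ?case using sc[of 0 0] fun_space.subspace_0[OF assms]
        by (simp add: fun_eq_iff zero_fun_def)
    next
      case (step c x y)
      have "x - p x \<in> N"
        using step(1) p(2)[of x] B0(1) fun_space.subspace_0[OF assms] by auto
      then have "?s c (x - p x) + (y - p y) \<in> N"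
        by (intro fun_space.subspace_add[OF assms] fun_space.subspace_scale[OF assms] step(2))
      also have "?s c (x - p x) + (y - p y) = ?s c x + y - p (?s c x + y)"
        unfolding add sc by (simp add: fun_eq_iff algebra_simps)
      finally show ?case .
    qed
  qed
  show ?thesis
  proof
    show "p (\<lambda>x. f x + g x) = (\<lambda>x. p f x + p g x)" for f g
      using add[of f g] by (simp add: plus_fun_def)
    show "p (\<lambda>x. a * f x) = (\<lambda>x. a * p f x)" for a f
      by (rule sc)
    show "f \<in> N \<Longrightarrow> p f = (\<lambda>_. 0)" for f
      using zero[of f] by (simp add: zero_fun_def)
    show "p f = (\<lambda>_. 0) \<Longrightarrow> f \<in> N" for f
      using diff[of f] by (simp add: fun_diff_def)
  qed
qed

text \<open>The space \<open>V\<close> is the quotient of the finitely supported functions on its own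
  carrier by the kernel of the map \<open>e\<close> that evaluates formal linear combinations. A linear map with this
  kernel therefore induces an injection of \<open>V\<close>.\<close>

lemma coordinates_exist:
  fixes V :: "(real, 'a) module"
  assumes V: "rvs V"
  shows "\<exists>\<kappa> :: 'a \<Rightarrow> 'a \<Rightarrow> real.
    (\<forall>x\<in>carrier V. \<forall>y\<in>carrier V. \<kappa> (x \<oplus>\<^bsub>V\<^esub> y) = (\<lambda>b. \<kappa> x b + \<kappa> y b)) \<and>
    (\<forall>a. \<forall>x\<in>carrier V. \<kappa> (a \<odot>\<^bsub>V\<^esub> x) = (\<lambda>b. a * \<kappa> x b)) \<and> inj_on \<kappa> (carrier V)"
proof -
  interpret M: Module.module class_ring V by (rule rvs_module[OF V])
  define e :: "('a \<Rightarrow> real) \<Rightarrow> 'a" where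
    "e f = (\<Oplus>\<^bsub>V\<^esub>x\<in>{x. f x \<noteq> 0}. f x \<odot>\<^bsub>V\<^esub> x)" for f
  define F where "F = {f :: 'a \<Rightarrow> real. fs f \<and> {x. f x \<noteq> 0} \<subseteq> carrier V}"
  have e_superset: "e f = (\<Oplus>\<^bsub>V\<^esub>x\<in>A. f x \<odot>\<^bsub>V\<^esub> x)"
    if "finite A" "{x. f x \<noteq> 0} \<subseteq> A" "A \<subseteq> carrier V" for f A
    unfolding e_def using that V
    by (intro M.add.finprod_mono_neutral_cong_left) 
       (auto simp: rvs_lmult_0)
  have e_add: "e (\<lambda>x. f x + g x) = e f \<oplus>\<^bsub>V\<^esub> e g" if "f \<in> F" "g \<in> F" for f g
  proof -
    let ?A = "{x. f x \<noteq> 0} \<union> {x. g x \<noteq> 0}"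
    have A: "finite ?A" "?A \<subseteq> carrier V" using that by (auto simp: F_def fs_def)
    have "e (\<lambda>x. f x + g x) = (\<Oplus>\<^bsub>V\<^esub>x\<in>?A. (f x + g x) \<odot>\<^bsub>V\<^esub> x)"
      using A by (intro e_superset) auto
    also have "\<dots> = (\<Oplus>\<^bsub>V\<^esub>x\<in>?A. f x \<odot>\<^bsub>V\<^esub> x \<oplus>\<^bsub>V\<^esub> g x \<odot>\<^bsub>V\<^esub> x)"
    proof (rule M.M.finsum_cong')
      fix x assume "x \<in> ?A"
      then have "x \<in> carrier V" using A by auto
      then show "(f x + g x) \<odot>\<^bsub>V\<^esub> x = f x \<odot>\<^bsub>V\<^esub> x \<oplus>\<^bsub>V\<^esub> g x \<odot>\<^bsub>V\<^esub> x"
        using M.smult_l_distr[of "f x" "g x" x] by (simp add: class_ring_simps)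
    qed (use A V in auto)
    also have "\<dots> = e f \<oplus>\<^bsub>V\<^esub> e g"
      using A V by (subst (1 2) e_superset[of ?A]) (auto intro!: M.M.finsum_addf)
    finally show ?thesis .
  qed
  have e_gen: "e (gen x) = x" if "x \<in> carrier V" for x
    using that V M.smult_one[of x]
    by (subst e_superset[of "{x}"]) (auto simp: gen_def class_ring_simps)
  have e_smult: "e (\<lambda>x. a * f x) = a \<odot>\<^bsub>V\<^esub> e f" if "f \<in> F" for f a
  proof -
    let ?A = "{x. f x \<noteq> 0}"
    have A: "finite ?A" "?A \<subseteq> carrier V" using that by (auto simp: F_def fs_def)
    have "e (\<lambda>x. a * f x) = (\<Oplus>\<^bsub>V\<^esub>x\<in>?A. (a * f x) \<odot>\<^bsub>V\<^esub> x)"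
      using A by (intro e_superset) auto
    also have "\<dots> = (\<Oplus>\<^bsub>V\<^esub>x\<in>?A. a \<odot>\<^bsub>V\<^esub> (f x \<odot>\<^bsub>V\<^esub> x))"
    proof (rule M.M.finsum_cong')
      fix x assume "x \<in> ?A"
      then have "x \<in> carrier V" using A by auto
      then show "(a * f x) \<odot>\<^bsub>V\<^esub> x = a \<odot>\<^bsub>V\<^esub> (f x \<odot>\<^bsub>V\<^esub> x)"
        using M.smult_assoc1[of a "f x" x] by (simp add: class_ring_simps)
    qed (use A V in auto)
    also have "\<dots> = a \<odot>\<^bsub>V\<^esub> e f"
      unfolding e_def using A V by (intro M.finsum_smult[symmetric]) auto
    finally show ?thesis .
  qed
  have F_gen: "gen x \<in> F" if "x \<in> carrier V" for x
    using that by (auto simp: F_def gen_def fs_gen[unfolded gen_def])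
  have F_add: "(\<lambda>x. f x + g x) \<in> F" if "f \<in> F" "g \<in> F" for f g
    using that by (auto simp: F_def) (metis (mono_tags, lifting) add_cancel_right_left mem_Collect_eq subsetD)
  have F_smult: "(\<lambda>x. a * f x) \<in> F" if "f \<in> F" for f a
    using that by (auto simp: F_def)
  define N where "N = {f \<in> F. e f = \<zero>\<^bsub>V\<^esub>}"
  have "fun_space.subspace N"
    using V rvs_module[OF V]
    by (intro fun_space.subspaceI)
       (auto simp: N_def e_add e_smult F_add F_smult plus_fun_def M.rmult_0 class_ring_simps
          , auto simp: F_def e_def zero_fun_def M.rmult_0)
  then obtain p :: "('a \<Rightarrow> real) \<Rightarrow> 'a \<Rightarrow> real" where p:
    "\<And>f g. p (\<lambda>x. f x + g x) = (\<lambda>x. p f x + p g x)"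
    "\<And>a f. p (\<lambda>x. a * f x) = (\<lambda>x. a * p f x)"
    "\<And>f. f \<in> N \<Longrightarrow> p f = (\<lambda>_. 0)" "\<And>f. p f = (\<lambda>_. 0) \<Longrightarrow> f \<in> N"
    by (rule linear_with_kernel) (rule that; assumption)
  have eq: "p f = p g \<longleftrightarrow> e f = e g" if "f \<in> F" "g \<in> F" for f g
  proof -
    let ?d = "\<lambda>x. f x + (-1) * g x"
    have d: "?d \<in> F" using F_add[OF that(1) F_smult[OF that(2), of "-1"]] .
    have pd: "p ?d = (\<lambda>x. p f x + (-1) * p g x)" 
      by (simp only: p(1)[of f "\<lambda>x. (-1) * g x"] p(2)[of "-1" g])
    have ed: "e ?d = e f \<oplus>\<^bsub>V\<^esub> (-1) \<odot>\<^bsub>V\<^esub> e g"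
      using e_add[OF that(1) F_smult[OF that(2), of "-1"]] e_smult[OF that(2), of "-1"] by simp
    have car: "e f \<in> carrier V" "e g \<in> carrier V"
      using that V by (auto simp: e_def F_def intro!: rvs_finsum)
    have "p f = p g \<longleftrightarrow> p ?d = (\<lambda>_. 0)"
      unfolding pd fun_eq_iff by simp
    also have "\<dots> \<longleftrightarrow> e ?d = \<zero>\<^bsub>V\<^esub>"
      using p(3)[of ?d] p(4)[of ?d] d unfolding N_def by blast
    also have "\<dots> \<longleftrightarrow> e f = e g"
      unfolding ed by (rule rvs_diff_eq_zero[OF V car])
    finally show ?thesis .
  qed
  define \<kappa> where "\<kappa> x = p (gen x)" for x
  have "\<kappa> (x \<oplus>\<^bsub>V\<^esub> y) = (\<lambda>b. \<kappa> x b + \<kappa> y b)" if "x \<in> carrier V" "y \<in> carrier V" for x y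
  proof -
    have "\<kappa> (x \<oplus>\<^bsub>V\<^esub> y) = p (\<lambda>b. gen x b + gen y b)"
      unfolding \<kappa>_def using that V by (subst eq) (auto simp: F_gen F_add e_add e_gen)
    then show ?thesis by (simp add: p \<kappa>_def)
  qed
  moreover have "\<kappa> (a \<odot>\<^bsub>V\<^esub> x) = (\<lambda>b. a * \<kappa> x b)" if "x \<in> carrier V" for x a
  proof -
    have "\<kappa> (a \<odot>\<^bsub>V\<^esub> x) = p (\<lambda>b. a * gen x b)"
      unfolding \<kappa>_def using that V by (subst eq) (auto simp: F_gen F_smult e_smult e_gen)
    then show ?thesis by (simp add: p \<kappa>_def)
  qed
  moreover have "inj_on \<kappa> (carrier V)"
    by (rule inj_onI) (auto simp: \<kappa>_def eq F_gen e_gen)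
  ultimately show ?thesis by blast
qed

definition crd :: "(real, 'a) module \<Rightarrow> 'a \<Rightarrow> 'a \<Rightarrow> real" where
  "crd V = (SOME \<kappa>.
    (\<forall>x\<in>carrier V. \<forall>y\<in>carrier V. \<kappa> (x \<oplus>\<^bsub>V\<^esub> y) = (\<lambda>b. \<kappa> x b + \<kappa> y b)) \<and>
    (\<forall>a. \<forall>x\<in>carrier V. \<kappa> (a \<odot>\<^bsub>V\<^esub> x) = (\<lambda>b. a * \<kappa> x b)) \<and> inj_on \<kappa> (carrier V))"

context
  fixes V :: "(real, 'a) module"
  assumes V: "rvs V"
begin

lemma crd_add [simp]:
    "x \<in> carrier V \<Longrightarrow> y \<in> carrier V \<Longrightarrow> crd V (x \<oplus>\<^bsub>V\<^esub> y) b = crd V x b + crd V y b"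
  and crd_smult [simp]: "x \<in> carrier V \<Longrightarrow> crd V (a \<odot>\<^bsub>V\<^esub> x) b = a * crd V x b"
  and crd_inj: "inj_on (crd V) (carrier V)"
  using someI_ex[OF coordinates_exist[OF V], folded crd_def] by auto

lemma crd_zero [simp]: "crd V \<zero>\<^bsub>V\<^esub> b = 0"
  using crd_smult[of "\<zero>\<^bsub>V\<^esub>" 0 b] crd_add[of "\<zero>\<^bsub>V\<^esub>" "\<zero>\<^bsub>V\<^esub>" b] V
    abelian_group.axioms(1)[OF rvs_abelian_group[OF V]]
  by (simp add: abelian_monoid.r_zero)

lemma crd_eqI: "(\<And>b. crd V x b = crd V y b) \<Longrightarrow> x \<in> carrier V \<Longrightarrow> y \<in> carrier V \<Longrightarrow> x = y"
  by (rule inj_onD[OF crd_inj]) auto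

lemma crd_finsum [simp]:
  assumes "\<And>i. i \<in> I \<Longrightarrow> f i \<in> carrier V"
  shows "crd V (finsum V f I) b = (\<Sum>i\<in>I. crd V (f i) b)"
proof -
  interpret M: Module.module class_ring V by (rule rvs_module[OF V])
  show ?thesis
    using assms
  proof (induction I rule: infinite_finite_induct)
    case (insert i I)
    then show ?case
      using V by (simp add: M.M.finsum_insert)
  qed (auto simp: V)
qed

end

lemma nonzero_functional:
  assumes "rvs V" "x \<in> carrier V" "x \<noteq> \<zero>\<^bsub>V\<^esub>"
  obtains b where "crd V x b \<noteq> 0"
  using crd_eqI[OF assms(1) _ assms(2), of "\<zero>\<^bsub>V\<^esub>"] assms by auto

lemma rvs_r_zero [simp]: "rvs V \<Longrightarrow> x \<in> carrier V \<Longrightarrow> x \<oplus>\<^bsub>V\<^esub> \<zero>\<^bsub>V\<^esub> = x"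
  and rvs_l_zero [simp]: "rvs V \<Longrightarrow> x \<in> carrier V \<Longrightarrow> \<zero>\<^bsub>V\<^esub> \<oplus>\<^bsub>V\<^esub> x = x"
  by (auto intro!: crd_eqI[of V])

section \<open>Anticommuting involutions\<close>

locale gamma_system =
  fixes n :: nat and V :: "(real, 'a) module" and \<gamma> :: "nat \<Rightarrow> 'a \<Rightarrow> 'a"
  assumes rvs [simp]: "rvs V"
    and gamma_lin: "i < n \<Longrightarrow> lin V V (\<gamma> i)"
    and gamma_square: "i < n \<Longrightarrow> s \<in> carrier V \<Longrightarrow> \<gamma> i (\<gamma> i s) = s"
    and gamma_anticommute: "i < n \<Longrightarrow> j < n \<Longrightarrow> i \<noteq> j \<Longrightarrow> s \<in> carrier V \<Longrightarrow>
      \<gamma> i (\<gamma> j s) = (-1) \<odot>\<^bsub>V\<^esub> \<gamma> j (\<gamma> i s)"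

definition stable :: "nat \<Rightarrow> (real, 'a) module \<Rightarrow> (nat \<Rightarrow> 'a \<Rightarrow> 'a) \<Rightarrow> 'a set \<Rightarrow> bool" where
  "stable n V \<gamma> W \<longleftrightarrow> subsp W V \<and> (\<forall>i<n. \<forall>s\<in>W. \<gamma> i s \<in> W)"

definition irr :: "nat \<Rightarrow> (real, 'a) module \<Rightarrow> (nat \<Rightarrow> 'a \<Rightarrow> 'a) \<Rightarrow> bool" where
  "irr n V \<gamma> \<longleftrightarrow> carrier V \<noteq> {\<zero>\<^bsub>V\<^esub>} \<and>
    (\<forall>W. stable n V \<gamma> W \<longrightarrow> W = {\<zero>\<^bsub>V\<^esub>} \<or> W = carrier V)"

lemma linD:
  assumes "lin V V' T"
  shows lin_closed: "x \<in> carrier V \<Longrightarrow> T x \<in> carrier V'"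
    and lin_add: "x \<in> carrier V \<Longrightarrow> y \<in> carrier V \<Longrightarrow> T (x \<oplus>\<^bsub>V\<^esub> y) = T x \<oplus>\<^bsub>V'\<^esub> T y"
    and lin_smult: "x \<in> carrier V \<Longrightarrow> T (a \<odot>\<^bsub>V\<^esub> x) = a \<odot>\<^bsub>V'\<^esub> T x"
  using assms by (auto simp: lin_def)

lemma lin_zero:
  assumes "rvs V" "rvs V'" "lin V V' T" shows "T \<zero>\<^bsub>V\<^esub> = \<zero>\<^bsub>V'\<^esub>"
  using lin_smult[OF assms(3), of "\<zero>\<^bsub>V\<^esub>" 0] lin_closed[OF assms(3), of "\<zero>\<^bsub>V\<^esub>"] assms
  by simp

lemma lin_id [simp]: "lin V V id" "lin V V (\<lambda>x. x)"
  by (auto simp: lin_def)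

lemma lin_comp: "lin V V' S \<Longrightarrow> lin V' V'' T \<Longrightarrow> lin V V'' (T \<circ> S)"
  by (auto simp: lin_def)

lemma lin_kernel_eq:
  assumes "rvs V" "rvs V'" "lin V V' S" "lin V V' T"
  shows "subsp {x \<in> carrier V. S x = T x} V"
  using assms lin_zero[OF assms(1,2,3)] lin_zero[OF assms(1,2,4)]
  by (auto simp: subsp_def lin_def)

lemma lin_preimage:
  assumes "rvs V" "rvs V'" "lin V V' T" "subsp W V'"
  shows "subsp {x \<in> carrier V. T x \<in> W} V"
  using assms lin_zero[OF assms(1-3)] by (auto simp: subsp_def lin_def)

lemma subspD:
  assumes "subsp W V"
  shows subsp_subset: "W \<subseteq> carrier V" and subsp_zero: "\<zero>\<^bsub>V\<^esub> \<in> W"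
    and subsp_add: "x \<in> W \<Longrightarrow> y \<in> W \<Longrightarrow> x \<oplus>\<^bsub>V\<^esub> y \<in> W"
    and subsp_smult: "x \<in> W \<Longrightarrow> a \<odot>\<^bsub>V\<^esub> x \<in> W"
  using assms by (auto simp: subsp_def)

lemma subsp_smult_iff:
  assumes "rvs V" "subsp W V" "x \<in> carrier V" "a \<noteq> 0"
  shows "a \<odot>\<^bsub>V\<^esub> x \<in> W \<longleftrightarrow> x \<in> W"
proof
  assume "a \<odot>\<^bsub>V\<^esub> x \<in> W"
  then have "(1 / a) \<odot>\<^bsub>V\<^esub> (a \<odot>\<^bsub>V\<^esub> x) \<in> W"
    by (rule subsp_smult[OF assms(2)])
  also have "(1 / a) \<odot>\<^bsub>V\<^esub> (a \<odot>\<^bsub>V\<^esub> x) = x"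
    by (rule crd_eqI[OF assms(1)]) (use assms in auto)
  finally show "x \<in> W" .
qed (rule subsp_smult[OF assms(2)])

lemma irrD:
  assumes "irr n V \<gamma>" "stable n V \<gamma> W" "s \<in> W" "s \<noteq> \<zero>\<^bsub>V\<^esub>"
  shows "W = carrier V"
  using assms by (auto simp: irr_def)

lemma irr_nonzero:
  assumes "irr n V \<gamma>" "rvs V" obtains s where "s \<in> carrier V" "s \<noteq> \<zero>\<^bsub>V\<^esub>"
  using assms rvs_zero[OF assms(2)] by (auto simp: irr_def)

abbreviation op :: "(nat \<Rightarrow> 'a \<Rightarrow> 'a) \<Rightarrow> nat list \<Rightarrow> 'a \<Rightarrow> 'a" where
  "op \<gamma> w \<equiv> foldr \<gamma> w"

text \<open>Interchanging the products over \<open>u\<close> and \<open>w\<close> costs the sign with this exponent: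
  each letter \<open>i\<close> of \<open>u\<close> anticommutes with the letters of \<open>w\<close> other than \<open>i\<close>.\<close>

definition sgnx :: "nat list \<Rightarrow> nat list \<Rightarrow> nat" where
  "sgnx u w = (\<Sum>i\<leftarrow>u. length w + count_list w i)"

lemma stable_op:
  "stable n V \<gamma> W \<Longrightarrow> set w \<subseteq> {..<n} \<Longrightarrow> s \<in> W \<Longrightarrow> op \<gamma> w s \<in> W"
  by (induction w) (auto simp: stable_def)

context gamma_system
begin

lemma gamma_closed [simp]: "i < n \<Longrightarrow> s \<in> carrier V \<Longrightarrow> \<gamma> i s \<in> carrier V"
  by (rule lin_closed[OF gamma_lin])

lemma op_lin: "set w \<subseteq> {..<n} \<Longrightarrow> lin V V (op \<gamma> w)"
  by (induction w) (auto simp del: o_apply intro!: lin_comp gamma_lin)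

lemma op_closed [simp]: "set w \<subseteq> {..<n} \<Longrightarrow> s \<in> carrier V \<Longrightarrow> op \<gamma> w s \<in> carrier V"
  by (rule lin_closed[OF op_lin])

lemma op_smult: "set w \<subseteq> {..<n} \<Longrightarrow> s \<in> carrier V \<Longrightarrow> op \<gamma> w (a \<odot>\<^bsub>V\<^esub> s) = a \<odot>\<^bsub>V\<^esub> op \<gamma> w s"
  by (rule lin_smult[OF op_lin])

lemma gamma_smult: "i < n \<Longrightarrow> s \<in> carrier V \<Longrightarrow> \<gamma> i (a \<odot>\<^bsub>V\<^esub> s) = a \<odot>\<^bsub>V\<^esub> \<gamma> i s"
  by (rule lin_smult[OF gamma_lin])

lemma smult_smult: "s \<in> carrier V \<Longrightarrow> a \<odot>\<^bsub>V\<^esub> (b \<odot>\<^bsub>V\<^esub> s) = (a * b) \<odot>\<^bsub>V\<^esub> s"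
  by (rule crd_eqI[OF rvs]) auto

lemma gamma_op:
  assumes "i < n" "set w \<subseteq> {..<n}" "s \<in> carrier V"
  shows "\<gamma> i (op \<gamma> w s) = (-1) ^ (length w + count_list w i) \<odot>\<^bsub>V\<^esub> op \<gamma> w (\<gamma> i s)"
  using assms(2)
proof (induction w)
  case (Cons j w)
  then have j: "j < n" and w: "set w \<subseteq> {..<n}" by auto
  have "\<gamma> i (\<gamma> j (op \<gamma> w s)) = (if i = j then 1 else -1) \<odot>\<^bsub>V\<^esub> \<gamma> j (\<gamma> i (op \<gamma> w s))"
    using gamma_anticommute[of i j "op \<gamma> w s"] assms j w by auto
  also have "\<dots> = (if i = j then 1 else -1) \<odot>\<^bsub>V\<^esub>
      \<gamma> j ((-1) ^ (length w + count_list w i) \<odot>\<^bsub>V\<^esub> op \<gamma> w (\<gamma> i s))"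
    using Cons by simp
  also have "\<dots> = ((if i = j then 1 else -1) * (-1) ^ (length w + count_list w i)) \<odot>\<^bsub>V\<^esub>
      \<gamma> j (op \<gamma> w (\<gamma> i s))"
    using j w assms by (simp only: gamma_smult smult_smult op_closed gamma_closed)
  finally show ?case
    by (auto simp: power_add)
qed (use assms in auto)

lemma op_swap:
  assumes "set u \<subseteq> {..<n}" "set w \<subseteq> {..<n}" "s \<in> carrier V"
  shows "op \<gamma> u (op \<gamma> w s) = (-1) ^ sgnx u w \<odot>\<^bsub>V\<^esub> op \<gamma> w (op \<gamma> u s)"
  using assms(1)
proof (induction u)
  case (Cons i u)
  then have i: "i < n" and u: "set u \<subseteq> {..<n}" by auto
  have "\<gamma> i (op \<gamma> u (op \<gamma> w s)) = \<gamma> i ((-1) ^ sgnx u w \<odot>\<^bsub>V\<^esub> op \<gamma> w (op \<gamma> u s))"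
    using Cons by simp
  also have "\<dots> = (-1) ^ sgnx u w \<odot>\<^bsub>V\<^esub> \<gamma> i (op \<gamma> w (op \<gamma> u s))"
    using assms u i by (intro gamma_smult) auto
  also have "\<dots> = (-1) ^ sgnx u w \<odot>\<^bsub>V\<^esub>
      ((-1) ^ (length w + count_list w i) \<odot>\<^bsub>V\<^esub> op \<gamma> w (\<gamma> i (op \<gamma> u s)))"
    using assms u i by (subst gamma_op) auto
  also have "\<dots> = (-1) ^ sgnx (i # u) w \<odot>\<^bsub>V\<^esub> op \<gamma> w (\<gamma> i (op \<gamma> u s))"
    using assms u i by (subst smult_smult) (auto simp: sgnx_def power_add mult_ac)
  finally show ?case by simp
qed (use assms in \<open>auto simp: sgnx_def\<close>)

lemma op_rev: "set w \<subseteq> {..<n} \<Longrightarrow> s \<in> carrier V \<Longrightarrow> op \<gamma> w (op \<gamma> (rev w) s) = s"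
proof (induction w arbitrary: s)
  case (Cons i w)
  then show ?case by (simp add: gamma_square)
qed auto

lemma op_eq_zero_iff:
  assumes "set w \<subseteq> {..<n}" "s \<in> carrier V"
  shows "op \<gamma> w s = \<zero>\<^bsub>V\<^esub> \<longleftrightarrow> s = \<zero>\<^bsub>V\<^esub>"
  using op_rev[of "rev w" s] assms lin_zero[OF rvs rvs op_lin[of w]] 
    lin_zero[OF rvs rvs op_lin[of "rev w"]] by auto

text \<open>Moving one of two equal letters next to the other costs a sign, and there the two cancel.\<close>

lemma op_even:
  assumes "set w \<subseteq> {..<n}" "\<And>i. even (count_list w i)"
  shows "\<exists>e\<in>{1, -1}. \<forall>s\<in>carrier V. op \<gamma> w s = e \<odot>\<^bsub>V\<^esub> s"
  using assms
proof (induction "length w" arbitrary: w rule: less_induct)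
  case less
  show ?case
  proof (cases w)
    case (Cons i u)
    have "odd (count_list u i)" using less.prems(2)[of i] Cons by auto
    then have "i \<in> set u" by (metis count_notin even_zero)
    then obtain a b where u: "u = a @ i # b" by (meson split_list)
    have ab: "set (a @ b) \<subseteq> {..<n}" "i < n" using less.prems(1) Cons u by auto
    have "even (count_list (a @ b) j)" for j
      using less.prems(2)[of j] Cons u by (auto split: if_splits)
    moreover have "length (a @ b) < length w" using Cons u by simp
    ultimately have "\<exists>e\<in>{1, -1}. \<forall>s\<in>carrier V. op \<gamma> (a @ b) s = e \<odot>\<^bsub>V\<^esub> s"
      using ab(1) by (intro less.hyps)
    then obtain e where e: "e \<in> {1, -1}" "\<forall>s\<in>carrier V. op \<gamma> (a @ b) s = e \<odot>\<^bsub>V\<^esub> s"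
      by (rule bexE)
    let ?e = "(-1) ^ (length a + count_list a i) * e"
    have "op \<gamma> w s = ?e \<odot>\<^bsub>V\<^esub> s" if s: "s \<in> carrier V" for s
    proof -
      have "op \<gamma> w s = \<gamma> i (op \<gamma> a (\<gamma> i (op \<gamma> b s)))" using Cons u by simp
      also have "\<dots> = (-1) ^ (length a + count_list a i) \<odot>\<^bsub>V\<^esub> op \<gamma> a (\<gamma> i (\<gamma> i (op \<gamma> b s)))"
        using ab s by (subst gamma_op) auto
      also have "\<dots> = (-1) ^ (length a + count_list a i) \<odot>\<^bsub>V\<^esub> op \<gamma> (a @ b) s"
        using ab s by (simp add: gamma_square)
      also have "\<dots> = ?e \<odot>\<^bsub>V\<^esub> s" using e s by (simp add: smult_smult del: foldr_append)
      finally show ?thesis .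
    qed
    moreover have "?e \<in> {1, -1}"
      using e(1) by (cases "even (length a + count_list a i)") auto
    ultimately show ?thesis by blast
  qed auto
qed

lemma op_same_parity:
  assumes "set u \<subseteq> {..<n}" "set w \<subseteq> {..<n}" "\<And>i. even (count_list u i + count_list w i)"
  shows "\<exists>e\<in>{1, -1}. \<forall>s\<in>carrier V. op \<gamma> w s = e \<odot>\<^bsub>V\<^esub> op \<gamma> u s"
proof -
  have "even (count_list (rev u @ w) i)" for i using assms(3)[of i] by simp
  then have "\<exists>e\<in>{1, -1}. \<forall>s\<in>carrier V. op \<gamma> (rev u @ w) s = e \<odot>\<^bsub>V\<^esub> s"
    using assms(1,2) by (intro op_even) auto
  then obtain e where e: "e \<in> {1, -1}" "\<forall>s\<in>carrier V. op \<gamma> (rev u @ w) s = e \<odot>\<^bsub>V\<^esub> s"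
    by (rule bexE)
  have "op \<gamma> w s = e \<odot>\<^bsub>V\<^esub> op \<gamma> u s" if s: "s \<in> carrier V" for s
  proof -
    have "op \<gamma> w s = op \<gamma> u (op \<gamma> (rev u) (op \<gamma> w s))"
      using op_rev[of u "op \<gamma> w s"] assms s by simp
    also have "\<dots> = op \<gamma> u (e \<odot>\<^bsub>V\<^esub> s)" using e s by simp
    finally show ?thesis using assms s by (simp add: op_smult)
  qed
  then show ?thesis using e by blast
qed


subsection \<open>Cyclic subspaces\<close>

definition cyc :: "'a \<Rightarrow> 'a set" where
  "cyc z = \<Inter>{W. stable n V \<gamma> W \<and> z \<in> W}"

lemma stable_carrier: "stable n V \<gamma> (carrier V)"
  by (auto simp: stable_def subsp_def)

lemma cyc_stable: "z \<in> carrier V \<Longrightarrow> stable n V \<gamma> (cyc z)"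
proof -
  assume z: "z \<in> carrier V"
  have "cyc z \<subseteq> carrier V" using stable_carrier z by (auto simp: cyc_def)
  then show ?thesis by (auto simp: cyc_def stable_def subsp_def)
qed

lemma cyc_self: "z \<in> cyc z"
  by (auto simp: cyc_def)

lemma cyc_subset: "stable n V \<gamma> W \<Longrightarrow> z \<in> W \<Longrightarrow> cyc z \<subseteq> W"
  by (auto simp: cyc_def)

lemma cyc_subset_words:
  assumes "z \<in> carrier V" "subsp X V" "\<And>w. set w \<subseteq> {..<n} \<Longrightarrow> op \<gamma> w z \<in> X"
  shows "cyc z \<subseteq> X"
proof -
  let ?W = "{p \<in> carrier V. \<forall>w. set w \<subseteq> {..<n} \<longrightarrow> op \<gamma> w p \<in> X}"
  have "op \<gamma> w (\<gamma> i p) \<in> X" if "p \<in> ?W" "i < n" "set w \<subseteq> {..<n}" for p i w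
    using that(1)[simplified] that(2,3) by (auto dest!: spec[of _ "w @ [i]"])
  moreover have "op \<gamma> w \<zero>\<^bsub>V\<^esub> = \<zero>\<^bsub>V\<^esub>" if "set w \<subseteq> {..<n}" for w
    using lin_zero[OF rvs rvs op_lin[OF that]] .
  ultimately have "stable n V \<gamma> ?W"
    using assms(2) by (auto simp: stable_def subsp_def lin_add[OF op_lin] op_smult)
  moreover have "z \<in> ?W" using assms by auto
  ultimately have "cyc z \<subseteq> ?W" by (rule cyc_subset)
  then show ?thesis by (auto dest!: spec[of _ "[]"])
qed

end

section \<open>The Hamming code and minimal vectors\<close>

text \<open>Generators of the extended Hamming code of length 8, as sets of positions.\<close>

definition hamming :: "nat list list" where
  "hamming = [[0,1,2,3], [0,1,4,5], [0,1,6,7], [0,2,4,6]]"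

text \<open>The \<open>i\<close>-th word anticommutes with the \<open>i\<close>-th generator of the code and commutes with the other
  three, so it changes exactly one joint eigenvalue.\<close>

definition flips :: "nat list list" where
  "flips = [[3], [5], [7], [2,3]]"

definition shift :: "nat \<Rightarrow> nat list \<Rightarrow> nat list" where
  "shift j w = map ((+) (8 * j)) w"

definition code :: "nat \<Rightarrow> nat list list" where
  "code k = concat (map (\<lambda>j. map (shift j) hamming) [0..<k])"

lemma code_0 [simp]: "code 0 = []"
  by (simp add: code_def)

lemma code_Suc: "code (Suc k) = code k @ map (shift k) hamming"
  by (simp add: code_def)

lemma set_code: "set (code k) = (\<Union>j<k. shift j ` set hamming)"
  by (auto simp: code_def)

lemma code_words: "u \<in> set (code k) \<Longrightarrow> length u = 4 \<and> set u \<subseteq> {..<8*k}"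
  by (force simp: set_code hamming_def shift_def)

lemma sgnx_disjoint: "length u = 4 \<Longrightarrow> set u \<inter> set w = {} \<Longrightarrow> even (sgnx u w)"
proof -
  assume u: "length u = 4" "set u \<inter> set w = {}"
  have "sgnx u w = (\<Sum>i\<leftarrow>u. length w)"
    unfolding sgnx_def using u(2)
    by (intro arg_cong[of _ _ sum_list] map_cong) (auto simp: count_list_0_iff)
  then show ?thesis using u(1) by (simp add: sum_list_triv)
qed

text \<open>The exponent of the sign by which the product over a word squares.\<close>

fun sqx :: "nat list \<Rightarrow> nat" where
  "sqx [] = 0"
| "sqx (i # w) = length w + count_list w i + sqx w"

text \<open>A list of words paired with flips. Joint eigenvectors are found from the end of the list, so the
  flip of a word has to respect only the words after it.\<close>

fun flippable :: "(nat list \<times> nat list) list \<Rightarrow> bool" where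
  "flippable [] \<longleftrightarrow> True"
| "flippable ((u, g) # L) \<longleftrightarrow> flippable L \<and> even (sqx u) \<and> odd (sgnx u g) \<and>
    (\<forall>u'\<in>fst ` set L. even (sgnx u' u) \<and> even (sgnx u' g))"

lemma flippable_append:
  "flippable (A @ B) \<longleftrightarrow> flippable A \<and> flippable B \<and>
    (\<forall>(u, g)\<in>set A. \<forall>u'\<in>fst ` set B. even (sgnx u' u) \<and> even (sgnx u' g))"
  by (induction A rule: flippable.induct) auto

lemma flippable_block:
  "flippable (zip (map (shift j) hamming) (map (shift j) flips))"
  by (simp add: hamming_def flips_def shift_def sgnx_def)

definition code_flips :: "nat \<Rightarrow> (nat list \<times> nat list) list" where
  "code_flips k = concat (map (\<lambda>j. zip (map (shift j) hamming) (map (shift j) flips)) [0..<k])"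

lemma map_fst_code_flips: "map fst (code_flips k) = code k"
  by (simp add: code_flips_def code_def map_concat comp_def hamming_def flips_def)

lemma code_flips_letters:
  "(u, g) \<in> set (code_flips k) \<Longrightarrow> set u \<subseteq> {..<8*k} \<and> set g \<subseteq> {..<8*k}"
  by (force simp: code_flips_def shift_def hamming_def flips_def)

lemma flippable_code: "flippable (code_flips k)"
proof (induction k)
  case (Suc k)
  let ?B = "zip (map (shift k) hamming) (map (shift k) flips)"
  have u': "length u' = 4 \<and> set u' \<inter> {..<8*k} = {}" if "u' \<in> fst ` set ?B" for u'
    using that by (force simp: shift_def hamming_def flips_def)
  have "even (sgnx u' u) \<and> even (sgnx u' g)" if "u' \<in> fst ` set ?B" "(u, g) \<in> set (code_flips k)" for u' u g
    using u'[OF that(1)] code_flips_letters[OF that(2)] by (intro conjI sgnx_disjoint) auto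
  then have "flippable (code_flips k @ ?B)"
    unfolding flippable_append using Suc flippable_block[of k] by blast
  then show ?case by (simp add: code_flips_def)
qed (simp add: code_flips_def)

text \<open>The commuting involutions whose joint fixed vectors are the minimal vectors. Outside dimension
  \<open>8 k\<close> the generator that follows the code blocks joins them, with the sign \<open>e\<close>.\<close>

definition stab :: "nat \<Rightarrow> nat \<Rightarrow> real \<Rightarrow> (real \<times> nat list) list" where
  "stab n k e = map (Pair 1) (code k) @ (if n = 8 * k then [] else [(e, [8 * k])])"

lemma count_list_shift: "count_list (shift k w) (8 * k + b) = count_list w b"
  by (induction w) (auto simp: shift_def)

context gamma_system
begin

lemma op_square:
  "set u \<subseteq> {..<n} \<Longrightarrow> s \<in> carrier V \<Longrightarrow> op \<gamma> u (op \<gamma> u s) = (-1) ^ sqx u \<odot>\<^bsub>V\<^esub> s"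
proof (induction u)
  case (Cons i u)
  then have i: "i < n" and u: "set u \<subseteq> {..<n}" by auto
  have "op \<gamma> u (\<gamma> i (op \<gamma> u s)) = (-1) ^ (length u + count_list u i) \<odot>\<^bsub>V\<^esub> \<gamma> i (op \<gamma> u (op \<gamma> u s))"
    using gamma_op[OF i u, of "op \<gamma> u s"] Cons.prems i u by (simp add: smult_smult flip: power_add)
  then show ?case
    using Cons i u by (simp add: gamma_smult gamma_square smult_smult flip: power_add)
qed auto

definition fixed :: "(real \<times> nat list) list \<Rightarrow> 'a \<Rightarrow> bool" where
  "fixed L s \<longleftrightarrow> s \<in> carrier V \<and> (\<forall>(e, w)\<in>set L. e \<odot>\<^bsub>V\<^esub> op \<gamma> w s = s)"

definition proj :: "real \<times> nat list \<Rightarrow> 'a \<Rightarrow> 'a" where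
  "proj = (\<lambda>(e, w) s. (1 / 2) \<odot>\<^bsub>V\<^esub> (s \<oplus>\<^bsub>V\<^esub> e \<odot>\<^bsub>V\<^esub> op \<gamma> w s))"

definition projs :: "(real \<times> nat list) list \<Rightarrow> 'a \<Rightarrow> 'a" where
  "projs L = foldr proj L"

lemma proj_lin: "set w \<subseteq> {..<n} \<Longrightarrow> lin V V (proj (e, w))"
  unfolding lin_def
  by (auto simp: proj_def lin_add[OF op_lin] lin_smult[OF op_lin] algebra_simps intro!: crd_eqI[OF rvs])

lemma projs_lin: "\<forall>(e, w)\<in>set L. set w \<subseteq> {..<n} \<Longrightarrow> lin V V (projs L)"
proof (induction L)
  case (Cons x L)
  then show ?case
    by (cases x) (auto simp: projs_def simp del: o_apply intro!: lin_comp proj_lin)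
qed (auto simp: projs_def)

lemma projs_fixed: "fixed L s \<Longrightarrow> projs L s = s"
proof (induction L)
  case (Cons x L)
  obtain e w where x: "x = (e, w)" by force
  have s: "s \<in> carrier V" "e \<odot>\<^bsub>V\<^esub> op \<gamma> w s = s" "fixed L s"
    using Cons.prems by (auto simp: fixed_def x)
  then have "proj x s = (1 / 2) \<odot>\<^bsub>V\<^esub> (s \<oplus>\<^bsub>V\<^esub> s)" by (simp add: proj_def x)
  also have "\<dots> = s" by (rule crd_eqI[OF rvs]) (use s in auto)
  finally show ?case using Cons.IH s by (simp add: projs_def)
qed (auto simp: projs_def)

lemma projs_eigen:
  assumes "\<forall>(e, w)\<in>set L. set w \<subseteq> {..<n}" "s \<in> carrier V"
    and "\<forall>(e, w)\<in>set L. e \<odot>\<^bsub>V\<^esub> op \<gamma> w s = (if P w then s else (-1) \<odot>\<^bsub>V\<^esub> s)"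
  shows "projs L s = (if \<forall>(e, w)\<in>set L. P w then s else \<zero>\<^bsub>V\<^esub>)"
  using assms(1,3)
proof (induction L)
  case (Cons x L)
  obtain e w where x: "x = (e, w)" by force
  have "projs (x # L) s = proj x (projs L s)" by (simp add: projs_def)
  also have "projs L s = (if \<forall>(e, w)\<in>set L. P w then s else \<zero>\<^bsub>V\<^esub>)"
    using Cons by auto
  also have "proj x \<dots> = (if \<forall>(e, w)\<in>set (x # L). P w then s else \<zero>\<^bsub>V\<^esub>)"
  proof (cases "\<forall>(e, w)\<in>set L. P w")
    case True
    have "e \<odot>\<^bsub>V\<^esub> op \<gamma> w s = (if P w then s else (-1) \<odot>\<^bsub>V\<^esub> s)" using Cons.prems x by auto
    then have "proj x s = (if P w then s else \<zero>\<^bsub>V\<^esub>)"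
      using assms(2) by (auto simp: proj_def x intro!: crd_eqI[OF rvs])
    then show ?thesis using True x by auto
  next
    case False
    have "lin V V (proj x)" using Cons.prems x proj_lin by auto
    then have "proj x \<zero>\<^bsub>V\<^esub> = \<zero>\<^bsub>V\<^esub>" by (intro lin_zero) auto
    then show ?thesis using False by auto
  qed
  finally show ?case .
qed (auto simp: projs_def)

text \<open>A word maps a minimal vector into a joint eigenspace of the involutions, for the eigenvalues
  given by the commutation signs.\<close>

lemma projs_op:
  assumes L: "\<forall>(e, u)\<in>set L. set u \<subseteq> {..<n}" and z: "fixed L z" and w: "set w \<subseteq> {..<n}"
  shows "projs L (op \<gamma> w z) = (if \<forall>(e, u)\<in>set L. even (sgnx u w) then op \<gamma> w z else \<zero>\<^bsub>V\<^esub>)"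
proof (rule projs_eigen[OF L])
  have zc: "z \<in> carrier V" using z by (simp add: fixed_def)
  then show "op \<gamma> w z \<in> carrier V" using w by simp
  have "e \<odot>\<^bsub>V\<^esub> op \<gamma> u (op \<gamma> w z) = (if even (sgnx u w) then op \<gamma> w z else (-1) \<odot>\<^bsub>V\<^esub> op \<gamma> w z)"
    if "(e, u) \<in> set L" for e u
  proof -
    have u: "set u \<subseteq> {..<n}" and eu: "e \<odot>\<^bsub>V\<^esub> op \<gamma> u z = z" using that L z by (auto simp: fixed_def)
    have "e \<odot>\<^bsub>V\<^esub> op \<gamma> u (op \<gamma> w z) = (-1) ^ sgnx u w \<odot>\<^bsub>V\<^esub> op \<gamma> w (e \<odot>\<^bsub>V\<^esub> op \<gamma> u z)"
      using u w zc by (subst op_swap) (auto simp: smult_smult op_smult mult_ac)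
    then show ?thesis using eu u w zc by simp
  qed
  then show "\<forall>(e, u)\<in>set L. e \<odot>\<^bsub>V\<^esub> op \<gamma> u (op \<gamma> w z) = (if even (sgnx u w) then op \<gamma> w z else (-1) \<odot>\<^bsub>V\<^esub> op \<gamma> w z)"
    by auto
qed

lemma count_list_filter: "count_list (filter P w) i = (if P i then count_list w i else 0)"
  by (induction w) auto

text \<open>The code is self-dual: a word that commutes with its generators agrees with a code word inside
  the block, up to the order of the letters and cancelling pairs, and code words fix \<open>z\<close>.\<close>

lemma code_reduce_block:
  assumes n: "8 * k + 8 \<le> n" and z: "z \<in> carrier V" "\<forall>u\<in>set hamming. op \<gamma> (shift k u) z = z"
    and w: "set w \<subseteq> {..<n}" and even: "\<forall>u\<in>set hamming. even (sgnx (shift k u) w)"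
  shows "\<exists>e\<in>{1, -1}. op \<gamma> (filter (\<lambda>i. 8 * k \<le> i) w) z = e \<odot>\<^bsub>V\<^esub> op \<gamma> (filter (\<lambda>i. 8 * k + 8 \<le> i) w) z"
proof -
  define x where "x b = odd (count_list w (8 * k + b))" for b
  \<comment> \<open>Positions 3, 5 and 7 each lie in a single generator, which decides the first three coefficients
    of the code word; position 2 decides the last.\<close>
  define c where "c = (if x 3 then shift k [0,1,2,3] else []) @ (if x 5 then shift k [0,1,4,5] else []) @
    (if x 7 then shift k [0,1,6,7] else []) @ (if x 2 \<noteq> x 3 then shift k [0,2,4,6] else [])"
  have cn: "set c \<subseteq> {8 * k..<8 * k + 8}"
    by (auto simp: c_def shift_def split: if_splits)
  have cz: "op \<gamma> c z = z"
    using z by (auto simp: c_def hamming_def)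
  have sg: "even (sgnx (shift k [a, b, c, d]) w) \<longleftrightarrow> ((x a = x b) = (x c = x d))" for a b c d
    by (simp add: sgnx_def shift_def x_def) argo
  have e: "(x 0 = x 1) = (x 2 = x 3)" "(x 0 = x 1) = (x 4 = x 5)" "(x 0 = x 1) = (x 6 = x 7)"
      "(x 0 = x 2) = (x 4 = x 6)"
    using even unfolding hamming_def list.set ball_simps sg by argo+
  have cc: "count_list c (8 * k + b) = (if x 3 then count_list [0,1,2,3] b else 0) +
      (if x 5 then count_list [0,1,4,5] b else 0) + (if x 7 then count_list [0,1,6,7] b else 0) +
      (if x 2 \<noteq> x 3 then count_list [0,2,4,6] b else 0)" for b
    by (simp only: c_def count_list_append count_list_shift if_distrib[of "\<lambda>l. count_list l (8 * k + b)"]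
        count_list.simps add.assoc)
  let ?u = "filter (\<lambda>i. 8 * k + 8 \<le> i) w @ c" and ?v = "filter (\<lambda>i. 8 * k \<le> i) w"
  have "even (count_list ?u i + count_list ?v i)" for i
  proof (cases "8 * k \<le> i \<and> i < 8 * k + 8")
    case True
    then obtain b where b: "i = 8 * k + b" "b < 8" by (metis le_Suc_ex nat_add_left_cancel_less)
    then have "b \<in> {0,1,2,3,4,5,6,7}" by auto
    moreover have "even (count_list c (8 * k + b)) \<longleftrightarrow> even (count_list w (8 * k + b))"
    proof -
      have "even (count_list c (8 * k + b)) \<longleftrightarrow> \<not> x b"
        unfolding cc using \<open>b \<in> _\<close> e
        by (elim insertE emptyE; simp; argo)
      then show ?thesis by (simp add: x_def)
    qed
    ultimately show ?thesis using b by (auto simp: count_list_filter)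
  next
    case False
    then have "count_list c i = 0" using cn by (auto intro!: count_notin)
    then show ?thesis using False by (auto simp: count_list_filter)
  qed
  then have "\<exists>e\<in>{1, -1}. \<forall>s\<in>carrier V. op \<gamma> ?v s = e \<odot>\<^bsub>V\<^esub> op \<gamma> ?u s"
    using w cn n by (intro op_same_parity) auto
  then show ?thesis using z cz by auto
qed

lemma code_reduce:
  assumes n: "8 * k \<le> n" and z: "z \<in> carrier V" "\<forall>u\<in>set (code k). op \<gamma> u z = z"
    and w: "set w \<subseteq> {..<n}" and even: "\<forall>u\<in>set (code k). even (sgnx u w)"
  shows "\<exists>e\<in>{1, -1}. op \<gamma> w z = e \<odot>\<^bsub>V\<^esub> op \<gamma> (filter (\<lambda>i. 8 * k \<le> i) w) z"
  using n z(2) even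
proof (induction k)
  case (Suc k)
  then obtain e where e: "e \<in> {1, -1}" "op \<gamma> w z = e \<odot>\<^bsub>V\<^esub> op \<gamma> (filter (\<lambda>i. 8 * k \<le> i) w) z"
    by (auto simp: code_Suc)
  obtain e' where e': "e' \<in> {1, -1}" 
    "op \<gamma> (filter (\<lambda>i. 8 * k \<le> i) w) z = e' \<odot>\<^bsub>V\<^esub> op \<gamma> (filter (\<lambda>i. 8 * k + 8 \<le> i) w) z"
    using code_reduce_block[OF _ z(1) _ w, of k] Suc.prems by (auto simp: code_Suc)
  have "set (filter (\<lambda>i. 8 * k + 8 \<le> i) w) \<subseteq> {..<n}" using w by auto
  then have "op \<gamma> w z = (e * e') \<odot>\<^bsub>V\<^esub> op \<gamma> (filter (\<lambda>i. 8 * Suc k \<le> i) w) z"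
    using e(2) e'(2) z(1) smult_smult[OF op_closed[of "filter (\<lambda>i. 8 * k + 8 \<le> i) w" z], of e e']
    by (simp add: add.commute)
  moreover have "e * e' \<in> {1, -1}" using e(1) e'(1) by auto
  ultimately show ?case by blast
next
  case 0
  show ?case by (rule bexI[of _ 1]) (use z(1) w in auto)
qed

end

lemma length_four_letters:
  "set w \<subseteq> {m..<m + 4} \<Longrightarrow>
    length w = count_list w m + count_list w (m + 1) + count_list w (m + 2) + count_list w (m + (3::nat))"
proof (induction w)
  case (Cons a w)
  then have "a = m \<or> a = m + 1 \<or> a = m + 2 \<or> a = m + 3" by auto
  then show ?case using Cons by auto
qed auto

context gamma_system
begin

lemma fixed_stab_iff:
  assumes "8 * k \<le> n"
  shows "fixed (stab n k e) z \<longleftrightarrow> z \<in> carrier V \<and> (\<forall>u\<in>set (code k). op \<gamma> u z = z) \<and>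
    (n \<noteq> 8 * k \<longrightarrow> e \<odot>\<^bsub>V\<^esub> \<gamma> (8 * k) z = z)"
proof -
  have "1 \<odot>\<^bsub>V\<^esub> op \<gamma> u z = op \<gamma> u z" if "u \<in> set (code k)" "z \<in> carrier V" for u
    using code_words[OF that(1)] assms that(2) by (intro rvs_one op_closed) auto
  then show ?thesis by (auto simp: fixed_def stab_def)
qed

lemma stab_words: "8 * k \<le> n \<Longrightarrow> \<forall>(e, u)\<in>set (stab n k e). set u \<subseteq> {..<n}"
  using code_words[of _ k] by (auto simp: stab_def) fastforce

text \<open>Multiplication by the quaternion \<open>a + b i + c j + d k\<close>, where the units are the even products of
  the generators \<open>m + 1\<close>, \<open>m + 2\<close>, \<open>m + 3\<close>. With fewer than \<open>m + 4\<close> generators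
  only the units that exist remain, so that the scalars are \<open>\<complex>\<close> or \<open>\<real>\<close>.\<close>

definition qop :: "nat \<Rightarrow> real \<Rightarrow> real \<Rightarrow> real \<Rightarrow> real \<Rightarrow> 'a \<Rightarrow> 'a" where
  "qop m a b c d s = a \<odot>\<^bsub>V\<^esub> s
    \<oplus>\<^bsub>V\<^esub> ((if m + 2 < n then b \<odot>\<^bsub>V\<^esub> op \<gamma> [m + 1, m + 2] s else \<zero>\<^bsub>V\<^esub>)
    \<oplus>\<^bsub>V\<^esub> (if m + 3 < n then c \<odot>\<^bsub>V\<^esub> op \<gamma> [m + 1, m + 3] s \<oplus>\<^bsub>V\<^esub> d \<odot>\<^bsub>V\<^esub> op \<gamma> [m + 2, m + 3] s
      else \<zero>\<^bsub>V\<^esub>))"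

lemma qop_closed [simp]: "s \<in> carrier V \<Longrightarrow> qop m a b c d s \<in> carrier V"
  by (simp add: qop_def)

lemma qop_zero: "s \<in> carrier V \<Longrightarrow> qop m 0 0 0 0 s = \<zero>\<^bsub>V\<^esub>"
  by (rule crd_eqI[OF rvs]) (auto simp: qop_def)

lemma qop_add: "s \<in> carrier V \<Longrightarrow>
    qop m a b c d s \<oplus>\<^bsub>V\<^esub> qop m a' b' c' d' s = qop m (a + a') (b + b') (c + c') (d + d') s"
  by (rule crd_eqI[OF rvs]) (auto simp: qop_def algebra_simps)

lemma qop_smult: "s \<in> carrier V \<Longrightarrow> r \<odot>\<^bsub>V\<^esub> qop m a b c d s = qop m (r * a) (r * b) (r * c) (r * d) s"
  by (rule crd_eqI[OF rvs]) (auto simp: qop_def algebra_simps)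

definition qline :: "nat \<Rightarrow> 'a \<Rightarrow> 'a set" where
  "qline m z = {qop m a b c d z | a b c d. True}"

lemma qlineI: "p = qop m a b c d z \<Longrightarrow> p \<in> qline m z"
  by (auto simp: qline_def)

lemma qline_subsp: "z \<in> carrier V \<Longrightarrow> subsp (qline m z) V"
  unfolding subsp_def
proof (intro conjI ballI allI)
  assume z: "z \<in> carrier V"
  show "qline m z \<subseteq> carrier V" using z by (auto simp: qline_def)
  show "\<zero>\<^bsub>V\<^esub> \<in> qline m z" by (rule qlineI[of _ _ 0 0 0 0]) (simp add: qop_zero z)
  fix p r assume "p \<in> qline m z"
  then obtain a b c d where p: "p = qop m a b c d z" by (auto simp: qline_def)
  show "r \<odot>\<^bsub>V\<^esub> p \<in> qline m z" using p z by (auto simp: qop_smult intro: qlineI)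
  fix p' assume "p' \<in> qline m z"
  then obtain a' b' c' d' where p': "p' = qop m a' b' c' d' z" by (auto simp: qline_def)
  show "p \<oplus>\<^bsub>V\<^esub> p' \<in> qline m z" using p p' z by (auto simp: qop_add intro: qlineI)
qed

lemma qop_units:
  assumes "z \<in> carrier V"
  shows "qop m 1 0 0 0 z = z"
    "m + 2 < n \<Longrightarrow> qop m 0 1 0 0 z = op \<gamma> [m + 1, m + 2] z"
    "m + 3 < n \<Longrightarrow> qop m 0 0 1 0 z = op \<gamma> [m + 1, m + 3] z"
    "m + 3 < n \<Longrightarrow> qop m 0 0 0 1 z = op \<gamma> [m + 2, m + 3] z"
  using assms by (auto simp: qop_def intro!: crd_eqI[OF rvs])

text \<open>Commuting with the generator \<open>8 k\<close>, a word in the last generators contains an even number of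
  letters other than \<open>8 k\<close>. The letter \<open>8 k\<close> acts on \<open>z\<close> by a sign, and the others leave one of
  the four quaternion units.\<close>

lemma tail_word_qline:
  assumes n: "8 * k < n" "n \<le> 8 * k + 4" and z: "z \<in> carrier V" "e \<odot>\<^bsub>V\<^esub> \<gamma> (8 * k) z = z" "e \<in> {1, -1}"
    and w: "set w \<subseteq> {8 * k..<n}" "even (length w + count_list w (8 * k))"
  shows "op \<gamma> w z \<in> qline (8 * k) z"
proof -
  let ?m = "8 * k"
  define x where "x b = odd (count_list w (?m + b))" for b
  have "length w = count_list w ?m + count_list w (?m + 1) + count_list w (?m + 2) + count_list w (?m + 3)"
    by (rule length_four_letters) (use w n in auto)
  then have x123: "(x 1 = x 2) = (\<not> x 3)" "x 0 = odd (count_list w ?m)"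
    using w(2) by (auto simp: x_def)
  define u where "u = (if x 1 \<and> x 2 then [?m + 1, ?m + 2] else if x 1 \<and> x 3 then [?m + 1, ?m + 3]
    else if x 2 \<and> x 3 then [?m + 2, ?m + 3] else [])"
  define v where "v = (if x 0 then [?m] else [])"
  have xn: "?m + b < n" if "x b" for b
  proof -
    have "?m + b \<in> set w" using that by (metis count_notin even_zero x_def)
    then show ?thesis using w by auto
  qed
  have un: "set u \<subseteq> {..<n}" using xn[of 1] xn[of 2] xn[of 3] by (auto simp: u_def split: if_splits)
  have vn: "set v \<subseteq> {..<n}" using n by (auto simp: v_def)
  have "even (count_list (u @ v) i + count_list w i)" for i
  proof (cases "?m \<le> i \<and> i < ?m + 4")
    case True
    then obtain b where b: "i = ?m + b" "b < 4" by (metis le_Suc_ex nat_add_left_cancel_less)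
    then have "b \<in> {0,1,2,3}" by auto
    moreover have "odd (count_list (u @ v) (?m + b)) = x b"
      using \<open>b \<in> _\<close> x123(1)
      by (elim insertE emptyE) (simp_all add: u_def v_def, argo+)
    ultimately have "odd (count_list (u @ v) (?m + b)) \<longleftrightarrow> odd (count_list w (?m + b))"
      by (simp only: x_def)
    then show ?thesis unfolding b(1) even_add by blast
  next
    case False
    then have "count_list w i = 0" "count_list (u @ v) i = 0"
      using w n by (auto simp: u_def v_def intro!: count_notin)
    then show ?thesis by simp
  qed
  then have "\<exists>e\<in>{1, -1}. \<forall>s\<in>carrier V. op \<gamma> w s = e \<odot>\<^bsub>V\<^esub> op \<gamma> (u @ v) s"
    using un vn w by (intro op_same_parity) auto
  then obtain e1 where e1: "op \<gamma> w z = e1 \<odot>\<^bsub>V\<^esub> op \<gamma> u (op \<gamma> v z)" using z by auto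
  have "\<gamma> ?m z = e \<odot>\<^bsub>V\<^esub> (e \<odot>\<^bsub>V\<^esub> \<gamma> ?m z)"
    using z(1,3) n by (subst smult_smult) auto
  then have "\<gamma> ?m z = e \<odot>\<^bsub>V\<^esub> z" using z by simp
  then obtain e2 where "op \<gamma> v z = e2 \<odot>\<^bsub>V\<^esub> z"
    using z by (cases "x 0") (auto simp: v_def intro!: that[of 1])
  then have eq: "op \<gamma> w z = (e1 * e2) \<odot>\<^bsub>V\<^esub> op \<gamma> u z"
    using e1 un z by (simp add: op_smult smult_smult)
  have "op \<gamma> u z \<in> qline ?m z"
  proof -
    have q: "op \<gamma> [] z \<in> qline ?m z"
      "?m + 2 < n \<Longrightarrow> op \<gamma> [?m + 1, ?m + 2] z \<in> qline ?m z"
      "?m + 3 < n \<Longrightarrow> op \<gamma> [?m + 1, ?m + 3] z \<in> qline ?m z"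
      "?m + 3 < n \<Longrightarrow> op \<gamma> [?m + 2, ?m + 3] z \<in> qline ?m z"
      using qop_units[OF z(1), of ?m, symmetric] by (auto intro: qlineI simp del: foldr.simps(2))
    show ?thesis
      using xn[of 2] xn[of 3] q by (auto simp: u_def simp del: foldr.simps)
  qed
  then show ?thesis unfolding eq using qline_subsp[OF z(1)] by (intro subsp_smult)
qed

text \<open>A cyclic subspace is spanned by the vectors \<open>op \<gamma> w z\<close>. The projection kills those
  for which \<open>w\<close> fails to commute with the involutions; of the other words only the part after the code
  blocks matters.\<close>

lemma projs_cyc:
  assumes n: "8 * k \<le> n" "n \<le> 8 * k + 4" and z: "fixed (stab n k e) z" "e \<in> {1, -1}"
    and p: "p \<in> cyc z"
  shows "projs (stab n k e) p \<in> qline (8 * k) z"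
proof -
  let ?L = "stab n k e" and ?m = "8 * k"
  have zc: "z \<in> carrier V" and zu: "\<forall>u\<in>set (code k). op \<gamma> u z = z"
    and zm: "n \<noteq> ?m \<longrightarrow> e \<odot>\<^bsub>V\<^esub> \<gamma> ?m z = z"
    using z(1) unfolding fixed_stab_iff[OF n(1)] by auto
  note Lw = stab_words[OF n(1), of e]
  have D: "subsp (qline ?m z) V" by (rule qline_subsp[OF zc])
  have "op \<gamma> w z \<in> {p \<in> carrier V. projs ?L p \<in> qline ?m z}" if w: "set w \<subseteq> {..<n}" for w
  proof -
    let ?w = "filter (\<lambda>i. ?m \<le> i) w"
    have wn: "set ?w \<subseteq> {..<n}" using w by auto
    have "projs ?L (op \<gamma> w z) \<in> qline ?m z"
    proof (cases "\<forall>(e, u)\<in>set ?L. even (sgnx u w)")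
      case False
      then have "projs ?L (op \<gamma> w z) = \<zero>\<^bsub>V\<^esub>" unfolding projs_op[OF Lw z(1) w] by (rule if_not_P)
      then show ?thesis using subsp_zero[OF D] by simp
    next
      case True
      then have "\<forall>u\<in>set (code k). even (sgnx u w)" by (auto simp: stab_def)
      then obtain e0 where e0: "op \<gamma> w z = e0 \<odot>\<^bsub>V\<^esub> op \<gamma> ?w z"
        using code_reduce[OF n(1) zc zu w] by blast
      have "projs ?L (op \<gamma> ?w z) \<in> qline ?m z"
      proof (cases "\<forall>(e, u)\<in>set ?L. even (sgnx u ?w)")
        case False
        then have "projs ?L (op \<gamma> ?w z) = \<zero>\<^bsub>V\<^esub>" unfolding projs_op[OF Lw z(1) wn] by (rule if_not_P)
        then show ?thesis using subsp_zero[OF D] by simp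
      next
        case True
        have "op \<gamma> ?w z \<in> qline ?m z"
        proof (cases "n = ?m")
          case True
          then have "?w = []" using w by (auto simp: filter_empty_conv)
          then show ?thesis using qop_units(1)[OF zc] by (auto intro: qlineI[OF sym])
        next
          case False
          then have "even (length ?w + count_list ?w ?m)"
            using True by (auto simp: stab_def sgnx_def)
          then show ?thesis
            using n False zc zm z(2) w by (intro tail_word_qline) auto
        qed
        then show ?thesis unfolding projs_op[OF Lw z(1) wn] if_P[OF True] .
      qed
      then have "e0 \<odot>\<^bsub>V\<^esub> projs ?L (op \<gamma> ?w z) \<in> qline ?m z" by (rule subsp_smult[OF D])
      then show ?thesis
        unfolding e0 using lin_smult[OF projs_lin[OF Lw]] wn zc by simp
    qed
    then show ?thesis using w zc by simp
  qed
  moreover have "subsp {p \<in> carrier V. projs ?L p \<in> qline ?m z} V"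
    by (rule lin_preimage[OF rvs rvs projs_lin[OF Lw] D])
  ultimately have "cyc z \<subseteq> {p \<in> carrier V. projs ?L p \<in> qline ?m z}"
    using cyc_subset_words[OF zc] by blast
  then show ?thesis using p by auto
qed

lemma fixed_in_cyc:
  assumes "8 * k \<le> n" "n \<le> 8 * k + 4" "fixed (stab n k e) z" "e \<in> {1, -1}"
    and "p \<in> cyc z" "fixed (stab n k e) p"
  shows "p \<in> qline (8 * k) z"
  using projs_cyc[OF assms(1-5)] projs_fixed[OF assms(6)] by simp

text \<open>Multiplying by the conjugate quaternion gives
  \<open>(a\<^sup>2 + b\<^sup>2 + c\<^sup>2 + d\<^sup>2) s = 0\<close>; the proof carries this out in a coordinate in which
  \<open>s\<close> does not vanish.\<close>

lemma qop_eq_zero: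
  assumes "s \<in> carrier V" "s \<noteq> \<zero>\<^bsub>V\<^esub>" "qop m a b c d s = \<zero>\<^bsub>V\<^esub>"
  shows "a = 0 \<and> (m + 2 < n \<longrightarrow> b = 0) \<and> (m + 3 < n \<longrightarrow> c = 0 \<and> d = 0)"
proof -
  obtain y where y: "crd V s y \<noteq> 0" using nonzero_functional[OF rvs assms(1,2)] .
  have eq: "op \<gamma> u (qop m a b c d s) = \<zero>\<^bsub>V\<^esub>" if "set u \<subseteq> {..<n}" for u
    using assms(3) lin_zero[OF rvs rvs op_lin[OF that]] by simp
  consider "n \<le> m + 2" | "n = m + 3" | "m + 3 < n" by linarith
  then show ?thesis
  proof cases
    case 1
    have "crd V (qop m a b c d s) y = a * crd V s y" using 1 assms(1) by (simp add: qop_def)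
    then show ?thesis using 1 assms(3) y by simp
  next
    case 2
    let ?I = "op \<gamma> [m + 1, m + 2]"
    have I: "set [m + 1, m + 2] \<subseteq> {..<n}" using 2 by auto
    have II: "?I (?I s) = (-1) \<odot>\<^bsub>V\<^esub> s" using op_square[OF I assms(1)] by simp
    have n2: "m + 2 < n" "\<not> m + 3 < n" using 2 by auto
    have q: "qop m a b c d s = a \<odot>\<^bsub>V\<^esub> s \<oplus>\<^bsub>V\<^esub> b \<odot>\<^bsub>V\<^esub> ?I s"
      using n2 assms(1) by (auto simp: qop_def intro!: crd_eqI[OF rvs])
    have 0: "a * crd V s y + b * crd V (?I s) y = 0"
      using assms(1) I arg_cong[OF q[unfolded assms(3)], of "\<lambda>t. crd V t y"] by (simp del: foldr.simps)
    have "?I (qop m a b c d s) = a \<odot>\<^bsub>V\<^esub> ?I s \<oplus>\<^bsub>V\<^esub> b \<odot>\<^bsub>V\<^esub> ?I (?I s)"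
      unfolding q using assms(1) I
      by (simp only: lin_add[OF op_lin[OF I]] lin_smult[OF op_lin[OF I]] op_closed rvs_smult rvs)
    then have 1: "a * crd V (?I s) y - b * crd V s y = 0"
      unfolding eq[OF I] II using assms(1) I
      by (drule_tac arg_cong[of _ _ "\<lambda>t. crd V t y"]) (simp del: foldr.simps)
    have "(a\<^sup>2 + b\<^sup>2) * crd V s y =
        a * (a * crd V s y + b * crd V (?I s) y) - b * (a * crd V (?I s) y - b * crd V s y)"
      by (simp add: algebra_simps power2_eq_square)
    then have "a\<^sup>2 + b\<^sup>2 = 0" using 0 1 y by simp
    then show ?thesis using 2 by simp
  next
    case 3
    let ?I = "op \<gamma> [m + 1, m + 2]" and ?J = "op \<gamma> [m + 1, m + 3]" and ?K = "op \<gamma> [m + 2, m + 3]"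
    have I: "set [m + 1, m + 2] \<subseteq> {..<n}" and J: "set [m + 1, m + 3] \<subseteq> {..<n}"
      and K: "set [m + 2, m + 3] \<subseteq> {..<n}" using 3 by auto
    have II: "?I (?I s) = (-1) \<odot>\<^bsub>V\<^esub> s" and JJ: "?J (?J s) = (-1) \<odot>\<^bsub>V\<^esub> s" 
      and KK: "?K (?K s) = (-1) \<odot>\<^bsub>V\<^esub> s"
      using op_square[OF I assms(1)] op_square[OF J assms(1)] op_square[OF K assms(1)] by simp_all
    have IJ: "?J (?I s) = (-1) \<odot>\<^bsub>V\<^esub> ?I (?J s)" and IK: "?K (?I s) = (-1) \<odot>\<^bsub>V\<^esub> ?I (?K s)"
      and JK: "?K (?J s) = (-1) \<odot>\<^bsub>V\<^esub> ?J (?K s)"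
      using op_swap[OF J I assms(1)] op_swap[OF K I assms(1)] op_swap[OF K J assms(1)]
      by (simp_all add: sgnx_def)
    have q: "qop m a b c d s = a \<odot>\<^bsub>V\<^esub> s \<oplus>\<^bsub>V\<^esub> b \<odot>\<^bsub>V\<^esub> ?I s \<oplus>\<^bsub>V\<^esub> c \<odot>\<^bsub>V\<^esub> ?J s \<oplus>\<^bsub>V\<^esub> d \<odot>\<^bsub>V\<^esub> ?K s"
      using 3 assms(1) by (auto simp: qop_def intro!: crd_eqI[OF rvs])
    have qu: "op \<gamma> u (qop m a b c d s) = a \<odot>\<^bsub>V\<^esub> op \<gamma> u s \<oplus>\<^bsub>V\<^esub> b \<odot>\<^bsub>V\<^esub> op \<gamma> u (?I s) \<oplus>\<^bsub>V\<^esub>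
        c \<odot>\<^bsub>V\<^esub> op \<gamma> u (?J s) \<oplus>\<^bsub>V\<^esub> d \<odot>\<^bsub>V\<^esub> op \<gamma> u (?K s)" if u: "set u \<subseteq> {..<n}" for u
      unfolding q using assms(1) I J K u
      by (simp only: lin_add[OF op_lin[OF u]] lin_smult[OF op_lin[OF u]] op_closed rvs_smult rvs_add rvs)
    have crd: "crd V (op \<gamma> u (op \<gamma> v s)) y = - crd V (op \<gamma> v (op \<gamma> u s)) y"
      if "op \<gamma> u (op \<gamma> v s) = (-1) \<odot>\<^bsub>V\<^esub> op \<gamma> v (op \<gamma> u s)" "set u \<subseteq> {..<n}" "set v \<subseteq> {..<n}" for u v
      unfolding that(1) using that(2,3) assms(1) by simp
    let ?s = "crd V s y" and ?i = "crd V (?I s) y" and ?j = "crd V (?J s) y" and ?k = "crd V (?K s) y"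
    let ?ij = "crd V (?I (?J s)) y" and ?ik = "crd V (?I (?K s)) y" and ?jk = "crd V (?J (?K s)) y"
    have 0: "a * ?s + b * ?i + c * ?j + d * ?k = 0"
      using assms(1) I J K arg_cong[OF q[unfolded assms(3)], of "\<lambda>t. crd V t y"] by (simp del: foldr.simps)
    have 1: "a * ?i - b * ?s + c * ?ij + d * ?ik = 0"
      using arg_cong[OF qu[OF I], of "\<lambda>t. crd V t y"] assms(1) I J K unfolding eq[OF I] II
      by (simp del: foldr.simps)
    have 2: "a * ?j - b * ?ij - c * ?s + d * ?jk = 0"
      using arg_cong[OF qu[OF J], of "\<lambda>t. crd V t y"] assms(1) I J K unfolding eq[OF J] JJ IJ
      by (simp del: foldr.simps)
    have 3: "a * ?k - b * ?ik - c * ?jk - d * ?s = 0"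
      using arg_cong[OF qu[OF K], of "\<lambda>t. crd V t y"] assms(1) I J K unfolding eq[OF K] KK IK JK
      by (simp del: foldr.simps)
    have "(a\<^sup>2 + b\<^sup>2 + c\<^sup>2 + d\<^sup>2) * ?s = a * (a * ?s + b * ?i + c * ?j + d * ?k)
        - b * (a * ?i - b * ?s + c * ?ij + d * ?ik) - c * (a * ?j - b * ?ij - c * ?s + d * ?jk)
        - d * (a * ?k - b * ?ik - c * ?jk - d * ?s)"
      by (simp add: algebra_simps power2_eq_square)
    then have "a\<^sup>2 + b\<^sup>2 + c\<^sup>2 + d\<^sup>2 = 0" unfolding 0 1 2 3 using y by simp
    then show ?thesis by (simp add: add_nonneg_eq_0_iff)
  qed
qed

text \<open>For the first word \<open>u\<close> and a joint fixed vector \<open>s\<close> of the others, \<open>s + u s\<close> is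
  fixed by \<open>u\<close>. If it vanishes, \<open>s\<close> has eigenvalue \<open>-1\<close> and the flip of \<open>u\<close> corrects
  this.\<close>

lemma flippable_fixed:
  assumes "flippable L" "\<forall>(u, g)\<in>set L. set u \<subseteq> {..<n} \<and> set g \<subseteq> {..<n}"
    and W: "stable n V \<gamma> W" and s: "s \<in> W" "s \<noteq> \<zero>\<^bsub>V\<^esub>"
  shows "\<exists>s\<in>W. s \<noteq> \<zero>\<^bsub>V\<^esub> \<and> (\<forall>u\<in>fst ` set L. op \<gamma> u s = s)"
  using assms(1,2)
proof (induction L rule: flippable.induct)
  case (2 u g L)
  have Wc: "W \<subseteq> carrier V" and Ws: "subsp W V" using W by (auto simp: stable_def subsp_def)
  have u: "set u \<subseteq> {..<n}" and g: "set g \<subseteq> {..<n}" 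
    using 2 by auto
  have L: "set u' \<subseteq> {..<n}" if "u' \<in> fst ` set L" for u'
    using 2(3) that by fastforce
  have ev: "even (sgnx u' u)" "even (sgnx u' g)" if "u' \<in> fst ` set L" for u'
    using 2(2) that by auto
  obtain s where s: "s \<in> W" "s \<noteq> \<zero>\<^bsub>V\<^esub>" "\<forall>u\<in>fst ` set L. op \<gamma> u s = s" using 2 by auto
  have sc: "s \<in> carrier V" using s Wc by auto
  have uu: "op \<gamma> u (op \<gamma> u s) = s" using op_square[OF u sc] 2 sc by simp
  let ?t = "s \<oplus>\<^bsub>V\<^esub> op \<gamma> u s"
  have ut: "op \<gamma> u ?t = ?t"
    using lin_add[OF op_lin[OF u], of s "op \<gamma> u s"] sc u uu by (auto intro!: crd_eqI[OF rvs])
  show ?case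
  proof (cases "?t = \<zero>\<^bsub>V\<^esub>")
    case False
    have "op \<gamma> u' ?t = ?t" if u': "u' \<in> fst ` set L" for u'
    proof -
      have "op \<gamma> u' (op \<gamma> u s) = op \<gamma> u (op \<gamma> u' s)"
        using op_swap[OF L[OF u'] u sc] ev[OF u'] sc u L[OF u'] by simp
      then show ?thesis
        using lin_add[OF op_lin[OF L[OF u']], of s "op \<gamma> u s"] sc u s(3) u' by simp
    qed
    moreover have "?t \<in> W" using stable_op[OF W u s(1)] s Ws by (auto intro: subsp_add)
    ultimately show ?thesis using ut False by (intro bexI[of _ ?t]) auto
  next
    case True
    have us: "op \<gamma> u s = (-1) \<odot>\<^bsub>V\<^esub> s"
    proof (rule crd_eqI[OF rvs])
      show "crd V (op \<gamma> u s) y = crd V ((-1) \<odot>\<^bsub>V\<^esub> s) y" for y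
        using arg_cong[OF True, of "\<lambda>t. crd V t y"] sc u by simp
    qed (use sc u in auto)
    let ?t = "op \<gamma> g s"
    have "op \<gamma> u ?t = (-1) \<odot>\<^bsub>V\<^esub> op \<gamma> g (op \<gamma> u s)"
      using op_swap[OF u g sc] 2(2) by simp
    then have "op \<gamma> u ?t = ?t" using us sc g by (simp add: op_smult smult_smult)
    moreover have "op \<gamma> u' ?t = ?t" if u': "u' \<in> fst ` set L" for u'
      using op_swap[OF L[OF u'] g sc] ev[OF u'] u' sc g s(3) by simp
    moreover have "?t \<noteq> \<zero>\<^bsub>V\<^esub>" using op_eq_zero_iff[OF g sc] s by simp
    moreover have "?t \<in> W" by (rule stable_op[OF W g s(1)])
    ultimately show ?thesis by (intro bexI[of _ ?t]) auto
  qed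
qed (use s in auto)

lemma code_fixed_exists:
  assumes "8 * k \<le> n" "stable n V \<gamma> W" "s \<in> W" "s \<noteq> \<zero>\<^bsub>V\<^esub>"
  shows "\<exists>s\<in>W. s \<noteq> \<zero>\<^bsub>V\<^esub> \<and> (\<forall>u\<in>set (code k). op \<gamma> u s = s)"
proof -
  have "\<forall>(u, g)\<in>set (code_flips k). set u \<subseteq> {..<n} \<and> set g \<subseteq> {..<n}"
    using code_flips_letters[of _ _ k] assms(1) by fastforce
  from flippable_fixed[OF flippable_code this assms(2-4)]
  show ?thesis by (simp flip: map_fst_code_flips)
qed

lemma code_gamma_fixed_exists:
  assumes "8 * k + 1 < n" "stable n V \<gamma> W" "s \<in> W" "s \<noteq> \<zero>\<^bsub>V\<^esub>"
  shows "\<exists>s\<in>W. s \<noteq> \<zero>\<^bsub>V\<^esub> \<and> fixed (stab n k 1) s"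
proof -
  \<comment> \<open>The next generator flips the sign of the generator \<open>8 k\<close>; this is why at least two generators
    have to follow the code blocks.\<close>
  let ?L = "([8 * k], [8 * k + 1]) # code_flips k"
  have fst: "fst ` set (code_flips k) = set (code k)" by (simp flip: map_fst_code_flips)
  have "even (sgnx u [8 * k + i])" if "u \<in> set (code k)" for u i
    using code_words[OF that] by (intro sgnx_disjoint) auto
  from this[of _ 0] this[of _ 1] have "flippable ?L" using flippable_code[of k] by (simp add: fst sgnx_def)
  moreover have "\<forall>(u, g)\<in>set ?L. set u \<subseteq> {..<n} \<and> set g \<subseteq> {..<n}"
    using code_flips_letters[of _ _ k] assms(1) by fastforce
  ultimately obtain s where s: "s \<in> W" "s \<noteq> \<zero>\<^bsub>V\<^esub>" "\<forall>u\<in>fst ` set ?L. op \<gamma> u s = s"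
    using flippable_fixed assms(2-4) by blast
  moreover have "s \<in> carrier V" using s assms(2) by (auto simp: stable_def subsp_def)
  ultimately have "fixed (stab n k 1) s"
    using fixed_stab_iff[of k 1 s] assms(1) by (auto simp: fst)
  then show ?thesis using s by blast
qed

end

section \<open>Irreducible gamma systems\<close>

lemma direct_sum_simps [simp]:
  "carrier (direct_sum V V') = carrier V \<times> carrier V'"
  "zero (direct_sum V V') = (\<zero>\<^bsub>V\<^esub>, \<zero>\<^bsub>V'\<^esub>)"
  "(s, t) \<oplus>\<^bsub>direct_sum V V'\<^esub> (s', t') = (s \<oplus>\<^bsub>V\<^esub> s', t \<oplus>\<^bsub>V'\<^esub> t')"
  "a \<odot>\<^bsub>direct_sum V V'\<^esub> (s, t) = (a \<odot>\<^bsub>V\<^esub> s, a \<odot>\<^bsub>V'\<^esub> t)"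
  by (simp_all add: direct_sum_def)

lemma gamma_system_direct_sum:
  assumes "gamma_system n V \<gamma>" "gamma_system n V' \<gamma>'"
  shows "gamma_system n (direct_sum V V') (\<lambda>i. map_prod (\<gamma> i) (\<gamma>' i))"
proof -
  interpret N: gamma_system n V \<gamma> by fact
  interpret N': gamma_system n V' \<gamma>' by fact
  show ?thesis
  proof (rule gamma_system.intro)
    fix i j :: nat and p assume i: "i < n"
    show "lin (direct_sum V V') (direct_sum V V') (map_prod (\<gamma> i) (\<gamma>' i))"
      unfolding lin_def using i
      by (simp add: N.gamma_smult N'.gamma_smult lin_add[OF N.gamma_lin] lin_add[OF N'.gamma_lin])
    assume "p \<in> carrier (direct_sum V V')"
    then obtain s t where p: "p = (s, t)" "s \<in> carrier V" "t \<in> carrier V'" by auto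
    show "map_prod (\<gamma> i) (\<gamma>' i) (map_prod (\<gamma> i) (\<gamma>' i) p) = p"
      using p i by (simp add: N.gamma_square N'.gamma_square)
    assume "j < n" "i \<noteq> j"
    then show "map_prod (\<gamma> i) (\<gamma>' i) (map_prod (\<gamma> j) (\<gamma>' j) p) =
        (-1) \<odot>\<^bsub>direct_sum V V'\<^esub> map_prod (\<gamma> j) (\<gamma>' j) (map_prod (\<gamma> i) (\<gamma>' i) p)"
      using p i N.gamma_anticommute[of i j s] N'.gamma_anticommute[of i j t] by simp
  qed (simp add: direct_sum_is_vs)
qed

lemma op_map_prod: "op (\<lambda>i. map_prod (\<gamma> i) (\<gamma>' i)) w (s, t) = (op \<gamma> w s, op \<gamma>' w t)"
  by (induction w) auto

definition intertwines :: "nat \<Rightarrow> (real, 'a) module \<Rightarrow> (nat \<Rightarrow> 'a \<Rightarrow> 'a) \<Rightarrow>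
    (real, 'b) module \<Rightarrow> (nat \<Rightarrow> 'b \<Rightarrow> 'b) \<Rightarrow> ('a \<Rightarrow> 'b) \<Rightarrow> bool" where
  "intertwines n V \<gamma> V' \<gamma>' T \<longleftrightarrow> lin V V' T \<and> (\<forall>i<n. \<forall>s\<in>carrier V. T (\<gamma> i s) = \<gamma>' i (T s))"

lemma intertwines_op:
  assumes "intertwines n V \<gamma> V' \<gamma>' T" "gamma_system n V \<gamma>" "set w \<subseteq> {..<n}" "s \<in> carrier V"
  shows "T (op \<gamma> w s) = op \<gamma>' w (T s)"
proof -
  interpret gamma_system n V \<gamma> by fact
  show ?thesis using assms(3) by (induction w) (use assms(1,4) in \<open>auto simp: intertwines_def\<close>)
qed

text \<open>The subspace \<open>P\<close> of the direct sum that is generated by \<open>(x, x')\<close> is the graph of the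
  isomorphism. If it contained \<open>(x, 0)\<close>, a minimal vector, then \<open>(x, 0)\<close> would be a quaternion
  multiple of \<open>(x, x')\<close>, and the second component forces that quaternion to vanish. Hence the kernels of
  both projections of \<open>P\<close> are proper stable subspaces, which are zero.\<close>

lemma minimal_vector_iso:
  assumes "gamma_system n V \<gamma>" "gamma_system n V' \<gamma>'" and irr: "irr n V \<gamma>" "irr n V' \<gamma>'"
    and n: "8 * k \<le> n" "n \<le> 8 * k + 4" and e: "e \<in> {1, -1}"
    and x: "gamma_system.fixed V \<gamma> (stab n k e) x" "x \<noteq> \<zero>\<^bsub>V\<^esub>"
    and x': "gamma_system.fixed V' \<gamma>' (stab n k e) x'" "x' \<noteq> \<zero>\<^bsub>V'\<^esub>"
  shows "\<exists>T. intertwines n V \<gamma> V' \<gamma>' T \<and> bij_betw T (carrier V) (carrier V') \<and> T x = x'"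
proof -
  interpret N: gamma_system n V \<gamma> by fact
  interpret N': gamma_system n V' \<gamma>' by fact
  let ?\<gamma> = "\<lambda>i. map_prod (\<gamma> i) (\<gamma>' i)" and ?V = "direct_sum V V'" and ?L = "stab n k e"
  interpret S: gamma_system n ?V ?\<gamma> by (rule gamma_system_direct_sum) fact+
  note fx = N.fixed_stab_iff[OF n(1), of e] N'.fixed_stab_iff[OF n(1), of e] S.fixed_stab_iff[OF n(1), of e]
  have xc: "x \<in> carrier V" "x' \<in> carrier V'" using x x' by (auto simp: fx)
  have z: "S.fixed ?L (x, x')" using x x' by (auto simp: fx op_map_prod)
  define P where "P = S.cyc (x, x')"
  have Pst: "stable n ?V ?\<gamma> P" unfolding P_def by (rule S.cyc_stable) (use xc in auto)
  then have Ps: "subsp P ?V" and Pgen: "\<forall>i<n. \<forall>p\<in>P. ?\<gamma> i p \<in> P" by (simp_all add: stable_def)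
  have P: "P \<subseteq> carrier V \<times> carrier V'" "(\<zero>\<^bsub>V\<^esub>, \<zero>\<^bsub>V'\<^esub>) \<in> P"
    using subsp_subset[OF Ps] subsp_zero[OF Ps] by simp_all
  have Padd: "(s \<oplus>\<^bsub>V\<^esub> s', t \<oplus>\<^bsub>V'\<^esub> t') \<in> P" if "(s, t) \<in> P" "(s', t') \<in> P" for s t s' t'
    using subsp_add[OF Ps that] by simp
  have Psm: "(a \<odot>\<^bsub>V\<^esub> s, a \<odot>\<^bsub>V'\<^esub> t) \<in> P" if "(s, t) \<in> P" for a s t
    using subsp_smult[OF Ps that] by simp
  have Pg: "(\<gamma> i s, \<gamma>' i t) \<in> P" if "i < n" "(s, t) \<in> P" for i s t
    using Pgen that by force
  have zP: "(x, x') \<in> P" unfolding P_def by (rule S.cyc_self)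
  have qop: "S.qop m a b c d (s, t) = (N.qop m a b c d s, N'.qop m a b c d t)" for m a b c d s t
    unfolding S.qop_def N.qop_def N'.qop_def op_map_prod by simp
  have zero: "op \<gamma> w \<zero>\<^bsub>V\<^esub> = \<zero>\<^bsub>V\<^esub>" "op \<gamma>' w \<zero>\<^bsub>V'\<^esub> = \<zero>\<^bsub>V'\<^esub>" if "set w \<subseteq> {..<n}" for w
    using N.op_eq_zero_iff[OF that, of "\<zero>\<^bsub>V\<^esub>"] N'.op_eq_zero_iff[OF that, of "\<zero>\<^bsub>V'\<^esub>"] by auto
  have codew: "set u \<subseteq> {..<n}" if "u \<in> set (code k)" for u
    using code_words[OF that] n by auto
  have zg: "\<gamma> i \<zero>\<^bsub>V\<^esub> = \<zero>\<^bsub>V\<^esub>" "\<gamma>' i \<zero>\<^bsub>V'\<^esub> = \<zero>\<^bsub>V'\<^esub>" if "i < n" for i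
    using zero[of "[i]"] that by auto
  have no1: "(x, \<zero>\<^bsub>V'\<^esub>) \<notin> P"
  proof
    assume p: "(x, \<zero>\<^bsub>V'\<^esub>) \<in> P"
    have "S.fixed ?L (x, \<zero>\<^bsub>V'\<^esub>)" using x n by (auto simp: fx op_map_prod zero codew zg)
    then have "(x, \<zero>\<^bsub>V'\<^esub>) \<in> S.qline (8 * k) (x, x')"
      using p unfolding P_def by (intro S.fixed_in_cyc[OF n z e])
    then obtain a b c d where q: "x = N.qop (8 * k) a b c d x" "\<zero>\<^bsub>V'\<^esub> = N'.qop (8 * k) a b c d x'"
      by (auto simp: S.qline_def qop)
    have "N.qop (8 * k) a b c d x = N.qop (8 * k) 0 0 0 0 x"
      using N'.qop_eq_zero[OF xc(2) x'(2) q(2)[symmetric]] by (simp add: N.qop_def xc)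
    then show False using q(1) N.qop_zero[OF xc(1)] x(2) by simp
  qed
  have no2: "(\<zero>\<^bsub>V\<^esub>, x') \<notin> P"
  proof
    assume p: "(\<zero>\<^bsub>V\<^esub>, x') \<in> P"
    have "S.fixed ?L (\<zero>\<^bsub>V\<^esub>, x')" using x' n by (auto simp: fx op_map_prod zero codew zg)
    then have "(\<zero>\<^bsub>V\<^esub>, x') \<in> S.qline (8 * k) (x, x')"
      using p unfolding P_def by (intro S.fixed_in_cyc[OF n z e])
    then obtain a b c d where q: "x' = N'.qop (8 * k) a b c d x'" "\<zero>\<^bsub>V\<^esub> = N.qop (8 * k) a b c d x"
      by (auto simp: S.qline_def qop)
    have "N'.qop (8 * k) a b c d x' = N'.qop (8 * k) 0 0 0 0 x'"
      using N.qop_eq_zero[OF xc(1) x(2) q(2)[symmetric]] by (simp add: N'.qop_def xc)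
    then show False using q(1) N'.qop_zero[OF xc(2)] x'(2) by simp
  qed
  have stab1: "stable n V \<gamma> {s \<in> carrier V. (s, \<zero>\<^bsub>V'\<^esub>) \<in> P}"
    unfolding stable_def subsp_def
  proof (intro conjI ballI allI impI)
    fix s t a i
    assume s: "s \<in> {s \<in> carrier V. (s, \<zero>\<^bsub>V'\<^esub>) \<in> P}"
    show "a \<odot>\<^bsub>V\<^esub> s \<in> {s \<in> carrier V. (s, \<zero>\<^bsub>V'\<^esub>) \<in> P}"
      using s Psm[of s "\<zero>\<^bsub>V'\<^esub>" a] by simp
    show "\<gamma> i s \<in> {s \<in> carrier V. (s, \<zero>\<^bsub>V'\<^esub>) \<in> P}" if "i < n"
      using s that Pg[of i s "\<zero>\<^bsub>V'\<^esub>"] by (simp add: zg)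
    assume "t \<in> {s \<in> carrier V. (s, \<zero>\<^bsub>V'\<^esub>) \<in> P}"
    then show "s \<oplus>\<^bsub>V\<^esub> t \<in> {s \<in> carrier V. (s, \<zero>\<^bsub>V'\<^esub>) \<in> P}"
      using s Padd[of s "\<zero>\<^bsub>V'\<^esub>" t "\<zero>\<^bsub>V'\<^esub>"] by simp
  qed (use P in auto)
  have ker1: "{s \<in> carrier V. (s, \<zero>\<^bsub>V'\<^esub>) \<in> P} = {\<zero>\<^bsub>V\<^esub>}"
    using irr(1) stab1 no1 xc(1) unfolding irr_def by (metis (no_types, lifting) mem_Collect_eq)
  have stab2: "stable n V' \<gamma>' {t \<in> carrier V'. (\<zero>\<^bsub>V\<^esub>, t) \<in> P}"
    unfolding stable_def subsp_def
  proof (intro conjI ballI allI impI)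
    fix s t a i
    assume s: "s \<in> {t \<in> carrier V'. (\<zero>\<^bsub>V\<^esub>, t) \<in> P}"
    show "a \<odot>\<^bsub>V'\<^esub> s \<in> {t \<in> carrier V'. (\<zero>\<^bsub>V\<^esub>, t) \<in> P}"
      using s Psm[of "\<zero>\<^bsub>V\<^esub>" s a] by simp
    show "\<gamma>' i s \<in> {t \<in> carrier V'. (\<zero>\<^bsub>V\<^esub>, t) \<in> P}" if "i < n"
      using s that Pg[of i "\<zero>\<^bsub>V\<^esub>" s] by (simp add: zg)
    assume "t \<in> {t \<in> carrier V'. (\<zero>\<^bsub>V\<^esub>, t) \<in> P}"
    then show "s \<oplus>\<^bsub>V'\<^esub> t \<in> {t \<in> carrier V'. (\<zero>\<^bsub>V\<^esub>, t) \<in> P}"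
      using s Padd[of "\<zero>\<^bsub>V\<^esub>" s "\<zero>\<^bsub>V\<^esub>" t] by simp
  qed (use P in auto)
  have ker2: "{t \<in> carrier V'. (\<zero>\<^bsub>V\<^esub>, t) \<in> P} = {\<zero>\<^bsub>V'\<^esub>}"
    using irr(2) stab2 no2 xc(2) unfolding irr_def by (metis (no_types, lifting) mem_Collect_eq)
  have "stable n V \<gamma> (fst ` P)"
    unfolding stable_def subsp_def using P Padd Psm Pg by (auto simp: image_iff Bex_def; blast)
  then have dom: "fst ` P = carrier V"
    by (rule irrD[OF irr(1) _ _ x(2)]) (use zP in force)
  have "stable n V' \<gamma>' (snd ` P)"
    unfolding stable_def subsp_def using P Padd Psm Pg by (auto simp: image_iff Bex_def; blast)
  then have ran: "snd ` P = carrier V'"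
    by (rule irrD[OF irr(2) _ _ x'(2)]) (use zP in force)
  have diff: "(s \<oplus>\<^bsub>V\<^esub> (-1) \<odot>\<^bsub>V\<^esub> s', t \<oplus>\<^bsub>V'\<^esub> (-1) \<odot>\<^bsub>V'\<^esub> t') \<in> P" if "(s, t) \<in> P" "(s', t') \<in> P" for s s' t t'
    using Padd[OF that(1) Psm[OF that(2), of "-1"]] .
  have uniq1: "t = t'" if "(s, t) \<in> P" "(s, t') \<in> P" for s t t'
  proof -
    have c: "s \<in> carrier V" "t \<in> carrier V'" "t' \<in> carrier V'" using that P by auto
    have "s \<oplus>\<^bsub>V\<^esub> (-1) \<odot>\<^bsub>V\<^esub> s = \<zero>\<^bsub>V\<^esub>" using rvs_diff_eq_zero[OF N.rvs c(1) c(1)] by simp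
    then have "t \<oplus>\<^bsub>V'\<^esub> (-1) \<odot>\<^bsub>V'\<^esub> t' \<in> {t \<in> carrier V'. (\<zero>\<^bsub>V\<^esub>, t) \<in> P}"
      using diff[OF that] c by simp
    then show ?thesis unfolding ker2 using rvs_diff_eq_zero[OF N'.rvs c(2) c(3)] by simp
  qed
  have uniq2: "s = s'" if "(s, t) \<in> P" "(s', t) \<in> P" for s s' t
  proof -
    have c: "s \<in> carrier V" "s' \<in> carrier V" "t \<in> carrier V'" using that P by auto
    have "t \<oplus>\<^bsub>V'\<^esub> (-1) \<odot>\<^bsub>V'\<^esub> t = \<zero>\<^bsub>V'\<^esub>" using rvs_diff_eq_zero[OF N'.rvs c(3) c(3)] by simp
    then have "s \<oplus>\<^bsub>V\<^esub> (-1) \<odot>\<^bsub>V\<^esub> s' \<in> {s \<in> carrier V. (s, \<zero>\<^bsub>V'\<^esub>) \<in> P}"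
      using diff[OF that] c by simp
    then show ?thesis unfolding ker1 using rvs_diff_eq_zero[OF N.rvs c(1) c(2)] by simp
  qed
  define T where "T s = (SOME t. (s, t) \<in> P)" for s
  have TP: "(s, T s) \<in> P" if "s \<in> carrier V" for s
    unfolding T_def by (rule someI_ex) (use dom that in force)
  have Teq: "T s = t" if "(s, t) \<in> P" for s t
    using uniq1[OF TP that] P that by auto
  have "lin V V' T"
    unfolding lin_def using P TP Padd Psm by (auto intro!: Teq)
  moreover have "T (\<gamma> i s) = \<gamma>' i (T s)" if "i < n" "s \<in> carrier V" for i s
    using that Pg TP by (intro Teq) auto
  moreover have "bij_betw T (carrier V) (carrier V')"
  proof (rule bij_betwI')
    show "T s = T s' \<longleftrightarrow> s = s'" if "s \<in> carrier V" "s' \<in> carrier V" for s s'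
      using uniq2[OF TP, of s s'] TP[of s'] that by auto
    show "T s \<in> carrier V'" if "s \<in> carrier V" for s using TP[OF that] P by auto
    show "\<exists>s\<in>carrier V. t = T s" if t: "t \<in> carrier V'" for t
    proof -
      obtain s where "(s, t) \<in> P" using ran t by force
      then show ?thesis using P Teq by auto
    qed
  qed
  moreover have "T x = x'" by (rule Teq[OF zP])
  ultimately show ?thesis unfolding intertwines_def by blast
qed

context gamma_system
begin

lemma qline_8k: "n = 8 * k \<Longrightarrow> s \<in> carrier V \<Longrightarrow> p \<in> qline (8 * k) s \<Longrightarrow> \<exists>a. p = a \<odot>\<^bsub>V\<^esub> s"
proof -
  assume n: "n = 8 * k" and s: "s \<in> carrier V" and p: "p \<in> qline (8 * k) s"
  have "\<not> 8 * k + 2 < n" "\<not> 8 * k + 3 < n" using n by auto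
  then show ?thesis using s p by (auto simp: qline_def qop_def)
qed

lemma irr_cyc: "irr n V \<gamma> \<Longrightarrow> z \<in> carrier V \<Longrightarrow> z \<noteq> \<zero>\<^bsub>V\<^esub> \<Longrightarrow> cyc z = carrier V"
  using irrD[OF _ cyc_stable cyc_self] by blast

text \<open>A nonzero stable subspace contains a minimal vector, which is a multiple of the generator.\<close>

lemma cyclic_minimal_irr:
  assumes "n = 8 * k" "z \<in> carrier V" "z \<noteq> \<zero>\<^bsub>V\<^esub>" "\<forall>u\<in>set (code k). op \<gamma> u z = z"
    and cyc: "cyc z = carrier V"
  shows "irr n V \<gamma>"
  unfolding irr_def
proof (intro conjI allI impI)
  show "carrier V \<noteq> {\<zero>\<^bsub>V\<^esub>}" using assms by auto
  fix W assume W: "stable n V \<gamma> W"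
  then have Ws: "subsp W V" by (simp add: stable_def)
  show "W = {\<zero>\<^bsub>V\<^esub>} \<or> W = carrier V"
  proof (cases "W = {\<zero>\<^bsub>V\<^esub>}")
    case False
    then obtain s where "s \<in> W" "s \<noteq> \<zero>\<^bsub>V\<^esub>" using subsp_zero[OF Ws] by auto
    then obtain p where p: "p \<in> W" "p \<noteq> \<zero>\<^bsub>V\<^esub>" "\<forall>u\<in>set (code k). op \<gamma> u p = p"
      using code_fixed_exists[OF _ W, of k] assms(1) by auto
    have pc: "p \<in> carrier V" using p Ws subsp_subset by auto
    have "p \<in> qline (8 * k) z"
      by (rule fixed_in_cyc[of k 1]) (use assms p pc fixed_stab_iff[of k 1] in auto)
    then obtain a where a: "p = a \<odot>\<^bsub>V\<^esub> z" using qline_8k assms by blast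
    then have "a \<noteq> 0" using p assms(2) by auto
    then have "z \<in> W" using subsp_smult_iff[OF rvs Ws assms(2)] a p by auto
    then have "carrier V \<subseteq> W" using cyc_subset[OF W] cyc by auto
    then show ?thesis using subsp_subset[OF Ws] by auto
  qed auto
qed

lemma irr_1_line:
  assumes "n = 1" "irr n V \<gamma>"
  shows "\<exists>z e. z \<in> carrier V \<and> z \<noteq> \<zero>\<^bsub>V\<^esub> \<and> e \<in> {1, -1} \<and> (\<forall>s\<in>carrier V. \<gamma> 0 s = e \<odot>\<^bsub>V\<^esub> s \<and> (\<exists>a. s = a \<odot>\<^bsub>V\<^esub> z))"
proof -
  obtain s where s: "s \<in> carrier V" "s \<noteq> \<zero>\<^bsub>V\<^esub>" using irr_nonzero[OF assms(2) rvs] .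
  let ?p = "s \<oplus>\<^bsub>V\<^esub> \<gamma> 0 s" 
  have eig: "\<exists>z e. z \<in> carrier V \<and> z \<noteq> \<zero>\<^bsub>V\<^esub> \<and> e \<in> {1, -1} \<and> \<gamma> 0 z = e \<odot>\<^bsub>V\<^esub> z"
  proof (cases "?p = \<zero>\<^bsub>V\<^esub>")
    case True
    have "\<gamma> 0 s = (-1) \<odot>\<^bsub>V\<^esub> s"
    proof (rule crd_eqI[OF rvs])
      show "crd V (\<gamma> 0 s) y = crd V ((-1) \<odot>\<^bsub>V\<^esub> s) y" for y
        using arg_cong[OF True, of "\<lambda>t. crd V t y"] s assms(1) by simp
    qed (use s assms in auto)
    then show ?thesis using s by blast
  next
    case False
    have "\<gamma> 0 ?p = 1 \<odot>\<^bsub>V\<^esub> ?p"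
      using s assms(1) by (auto simp: lin_add[OF gamma_lin] gamma_square intro!: crd_eqI[OF rvs])
    then show ?thesis using False s assms(1) by (intro exI[of _ ?p] exI[of _ 1]) auto
  qed
  then obtain z e where z: "z \<in> carrier V" "z \<noteq> \<zero>\<^bsub>V\<^esub>" "e \<in> {1, -1}" "\<gamma> 0 z = e \<odot>\<^bsub>V\<^esub> z" by auto
  let ?W = "{a \<odot>\<^bsub>V\<^esub> z | a. True}"
  have "subsp ?W V"
    unfolding subsp_def
  proof (intro conjI ballI allI)
    show "\<zero>\<^bsub>V\<^esub> \<in> ?W" using z by (auto intro!: exI[of _ 0])
    show "x \<oplus>\<^bsub>V\<^esub> y \<in> ?W" if xy: "x \<in> ?W" "y \<in> ?W" for x y
    proof -
      obtain a b where "x = a \<odot>\<^bsub>V\<^esub> z" "y = b \<odot>\<^bsub>V\<^esub> z" using xy by auto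
      then have "x \<oplus>\<^bsub>V\<^esub> y = (a + b) \<odot>\<^bsub>V\<^esub> z" using z by (auto intro!: crd_eqI[OF rvs] simp: algebra_simps)
      then show ?thesis by auto
    qed
  qed (use z in \<open>auto simp: smult_smult\<close>)
  moreover have "\<gamma> 0 p \<in> ?W" if p: "p \<in> ?W" for p
    using p z assms(1) by (auto simp: gamma_smult smult_smult)
  ultimately have "stable n V \<gamma> ?W" using assms(1) by (auto simp: stable_def)
  then have W: "?W = carrier V"
    by (rule irrD[OF assms(2), of _ z]) (use z in \<open>auto intro!: exI[of _ 1]\<close>)
  have "\<gamma> 0 s = e \<odot>\<^bsub>V\<^esub> s \<and> (\<exists>a. s = a \<odot>\<^bsub>V\<^esub> z)" if "s \<in> carrier V" for s
  proof -
    have "s \<in> ?W" unfolding W by (rule that)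
    then obtain a where "s = a \<odot>\<^bsub>V\<^esub> z" by auto
    then show ?thesis using z assms(1) by (auto simp: gamma_smult smult_smult mult.commute)
  qed
  then show ?thesis using z by blast
qed

end

section \<open>Quotients of free spaces\<close>

lemma subsp_abelian_subgroup:
  assumes "rvs V" "subsp W V" shows "abelian_subgroup W V"
proof (rule abelian_subgroupI3[OF additive_subgroup.intro[OF subgroup.intro] rvs_abelian_group])
  show "inv\<^bsub>add_monoid V\<^esub> x \<in> W" if "x \<in> W" for x
  proof -
    have "x \<in> carrier V" using that assms subsp_subset by auto
    then have "\<ominus>\<^bsub>V\<^esub> x \<in> W" using subsp_smult[OF assms(2) that] assms(1) by simp
    then show ?thesis by (simp add: a_inv_def)
  qed
qed (use assms in \<open>auto simp: subsp_def\<close>)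

lemma coset_mem:
  assumes "rvs V" "subsp W V" "x \<in> carrier V"
  shows "y \<in> W +>\<^bsub>V\<^esub> x \<longleftrightarrow> y \<in> carrier V \<and> y \<oplus>\<^bsub>V\<^esub> (-1) \<odot>\<^bsub>V\<^esub> x \<in> W"
proof
  assume "y \<in> W +>\<^bsub>V\<^esub> x"
  then obtain w where w: "w \<in> W" "y = w \<oplus>\<^bsub>V\<^esub> x" by (auto simp: a_r_coset_def')
  have wc: "w \<in> carrier V" using w assms subsp_subset by auto
  have "y \<oplus>\<^bsub>V\<^esub> (-1) \<odot>\<^bsub>V\<^esub> x = w"
    unfolding w(2) by (rule crd_eqI[OF assms(1)]) (use assms wc in auto)
  then show "y \<in> carrier V \<and> y \<oplus>\<^bsub>V\<^esub> (-1) \<odot>\<^bsub>V\<^esub> x \<in> W" using w wc assms by simp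
next
  assume y: "y \<in> carrier V \<and> y \<oplus>\<^bsub>V\<^esub> (-1) \<odot>\<^bsub>V\<^esub> x \<in> W"
  have "y = (y \<oplus>\<^bsub>V\<^esub> (-1) \<odot>\<^bsub>V\<^esub> x) \<oplus>\<^bsub>V\<^esub> x"
    by (rule crd_eqI[OF assms(1)]) (use assms y in auto)
  then show "y \<in> W +>\<^bsub>V\<^esub> x" using y unfolding a_r_coset_def' by blast
qed

lemma coset_self: "rvs V \<Longrightarrow> subsp W V \<Longrightarrow> x \<in> carrier V \<Longrightarrow> x \<in> W +>\<^bsub>V\<^esub> x"
  using rvs_diff_eq_zero[of V x x] by (simp add: coset_mem subsp_zero)

lemma coset_eq_iff:
  assumes "rvs V" "subsp W V" "x \<in> carrier V" "y \<in> carrier V"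
  shows "W +>\<^bsub>V\<^esub> x = W +>\<^bsub>V\<^esub> y \<longleftrightarrow> x \<oplus>\<^bsub>V\<^esub> (-1) \<odot>\<^bsub>V\<^esub> y \<in> W"
proof
  assume "W +>\<^bsub>V\<^esub> x = W +>\<^bsub>V\<^esub> y"
  then show "x \<oplus>\<^bsub>V\<^esub> (-1) \<odot>\<^bsub>V\<^esub> y \<in> W"
    using coset_self[OF assms(1-3)] coset_mem[OF assms(1,2,4)] by simp
next
  assume xy: "x \<oplus>\<^bsub>V\<^esub> (-1) \<odot>\<^bsub>V\<^esub> y \<in> W"
  have yx: "(-1) \<odot>\<^bsub>V\<^esub> (x \<oplus>\<^bsub>V\<^esub> (-1) \<odot>\<^bsub>V\<^esub> y) \<in> W" by (rule subsp_smult[OF assms(2) xy])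
  have 1: "z \<oplus>\<^bsub>V\<^esub> (-1) \<odot>\<^bsub>V\<^esub> y = (z \<oplus>\<^bsub>V\<^esub> (-1) \<odot>\<^bsub>V\<^esub> x) \<oplus>\<^bsub>V\<^esub> (x \<oplus>\<^bsub>V\<^esub> (-1) \<odot>\<^bsub>V\<^esub> y)"
    "z \<oplus>\<^bsub>V\<^esub> (-1) \<odot>\<^bsub>V\<^esub> x = (z \<oplus>\<^bsub>V\<^esub> (-1) \<odot>\<^bsub>V\<^esub> y) \<oplus>\<^bsub>V\<^esub> (-1) \<odot>\<^bsub>V\<^esub> (x \<oplus>\<^bsub>V\<^esub> (-1) \<odot>\<^bsub>V\<^esub> y)"
    if "z \<in> carrier V" for z
    by (rule crd_eqI[OF assms(1)]; use assms that in simp)+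
  show "W +>\<^bsub>V\<^esub> x = W +>\<^bsub>V\<^esub> y"
  proof (rule Set.set_eqI)
    fix z
    show "z \<in> W +>\<^bsub>V\<^esub> x \<longleftrightarrow> z \<in> W +>\<^bsub>V\<^esub> y"
    proof
      assume "z \<in> W +>\<^bsub>V\<^esub> x"
      then have z: "z \<in> carrier V" "z \<oplus>\<^bsub>V\<^esub> (-1) \<odot>\<^bsub>V\<^esub> x \<in> W"
        unfolding coset_mem[OF assms(1-3)] by auto
      have "z \<oplus>\<^bsub>V\<^esub> (-1) \<odot>\<^bsub>V\<^esub> y \<in> W"
        unfolding 1(1)[OF z(1)] by (rule subsp_add[OF assms(2) z(2) xy])
      then show "z \<in> W +>\<^bsub>V\<^esub> y" unfolding coset_mem[OF assms(1,2,4)] using z by simp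
    next
      assume "z \<in> W +>\<^bsub>V\<^esub> y"
      then have z: "z \<in> carrier V" "z \<oplus>\<^bsub>V\<^esub> (-1) \<odot>\<^bsub>V\<^esub> y \<in> W"
        unfolding coset_mem[OF assms(1,2,4)] by auto
      have "z \<oplus>\<^bsub>V\<^esub> (-1) \<odot>\<^bsub>V\<^esub> x \<in> W"
        by (subst 1(2)[OF z(1)]) (rule subsp_add[OF assms(2) z(2) yx])
      then show "z \<in> W +>\<^bsub>V\<^esub> x" unfolding coset_mem[OF assms(1-3)] using z by simp
    qed
  qed
qed

lemma UN_coset:
  assumes "rvs V" "subsp W V" "x \<in> carrier V"
    and "\<And>y. y \<in> carrier V \<Longrightarrow> y \<oplus>\<^bsub>V\<^esub> (-1) \<odot>\<^bsub>V\<^esub> x \<in> W \<Longrightarrow> f y = f x"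
  shows "(\<Union>y\<in>W +>\<^bsub>V\<^esub> x. f y) = f x"
  using coset_self[OF assms(1-3)] coset_mem[OF assms(1-3)] assms(4) by blast

context
  fixes V :: "(real, 'a) module" and W
  assumes V: "rvs V" and W: "subsp W V"
begin

lemma quotient_carrier: "carrier (quotient_space V W) = (\<lambda>x. W +>\<^bsub>V\<^esub> x) ` carrier V"
  by (auto simp: quotient_space_def A_RCOSETS_def')

lemma quotient_add:
  "x \<in> carrier V \<Longrightarrow> y \<in> carrier V \<Longrightarrow>
    (W +>\<^bsub>V\<^esub> x) \<oplus>\<^bsub>quotient_space V W\<^esub> (W +>\<^bsub>V\<^esub> y) = W +>\<^bsub>V\<^esub> (x \<oplus>\<^bsub>V\<^esub> y)"
  using abelian_subgroup.a_rcos_sum[OF subsp_abelian_subgroup[OF V W]]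
  by (simp add: quotient_space_def)

lemma quotient_smult:
  assumes "x \<in> carrier V"
  shows "a \<odot>\<^bsub>quotient_space V W\<^esub> (W +>\<^bsub>V\<^esub> x) = W +>\<^bsub>V\<^esub> (a \<odot>\<^bsub>V\<^esub> x)"
proof -
  have "W +>\<^bsub>V\<^esub> (a \<odot>\<^bsub>V\<^esub> y) = W +>\<^bsub>V\<^esub> (a \<odot>\<^bsub>V\<^esub> x)" if "y \<in> carrier V" "y \<oplus>\<^bsub>V\<^esub> (-1) \<odot>\<^bsub>V\<^esub> x \<in> W" for y
  proof -
    have "a \<odot>\<^bsub>V\<^esub> y \<oplus>\<^bsub>V\<^esub> (-1) \<odot>\<^bsub>V\<^esub> (a \<odot>\<^bsub>V\<^esub> x) = a \<odot>\<^bsub>V\<^esub> (y \<oplus>\<^bsub>V\<^esub> (-1) \<odot>\<^bsub>V\<^esub> x)"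
      by (rule crd_eqI[OF V]) (use V that assms in \<open>auto simp: algebra_simps\<close>)
    then show ?thesis
      using subsp_smult[OF W that(2)] that assms V by (subst coset_eq_iff[OF V W]) auto
  qed
  then show ?thesis
    using UN_coset[OF V W assms, of "\<lambda>y. W +>\<^bsub>V\<^esub> (a \<odot>\<^bsub>V\<^esub> y)"] by (simp add: quotient_space_def)
qed

lemma quotient_zero: "\<zero>\<^bsub>quotient_space V W\<^esub> = W +>\<^bsub>V\<^esub> \<zero>\<^bsub>V\<^esub>"
proof -
  have "W +>\<^bsub>V\<^esub> \<zero>\<^bsub>V\<^esub> = W"
    using V subsp_subset[OF W] by (auto simp: coset_mem[OF V W])
  then show ?thesis by (simp add: quotient_space_def)
qed

lemma quotient_zero_iff: "x \<in> carrier V \<Longrightarrow> W +>\<^bsub>V\<^esub> x = \<zero>\<^bsub>quotient_space V W\<^esub> \<longleftrightarrow> x \<in> W"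
  unfolding quotient_zero using V by (subst coset_eq_iff[OF V W]) auto

lemma quotient_rvs: "rvs (quotient_space V W)"
proof (rule rvsI)
  let ?Q = "quotient_space V W" and ?p = "\<lambda>x. W +>\<^bsub>V\<^esub> x"
  note q = quotient_carrier quotient_add quotient_smult quotient_zero V
  show "\<zero>\<^bsub>?Q\<^esub> \<in> carrier ?Q" by (simp add: q)
  fix a b :: real and X Y Z assume "X \<in> carrier ?Q"
  then obtain x where x: "X = ?p x" "x \<in> carrier V" by (auto simp: q)
  show "a \<odot>\<^bsub>?Q\<^esub> X \<in> carrier ?Q" "1 \<odot>\<^bsub>?Q\<^esub> X = X" "X \<oplus>\<^bsub>?Q\<^esub> \<zero>\<^bsub>?Q\<^esub> = X"
    using x by (simp_all add: q)
  show "X \<oplus>\<^bsub>?Q\<^esub> (-1) \<odot>\<^bsub>?Q\<^esub> X = \<zero>\<^bsub>?Q\<^esub>"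
    using x rvs_diff_eq_zero[OF V x(2) x(2)] by (simp add: q)
  have v: "(a * b) \<odot>\<^bsub>V\<^esub> x = a \<odot>\<^bsub>V\<^esub> (b \<odot>\<^bsub>V\<^esub> x)" "(a + b) \<odot>\<^bsub>V\<^esub> x = a \<odot>\<^bsub>V\<^esub> x \<oplus>\<^bsub>V\<^esub> b \<odot>\<^bsub>V\<^esub> x"
    by (rule crd_eqI[OF V]; use x V in \<open>simp add: algebra_simps\<close>)+
  show "(a * b) \<odot>\<^bsub>?Q\<^esub> X = a \<odot>\<^bsub>?Q\<^esub> (b \<odot>\<^bsub>?Q\<^esub> X)" "(a + b) \<odot>\<^bsub>?Q\<^esub> X = a \<odot>\<^bsub>?Q\<^esub> X \<oplus>\<^bsub>?Q\<^esub> b \<odot>\<^bsub>?Q\<^esub> X"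
    using x v by (simp_all add: q)
  assume "Y \<in> carrier ?Q"
  then obtain y where y: "Y = ?p y" "y \<in> carrier V" by (auto simp: q)
  show "X \<oplus>\<^bsub>?Q\<^esub> Y \<in> carrier ?Q" using x y by (simp add: q)
  have v: "x \<oplus>\<^bsub>V\<^esub> y = y \<oplus>\<^bsub>V\<^esub> x" "a \<odot>\<^bsub>V\<^esub> (x \<oplus>\<^bsub>V\<^esub> y) = a \<odot>\<^bsub>V\<^esub> x \<oplus>\<^bsub>V\<^esub> a \<odot>\<^bsub>V\<^esub> y"
    by (rule crd_eqI[OF V]; use x y V in \<open>simp add: algebra_simps\<close>)+
  show "X \<oplus>\<^bsub>?Q\<^esub> Y = Y \<oplus>\<^bsub>?Q\<^esub> X" using x y v(1) by (simp add: q)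
  show "a \<odot>\<^bsub>?Q\<^esub> (X \<oplus>\<^bsub>?Q\<^esub> Y) = a \<odot>\<^bsub>?Q\<^esub> X \<oplus>\<^bsub>?Q\<^esub> a \<odot>\<^bsub>?Q\<^esub> Y" using x y v(2) by (simp add: q)
  assume "Z \<in> carrier ?Q"
  then obtain z where z: "Z = ?p z" "z \<in> carrier V" by (auto simp: q)
  show "X \<oplus>\<^bsub>?Q\<^esub> Y \<oplus>\<^bsub>?Q\<^esub> Z = X \<oplus>\<^bsub>?Q\<^esub> (Y \<oplus>\<^bsub>?Q\<^esub> Z)"
  proof -
    have "x \<oplus>\<^bsub>V\<^esub> y \<oplus>\<^bsub>V\<^esub> z = x \<oplus>\<^bsub>V\<^esub> (y \<oplus>\<^bsub>V\<^esub> z)"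
      by (rule crd_eqI[OF V]; use x y z V in simp)
    then show ?thesis using x y z by (simp add: q)
  qed
qed

lemma quotient_map_coset:
  assumes f: "lin V V f" "\<And>x. x \<in> W \<Longrightarrow> f x \<in> W" and x: "x \<in> carrier V"
  shows "quotient_map V W f (W +>\<^bsub>V\<^esub> x) = W +>\<^bsub>V\<^esub> f x"
proof -
  have "W +>\<^bsub>V\<^esub> f y = W +>\<^bsub>V\<^esub> f x" if "y \<in> carrier V" "y \<oplus>\<^bsub>V\<^esub> (-1) \<odot>\<^bsub>V\<^esub> x \<in> W" for y
    using f(2)[OF that(2)] that x V
    by (subst coset_eq_iff[OF V W]) (auto simp: lin_closed[OF f(1)] lin_add[OF f(1)] lin_smult[OF f(1)])
  then show ?thesis
    using UN_coset[OF V W x, of "\<lambda>y. W +>\<^bsub>V\<^esub> f y"] by (simp add: quotient_map_def)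
qed

end

subsection \<open>Spaces presented by generators and relations\<close>

lemma carrier_free_space: "f \<in> carrier (free_space X) \<longleftrightarrow> fs f \<and> {x. f x \<noteq> 0} \<subseteq> X"
  by (auto simp: free_space_def fs_def)

lemma free_space_simps [simp]:
  "\<zero>\<^bsub>free_space X\<^esub> = (\<lambda>_. 0)" "f \<oplus>\<^bsub>free_space X\<^esub> g = (\<lambda>x. f x + g x)"
  "a \<odot>\<^bsub>free_space X\<^esub> f = (\<lambda>x. a * f x)"
  by (auto simp: free_space_def)

lemma free_space_rvs: "rvs (free_space X)"
proof (rule rvsI)
  show "\<zero>\<^bsub>free_space X\<^esub> \<in> carrier (free_space X)" by (simp add: carrier_free_space)
  fix f g and a :: real assume f: "f \<in> carrier (free_space X)"
  show "a \<odot>\<^bsub>free_space X\<^esub> f \<in> carrier (free_space X)"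
    using f by (auto simp: carrier_free_space)
  assume g: "g \<in> carrier (free_space X)"
  have "{x. f x + g x \<noteq> 0} \<subseteq> {x. f x \<noteq> 0} \<union> {x. g x \<noteq> 0}" by auto
  also have "\<dots> \<subseteq> X" using f g by (simp add: carrier_free_space)
  finally show "f \<oplus>\<^bsub>free_space X\<^esub> g \<in> carrier (free_space X)"
    using f g unfolding carrier_free_space free_space_simps by (intro conjI fs_add) auto
qed (unfold free_space_simps, (rule ext, simp add: algebra_simps)+)

lemma gen_carrier [simp]: "gen x \<in> carrier (free_space X) \<longleftrightarrow> x \<in> X"
proof -
  have "{y. gen x y \<noteq> 0} = {x}" by (auto simp: gen_def)
  then show ?thesis by (simp add: carrier_free_space)
qed

lemma free_space_diff:
  "f \<in> carrier (free_space X) \<Longrightarrow> g \<in> carrier (free_space X) \<Longrightarrow> (\<lambda>x. f x - g x) \<in> carrier (free_space X)"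
  using rvs_add[OF free_space_rvs _ rvs_smult[OF free_space_rvs], of f X g "-1"] by simp

lemma free_space_mult:
  "f \<in> carrier (free_space X) \<Longrightarrow> (\<lambda>x. a * f x) \<in> carrier (free_space X)"
  using rvs_smult[OF free_space_rvs, of f X a] by simp

lemma free_map_ev:
  assumes "fs f" shows "free_map h f y = ev (\<lambda>x. if h x = y then 1 else 0) f"
proof -
  have "{x. f x \<noteq> 0 \<and> h x = y} = {x. f x \<noteq> 0} \<inter> {x. h x = y}" by auto
  then show ?thesis
    using assms by (simp add: free_map_def ev_def fs_def sum.inter_restrict if_distrib[of "\<lambda>t. _ * t"] cong: if_cong)
qed

lemma free_map_gen [simp]: "free_map h (gen x) = gen (h x)"
  by (rule ext) (auto simp: free_map_ev gen_def[of "h x"])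

lemma free_map_add: "fs f \<Longrightarrow> fs g \<Longrightarrow> free_map h (\<lambda>x. f x + g x) = (\<lambda>y. free_map h f y + free_map h g y)"
  by (rule ext) (simp add: free_map_ev ev_add)

lemma free_map_diff: "fs f \<Longrightarrow> fs g \<Longrightarrow> free_map h (\<lambda>x. f x - g x) = (\<lambda>y. free_map h f y - free_map h g y)"
  by (rule ext) (simp add: free_map_ev ev_diff)

lemma free_map_smult: "fs f \<Longrightarrow> free_map h (\<lambda>x. a * f x) = (\<lambda>y. a * free_map h f y)"
  by (rule ext) (simp add: free_map_ev ev_smult)

lemma free_map_lin:
  assumes "\<And>x. x \<in> X \<Longrightarrow> h x \<in> Y"
  shows "lin (free_space X) (free_space Y) (free_map h)"
  unfolding lin_def
proof (intro conjI ballI allI)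
  fix f g a assume f: "f \<in> carrier (free_space X)"
  then have fsf: "fs f" by (simp add: carrier_free_space)
  have sub: "{y. free_map h f y \<noteq> 0} \<subseteq> h ` {x. f x \<noteq> 0}"
  proof
    fix y assume "y \<in> {y. free_map h f y \<noteq> 0}"
    then have "(\<Sum>x | f x \<noteq> 0 \<and> h x = y. f x) \<noteq> 0" by (simp add: free_map_def)
    then have "{x. f x \<noteq> 0 \<and> h x = y} \<noteq> {}" by (metis sum.empty)
    then show "y \<in> h ` {x. f x \<noteq> 0}" by auto
  qed
  have fin: "finite {x. f x \<noteq> 0}" and supp: "{x. f x \<noteq> 0} \<subseteq> X"
    using f by (simp_all add: carrier_free_space fs_def)
  have "h ` {x. f x \<noteq> 0} \<subseteq> Y" using supp assms by blast
  then show "free_map h f \<in> carrier (free_space Y)"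
    using finite_subset[OF sub finite_imageI[OF fin]] sub
    unfolding carrier_free_space fs_def by blast
  show "free_map h (a \<odot>\<^bsub>free_space X\<^esub> f) = a \<odot>\<^bsub>free_space Y\<^esub> free_map h f"
    using fsf by (simp add: free_map_smult)
  assume "g \<in> carrier (free_space X)"
  then have "fs g" by (simp add: carrier_free_space)
  then show "free_map h (f \<oplus>\<^bsub>free_space X\<^esub> g) = free_map h f \<oplus>\<^bsub>free_space Y\<^esub> free_map h g"
    using fsf by (simp add: free_map_add)
qed

abbreviation span_in :: "(real, 'a) module \<Rightarrow> 'a set \<Rightarrow> 'a set" where
  "span_in V R \<equiv> LinearCombinations.module.span class_ring V R"

lemma span_in:
  assumes "rvs V" "R \<subseteq> carrier V"
  shows span_in_subsp: "subsp (span_in V R) V"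
    and span_in_superset: "R \<subseteq> span_in V R"
    and span_in_least: "subsp W V \<Longrightarrow> R \<subseteq> W \<Longrightarrow> span_in V R \<subseteq> W"
proof -
  interpret M: Module.module class_ring V by (rule rvs_module[OF assms(1)])
  show "subsp (span_in V R) V"
    using M.span_is_submodule[OF assms(2)] assms(1)
    by (simp add: subspace_def flip: subspace_iff_subsp)
  show "R \<subseteq> span_in V R" by (rule M.in_own_span[OF assms(2)])
  show "span_in V R \<subseteq> W" if "subsp W V" "R \<subseteq> W"
    using M.span_is_subset[OF that(2)] that(1) assms(1)
    by (simp add: subspace_def flip: subspace_iff_subsp)
qed


locale presentation =
  fixes X :: "'x set" and R :: "('x \<Rightarrow> real) set"
  assumes R: "R \<subseteq> carrier (free_space X)"
begin

abbreviation "F \<equiv> free_space X"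
abbreviation "K \<equiv> span_in F R"
abbreviation "Q \<equiv> quotient_space F K"

definition cl :: "'x \<Rightarrow> ('x \<Rightarrow> real) set" where
  "cl x = K +>\<^bsub>F\<^esub> gen x"

lemma K: "subsp K F"
  by (rule span_in_subsp[OF free_space_rvs R])

lemma Q_rvs: "rvs Q"
  by (rule quotient_rvs[OF free_space_rvs K])

lemma cl_carrier: "x \<in> X \<Longrightarrow> cl x \<in> carrier Q"
  by (simp add: cl_def quotient_carrier[OF free_space_rvs K])

lemma Q_generated:
  assumes W: "subsp W Q" "\<And>x. x \<in> X \<Longrightarrow> cl x \<in> W"
  shows "carrier Q \<subseteq> W"
proof
  fix A assume "A \<in> carrier Q"
  then obtain f where A: "A = K +>\<^bsub>F\<^esub> f" and f: "f \<in> carrier F"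
    by (auto simp: quotient_carrier[OF free_space_rvs K])
  have "fs f" "{x. f x \<noteq> 0} \<subseteq> X" using f by (simp_all add: carrier_free_space)
  then have "f \<in> carrier F \<and> K +>\<^bsub>F\<^esub> f \<in> W"
  proof (induction rule: fs_induct)
    case zero
    show ?case
      using subsp_zero[OF W(1)] rvs_zero[OF free_space_rvs, of X]
      by (simp add: quotient_zero[OF free_space_rvs K])
  next
    case (gen f a x)
    have g: "gen x \<in> carrier F" using gen by simp
    have ag: "(\<lambda>y. a * gen x y) \<in> carrier F" by (rule free_space_mult[OF g])
    have "K +>\<^bsub>F\<^esub> (\<lambda>y. f y + a * gen x y) = (K +>\<^bsub>F\<^esub> f) \<oplus>\<^bsub>Q\<^esub> a \<odot>\<^bsub>Q\<^esub> cl x"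
      using gen.IH g ag by (simp add: cl_def quotient_smult[OF free_space_rvs K] quotient_add[OF free_space_rvs K])
    also have "\<dots> \<in> W"
      using gen W by (intro subsp_add[OF W(1)] subsp_smult[OF W(1)]) auto
    finally show ?case
      using rvs_add[OF free_space_rvs _ ag, of f] gen.IH by simp
  qed
  then show "A \<in> W" using A by simp
qed

text \<open>A generator is nonzero as soon as some map on the generators extends to a linear map that kills
  the relations but not this generator.\<close>

lemma cl_nonzero:
  fixes b :: "'x \<Rightarrow> 'v::real_vector"
  assumes "\<And>\<rho>. \<rho> \<in> R \<Longrightarrow> ev b \<rho> = 0" "x \<in> X" "b x \<noteq> 0"
  shows "cl x \<noteq> \<zero>\<^bsub>Q\<^esub>"
proof
  assume "cl x = \<zero>\<^bsub>Q\<^esub>"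
  then have "gen x \<in> K"
    using quotient_zero_iff[OF free_space_rvs K, of "gen x"] assms(2) by (simp add: cl_def)
  moreover have "K \<subseteq> {f \<in> carrier F. ev b f = 0}"
  proof (rule span_in_least[OF free_space_rvs R])
    show "subsp {f \<in> carrier F. ev b f = 0} F"
      unfolding subsp_def
    proof (intro conjI ballI allI)
      show "\<zero>\<^bsub>F\<^esub> \<in> {f \<in> carrier F. ev b f = 0}"
        using rvs_zero[OF free_space_rvs, of X] by simp
      fix f g and a :: real assume f: "f \<in> {f \<in> carrier F. ev b f = 0}"
      then have ff: "fs f" by (simp add: carrier_free_space)
      show "a \<odot>\<^bsub>F\<^esub> f \<in> {f \<in> carrier F. ev b f = 0}"
        using rvs_smult[OF free_space_rvs, of f X a] f ff by (simp add: ev_smult)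
      assume g: "g \<in> {f \<in> carrier F. ev b f = 0}"
      then have gg: "fs g" by (simp add: carrier_free_space)
      show "f \<oplus>\<^bsub>F\<^esub> g \<in> {f \<in> carrier F. ev b f = 0}"
        using rvs_add[OF free_space_rvs, of f X g] f g ff gg by (simp add: ev_add)
    qed auto
    show "R \<subseteq> {f \<in> carrier F. ev b f = 0}" using R assms(1) by auto
  qed
  ultimately show False using assms(3) by auto
qed

lemma K_diff_cl:
  assumes "f \<in> carrier F" "g \<in> carrier F" "(\<lambda>x. f x - g x) \<in> R"
  shows "K +>\<^bsub>F\<^esub> f = K +>\<^bsub>F\<^esub> g"
  using span_in_superset[OF free_space_rvs R] assms
  by (subst coset_eq_iff[OF free_space_rvs K]) auto

lemma cl_add:
  assumes "(\<lambda>p. gen x p - gen y p - gen z p) \<in> R" "x \<in> X" "y \<in> X" "z \<in> X"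
  shows "cl x = cl y \<oplus>\<^bsub>Q\<^esub> cl z"
proof -
  have s: "(\<lambda>p. gen y p + gen z p) \<in> carrier F"
    using rvs_add[OF free_space_rvs, of "gen y" X "gen z"] assms by simp
  have "cl x = K +>\<^bsub>F\<^esub> (\<lambda>p. gen y p + gen z p)"
    unfolding cl_def by (rule K_diff_cl) (use assms s in \<open>simp_all add: algebra_simps\<close>)
  then show ?thesis
    using assms by (simp add: cl_def quotient_add[OF free_space_rvs K])
qed

lemma cl_smult:
  assumes "(\<lambda>p. gen x p - a * gen y p) \<in> R" "x \<in> X" "y \<in> X"
  shows "cl x = a \<odot>\<^bsub>Q\<^esub> cl y"
proof -
  have s: "(\<lambda>p. a * gen y p) \<in> carrier F"
    by (rule free_space_mult) (use assms in simp)
  have "cl x = K +>\<^bsub>F\<^esub> (\<lambda>p. a * gen y p)"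
    unfolding cl_def by (rule K_diff_cl) (use assms s in simp_all)
  then show ?thesis
    using assms by (simp add: cl_def quotient_smult[OF free_space_rvs K])
qed

lemma cl_eq: "(\<lambda>p. gen x p - gen y p) \<in> R \<Longrightarrow> x \<in> X \<Longrightarrow> y \<in> X \<Longrightarrow> cl x = cl y"
  unfolding cl_def by (rule K_diff_cl) auto

context
  fixes h assumes hX: "\<And>x. x \<in> X \<Longrightarrow> h x \<in> X" and hR: "\<And>\<rho>. \<rho> \<in> R \<Longrightarrow> free_map h \<rho> \<in> R"
begin

lemma free_map_K: "f \<in> K \<Longrightarrow> free_map h f \<in> K"
proof -
  have l: "lin F F (free_map h)" by (rule free_map_lin[OF hX])
  have "K \<subseteq> {f \<in> carrier F. free_map h f \<in> K}"
    by (rule span_in_least[OF free_space_rvs R lin_preimage[OF free_space_rvs free_space_rvs l K]])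
       (use R hR span_in_superset[OF free_space_rvs R] in auto)
  then show "f \<in> K \<Longrightarrow> free_map h f \<in> K" by auto
qed

lemma quotient_map_cl: "x \<in> X \<Longrightarrow> quotient_map F K (free_map h) (cl x) = cl (h x)"
  unfolding cl_def
  by (subst quotient_map_coset[OF free_space_rvs K free_map_lin[OF hX] free_map_K]) auto

lemma quotient_map_lin: "lin Q Q (quotient_map F K (free_map h))"
  unfolding lin_def
proof (intro conjI ballI allI)
  have l: "lin F F (free_map h)" by (rule free_map_lin[OF hX])
  note q = quotient_map_coset[OF free_space_rvs K l free_map_K]
    quotient_carrier[OF free_space_rvs K] quotient_add[OF free_space_rvs K] quotient_smult[OF free_space_rvs K]
  note c = rvs_add[OF free_space_rvs] rvs_smult[OF free_space_rvs]
  fix A B a assume "A \<in> carrier Q"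
  then obtain f where f: "A = K +>\<^bsub>F\<^esub> f" "f \<in> carrier F" by (auto simp: q)
  show "quotient_map F K (free_map h) A \<in> carrier Q"
    using f by (simp add: q lin_closed[OF l])
  show "quotient_map F K (free_map h) (a \<odot>\<^bsub>Q\<^esub> A) = a \<odot>\<^bsub>Q\<^esub> quotient_map F K (free_map h) A"
    using f by (simp add: q c lin_closed[OF l] lin_smult[OF l] del: free_space_simps)
  assume "B \<in> carrier Q"
  then obtain g where g: "B = K +>\<^bsub>F\<^esub> g" "g \<in> carrier F" by (auto simp: q)
  show "quotient_map F K (free_map h) (A \<oplus>\<^bsub>Q\<^esub> B) =
      quotient_map F K (free_map h) A \<oplus>\<^bsub>Q\<^esub> quotient_map F K (free_map h) B"
    using f g by (simp add: q c lin_closed[OF l] lin_add[OF l] del: free_space_simps)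
qed

end

end

section \<open>Tensor products and tensor powers\<close>

locale tensor_pair =
  fixes M :: "(real, 'm) module" and r :: "'k \<Rightarrow> 'm \<Rightarrow> 'm"
    and N :: "(real, 'n) module" and l :: "'k \<Rightarrow> 'n \<Rightarrow> 'n"
  assumes M [simp]: "rvs M" and N [simp]: "rvs N"
    and r [simp]: "m \<in> carrier M \<Longrightarrow> r q m \<in> carrier M"
    and l [simp]: "n \<in> carrier N \<Longrightarrow> l q n \<in> carrier N"
begin

lemma tensor_relsI:
  assumes "m \<in> carrier M" "n \<in> carrier N"
  shows "m' \<in> carrier M \<Longrightarrow>
      (\<lambda>p. gen (m \<oplus>\<^bsub>M\<^esub> m', n) p - gen (m, n) p - gen (m', n) p) \<in> tensor_rels M r N l"
    "n' \<in> carrier N \<Longrightarrow>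
      (\<lambda>p. gen (m, n \<oplus>\<^bsub>N\<^esub> n') p - gen (m, n) p - gen (m, n') p) \<in> tensor_rels M r N l"
    "(\<lambda>p. gen (a \<odot>\<^bsub>M\<^esub> m, n) p - a * gen (m, n) p) \<in> tensor_rels M r N l"
    "(\<lambda>p. gen (m, a \<odot>\<^bsub>N\<^esub> n) p - a * gen (m, n) p) \<in> tensor_rels M r N l"
    "(\<lambda>p. gen (r q m, n) p - gen (m, l q n) p) \<in> tensor_rels M r N l"
  using assms unfolding tensor_rels_def by blast+

lemma tensor_rels_carrier: "tensor_rels M r N l \<subseteq> carrier (free_space (carrier M \<times> carrier N))"
proof -
  have g: "gen (m, n) \<in> carrier (free_space (carrier M \<times> carrier N))"
    if "m \<in> carrier M" "n \<in> carrier N" for m n using that by simp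
  show ?thesis
    unfolding tensor_rels_def
    by (intro Un_least subsetI; clarify; intro free_space_diff free_space_mult g; simp)
qed

sublocale P: presentation "carrier M \<times> carrier N" "tensor_rels M r N l"
  by unfold_locales (rule tensor_rels_carrier)

definition tens :: "'m \<Rightarrow> 'n \<Rightarrow> ('m \<times> 'n \<Rightarrow> real) set" where
  "tens m n = P.cl (m, n)"

abbreviation "T \<equiv> tensor M r N l"

lemma T_eq: "T = P.Q"
  by (simp add: tensor_def tensor_kernel_def)

lemma T_rvs [simp]: "rvs T"
  unfolding T_eq by (rule P.Q_rvs)

lemma tens_closed [simp]: "m \<in> carrier M \<Longrightarrow> n \<in> carrier N \<Longrightarrow> tens m n \<in> carrier T"
  unfolding T_eq tens_def by (rule P.cl_carrier) simp

lemma tens_add_left: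
  assumes "m \<in> carrier M" "m' \<in> carrier M" "n \<in> carrier N"
  shows "tens (m \<oplus>\<^bsub>M\<^esub> m') n = tens m n \<oplus>\<^bsub>T\<^esub> tens m' n"
  unfolding T_eq tens_def
  by (rule P.cl_add) (use assms in \<open>simp_all add: tensor_relsI\<close>)

lemma tens_add_right:
  assumes "m \<in> carrier M" "n \<in> carrier N" "n' \<in> carrier N"
  shows "tens m (n \<oplus>\<^bsub>N\<^esub> n') = tens m n \<oplus>\<^bsub>T\<^esub> tens m n'"
  unfolding T_eq tens_def
  by (rule P.cl_add) (use assms in \<open>simp_all add: tensor_relsI\<close>)

lemma tens_smult_left:
  assumes "m \<in> carrier M" "n \<in> carrier N"
  shows "tens (a \<odot>\<^bsub>M\<^esub> m) n = a \<odot>\<^bsub>T\<^esub> tens m n"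
  unfolding T_eq tens_def
  by (rule P.cl_smult) (use assms in \<open>simp_all add: tensor_relsI\<close>)

lemma tens_smult_right:
  assumes "m \<in> carrier M" "n \<in> carrier N"
  shows "tens m (a \<odot>\<^bsub>N\<^esub> n) = a \<odot>\<^bsub>T\<^esub> tens m n"
  unfolding T_eq tens_def
  by (rule P.cl_smult) (use assms in \<open>simp_all add: tensor_relsI\<close>)

lemma tens_balanced:
  assumes "m \<in> carrier M" "n \<in> carrier N"
  shows "tens (r q m) n = tens m (l q n)"
  unfolding tens_def
  by (rule P.cl_eq) (use assms in \<open>simp_all add: tensor_relsI\<close>)

lemma tens_right_lin: "m \<in> carrier M \<Longrightarrow> lin N T (tens m)"
  by (simp add: lin_def tens_add_right tens_smult_right)

lemma tens_left_lin: "n \<in> carrier N \<Longrightarrow> lin M T (\<lambda>m. tens m n)"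
  by (simp add: lin_def tens_add_left tens_smult_left)

lemma tens_generate:
  assumes "subsp W T" "\<And>m n. m \<in> carrier M \<Longrightarrow> n \<in> carrier N \<Longrightarrow> tens m n \<in> W"
  shows "carrier T \<subseteq> W"
  unfolding T_eq by (rule P.Q_generated) (use assms in \<open>auto simp: T_eq tens_def\<close>)

lemma tens_lin_eq:
  assumes "rvs V" "lin T V f" "lin T V g"
    and "\<And>m n. m \<in> carrier M \<Longrightarrow> n \<in> carrier N \<Longrightarrow> f (tens m n) = g (tens m n)"
    and "t \<in> carrier T"
  shows "f t = g t"
proof -
  have "carrier T \<subseteq> {t \<in> carrier T. f t = g t}"
    by (rule tens_generate[OF lin_kernel_eq[OF T_rvs assms(1-3)]]) (use assms(4) in simp)
  then show ?thesis using assms(5) by auto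
qed

text \<open>Pure tensors are detected by balanced bilinear maps.\<close>

lemma tens_nonzero:
  fixes b :: "'m \<Rightarrow> 'n \<Rightarrow> 'v::real_vector"
  assumes "\<And>m m' n. m \<in> carrier M \<Longrightarrow> m' \<in> carrier M \<Longrightarrow> n \<in> carrier N \<Longrightarrow> b (m \<oplus>\<^bsub>M\<^esub> m') n = b m n + b m' n"
    and "\<And>m n n'. m \<in> carrier M \<Longrightarrow> n \<in> carrier N \<Longrightarrow> n' \<in> carrier N \<Longrightarrow> b m (n \<oplus>\<^bsub>N\<^esub> n') = b m n + b m n'"
    and "\<And>a m n. m \<in> carrier M \<Longrightarrow> n \<in> carrier N \<Longrightarrow> b (a \<odot>\<^bsub>M\<^esub> m) n = a *\<^sub>R b m n"
    and "\<And>a m n. m \<in> carrier M \<Longrightarrow> n \<in> carrier N \<Longrightarrow> b m (a \<odot>\<^bsub>N\<^esub> n) = a *\<^sub>R b m n"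
    and "\<And>q m n. m \<in> carrier M \<Longrightarrow> n \<in> carrier N \<Longrightarrow> b (r q m) n = b m (l q n)"
    and "m \<in> carrier M" "n \<in> carrier N" "b m n \<noteq> 0"
  shows "tens m n \<noteq> \<zero>\<^bsub>T\<^esub>"
  unfolding T_eq tens_def
proof (rule P.cl_nonzero)
  fix \<rho> assume "\<rho> \<in> tensor_rels M r N l"
  then show "ev (\<lambda>(m, n). b m n) \<rho> = 0"
    unfolding tensor_rels_def Un_iff mem_Collect_eq
    by (elim disjE exE conjE) (simp_all add: ev_diff ev_smult assms(1-5))
qed (use assms in auto)

lemma free_map_tensor_rels:
  assumes f: "lin M M f" "\<And>q m. m \<in> carrier M \<Longrightarrow> f (r q m) = r q (f m)"
    and g: "lin N N g" "\<And>q n. n \<in> carrier N \<Longrightarrow> g (l q n) = l q (g n)"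
    and "\<rho> \<in> tensor_rels M r N l"
  shows "free_map (map_prod f g) \<rho> \<in> tensor_rels M r N l"
proof -
  note c = lin_closed[OF f(1)] lin_closed[OF g(1)]
  have h: "free_map (map_prod f g) (\<lambda>p. gen x p - gen y p - gen z p) =
      (\<lambda>p. gen (map_prod f g x) p - gen (map_prod f g y) p - gen (map_prod f g z) p)" for x y z
    by (simp add: free_map_diff)
  have h2: "free_map (map_prod f g) (\<lambda>p. gen x p - a * gen y p) =
      (\<lambda>p. gen (map_prod f g x) p - a * gen (map_prod f g y) p)" for x y a
    by (simp add: free_map_diff free_map_smult)
  have h3: "free_map (map_prod f g) (\<lambda>p. gen x p - gen y p) =
      (\<lambda>p. gen (map_prod f g x) p - gen (map_prod f g y) p)" for x y
    by (simp add: free_map_diff)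
  from assms(5) consider
    (1) m m' n where "\<rho> = (\<lambda>p. gen (m \<oplus>\<^bsub>M\<^esub> m', n) p - gen (m, n) p - gen (m', n) p)"
      "m \<in> carrier M" "m' \<in> carrier M" "n \<in> carrier N"
  | (2) m n n' where "\<rho> = (\<lambda>p. gen (m, n \<oplus>\<^bsub>N\<^esub> n') p - gen (m, n) p - gen (m, n') p)"
      "m \<in> carrier M" "n \<in> carrier N" "n' \<in> carrier N"
  | (3) a m n where "\<rho> = (\<lambda>p. gen (a \<odot>\<^bsub>M\<^esub> m, n) p - a * gen (m, n) p)" "m \<in> carrier M" "n \<in> carrier N"
  | (4) a m n where "\<rho> = (\<lambda>p. gen (m, a \<odot>\<^bsub>N\<^esub> n) p - a * gen (m, n) p)" "m \<in> carrier M" "n \<in> carrier N"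
  | (5) q m n where "\<rho> = (\<lambda>p. gen (r q m, n) p - gen (m, l q n) p)" "m \<in> carrier M" "n \<in> carrier N"
    unfolding tensor_rels_def by blast
  then show ?thesis
  proof cases
    case 1
    then show ?thesis unfolding 1(1) h map_prod_simp lin_add[OF f(1) 1(2,3)]
      unfolding tensor_rels_def using c by blast
  next
    case 2
    then show ?thesis unfolding 2(1) h map_prod_simp lin_add[OF g(1) 2(3,4)]
      unfolding tensor_rels_def using c by blast
  next
    case 3
    then show ?thesis unfolding 3(1) h2 map_prod_simp lin_smult[OF f(1) 3(2)]
      unfolding tensor_rels_def using c by blast
  next
    case 4
    then show ?thesis unfolding 4(1) h2 map_prod_simp lin_smult[OF g(1) 4(3)]
      unfolding tensor_rels_def using c by blast
  next
    case 5
    then show ?thesis unfolding 5(1) h3 map_prod_simp f(2)[OF 5(2)] g(2)[OF 5(3)]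
      unfolding tensor_rels_def using c by blast
  qed
qed

context
  fixes f g
  assumes f: "lin M M f" "\<And>q m. m \<in> carrier M \<Longrightarrow> f (r q m) = r q (f m)"
    and g: "lin N N g" "\<And>q n. n \<in> carrier N \<Longrightarrow> g (l q n) = l q (g n)"
begin

lemma tensor_map_tens:
  "m \<in> carrier M \<Longrightarrow> n \<in> carrier N \<Longrightarrow> tensor_map M r N l f g (tens m n) = tens (f m) (g n)"
  unfolding tensor_map_def tensor_kernel_def tens_def
  by (subst P.quotient_map_cl[OF _ free_map_tensor_rels[OF f g]])
     (auto simp: lin_closed[OF f(1)] lin_closed[OF g(1)])

lemma tensor_map_lin: "lin T T (tensor_map M r N l f g)"
  unfolding tensor_map_def tensor_kernel_def T_eq
  by (rule P.quotient_map_lin[OF _ free_map_tensor_rels[OF f g]])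
     (auto simp: lin_closed[OF f(1)] lin_closed[OF g(1)])

end

end

subsection \<open>Tensor powers\<close>

locale tensor_pow =
  fixes k :: nat and V :: "(real, 'a) module"
  assumes V [simp]: "rvs V"
begin

definition tuples :: "'a list set" where
  "tuples = {xs. length xs = k \<and> set xs \<subseteq> carrier V}"

lemma tuples_update: "xs \<in> tuples \<Longrightarrow> x \<in> carrier V \<Longrightarrow> xs[i := x] \<in> tuples"
  by (auto simp: tuples_def dest: subsetD[OF set_update_subset_insert])

lemma tuples_nth: "xs \<in> tuples \<Longrightarrow> i < k \<Longrightarrow> xs ! i \<in> carrier V"
  by (auto simp: tuples_def)

lemma power_relsI:
  assumes "xs \<in> tuples" "i < k" "x \<in> carrier V"
  shows "y \<in> carrier V \<Longrightarrow>
      (\<lambda>p. gen (xs[i := x \<oplus>\<^bsub>V\<^esub> y]) p - gen (xs[i := x]) p - gen (xs[i := y]) p) \<in> power_rels k V"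
    "(\<lambda>p. gen (xs[i := a \<odot>\<^bsub>V\<^esub> x]) p - a * gen (xs[i := x]) p) \<in> power_rels k V"
  using assms unfolding power_rels_def tuples_def by blast+

lemma power_rels_carrier: "power_rels k V \<subseteq> carrier (free_space tuples)"
proof
  have g: "gen (xs[i := x]) \<in> carrier (free_space tuples)"
    if "length xs = k" "set xs \<subseteq> carrier V" "x \<in> carrier V" for xs i x
    using tuples_update[of xs x i] that by (simp add: tuples_def)
  fix \<rho> assume "\<rho> \<in> power_rels k V"
  then consider
    (1) xs i x y where "\<rho> = (\<lambda>p. gen (xs[i := x \<oplus>\<^bsub>V\<^esub> y]) p - gen (xs[i := x]) p - gen (xs[i := y]) p)"
      "length xs = k" "set xs \<subseteq> carrier V" "x \<in> carrier V" "y \<in> carrier V"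
  | (2) xs i a x where "\<rho> = (\<lambda>p. gen (xs[i := a \<odot>\<^bsub>V\<^esub> x]) p - a * gen (xs[i := x]) p)"
      "length xs = k" "set xs \<subseteq> carrier V" "x \<in> carrier V"
    unfolding power_rels_def by blast
  then show "\<rho> \<in> carrier (free_space tuples)"
  proof cases
    case 1
    show ?thesis
      unfolding 1(1) by (intro free_space_diff g 1 rvs_add[OF V])
  next
    case 2
    show ?thesis
      unfolding 2(1) by (intro free_space_diff free_space_mult g 2 rvs_smult[OF V])
  qed
qed

sublocale P: presentation tuples "power_rels k V"
  by unfold_locales (rule power_rels_carrier)

definition tpow :: "'a list \<Rightarrow> ('a list \<Rightarrow> real) set" where
  "tpow xs = P.cl xs"

abbreviation "T \<equiv> tensor_power k V"

lemma T_eq: "T = P.Q"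
  by (simp add: tensor_power_def power_free_def power_kernel_def tuples_def)

lemma T_rvs [simp]: "rvs T"
  unfolding T_eq by (rule P.Q_rvs)

lemma tpow_closed [simp]: "xs \<in> tuples \<Longrightarrow> tpow xs \<in> carrier T"
  unfolding T_eq tpow_def by (rule P.cl_carrier)

lemma tpow_add:
  assumes "xs \<in> tuples" "i < k" "x \<in> carrier V" "y \<in> carrier V"
  shows "tpow (xs[i := x \<oplus>\<^bsub>V\<^esub> y]) = tpow (xs[i := x]) \<oplus>\<^bsub>T\<^esub> tpow (xs[i := y])"
  unfolding T_eq tpow_def
  by (rule P.cl_add) (use assms in \<open>simp_all add: tuples_update power_relsI\<close>)

lemma tpow_smult:
  assumes "xs \<in> tuples" "i < k" "x \<in> carrier V"
  shows "tpow (xs[i := a \<odot>\<^bsub>V\<^esub> x]) = a \<odot>\<^bsub>T\<^esub> tpow (xs[i := x])"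
  unfolding T_eq tpow_def
  by (rule P.cl_smult) (use assms in \<open>simp_all add: tuples_update power_relsI\<close>)

lemma tpow_lin:
  assumes "xs \<in> tuples" "i < k" shows "lin V T (\<lambda>x. tpow (xs[i := x]))"
  using assms by (simp add: lin_def tpow_add tpow_smult tuples_update)

lemma tpow_generate:
  assumes "subsp W T" "\<And>xs. xs \<in> tuples \<Longrightarrow> tpow xs \<in> W"
  shows "carrier T \<subseteq> W"
  unfolding T_eq by (rule P.Q_generated) (use assms in \<open>auto simp: T_eq tpow_def\<close>)

lemma tpow_lin_eq:
  assumes "rvs V'" "lin T V' f" "lin T V' g" "\<And>xs. xs \<in> tuples \<Longrightarrow> f (tpow xs) = g (tpow xs)"
    and "t \<in> carrier T"
  shows "f t = g t"
proof -
  have "carrier T \<subseteq> {t \<in> carrier T. f t = g t}"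
    by (rule tpow_generate[OF lin_kernel_eq[OF T_rvs assms(1-3)]]) (use assms(4) in simp)
  then show ?thesis using assms(5) by auto
qed

text \<open>The functional \<open>b\<close> on each factor gives the multilinear map \<open>xs \<mapsto> \<Prod>x\<leftarrow>xs. b x\<close>.\<close>

lemma tpow_nonzero:
  fixes b :: "'a \<Rightarrow> real"
  assumes "\<And>x y. x \<in> carrier V \<Longrightarrow> y \<in> carrier V \<Longrightarrow> b (x \<oplus>\<^bsub>V\<^esub> y) = b x + b y"
    and "\<And>a x. x \<in> carrier V \<Longrightarrow> b (a \<odot>\<^bsub>V\<^esub> x) = a * b x"
    and "xs \<in> tuples" "\<And>x. x \<in> set xs \<Longrightarrow> b x \<noteq> 0"
  shows "tpow xs \<noteq> \<zero>\<^bsub>T\<^esub>"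
  unfolding T_eq tpow_def
proof (rule P.cl_nonzero)
  let ?b = "\<lambda>xs. prod_list (map b xs)"
  have upd: "?b (xs[i := x]) = b x * (\<Prod>j\<in>{..<k} - {i}. b (xs ! j))" if "length xs = k" "i < k" for xs i x
  proof -
    have "?b (xs[i := x]) = (\<Prod>j\<in>{..<k}. b (xs[i := x] ! j))"
      using that by (simp add: prod.list_conv_set_nth atLeast0LessThan)
    also have "\<dots> = b x * (\<Prod>j\<in>{..<k} - {i}. b (xs[i := x] ! j))"
      using that by (subst prod.remove[of _ i]) auto
    also have "(\<Prod>j\<in>{..<k} - {i}. b (xs[i := x] ! j)) = (\<Prod>j\<in>{..<k} - {i}. b (xs ! j))"
      by (rule prod.cong) auto
    finally show ?thesis .
  qed
  fix \<rho> assume "\<rho> \<in> power_rels k V"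
  then show "ev ?b \<rho> = 0"
    unfolding power_rels_def Un_iff mem_Collect_eq
    by (elim disjE exE conjE) (simp_all add: ev_diff ev_smult upd assms(1,2) distrib_right)
next
  show "prod_list (map b xs) \<noteq> 0" using assms(4) by (auto simp: prod_list_zero_iff)
qed (use assms in auto)

abbreviation pmap :: "(nat \<Rightarrow> 'a \<Rightarrow> 'a) \<Rightarrow> 'a list \<Rightarrow> 'a list" where
  "pmap f xs \<equiv> map (\<lambda>i. f i (xs ! i)) [0..<k]"

lemma pmap_update: "length xs = k \<Longrightarrow> pmap f (xs[i := x]) = (pmap f xs)[i := f i x]"
proof (rule nth_equalityI)
  fix j assume "length xs = k" "j < length (pmap f (xs[i := x]))"
  then show "pmap f (xs[i := x]) ! j = (pmap f xs)[i := f i x] ! j"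
    by (cases "i = j") auto
qed auto

context
  fixes f assumes f: "\<And>i. i < k \<Longrightarrow> lin V V (f i)"
begin

lemma pmap_tuples: "xs \<in> tuples \<Longrightarrow> pmap f xs \<in> tuples"
proof -
  assume xs: "xs \<in> tuples"
  have "f i (xs ! i) \<in> carrier V" if "i < k" for i
    by (rule lin_closed[OF f[OF that] tuples_nth[OF xs that]])
  then show ?thesis by (auto simp: tuples_def)
qed

lemma free_map_power_rels:
  assumes "\<rho> \<in> power_rels k V"
  shows "free_map (pmap f) \<rho> \<in> power_rels k V"
proof -
  have h: "free_map (pmap f) (\<lambda>p. gen x p - gen y p - gen z p) =
      (\<lambda>p. gen (pmap f x) p - gen (pmap f y) p - gen (pmap f z) p)" for x y z
    by (simp add: free_map_diff)
  have h2: "free_map (pmap f) (\<lambda>p. gen x p - a * gen y p) =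
      (\<lambda>p. gen (pmap f x) p - a * gen (pmap f y) p)" for x y a
    by (simp add: free_map_diff free_map_smult)
  from assms consider
    (1) xs i x y where "\<rho> = (\<lambda>p. gen (xs[i := x \<oplus>\<^bsub>V\<^esub> y]) p - gen (xs[i := x]) p - gen (xs[i := y]) p)"
      "length xs = k" "set xs \<subseteq> carrier V" "i < k" "x \<in> carrier V" "y \<in> carrier V"
  | (2) xs i a x where "\<rho> = (\<lambda>p. gen (xs[i := a \<odot>\<^bsub>V\<^esub> x]) p - a * gen (xs[i := x]) p)"
      "length xs = k" "set xs \<subseteq> carrier V" "i < k" "x \<in> carrier V"
    unfolding power_rels_def by blast
  then show ?thesis
  proof cases
    case 1
    have "pmap f xs \<in> tuples" using 1 by (intro pmap_tuples) (simp add: tuples_def)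
    then have p: "length (pmap f xs) = k" "set (pmap f xs) \<subseteq> carrier V" by (simp_all only: tuples_def mem_Collect_eq)
    have c: "f i x \<in> carrier V" "f i y \<in> carrier V" using lin_closed[OF f[OF 1(4)]] 1 by auto
    show ?thesis
      unfolding 1(1) h pmap_update[OF 1(2)] lin_add[OF f[OF 1(4)] 1(5,6)]
      unfolding power_rels_def using p c 1(4) by blast
  next
    case 2
    have "pmap f xs \<in> tuples" using 2 by (intro pmap_tuples) (simp add: tuples_def)
    then have p: "length (pmap f xs) = k" "set (pmap f xs) \<subseteq> carrier V" by (simp_all only: tuples_def mem_Collect_eq)
    have c: "f i x \<in> carrier V" using lin_closed[OF f[OF 2(4)]] 2 by auto
    show ?thesis
      unfolding 2(1) h2 pmap_update[OF 2(2)] lin_smult[OF f[OF 2(4)] 2(5)]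
      unfolding power_rels_def using p c 2(4) by blast
  qed
qed

lemma tensor_power_map_eq:
  "tensor_power_map k V f = quotient_map (free_space tuples) P.K (free_map (pmap f))"
  by (simp add: tensor_power_map_def power_free_def power_kernel_def tuples_def)

lemma tensor_power_map_tpow:
  "xs \<in> tuples \<Longrightarrow> tensor_power_map k V f (tpow xs) = tpow (pmap f xs)"
  unfolding tensor_power_map_eq tpow_def
  by (rule P.quotient_map_cl[OF pmap_tuples free_map_power_rels])

lemma tensor_power_map_lin: "lin T T (tensor_power_map k V f)"
  unfolding tensor_power_map_eq T_eq
  by (rule P.quotient_map_lin[OF pmap_tuples free_map_power_rels])

end

end

section \<open>The Clifford algebra acts through Clifford maps\<close>

definition conv :: "('x list \<Rightarrow> real) \<Rightarrow> ('x list \<Rightarrow> real) \<Rightarrow> 'x list \<Rightarrow> real" where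
  "conv f g w = (\<Sum>i\<le>length w. f (take i w) * g (drop i w))"

lemma conv_left: "conv (\<lambda>y. f y + a * f' y) g = (\<lambda>w. conv f g w + a * conv f' g w)"
  by (auto simp: conv_def fun_eq_iff sum.distrib sum_distrib_left distrib_right mult.assoc)

lemma conv_right: "conv f (\<lambda>y. g y + a * g' y) = (\<lambda>w. conv f g w + a * conv f g' w)"
  by (auto simp: conv_def fun_eq_iff sum.distrib sum_distrib_left distrib_left mult.left_commute)

lemma conv_zero [simp]: "conv (\<lambda>_. 0) g = (\<lambda>_. 0)" "conv f (\<lambda>_. 0) = (\<lambda>_. 0)"
  by (auto simp: conv_def)

lemma conv_gen: "conv (gen u) (gen v) = gen (u @ v)"
proof
  fix w
  show "conv (gen u) (gen v) w = gen (u @ v) w"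
  proof (cases "w = u @ v")
    case True
    have "conv (gen u) (gen v) w = (\<Sum>i\<le>length w. if i = length u then 1 else 0)"
      unfolding conv_def
    proof (rule sum.cong)
      fix i assume "i \<in> {..length w}"
      then have "length (take i w) = i" by simp
      then have "take i w = u \<longleftrightarrow> i = length u" using True by (metis append_eq_conv_conj)
      then show "gen u (take i w) * gen v (drop i w) = (if i = length u then 1 else 0)"
        using True by (auto simp: gen_def)
    qed simp
    then show ?thesis using True by (simp add: gen_def)
  next
    case False
    then have "take i w = u \<longrightarrow> drop i w \<noteq> v" for i by (metis append_take_drop_id)
    then have "conv (gen u) (gen v) w = 0"
      unfolding conv_def by (intro sum.neutral) (auto simp: gen_def)
    then show ?thesis using False by (simp add: gen_def)
  qed
qed

abbreviation "wcar n \<equiv> carrier (free_space (lists (carrier_vec n) :: real vec list set))"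

lemma word_algebra_simps [simp]:
  "carrier (word_algebra n) = wcar n" "f \<otimes>\<^bsub>word_algebra n\<^esub> g = conv f g"
  "\<one>\<^bsub>word_algebra n\<^esub> = gen []" "\<zero>\<^bsub>word_algebra n\<^esub> = (\<lambda>_. 0)"
  "f \<oplus>\<^bsub>word_algebra n\<^esub> g = (\<lambda>w. f w + g w)"
  by (auto simp: word_algebra_def free_space_def conv_def fun_eq_iff)

lemma wcar_induct [consumes 1, case_names zero gen]:
  assumes "f \<in> wcar n" "P (\<lambda>_. 0)"
    and "\<And>f a w. f \<in> wcar n \<Longrightarrow> w \<in> lists (carrier_vec n) \<Longrightarrow> P f \<Longrightarrow> P (\<lambda>y. f y + a * gen w y)"
  shows "P f"
proof -
  have "fs f" "{x. f x \<noteq> 0} \<subseteq> lists (carrier_vec n)" using assms(1) by (simp_all add: carrier_free_space)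
  then show ?thesis
    by (induction rule: fs_induct) (use assms(2,3) in \<open>simp_all add: carrier_free_space\<close>)
qed

lemma wcar_add: "f \<in> wcar n \<Longrightarrow> g \<in> wcar n \<Longrightarrow> (\<lambda>w. f w + g w) \<in> wcar n"
  using rvs_add[OF free_space_rvs, of f "lists (carrier_vec n)" g] by simp

lemma wcar_lincomb: "f \<in> wcar n \<Longrightarrow> g \<in> wcar n \<Longrightarrow> (\<lambda>w. f w + a * g w) \<in> wcar n"
  using wcar_add[OF _ free_space_mult, of f n g a] by simp

lemma wcar_zero: "(\<lambda>_. 0) \<in> wcar n"
  using rvs_zero[OF free_space_rvs, of "lists (carrier_vec n)"] by simp

lemma conv_gen_closed:
  assumes "u \<in> lists (carrier_vec n)" "g \<in> wcar n" shows "conv (gen u) g \<in> wcar n"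
  using assms(2)
proof (induction rule: wcar_induct)
  case (gen f a w)
  then show ?case unfolding conv_right using assms(1) by (intro wcar_lincomb) (simp_all add: conv_gen)
qed (simp add: wcar_zero)

lemma conv_closed: "f \<in> wcar n \<Longrightarrow> g \<in> wcar n \<Longrightarrow> conv f g \<in> wcar n"
proof (induction rule: wcar_induct)
  case (gen f a w)
  then show ?case unfolding conv_left by (intro wcar_lincomb conv_gen_closed) auto
qed (simp add: wcar_zero)

text \<open>Both sides of the associative law are linear in each argument, so it is enough to know it for
  words; the next three lemmas release one argument at a time.\<close>

lemma conv_assoc_gen2:
  assumes "h \<in> wcar n" shows "conv (conv (gen u) (gen v)) h = conv (gen u) (conv (gen v) h)"
  using assms
proof (induction rule: wcar_induct)
  case (gen f a w)
  then show ?case by (simp only: conv_right conv_gen append_assoc)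
qed simp

lemma conv_assoc_gen:
  assumes "g \<in> wcar n" "h \<in> wcar n" shows "conv (conv (gen u) g) h = conv (gen u) (conv g h)"
  using assms(1)
proof (induction rule: wcar_induct)
  case (gen f a w)
  then show ?case by (simp only: conv_right conv_left conv_assoc_gen2[OF assms(2)])
qed simp

lemma conv_assoc:
  assumes "f \<in> wcar n" "g \<in> wcar n" "h \<in> wcar n" shows "conv (conv f g) h = conv f (conv g h)"
  using assms(1)
proof (induction rule: wcar_induct)
  case (gen f a w)
  then show ?case by (simp only: conv_left conv_assoc_gen[OF assms(2,3)])
qed simp

lemma conv_one: 
  assumes "f \<in> wcar n" shows "conv (gen []) f = f" "conv f (gen []) = f"
proof -
  from assms have "conv (gen []) f = f \<and> conv f (gen []) = f"
  proof (induction rule: wcar_induct)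
    case (gen f a w)
    then show ?case by (simp add: conv_left conv_right conv_gen)
  qed simp
  then show "conv (gen []) f = f" "conv f (gen []) = f" by auto
qed

lemma word_algebra_ring: "ring (word_algebra n)"
proof (rule ringI)
  show "abelian_group (word_algebra n)"
  proof (rule abelian_groupI, unfold word_algebra_simps)
    fix f assume f: "f \<in> wcar n"
    show "\<exists>g\<in>wcar n. (\<lambda>w. g w + f w) = (\<lambda>_. 0)"
      by (rule bexI[OF _ free_space_mult[OF f, of "-1"]]) (simp add: fun_eq_iff)
  qed (auto simp: wcar_add wcar_zero add_ac)
  show "Group.monoid (word_algebra n)"
    by (rule monoidI) (auto simp: conv_closed conv_assoc conv_one)
next
  fix f g h
  show "(f \<oplus>\<^bsub>word_algebra n\<^esub> g) \<otimes>\<^bsub>word_algebra n\<^esub> h =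
      f \<otimes>\<^bsub>word_algebra n\<^esub> h \<oplus>\<^bsub>word_algebra n\<^esub> g \<otimes>\<^bsub>word_algebra n\<^esub> h"
    using conv_left[of f 1 g h] by simp
  show "h \<otimes>\<^bsub>word_algebra n\<^esub> (f \<oplus>\<^bsub>word_algebra n\<^esub> g) =
      h \<otimes>\<^bsub>word_algebra n\<^esub> f \<oplus>\<^bsub>word_algebra n\<^esub> h \<otimes>\<^bsub>word_algebra n\<^esub> g"
    using conv_right[of h f 1 g] by simp
qed

lemma clifford_rels_carrier: "clifford_rels n \<subseteq> wcar n"
proof -
  have g: "gen [v] \<in> wcar n" "gen [v, w] \<in> wcar n" "gen [] \<in> wcar n"
    if "v \<in> carrier_vec n" "w \<in> carrier_vec n" for v w using that by simp_all
  show ?thesis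
    unfolding clifford_rels_def
    by (intro Un_least subsetI; clarify; intro free_space_diff free_space_mult wcar_add g) auto
qed

lemma clifford_ideal: "ideal (clifford_ideal n) (word_algebra n)"
  unfolding clifford_ideal_def
  by (rule ring.genideal_ideal[OF word_algebra_ring]) (simp add: clifford_rels_carrier)

lemma clifford_ideal_carrier: "clifford_ideal n \<subseteq> wcar n"
  using additive_subgroup.a_subset[OF ideal.axioms(1)[OF clifford_ideal]] by simp

abbreviation "ccls n x \<equiv> clifford_ideal n +>\<^bsub>word_algebra n\<^esub> x"

lemma Cl_carrier: "carrier (Cl n) = (\<lambda>x. ccls n x) ` wcar n"
  by (auto simp: Cl_def FactRing_def A_RCOSETS_def')

lemma Cl_add: "x \<in> wcar n \<Longrightarrow> y \<in> wcar n \<Longrightarrow> ccls n x \<oplus>\<^bsub>Cl n\<^esub> ccls n y = ccls n (\<lambda>w. x w + y w)"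
  using abelian_subgroup.a_rcos_sum[OF abelian_subgroupI3[OF ideal.axioms(1)[OF clifford_ideal]
    ring.is_abelian_group[OF word_algebra_ring]], of x n y]
  by (simp add: Cl_def FactRing_def)

lemma Cl_mult: "x \<in> wcar n \<Longrightarrow> y \<in> wcar n \<Longrightarrow> ccls n x \<otimes>\<^bsub>Cl n\<^esub> ccls n y = ccls n (conv x y)"
  using ideal.rcoset_mult_add[OF clifford_ideal, of x n y]
  by (simp add: Cl_def FactRing_def)

lemma Cl_one: "\<one>\<^bsub>Cl n\<^esub> = ccls n (gen [])"
  by (simp add: Cl_def FactRing_def)

locale clifford_module =
  fixes n :: nat and M :: "('a, 'z) rep_scheme"
  assumes clifford_map: "clifford_map n M"
begin

abbreviation "V \<equiv> space M"
abbreviation "c \<equiv> cmap M"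

lemma V [simp]: "rvs V"
  using clifford_map by (simp add: clifford_map_def)

lemma c_lin: "v \<in> carrier_vec n \<Longrightarrow> lin V V (c v)"
  using clifford_map by (simp add: clifford_map_def linear_map_iff_lin)

lemma c_closed [simp]: "v \<in> carrier_vec n \<Longrightarrow> s \<in> carrier V \<Longrightarrow> c v s \<in> carrier V"
  by (rule lin_closed[OF c_lin])

lemma c_add: "v \<in> carrier_vec n \<Longrightarrow> w \<in> carrier_vec n \<Longrightarrow> s \<in> carrier V \<Longrightarrow> c (v + w) s = c v s \<oplus>\<^bsub>V\<^esub> c w s"
  using clifford_map by (simp add: clifford_map_def)

lemma c_smult: "v \<in> carrier_vec n \<Longrightarrow> s \<in> carrier V \<Longrightarrow> c (a \<cdot>\<^sub>v v) s = a \<odot>\<^bsub>V\<^esub> c v s"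
  using clifford_map by (simp add: clifford_map_def)

lemma c_clifford:
  "v \<in> carrier_vec n \<Longrightarrow> w \<in> carrier_vec n \<Longrightarrow> s \<in> carrier V \<Longrightarrow>
    c v (c w s) \<oplus>\<^bsub>V\<^esub> c w (c v s) = (- 2 * cform v w) \<odot>\<^bsub>V\<^esub> s"
  using clifford_map by (simp add: clifford_map_def clifford_condition_def)

lemma word_lin: "w \<in> lists (carrier_vec n) \<Longrightarrow> lin V V (foldr c w)"
  by (induction w) (auto simp del: o_apply intro!: lin_comp c_lin)

lemma word_closed [simp]: "w \<in> lists (carrier_vec n) \<Longrightarrow> s \<in> carrier V \<Longrightarrow> foldr c w s \<in> carrier V"
  by (rule lin_closed[OF word_lin])

lemma word_act_summand: "x \<in> wcar n \<Longrightarrow> s \<in> carrier V \<Longrightarrow> w \<in> {w. x w \<noteq> 0} \<Longrightarrow>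
    x w \<odot>\<^bsub>V\<^esub> foldr c w s \<in> carrier V"
  by (intro rvs_smult[OF V] word_closed) (auto simp: carrier_free_space)

lemma word_act_closed [simp]: "x \<in> wcar n \<Longrightarrow> s \<in> carrier V \<Longrightarrow> word_act M x s \<in> carrier V"
  unfolding word_act_def by (rule rvs_finsum[OF V word_act_summand])

lemma word_act_crd:
  assumes "x \<in> wcar n" "s \<in> carrier V"
  shows "crd V (word_act M x s) b = ev (\<lambda>w. crd V (foldr c w s) b) x"
proof -
  have "crd V (word_act M x s) b = (\<Sum>w | x w \<noteq> 0. crd V (x w \<odot>\<^bsub>V\<^esub> foldr c w s) b)"
    unfolding word_act_def by (rule crd_finsum[OF V word_act_summand[OF assms]])
  also have "\<dots> = (\<Sum>w | x w \<noteq> 0. x w * crd V (foldr c w s) b)"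
    using assms by (intro sum.cong crd_smult[OF V] word_closed) (auto simp: carrier_free_space)
  finally show ?thesis by (simp add: ev_def)
qed

lemma word_act_lincomb:
  assumes "x \<in> wcar n" "y \<in> wcar n" "s \<in> carrier V"
  shows "word_act M (\<lambda>w. x w + a * y w) s = word_act M x s \<oplus>\<^bsub>V\<^esub> a \<odot>\<^bsub>V\<^esub> word_act M y s"
proof (rule crd_eqI[OF V])
  have "fs x" "fs y" using assms by (simp_all add: carrier_free_space)
  then show "crd V (word_act M (\<lambda>w. x w + a * y w) s) b =
      crd V (word_act M x s \<oplus>\<^bsub>V\<^esub> a \<odot>\<^bsub>V\<^esub> word_act M y s) b" for b
    using assms by (simp add: word_act_crd wcar_lincomb ev_add ev_smult)
qed (use assms in \<open>simp_all add: wcar_lincomb\<close>)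

lemma word_act_add:
  "x \<in> wcar n \<Longrightarrow> y \<in> wcar n \<Longrightarrow> s \<in> carrier V \<Longrightarrow>
    word_act M (\<lambda>w. x w + y w) s = word_act M x s \<oplus>\<^bsub>V\<^esub> word_act M y s"
  using word_act_lincomb[of x y s 1] by simp

lemma word_act_gen: "w \<in> lists (carrier_vec n) \<Longrightarrow> s \<in> carrier V \<Longrightarrow> word_act M (gen w) s = foldr c w s"
  by (rule crd_eqI[OF V]) (simp_all add: word_act_crd)

lemma word_act_zero: "s \<in> carrier V \<Longrightarrow> word_act M (\<lambda>_. 0) s = \<zero>\<^bsub>V\<^esub>"
  by (rule crd_eqI[OF V]) (simp_all add: word_act_crd wcar_zero)

lemma word_act_lin: "x \<in> wcar n \<Longrightarrow> lin V V (word_act M x)"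
proof (induction rule: wcar_induct)
  case zero
  then show ?case by (simp add: lin_def word_act_zero)
next
  case (gen f a w)
  have g: "gen w \<in> wcar n" using gen by simp
  have e: "word_act M (\<lambda>y. f y + a * gen w y) s = word_act M f s \<oplus>\<^bsub>V\<^esub> a \<odot>\<^bsub>V\<^esub> foldr c w s"
    if "s \<in> carrier V" for s
    using word_act_lincomb[OF gen(1) g that] word_act_gen[OF gen(2) that] by simp
  note L = word_lin[OF gen(2)] and F = gen(3)
  show ?case
    unfolding lin_def
  proof (intro conjI ballI allI)
    fix x y b assume x: "x \<in> carrier V"
    note cl = lin_closed[OF L] lin_closed[OF F] lin_add[OF L] lin_add[OF F] lin_smult[OF L] lin_smult[OF F]
    show "word_act M (\<lambda>y. f y + a * gen w y) x \<in> carrier V" using x by (simp add: e cl)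
    show "word_act M (\<lambda>y. f y + a * gen w y) (b \<odot>\<^bsub>V\<^esub> x) = b \<odot>\<^bsub>V\<^esub> word_act M (\<lambda>y. f y + a * gen w y) x"
      by (rule crd_eqI[OF V]) (use x in \<open>simp_all add: e cl algebra_simps\<close>)
    assume y: "y \<in> carrier V"
    show "word_act M (\<lambda>y. f y + a * gen w y) (x \<oplus>\<^bsub>V\<^esub> y) =
        word_act M (\<lambda>y. f y + a * gen w y) x \<oplus>\<^bsub>V\<^esub> word_act M (\<lambda>y. f y + a * gen w y) y"
      by (rule crd_eqI[OF V]) (use x y in \<open>simp_all add: e cl algebra_simps\<close>)
  qed
qed

lemma word_act_conv_gen:
  assumes "y \<in> wcar n" "u \<in> lists (carrier_vec n)" "s \<in> carrier V"
  shows "word_act M (conv (gen u) y) s = foldr c u (word_act M y s)"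
  using assms(1)
proof (induction rule: wcar_induct)
  case zero
  then show ?case using assms lin_zero[OF V V word_lin] by (simp add: word_act_zero)
next
  case (gen f a w)
  have g: "gen w \<in> wcar n" using gen by simp
  have "word_act M (conv (gen u) (\<lambda>y. f y + a * gen w y)) s =
      word_act M (conv (gen u) f) s \<oplus>\<^bsub>V\<^esub> a \<odot>\<^bsub>V\<^esub> word_act M (conv (gen u) (gen w)) s"
    unfolding conv_right using assms gen g by (intro word_act_lincomb conv_gen_closed)
  also have "\<dots> = foldr c u (word_act M f s) \<oplus>\<^bsub>V\<^esub> a \<odot>\<^bsub>V\<^esub> foldr c u (foldr c w s)"
    using assms gen by (simp add: conv_gen word_act_gen)
  also have "\<dots> = foldr c u (word_act M f s \<oplus>\<^bsub>V\<^esub> a \<odot>\<^bsub>V\<^esub> foldr c w s)"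
    using assms gen by (simp add: lin_add[OF word_lin] lin_smult[OF word_lin])
  also have "word_act M f s \<oplus>\<^bsub>V\<^esub> a \<odot>\<^bsub>V\<^esub> foldr c w s = word_act M (\<lambda>y. f y + a * gen w y) s"
    using assms gen g by (simp add: word_act_lincomb word_act_gen)
  finally show ?case .
qed

lemma word_act_conv:
  assumes "x \<in> wcar n" "y \<in> wcar n" "s \<in> carrier V"
  shows "word_act M (conv x y) s = word_act M x (word_act M y s)"
  using assms(1)
proof (induction rule: wcar_induct)
  case zero
  then show ?case using assms by (simp add: word_act_zero)
next
  case (gen f a w)
  have "word_act M (conv (\<lambda>y. f y + a * gen w y) y) s =
      word_act M (conv f y) s \<oplus>\<^bsub>V\<^esub> a \<odot>\<^bsub>V\<^esub> word_act M (conv (gen w) y) s"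
    unfolding conv_left using assms gen by (intro word_act_lincomb conv_closed) auto
  then show ?case
    using assms gen by (simp add: word_act_lincomb word_act_conv_gen word_act_gen)
qed

lemma word_act_rels:
  assumes "x \<in> clifford_rels n" "s \<in> carrier V" shows "word_act M x s = \<zero>\<^bsub>V\<^esub>"
proof (rule crd_eqI[OF V])
  have x: "x \<in> wcar n" using assms clifford_rels_carrier by auto
  show "crd V (word_act M x s) b = crd V \<zero>\<^bsub>V\<^esub> b" for b
  proof -
    from assms(1) consider 
      (1) v w where "x = (\<lambda>p. gen [v + w] p - gen [v] p - gen [w] p)" "v \<in> carrier_vec n" "w \<in> carrier_vec n"
    | (2) a v where "x = (\<lambda>p. gen [a \<cdot>\<^sub>v v] p - a * gen [v] p)" "v \<in> carrier_vec n"
    | (3) v w where "x = (\<lambda>p. gen [v, w] p + gen [w, v] p - (- 2 * cform v w) * gen [] p)"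
        "v \<in> carrier_vec n" "w \<in> carrier_vec n"
      unfolding clifford_rels_def by blast
    then have "ev (\<lambda>w. crd V (foldr c w s) b) x = 0"
    proof cases
      case 1
      then show ?thesis using assms(2) by (simp add: ev_diff c_add)
    next
      case 2
      then show ?thesis using assms(2) by (simp add: ev_diff ev_smult c_smult)
    next
      case 3
      have "crd V (c v (c w s)) b + crd V (c w (c v s)) b = - 2 * cform v w * crd V s b"
        using arg_cong[OF c_clifford[OF 3(2,3) assms(2)], of "\<lambda>t. crd V t b"] 3 assms(2) by simp
      then show ?thesis
        unfolding 3(1) ev_diff[OF fs_add[OF fs_gen fs_gen] fs_smult[OF fs_gen]] 
          ev_add[OF fs_gen fs_gen] ev_smult[OF fs_gen] ev_gen by simp
    qed
    then show ?thesis using word_act_crd[OF x assms(2)] by simp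
  qed
  show "word_act M x s \<in> carrier V" using x assms(2) by simp
qed simp

text \<open>The elements that annihilate \<open>V\<close> form a two-sided ideal, which contains the relations.\<close>

lemma word_act_ideal:
  assumes "x \<in> clifford_ideal n" "s \<in> carrier V" shows "word_act M x s = \<zero>\<^bsub>V\<^esub>"
proof -
  let ?A = "word_algebra n" and ?J = "{x \<in> wcar n. \<forall>s\<in>carrier V. word_act M x s = \<zero>\<^bsub>V\<^esub>}"
  have "ideal ?J ?A"
  proof (rule idealI[OF word_algebra_ring])
    show "subgroup ?J (add_monoid ?A)"
    proof (rule group.subgroupI)
      show "Group.group (add_monoid ?A)"
        using abelian_group.a_group[OF ring.is_abelian_group[OF word_algebra_ring]] .
      show "?J \<noteq> {}" using wcar_zero word_act_zero by auto
      fix x assume x: "x \<in> ?J"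
      have neg: "\<ominus>\<^bsub>?A\<^esub> x = (\<lambda>w. (-1) * x w)"
        by (rule abelian_group.minus_equality[OF ring.is_abelian_group[OF word_algebra_ring]])
           (use x free_space_mult[of x _ "-1"] in auto)
      have "(\<lambda>w. (-1) * x w) \<in> wcar n" by (rule free_space_mult) (use x in auto)
      moreover have "word_act M (\<lambda>w. (-1) * x w) s = \<zero>\<^bsub>V\<^esub>" if s: "s \<in> carrier V" for s
        using word_act_lincomb[OF wcar_zero _ s, of x "-1"] x s by (simp add: word_act_zero)
      ultimately have "\<ominus>\<^bsub>?A\<^esub> x \<in> ?J" unfolding neg by auto
      then show "inv\<^bsub>add_monoid ?A\<^esub> x \<in> ?J" by (simp add: a_inv_def)
      fix y assume y: "y \<in> ?J"
      show "x \<otimes>\<^bsub>add_monoid ?A\<^esub> y \<in> ?J"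
        using x y by (simp add: wcar_add word_act_add)
    qed auto
    fix x y assume x: "x \<in> ?J" and y: "y \<in> carrier ?A"
    show "y \<otimes>\<^bsub>?A\<^esub> x \<in> ?J" using x y lin_zero[OF V V word_act_lin[of y]] by (simp add: conv_closed word_act_conv)
    show "x \<otimes>\<^bsub>?A\<^esub> y \<in> ?J" using x y by (simp add: conv_closed word_act_conv)
  qed
  moreover have "clifford_rels n \<subseteq> ?J" using clifford_rels_carrier word_act_rels by auto
  ultimately have "clifford_ideal n \<subseteq> ?J"
    unfolding clifford_ideal_def by (rule ring.genideal_minimal[OF word_algebra_ring])
  then show ?thesis using assms by auto
qed

lemma Cl_act_class:
  assumes "x \<in> wcar n" "s \<in> carrier V" shows "Cl_act M (ccls n x) s = word_act M x s"
proof -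
  have "word_act M y s = word_act M x s" if y: "y \<in> ccls n x" for y
  proof -
    obtain i where i: "i \<in> clifford_ideal n" "y = (\<lambda>w. i w + x w)"
      using y by (auto simp: a_r_coset_def')
    have "i \<in> wcar n" using i(1) clifford_ideal_carrier by blast
    then show ?thesis
      unfolding i(2) using assms word_act_ideal[OF i(1) assms(2)] by (simp add: word_act_add)
  qed
  moreover have "x \<in> ccls n x"
  proof -
    have "(\<lambda>_. 0) \<in> clifford_ideal n"
      using additive_subgroup.zero_closed[OF ideal.axioms(1)[OF clifford_ideal], of n] by simp
    then have "(\<lambda>_. 0) \<oplus>\<^bsub>word_algebra n\<^esub> x \<in> ccls n x" unfolding a_r_coset_def' by blast
    then show ?thesis by simp
  qed
  ultimately have "(\<lambda>x. word_act M x s) ` ccls n x = {word_act M x s}" by blast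
  then show ?thesis by (simp add: Cl_act_def)
qed

lemma Cl_module: "Cl_module n V (Cl_act M)"
  unfolding Cl_module_def
proof (intro conjI ballI allI)
  fix X assume "X \<in> carrier (Cl n)"
  then obtain x where x: "X = ccls n x" "x \<in> wcar n" by (auto simp: Cl_carrier)
  have "lin V V (Cl_act M X)"
    using word_act_lin[OF x(2)] by (simp add: x Cl_act_class lin_def)
  then show "linear_map class_ring V V (Cl_act M X)" by (simp add: linear_map_iff_lin)
  fix Y s assume "Y \<in> carrier (Cl n)" and s: "s \<in> carrier V"
  then obtain y where y: "Y = ccls n y" "y \<in> wcar n" by (auto simp: Cl_carrier)
  show "Cl_act M (X \<oplus>\<^bsub>Cl n\<^esub> Y) s = Cl_act M X s \<oplus>\<^bsub>V\<^esub> Cl_act M Y s"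
    using x y s by (simp add: Cl_add Cl_act_class wcar_add word_act_add)
  show "Cl_act M (X \<otimes>\<^bsub>Cl n\<^esub> Y) s = Cl_act M X (Cl_act M Y s)"
    using x y s by (simp add: Cl_mult Cl_act_class conv_closed word_act_conv)
next
  fix a s assume s: "s \<in> carrier V"
  have g: "gen [] \<in> wcar n" by simp
  show "Cl_act M \<one>\<^bsub>Cl n\<^esub> s = s" using s by (simp add: Cl_one Cl_act_class word_act_gen)
  have "word_act M (\<lambda>w. 0 + a * gen [] w) s = a \<odot>\<^bsub>V\<^esub> s"
    unfolding word_act_lincomb[OF wcar_zero g s] using s by (simp add: word_act_gen word_act_zero)
  then show "Cl_act M (Cl_of_real n a) s = a \<odot>\<^bsub>V\<^esub> s"
    unfolding Cl_of_real_def using s by (simp add: Cl_act_class free_space_mult)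
qed simp

lemma Cl_submodule_iff:
  "Cl_submodule n V (Cl_act M) W \<longleftrightarrow> subsp W V \<and> (\<forall>v\<in>carrier_vec n. \<forall>s\<in>W. c v s \<in> W)"
proof
  assume *: "Cl_submodule n V (Cl_act M) W"
  then have W: "subsp W V" by (simp add: Cl_submodule_def subspace_iff_subsp)
  have "c v s \<in> W" if "v \<in> carrier_vec n" "s \<in> W" for v s
  proof -
    have s: "s \<in> carrier V" using that W subsp_subset by auto
    have "ccls n (gen [v]) \<in> carrier (Cl n)" using that by (simp add: Cl_carrier)
    then have "Cl_act M (ccls n (gen [v])) s \<in> W" using * that by (simp add: Cl_submodule_def)
    then show ?thesis using that s by (simp add: Cl_act_class word_act_gen)
  qed
  then show "subsp W V \<and> (\<forall>v\<in>carrier_vec n. \<forall>s\<in>W. c v s \<in> W)" using W by auto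
next
  assume *: "subsp W V \<and> (\<forall>v\<in>carrier_vec n. \<forall>s\<in>W. c v s \<in> W)"
  then have W: "subsp W V" by simp
  have word: "foldr c w s \<in> W" if "w \<in> lists (carrier_vec n)" "s \<in> W" for w s
    using that by (induction w) (use * in auto)
  have "word_act M x s \<in> W" if "x \<in> wcar n" "s \<in> W" for x s
    using that(1)
  proof (induction rule: wcar_induct)
    have s: "s \<in> carrier V" using that W subsp_subset by auto
    case zero
    show ?case using s subsp_zero[OF W] by (simp add: word_act_zero)
    case (gen f a w)
    then show ?case
      using s word[OF gen(2) that(2)] W subsp_add[OF W] subsp_smult[OF W]
      by (simp add: word_act_lincomb word_act_gen)
  qed
  then show "Cl_submodule n V (Cl_act M) W"
    using W subsp_subset[OF W] by (auto simp: Cl_submodule_def subspace_iff_subsp Cl_carrier Cl_act_class subset_iff)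
qed


subsection \<open>Reduction to an orthonormal basis\<close>

abbreviation "gam i \<equiv> c (unit_vec n i)"

lemma vec_unit_induct [consumes 1, case_names zero step]:
  assumes v: "v \<in> carrier_vec n" and "P (0\<^sub>v n)"
    and "\<And>(v :: real vec) a i. v \<in> carrier_vec n \<Longrightarrow> i < n \<Longrightarrow> P v \<Longrightarrow> P (v + a \<cdot>\<^sub>v unit_vec n i)"
  shows "P v"
proof -
  have "P (vec n (\<lambda>i. if i < j then v $ i else 0))" if "j \<le> n" for j
    using that
  proof (induction j)
    case 0
    have "vec n (\<lambda>i. if i < 0 then v $ i else 0) = 0\<^sub>v n" by auto
    then show ?case using assms(2) by simp
  next
    case (Suc j)
    have "vec n (\<lambda>i. if i < Suc j then v $ i else 0) =
        vec n (\<lambda>i. if i < j then v $ i else 0) + v $ j \<cdot>\<^sub>v unit_vec n j"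
      by (rule eq_vecI) (auto simp: unit_vec_def less_Suc_eq)
    then show ?case using Suc assms(3)[of "vec n (\<lambda>i. if i < j then v $ i else 0)" j "v $ j"] by simp
  qed
  moreover have "vec n (\<lambda>i. if i < n then v $ i else 0) = v" using v by auto
  ultimately show ?thesis by force
qed

lemma c_zero: "s \<in> carrier V \<Longrightarrow> c (0\<^sub>v n) s = \<zero>\<^bsub>V\<^esub>"
proof -
  assume s: "s \<in> carrier V"
  have "0 \<cdot>\<^sub>v (0\<^sub>v n :: real vec) = 0\<^sub>v n" by auto
  then show ?thesis using c_smult[of "0\<^sub>v n" s 0] s by simp
qed

lemma c_step: "v \<in> carrier_vec n \<Longrightarrow> i < n \<Longrightarrow> s \<in> carrier V \<Longrightarrow>
    c (v + a \<cdot>\<^sub>v unit_vec n i) s = c v s \<oplus>\<^bsub>V\<^esub> a \<odot>\<^bsub>V\<^esub> gam i s"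
  by (simp add: c_add c_smult)

lemma stable_iff: "stable n V gam W \<longleftrightarrow> subsp W V \<and> (\<forall>v\<in>carrier_vec n. \<forall>s\<in>W. c v s \<in> W)"
proof
  assume st: "stable n V gam W"
  then have W: "subsp W V" by (simp add: stable_def)
  have "\<forall>s\<in>W. c v s \<in> W" if "v \<in> carrier_vec n" for v
    using that
  proof (induction rule: vec_unit_induct)
    case (step v a i)
    have "gam i s \<in> W" if "s \<in> W" for s using st step(2) that by (auto simp: stable_def)
    then show ?case
      using step subsp_add[OF W] subsp_smult[OF W] subsp_subset[OF W] by (auto simp: c_step subset_iff)
  next
    case zero
    show ?case using subsp_zero[OF W] subsp_subset[OF W] by (auto simp: c_zero subset_iff)
  qed
  then show "subsp W V \<and> (\<forall>v\<in>carrier_vec n. \<forall>s\<in>W. c v s \<in> W)" using W by blast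
qed (auto simp: stable_def)

lemma gamma_system: "gamma_system n V gam"
proof (rule gamma_system.intro)
  fix i j s assume i: "i < n"
  show "lin V V (gam i)" by (rule c_lin) simp
  assume s: "s \<in> carrier V"
  show "gam i (gam i s) = s"
  proof (rule crd_eqI[OF V])
    show "crd V (gam i (gam i s)) b = crd V s b" for b
      using arg_cong[OF c_clifford[of "unit_vec n i" "unit_vec n i" s], of "\<lambda>t. crd V t b"] i s
      by (simp add: cform_def)
  qed (use s in auto)
  assume j: "j < n" "i \<noteq> j"
  show "gam i (gam j s) = (-1) \<odot>\<^bsub>V\<^esub> gam j (gam i s)"
  proof (rule crd_eqI[OF V])
    show "crd V (gam i (gam j s)) b = crd V ((-1) \<odot>\<^bsub>V\<^esub> gam j (gam i s)) b" for b
      using arg_cong[OF c_clifford[of "unit_vec n i" "unit_vec n j" s], of "\<lambda>t. crd V t b"] i j s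
      by (simp add: cform_def)
  qed (use s in auto)
qed simp

lemma irreducible_iff: "irreducible_rep n M \<longleftrightarrow> irr n V gam"
proof -
  have "Cl_submodule n V (Cl_act M) W \<longleftrightarrow> stable n V gam W" for W
    unfolding Cl_submodule_iff stable_iff ..
  then show ?thesis
    using clifford_map Cl_module by (simp add: irreducible_rep_def irreducible_Cl_module_def irr_def)
qed

end

lemma intertwines_cmap:
  assumes "clifford_module n M" "clifford_module n N"
    and T: "intertwines n (space M) (\<lambda>i. cmap M (unit_vec n i)) (space N) (\<lambda>i. cmap N (unit_vec n i)) T"
    and v: "v \<in> carrier_vec n" and s: "s \<in> carrier (space M)"
  shows "T (cmap M v s) = cmap N v (T s)"
proof -
  interpret M: clifford_module n M by fact
  interpret N: clifford_module n N by fact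
  have lin: "lin (space M) (space N) T" using T by (simp add: intertwines_def)
  have Ts: "T s \<in> carrier (space N)" by (rule lin_closed[OF lin s])
  show ?thesis
    using v
  proof (induction rule: M.vec_unit_induct)
    case zero
    show ?case using s Ts lin_zero[OF M.V N.V lin] by (simp add: M.c_zero N.c_zero)
  next
    case (step v a i)
    have "T (cmap M (unit_vec n i) s) = cmap N (unit_vec n i) (T s)"
      using T step(2) s by (simp add: intertwines_def)
    then show ?case
      using step s Ts by (simp add: M.c_step N.c_step lin_add[OF lin] lin_smult[OF lin])
  qed
qed

text \<open>The unit vectors generate the Clifford algebra, so commuting with them is enough.\<close>

lemma intertwiners_iff:
  assumes "clifford_module n M" "clifford_module n N"
  shows "T \<in> intertwiners n (space M) (Cl_act M) (space N) (Cl_act N) \<longleftrightarrow>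
    intertwines n (space M) (\<lambda>i. cmap M (unit_vec n i)) (space N) (\<lambda>i. cmap N (unit_vec n i)) T"
proof -
  interpret M: clifford_module n M by fact
  interpret N: clifford_module n N by fact
  show ?thesis
  proof
    assume T: "T \<in> intertwiners n (space M) (Cl_act M) (space N) (Cl_act N)"
    then have lin: "lin (space M) (space N) T" by (simp add: intertwiners_def linear_map_iff_lin)
    have "T (cmap M (unit_vec n i) s) = cmap N (unit_vec n i) (T s)"
      if s: "s \<in> carrier (space M)" for i s
    proof -
      have "ccls n (gen [unit_vec n i]) \<in> carrier (Cl n)" by (simp add: Cl_carrier)
      then have "T (Cl_act M (ccls n (gen [unit_vec n i])) s) = Cl_act N (ccls n (gen [unit_vec n i])) (T s)"
        using T s by (simp add: intertwiners_def)
      then show ?thesis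
        using s lin_closed[OF lin s] by (simp add: M.Cl_act_class N.Cl_act_class M.word_act_gen N.word_act_gen)
    qed
    then show "intertwines n (space M) (\<lambda>i. cmap M (unit_vec n i)) (space N) (\<lambda>i. cmap N (unit_vec n i)) T"
      using lin by (simp add: intertwines_def)
  next
    assume T: "intertwines n (space M) (\<lambda>i. cmap M (unit_vec n i)) (space N) (\<lambda>i. cmap N (unit_vec n i)) T"
    then have lin: "lin (space M) (space N) T" by (simp add: intertwines_def)
    note cm = intertwines_cmap[OF assms T]
    have word: "T (foldr (cmap M) w s) = foldr (cmap N) w (T s)"
      if "w \<in> lists (carrier_vec n)" "s \<in> carrier (space M)" for w s
      using that by (induction w) (auto simp: cm)
    have "T (word_act M x s) = word_act N x (T s)" if "x \<in> wcar n" and s: "s \<in> carrier (space M)" for x s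
      using that(1)
    proof (induction rule: wcar_induct)
      case zero
      show ?case
        using s lin_closed[OF lin s] lin_zero[OF M.V N.V lin] by (simp add: M.word_act_zero N.word_act_zero)
    next
      case (gen f a w)
      then show ?case
        using s lin_closed[OF lin s] word[OF gen(2) s]
        by (simp add: M.word_act_lincomb N.word_act_lincomb M.word_act_gen N.word_act_gen
            lin_add[OF lin] lin_smult[OF lin])
    qed
    then show "T \<in> intertwiners n (space M) (Cl_act M) (space N) (Cl_act N)"
      using lin by (auto simp: intertwiners_def linear_map_iff_lin Cl_carrier M.Cl_act_class N.Cl_act_class
          lin_closed[OF lin])
  qed
qed

lemma isomorphic_reps_iff:
  assumes "clifford_module n M" "clifford_module n N"
  shows "isomorphic_reps n M N \<longleftrightarrow> (\<exists>T.
    intertwines n (space M) (\<lambda>i. cmap M (unit_vec n i)) (space N) (\<lambda>i. cmap N (unit_vec n i)) T \<and>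
    bij_betw T (carrier (space M)) (carrier (space N)))"
  unfolding isomorphic_reps_def Bex_def intertwiners_iff[OF assms] ..

lemma irreducible_rep_clifford: "irreducible_rep n M \<Longrightarrow> clifford_module n M"
  by (simp add: irreducible_rep_def clifford_module_def)

section \<open>Graded Clifford modules and their tensor products\<close>

lemma rvs_r_distr:
  "rvs V \<Longrightarrow> x \<in> carrier V \<Longrightarrow> y \<in> carrier V \<Longrightarrow> a \<odot>\<^bsub>V\<^esub> (x \<oplus>\<^bsub>V\<^esub> y) = a \<odot>\<^bsub>V\<^esub> x \<oplus>\<^bsub>V\<^esub> a \<odot>\<^bsub>V\<^esub> y"
  by (rule crd_eqI[of V]) (simp_all add: distrib_left)

lemma rvs_add4:
  "rvs V \<Longrightarrow> x \<in> carrier V \<Longrightarrow> y \<in> carrier V \<Longrightarrow> z \<in> carrier V \<Longrightarrow> w \<in> carrier V \<Longrightarrow>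
    (x \<oplus>\<^bsub>V\<^esub> y) \<oplus>\<^bsub>V\<^esub> (z \<oplus>\<^bsub>V\<^esub> w) = (x \<oplus>\<^bsub>V\<^esub> z) \<oplus>\<^bsub>V\<^esub> (y \<oplus>\<^bsub>V\<^esub> w)"
  by (rule crd_eqI[of V]) simp_all

lemma rvs_smult_smult:
  "rvs V \<Longrightarrow> x \<in> carrier V \<Longrightarrow> a \<odot>\<^bsub>V\<^esub> (b \<odot>\<^bsub>V\<^esub> x) = (a * b) \<odot>\<^bsub>V\<^esub> x"
  by (rule crd_eqI[of V]) simp_all

lemma lin_oplus:
  assumes "rvs V'" "lin V V' f" "lin V V' g" shows "lin V V' (\<lambda>t. f t \<oplus>\<^bsub>V'\<^esub> g t)"
  unfolding lin_def
  by (simp add: assms(1) linD[OF assms(2)] linD[OF assms(3)] rvs_add4 rvs_r_distr)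

lemma lin_scale:
  assumes "rvs V'" "lin V V' f" shows "lin V V' (\<lambda>t. a \<odot>\<^bsub>V'\<^esub> f t)"
  unfolding lin_def
  by (simp add: assms(1) linD[OF assms(2)] rvs_r_distr rvs_smult_smult mult.commute)

lemma sqx_upt_4: "even (sqx ([m..<m + 4 * j]))"
proof (induction j arbitrary: m)
  case (Suc j)
  have c: "count_list [a..<b] i = (if a \<le> i \<and> i < b then 1 else 0)" for a b i :: nat
    by (induction b) auto
  have "[m..<m + 4] = [m, Suc m, Suc (Suc m), Suc (Suc (Suc m))]"
    by (simp add: upt_conv_Cons numeral_eq_Suc)
  then have "[m..<m + 4 * Suc j] = m # Suc m # Suc (Suc m) # Suc (Suc (Suc m)) # [m + 4..<m + 4 + 4 * j]"
    using upt_add_eq_append[of m "m + 4" "4 * j"] by (simp add: add.assoc)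
  then show ?case using Suc[of "m + 4"] by (simp add: c)
qed auto

lemma count_list_upt: "count_list [a..<b] i = (if a \<le> i \<and> i < b then 1 else 0)" for a b i :: nat
  by (induction b) auto

context gamma_system
begin

abbreviation "vol \<equiv> op \<gamma> [0..<n]"

lemma vol_lin: "lin V V vol"
  by (rule op_lin) auto

lemma vol_closed [simp]: "s \<in> carrier V \<Longrightarrow> vol s \<in> carrier V"
  by (rule lin_closed[OF vol_lin])

lemma vol_square: "4 dvd n \<Longrightarrow> s \<in> carrier V \<Longrightarrow> vol (vol s) = s"
proof -
  assume "4 dvd n" and s: "s \<in> carrier V"
  then obtain j where "n = 4 * j" by (auto elim: dvdE)
  then have "even (sqx [0..<n])" using sqx_upt_4[of 0 j] by simp
  moreover have "set [0..<n] \<subseteq> {..<n}" by auto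
  ultimately show ?thesis using op_square[of "[0..<n]" s] s by simp
qed

lemma gamma_vol: "even n \<Longrightarrow> i < n \<Longrightarrow> s \<in> carrier V \<Longrightarrow> \<gamma> i (vol s) = (-1) \<odot>\<^bsub>V\<^esub> vol (\<gamma> i s)"
  using gamma_op[of i "[0..<n]" s] by (simp add: count_list_upt atLeast0LessThan)

end

text \<open>All gradings that occur come from a volume element in a dimension divisible by 4, where it
  squares to one and anticommutes with every vector.\<close>

locale graded_module = clifford_module p M for p :: nat and M :: "'a graded_rep" +
  assumes dvd4: "4 dvd p" and parity_volume: "s \<in> carrier (space M) \<Longrightarrow> parity M s = volume p M s"
begin

sublocale G: gamma_system p "space M" gam
  by (rule gamma_system)

lemma volume_op: "volume p M = op gam [0..<p]"
  by (rule ext) (simp add: volume_def foldr_map comp_def)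

lemma parity_vol: "s \<in> carrier V \<Longrightarrow> parity M s = op gam [0..<p] s"
  using parity_volume by (simp add: volume_op)

lemma parity_closed [simp]: "s \<in> carrier V \<Longrightarrow> parity M s \<in> carrier V"
  by (simp add: parity_vol)

lemma parity_lin: "lin V V (parity M)"
  using G.vol_lin by (simp add: lin_def parity_vol)

lemma parity_square [simp]: "s \<in> carrier V \<Longrightarrow> parity M (parity M s) = s"
  using G.vol_square[OF dvd4] by (simp add: parity_vol)

lemma even_p: "even p"
  using dvd4 by (auto elim!: dvdE)

lemma gam_parity: "i < p \<Longrightarrow> s \<in> carrier V \<Longrightarrow> gam i (parity M s) = (-1) \<odot>\<^bsub>V\<^esub> parity M (gam i s)"
  using G.gamma_vol[OF even_p] by (simp add: parity_vol)

lemma c_parity: "v \<in> carrier_vec p \<Longrightarrow> s \<in> carrier V \<Longrightarrow> c v (parity M s) = (-1) \<odot>\<^bsub>V\<^esub> parity M (c v s)"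
proof (induction rule: vec_unit_induct)
  case zero
  then show ?case using lin_zero[OF V V parity_lin] by (simp add: c_zero)
next
  case (step v a i)
  then show ?case
    by (auto simp: c_step gam_parity lin_add[OF parity_lin] lin_smult[OF parity_lin] intro!: crd_eqI[OF V])
qed

end

lemma graded_module_iff:
  "graded_module p M \<longleftrightarrow> 4 dvd p \<and> clifford_map p M \<and>
    (\<forall>s\<in>carrier (space M). parity M s = volume p M s)"
  by (auto simp: graded_module_def graded_module_axioms_def clifford_module_def)

locale rep_pair = M: graded_module p M + N: clifford_module q N
  + tensor_pair "space M" r "space N" l
  for p q and M :: "'m graded_rep" and N :: "'n graded_rep"
    and r :: "'k \<Rightarrow> 'm \<Rightarrow> 'm" and l :: "'k \<Rightarrow> 'n \<Rightarrow> 'n" +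
  assumes c_r: "v \<in> carrier_vec p \<Longrightarrow> m \<in> carrier (space M) \<Longrightarrow> cmap M v (r z m) = r z (cmap M v m)"
    and c_l: "v \<in> carrier_vec q \<Longrightarrow> n \<in> carrier (space N) \<Longrightarrow> cmap N v (l z n) = l z (cmap N v n)"
begin

sublocale GN: gamma_system q "space N" N.gam
  by (rule N.gamma_system)

abbreviation "RT \<equiv> rep_tensor p q M r N l"

lemma space_RT [simp]: "space RT = T"
  by (simp add: rep_tensor_def)

lemma gam_op_r: "set w \<subseteq> {..<p} \<Longrightarrow> m \<in> carrier (space M) \<Longrightarrow> op M.gam w (r z m) = r z (op M.gam w m)"
  by (induction w) (auto simp: c_r)

lemma parity_r: "m \<in> carrier (space M) \<Longrightarrow> parity M (r z m) = r z (parity M m)"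
  using gam_op_r[of "[0..<p]"] by (simp add: M.parity_vol atLeast0LessThan)

definition left :: "real vec \<Rightarrow> ('m \<times> 'n \<Rightarrow> real) set \<Rightarrow> ('m \<times> 'n \<Rightarrow> real) set" where
  "left u = tensor_map (space M) r (space N) l (cmap M u \<circ> (parity M ^^ 0)) id"

definition right :: "real vec \<Rightarrow> ('m \<times> 'n \<Rightarrow> real) set \<Rightarrow> ('m \<times> 'n \<Rightarrow> real) set" where
  "right v = tensor_map (space M) r (space N) l (id \<circ> (parity M ^^ 1)) (cmap N v)"

lemma cmap_RT: "cmap RT w t = left (vec_first w p) t \<oplus>\<^bsub>T\<^esub> right (vec_last w q) t"
  by (simp add: rep_tensor_def graded_tensor_map_def left_def right_def)

lemma left_tens: "u \<in> carrier_vec p \<Longrightarrow> m \<in> carrier (space M) \<Longrightarrow> n \<in> carrier (space N) \<Longrightarrow>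
    left u (tens m n) = tens (cmap M u m) n"
  and left_lin: "u \<in> carrier_vec p \<Longrightarrow> lin T T (left u)"
  unfolding left_def
  by (subst tensor_map_tens; auto simp: M.c_lin c_r)
     (rule tensor_map_lin; auto simp: M.c_lin c_r)

lemma right_tens: "v \<in> carrier_vec q \<Longrightarrow> m \<in> carrier (space M) \<Longrightarrow> n \<in> carrier (space N) \<Longrightarrow>
    right v (tens m n) = tens (parity M m) (cmap N v n)"
  and right_lin: "v \<in> carrier_vec q \<Longrightarrow> lin T T (right v)"
  unfolding right_def
  by (subst tensor_map_tens; auto simp: M.parity_lin parity_r N.c_lin c_l)
     (rule tensor_map_lin; auto simp: M.parity_lin parity_r N.c_lin c_l)

lemma cmap_RT_tens:
  "m \<in> carrier (space M) \<Longrightarrow> n \<in> carrier (space N) \<Longrightarrow>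
    cmap RT w (tens m n) = tens (cmap M (vec_first w p) m) n
      \<oplus>\<^bsub>T\<^esub> tens (parity M m) (cmap N (vec_last w q) n)"
  by (simp add: cmap_RT left_tens right_tens)

lemma cmap_RT_lin: "lin T T (cmap RT w)"
  unfolding cmap_RT by (intro lin_oplus T_rvs left_lin right_lin) auto

lemma tens_zero [simp]:
  "n \<in> carrier (space N) \<Longrightarrow> tens \<zero>\<^bsub>space M\<^esub> n = \<zero>\<^bsub>T\<^esub>"
  "m \<in> carrier (space M) \<Longrightarrow> tens m \<zero>\<^bsub>space N\<^esub> = \<zero>\<^bsub>T\<^esub>"
  using lin_zero[OF M T_rvs tens_left_lin] lin_zero[OF N T_rvs tens_right_lin] by auto

lemma vec_first_linear:
  assumes "v \<in> carrier_vec (p + q)" "w \<in> carrier_vec (p + q)"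
  shows "vec_first (v + w) p = vec_first v p + vec_first w p"
    "vec_first (a \<cdot>\<^sub>v v) p = a \<cdot>\<^sub>v vec_first v p"
    "vec_last (v + w) q = vec_last v q + vec_last w q"
    "vec_last (a \<cdot>\<^sub>v v) q = a \<cdot>\<^sub>v vec_last v q"
  using assms by (auto simp: vec_first_def vec_last_def)

lemma cform_split:
  assumes "v \<in> carrier_vec (p + q)" "w \<in> carrier_vec (p + q)"
  shows "cform v w = cform (vec_first v p) (vec_first w p) + cform (vec_last v q) (vec_last w q)"
  using scalar_prod_append[of "vec_first v p" p "vec_last v q" q "vec_first w p" "vec_last w q"] assms
  by (simp add: cform_def)

lemma clifford_RT: "clifford_map (p + q) RT"
  unfolding clifford_map_def clifford_condition_def space_RT
proof (intro conjI ballI allI)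
  fix v w :: "real vec" and t a assume v: "v \<in> carrier_vec (p + q)"
  show "linear_map class_ring T T (cmap RT v)"
    by (simp add: linear_map_iff_lin cmap_RT_lin)
  assume t: "t \<in> carrier T"
  note tl = tens_add_left tens_add_right tens_smult_left tens_smult_right
  show "cmap RT (a \<cdot>\<^sub>v v) t = a \<odot>\<^bsub>T\<^esub> cmap RT v t"
    by (rule tens_lin_eq[OF T_rvs cmap_RT_lin lin_scale[OF T_rvs cmap_RT_lin] _ t])
       (simp add: cmap_RT_tens vec_first_linear[OF v v] M.c_smult N.c_smult tl rvs_r_distr)
  assume w: "w \<in> carrier_vec (p + q)"
  show "cmap RT (v + w) t = cmap RT v t \<oplus>\<^bsub>T\<^esub> cmap RT w t"
    by (rule tens_lin_eq[OF T_rvs cmap_RT_lin lin_oplus[OF T_rvs cmap_RT_lin cmap_RT_lin] _ t])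
       (simp add: cmap_RT_tens vec_first_linear[OF v w] M.c_add N.c_add tl rvs_add4)
  show "cmap RT v (cmap RT w t) \<oplus>\<^bsub>T\<^esub> cmap RT w (cmap RT v t) = (- 2 * cform v w) \<odot>\<^bsub>T\<^esub> t"
  proof (rule tens_lin_eq[OF T_rvs _ _ _ t])
    show "lin T T (\<lambda>t. cmap RT v (cmap RT w t) \<oplus>\<^bsub>T\<^esub> cmap RT w (cmap RT v t))"
      using lin_comp[OF cmap_RT_lin[of w] cmap_RT_lin[of v]] lin_comp[OF cmap_RT_lin[of v] cmap_RT_lin[of w]]
      by (intro lin_oplus T_rvs) (simp_all add: comp_def)
    show "lin T T (\<lambda>t. (- 2 * cform v w) \<odot>\<^bsub>T\<^esub> t)" by (intro lin_scale T_rvs lin_id)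
    fix m n assume m: "m \<in> carrier (space M)" and n: "n \<in> carrier (space N)"
    let ?v = "vec_first v p" and ?w = "vec_first w p" and ?v' = "vec_last v q" and ?w' = "vec_last w q"
    have c: "cmap RT x (cmap RT y (tens m n)) = (tens (cmap M (vec_first x p) (cmap M (vec_first y p) m)) n
        \<oplus>\<^bsub>T\<^esub> tens (parity M (cmap M (vec_first y p) m)) (cmap N (vec_last x q) n))
        \<oplus>\<^bsub>T\<^esub> ((-1) \<odot>\<^bsub>T\<^esub> tens (parity M (cmap M (vec_first x p) m)) (cmap N (vec_last y q) n)
        \<oplus>\<^bsub>T\<^esub> tens m (cmap N (vec_last x q) (cmap N (vec_last y q) n)))" for x y
      using m n by (simp add: cmap_RT_tens lin_add[OF cmap_RT_lin] M.c_parity tens_smult_left)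
    have 1: "tens (cmap M ?v (cmap M ?w m)) n \<oplus>\<^bsub>T\<^esub> tens (cmap M ?w (cmap M ?v m)) n =
        (- 2 * cform ?v ?w) \<odot>\<^bsub>T\<^esub> tens m n"
      using M.c_clifford[of ?v ?w m] m n by (simp flip: tens_add_left tens_smult_left)
    have 2: "tens m (cmap N ?v' (cmap N ?w' n)) \<oplus>\<^bsub>T\<^esub> tens m (cmap N ?w' (cmap N ?v' n)) =
        (- 2 * cform ?v' ?w') \<odot>\<^bsub>T\<^esub> tens m n"
      using N.c_clifford[of ?v' ?w' n] m n by (simp flip: tens_add_right tens_smult_right)
    show "cmap RT v (cmap RT w (tens m n)) \<oplus>\<^bsub>T\<^esub> cmap RT w (cmap RT v (tens m n)) =
        (- 2 * cform v w) \<odot>\<^bsub>T\<^esub> tens m n"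
    proof (rule crd_eqI[OF T_rvs])
      show "crd T (cmap RT v (cmap RT w (tens m n)) \<oplus>\<^bsub>T\<^esub> cmap RT w (cmap RT v (tens m n))) b =
          crd T ((- 2 * cform v w) \<odot>\<^bsub>T\<^esub> tens m n) b" for b
        using arg_cong[OF 1, of "\<lambda>t. crd T t b"] arg_cong[OF 2, of "\<lambda>t. crd T t b"] m n
        by (simp add: c cform_split[OF v w] algebra_simps)
    qed (use m n in \<open>simp_all add: c\<close>)
  qed
qed simp_all

sublocale R: clifford_module "p + q" RT
  by unfold_locales (rule clifford_RT)

sublocale GR: gamma_system "p + q" T R.gam
  using R.gamma_system by simp

lemma gam_left: 
  assumes "i < p" "m \<in> carrier (space M)" "n \<in> carrier (space N)"
  shows "R.gam i (tens m n) = tens (M.gam i m) n"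
proof -
  have "vec_first (unit_vec (p + q) i) p = (unit_vec p i :: real vec)"
    "vec_last (unit_vec (p + q) i) q = (0\<^sub>v q :: real vec)"
    using assms by (auto simp: vec_first_def vec_last_def unit_vec_def)
  then show ?thesis using assms by (simp add: cmap_RT_tens N.c_zero)
qed

lemma gam_right: 
  assumes "j < q" "m \<in> carrier (space M)" "n \<in> carrier (space N)"
  shows "R.gam (p + j) (tens m n) = tens (parity M m) (N.gam j n)"
proof -
  have "vec_first (unit_vec (p + q) (p + j)) p = (0\<^sub>v p :: real vec)"
    "vec_last (unit_vec (p + q) (p + j)) q = (unit_vec q j :: real vec)"
    using assms by (auto simp: vec_first_def vec_last_def unit_vec_def)
  then show ?thesis using assms by (simp add: cmap_RT_tens M.c_zero)
qed

lemma op_left: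
  "set w \<subseteq> {..<p} \<Longrightarrow> m \<in> carrier (space M) \<Longrightarrow> n \<in> carrier (space N) \<Longrightarrow>
    op R.gam w (tens m n) = tens (op M.gam w m) n"
  by (induction w) (auto simp: gam_left)

lemma parity_power: "m \<in> carrier (space M) \<Longrightarrow> (parity M ^^ j) m = (if even j then m else parity M m)"
  by (induction j) auto

lemma op_right:
  "set w \<subseteq> {..<q} \<Longrightarrow> m \<in> carrier (space M) \<Longrightarrow> n \<in> carrier (space N) \<Longrightarrow>
    op R.gam (map ((+) p) w) (tens m n) = tens ((parity M ^^ length w) m) (op N.gam w n)"
  by (induction w) (auto simp: gam_right parity_power)

lemma op_vol_left: "m \<in> carrier (space M) \<Longrightarrow> n \<in> carrier (space N) \<Longrightarrow>
    op R.gam [0..<p] (tens m n) = tens (parity M m) n"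
  by (subst op_left) (auto simp: M.parity_vol)

text \<open>The volume element of the first factor cancels the grading sign, so that a stable subspace is
  also stable under the ungraded operators \<open>I \<otimes> \<gamma> j\<close>.\<close>

definition rgam :: "nat \<Rightarrow> ('m \<times> 'n \<Rightarrow> real) set \<Rightarrow> ('m \<times> 'n \<Rightarrow> real) set" where
  "rgam j t = op R.gam [0..<p] (R.gam (p + j) t)"

lemma rgam_tens: "j < q \<Longrightarrow> m \<in> carrier (space M) \<Longrightarrow> n \<in> carrier (space N) \<Longrightarrow>
    rgam j (tens m n) = tens m (N.gam j n)"
  by (simp add: rgam_def gam_right op_vol_left)

lemma rgam_lin: "j < q \<Longrightarrow> lin T T (rgam j)"
proof -
  assume "j < q"
  then have "lin T T (op R.gam [0..<p] \<circ> R.gam (p + j))"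
    by (intro lin_comp[OF GR.gamma_lin GR.op_lin]) auto
  moreover have "op R.gam [0..<p] \<circ> R.gam (p + j) = rgam j" by (rule ext) (simp add: rgam_def)
  ultimately show ?thesis by simp
qed

lemma rgam_stable: "stable (p + q) T R.gam W \<Longrightarrow> j < q \<Longrightarrow> t \<in> W \<Longrightarrow> rgam j t \<in> W"
  unfolding rgam_def by (rule stable_op) (auto simp: stable_def)

lemma left_stable:
  assumes "stable (p + q) T R.gam W" "n \<in> carrier (space N)"
  shows "stable p (space M) M.gam {m \<in> carrier (space M). tens m n \<in> W}"
  using lin_preimage[OF M T_rvs tens_left_lin[OF assms(2)]] assms
  by (auto simp: stable_def gam_left[symmetric])

lemma right_stable:
  assumes "stable (p + q) T R.gam W" "m \<in> carrier (space M)"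
  shows "stable q (space N) N.gam {n \<in> carrier (space N). tens m n \<in> W}"
proof -
  have "tens m (N.gam i n) \<in> W" if "i < q" "n \<in> carrier (space N)" "tens m n \<in> W" for i n
    using rgam_stable[OF assms(1) that(1,3)] rgam_tens[OF that(1) assms(2) that(2)] by simp
  moreover have "subsp W T" using assms by (simp add: stable_def)
  ultimately show ?thesis
    using lin_preimage[OF N T_rvs tens_right_lin[OF assms(2)], of W]
    by (auto simp: stable_def)
qed

lemma projs_left:
  assumes "\<forall>(e, w)\<in>set L. set w \<subseteq> {..<p}" "m \<in> carrier (space M)" "n \<in> carrier (space N)"
  shows "GR.projs L (tens m n) = tens (M.G.projs L m) n"
  using assms(1)
proof (induction L)
  case (Cons x L)
  obtain e w where x: "x = (e, w)" by force
  have "lin (space M) (space M) (M.G.projs L)" by (rule M.G.projs_lin) (use Cons in auto)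
  then have c: "M.G.projs L m \<in> carrier (space M)" by (rule lin_closed[OF _ assms(2)])
  have w: "set w \<subseteq> {..<p}" using Cons.prems x by auto
  have "GR.projs (x # L) (tens m n) = GR.proj (e, w) (tens (M.G.projs L m) n)"
    using Cons by (simp add: GR.projs_def x)
  also have "\<dots> = tens (M.G.proj (e, w) (M.G.projs L m)) n"
    using c w assms(3) by (simp add: GR.proj_def M.G.proj_def op_left tens_add_left tens_smult_left)
  finally show ?case by (simp add: M.G.projs_def x)
qed (simp add: GR.projs_def M.G.projs_def)

text \<open>Let \<open>W\<close> be a nonzero stable subspace. It contains a vector \<open>w\<close> fixed by the code of the first
  factor. The projection of the first factor to the minimal vectors has image \<open>\<real> z\<close>, so
  \<open>w = z \<otimes> n\<close>. Then \<open>W\<close> contains \<open>z \<otimes> N\<close> and finally all of \<open>M \<otimes> N\<close>, by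
  irreducibility of the two factors.\<close>

lemma irr_left:
  assumes p: "p = 8 * k" and irrM: "irr p (space M) M.gam" and irrN: "irr q (space N) N.gam"
    and nz: "carrier T \<noteq> {\<zero>\<^bsub>T\<^esub>}"
  shows "irr (p + q) T R.gam"
  unfolding irr_def
proof (intro conjI nz allI impI)
  fix W assume W: "stable (p + q) T R.gam W"
  then have Ws: "subsp W T" by (simp add: stable_def)
  show "W = {\<zero>\<^bsub>T\<^esub>} \<or> W = carrier T"
  proof (cases "W = {\<zero>\<^bsub>T\<^esub>}")
    case False
    then obtain s where "s \<in> W" "s \<noteq> \<zero>\<^bsub>T\<^esub>" using subsp_zero[OF Ws] by auto
    then have "\<exists>w\<in>W. w \<noteq> \<zero>\<^bsub>T\<^esub> \<and> (\<forall>u\<in>set (code k). op R.gam u w = w)"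
      using p by (intro GR.code_fixed_exists[OF _ W]) auto
    then obtain w where w: "w \<in> W" "w \<noteq> \<zero>\<^bsub>T\<^esub>" "\<forall>u\<in>set (code k). op R.gam u w = w"
      by blast
    have wc: "w \<in> carrier T" using w Ws subsp_subset by blast
    obtain z where z: "z \<in> carrier (space M)" "z \<noteq> \<zero>\<^bsub>space M\<^esub>" "\<forall>u\<in>set (code k). op M.gam u z = z"
    proof -
      obtain s where "s \<in> carrier (space M)" "s \<noteq> \<zero>\<^bsub>space M\<^esub>" using irr_nonzero[OF irrM M] .
      then have "\<exists>z\<in>carrier (space M). z \<noteq> \<zero>\<^bsub>space M\<^esub> \<and> (\<forall>u\<in>set (code k). op M.gam u z = z)"
        using p by (intro M.G.code_fixed_exists[OF _ M.G.stable_carrier]) auto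
      then show ?thesis using that by blast
    qed
    let ?L = "map (Pair 1) (code k)"
    have st: "?L = stab p k 1" using p by (simp add: stab_def)
    have Lw: "\<forall>(e, u)\<in>set ?L. set u \<subseteq> {..<p}" using code_words[of _ k] p by auto
    then have Lw': "\<forall>(e, u)\<in>set ?L. set u \<subseteq> {..<p + q}" by fastforce
    have zf: "M.G.fixed (stab p k 1) z" using z p by (subst M.G.fixed_stab_iff) simp_all
    let ?Z = "{tens z n | n. n \<in> carrier (space N)}"
    have Z: "subsp ?Z T"
      unfolding subsp_def
    proof (intro conjI ballI allI)
      show "\<zero>\<^bsub>T\<^esub> \<in> ?Z" using z by (auto intro!: exI[of _ "\<zero>\<^bsub>space N\<^esub>"])
      fix x y a assume x: "x \<in> ?Z"
      then obtain n where n: "x = tens z n" "n \<in> carrier (space N)" by auto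
      have "a \<odot>\<^bsub>T\<^esub> x = tens z (a \<odot>\<^bsub>space N\<^esub> n)" using n z by (simp add: tens_smult_right)
      then show "a \<odot>\<^bsub>T\<^esub> x \<in> ?Z" using n by (metis (mono_tags, lifting) N mem_Collect_eq rvs_smult)
      assume "y \<in> ?Z"
      then obtain n' where n': "y = tens z n'" "n' \<in> carrier (space N)" by auto
      have "x \<oplus>\<^bsub>T\<^esub> y = tens z (n \<oplus>\<^bsub>space N\<^esub> n')" using n n' z by (simp add: tens_add_right)
      then show "x \<oplus>\<^bsub>T\<^esub> y \<in> ?Z" using n n' by (metis (mono_tags, lifting) N mem_Collect_eq rvs_add)
    qed (use z in auto)
    have sub: "carrier T \<subseteq> {t \<in> carrier T. GR.projs ?L t \<in> ?Z}"
    proof (rule tens_generate[OF lin_preimage[OF T_rvs T_rvs GR.projs_lin[OF Lw'] Z]])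
      fix m n assume m: "m \<in> carrier (space M)" and n: "n \<in> carrier (space N)"
      have "m \<in> M.G.cyc z" using M.G.irr_cyc[OF irrM z(1,2)] m by simp
      then have "M.G.projs (stab p k 1) m \<in> M.G.qline (8 * k) z"
        using p zf by (intro M.G.projs_cyc) auto
      then obtain a where a: "M.G.projs ?L m = a \<odot>\<^bsub>space M\<^esub> z"
        using M.G.qline_8k[OF p z(1)] unfolding st by blast
      have "GR.projs ?L (tens m n) = tens z (a \<odot>\<^bsub>space N\<^esub> n)"
        using projs_left[OF Lw m n] a n z by (simp add: tens_smult_left tens_smult_right)
      moreover have "a \<odot>\<^bsub>space N\<^esub> n \<in> carrier (space N)" using n by simp
      ultimately show "tens m n \<in> {t \<in> carrier T. GR.projs ?L t \<in> ?Z}" using m n by auto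
    qed
    have fw: "GR.projs ?L w = w"
    proof (rule GR.projs_fixed)
      have "1 \<odot>\<^bsub>T\<^esub> op R.gam u w = w" if "u \<in> set (code k)" for u using w(3) wc that by simp
      then show "GR.fixed ?L w" using wc by (auto simp: GR.fixed_def)
    qed
    have "GR.projs ?L w \<in> ?Z" using subsetD[OF sub wc] by simp
    then have "w \<in> ?Z" unfolding fw .
    then obtain n where n: "w = tens z n" "n \<in> carrier (space N)" by blast
    have n0: "n \<noteq> \<zero>\<^bsub>space N\<^esub>" using n w(2) z by auto
    have "{n \<in> carrier (space N). tens z n \<in> W} = carrier (space N)"
      by (rule irrD[OF irrN right_stable[OF W z(1)] _ n0]) (use n w in auto)
    then have zn: "tens z n \<in> W" if "n \<in> carrier (space N)" for n using that by auto
    have "{m \<in> carrier (space M). tens m n \<in> W} = carrier (space M)" if "n \<in> carrier (space N)" for n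
      by (rule irrD[OF irrM left_stable[OF W that] _ z(2)]) (use zn that z in auto)
    then have "carrier T \<subseteq> W" by (intro tens_generate[OF Ws]) auto
    then show ?thesis using subsp_subset[OF Ws] by auto
  qed simp
qed

text \<open>The projection \<open>f = I \<otimes> (1 + e \<gamma> 0) / 2\<close> preserves a stable subspace and maps
  \<open>m \<otimes> n\<close> to \<open>m \<otimes> z n\<^sub>0 = m z \<otimes> n\<^sub>0\<close>. It therefore produces a pure tensor in the
  stable subspace, provided that it does not vanish there. The assumption \<open>flip\<close> excludes this: either
  the projection is the identity, or the generator 1 exchanges its kernel and its image.\<close>

lemma irr_right:
  assumes irrM: "irr p (space M) M.gam" and irrN: "irr q (space N) N.gam" and q: "0 < q"
    and n0: "n0 \<in> carrier (space N)" and e: "e \<in> {1, -1}"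
    and line: "\<And>n. n \<in> carrier (space N) \<Longrightarrow>
      \<exists>z. (1 / 2) \<odot>\<^bsub>space N\<^esub> (n \<oplus>\<^bsub>space N\<^esub> e \<odot>\<^bsub>space N\<^esub> N.gam 0 n) = l z n0"
    and flip: "1 < q \<or> (\<forall>n\<in>carrier (space N). e \<odot>\<^bsub>space N\<^esub> N.gam 0 n = n)"
    and nz: "carrier T \<noteq> {\<zero>\<^bsub>T\<^esub>}"
  shows "irr (p + q) T R.gam"
  unfolding irr_def
proof (intro conjI nz allI impI)
  fix W assume W: "stable (p + q) T R.gam W"
  then have Ws: "subsp W T" by (simp add: stable_def)
  define f where "f t = (1 / 2) \<odot>\<^bsub>T\<^esub> (t \<oplus>\<^bsub>T\<^esub> e \<odot>\<^bsub>T\<^esub> rgam 0 t)" for t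
  have f_lin: "lin T T f"
    unfolding f_def by (intro lin_scale lin_oplus lin_id rgam_lin q T_rvs)
  have f_tens: "f (tens m n) = tens m ((1 / 2) \<odot>\<^bsub>space N\<^esub> (n \<oplus>\<^bsub>space N\<^esub> e \<odot>\<^bsub>space N\<^esub> N.gam 0 n))"
    if "m \<in> carrier (space M)" "n \<in> carrier (space N)" for m n
    using that q by (simp add: f_def rgam_tens tens_add_right tens_smult_right)
  show "W = {\<zero>\<^bsub>T\<^esub>} \<or> W = carrier T"
  proof (cases "W = {\<zero>\<^bsub>T\<^esub>}")
    case False
    then obtain s where s: "s \<in> W" "s \<noteq> \<zero>\<^bsub>T\<^esub>" using subsp_zero[OF Ws] by auto
    have sc: "s \<in> carrier T" using s Ws subsp_subset by blast
    have r0c: "rgam j t \<in> carrier T" if "j < q" "t \<in> carrier T" for j t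
      by (rule lin_closed[OF rgam_lin]) (use that in auto)
    have "\<exists>w\<in>W. f w \<noteq> \<zero>\<^bsub>T\<^esub>"
    proof (cases "f s = \<zero>\<^bsub>T\<^esub>")
      case True
      have "1 < q"
      proof (rule ccontr)
        assume "\<not> 1 < q"
        then have fix0: "\<forall>n\<in>carrier (space N). e \<odot>\<^bsub>space N\<^esub> N.gam 0 n = n" using flip by blast
        have "f s = s"
        proof (rule tens_lin_eq[OF T_rvs f_lin lin_id(2) _ sc])
          fix m n assume m: "m \<in> carrier (space M)" and n: "n \<in> carrier (space N)"
          have "(1 / 2) \<odot>\<^bsub>space N\<^esub> (n \<oplus>\<^bsub>space N\<^esub> n) = n"
            by (rule crd_eqI[OF N]) (use n in auto)
          then show "f (tens m n) = tens m n" using f_tens[OF m n] fix0 n by simp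
        qed
        then show False using True s by simp
      qed
      let ?t = "rgam 1 s"
      have t: "?t \<in> W" by (rule rgam_stable[OF W]) (use \<open>1 < q\<close> s in auto)
      have sq: "rgam 1 (rgam 1 s) = s"
      proof (rule tens_lin_eq[OF T_rvs _ lin_id(2) _ sc])
        show "lin T T (\<lambda>s. rgam 1 (rgam 1 s))"
          using lin_comp[OF rgam_lin rgam_lin, of 1 1] \<open>1 < q\<close> by (simp add: comp_def)
      qed (use \<open>1 < q\<close> in \<open>simp add: rgam_tens GN.gamma_square\<close>)
      have anti: "rgam 0 (rgam 1 s) = (-1) \<odot>\<^bsub>T\<^esub> rgam 1 (rgam 0 s)"
      proof (rule tens_lin_eq[OF T_rvs _ _ _ sc])
        show "lin T T (\<lambda>s. rgam 0 (rgam 1 s))"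
          using lin_comp[OF rgam_lin rgam_lin, of 1 0] \<open>1 < q\<close> by (simp add: comp_def)
        show "lin T T (\<lambda>s. (-1) \<odot>\<^bsub>T\<^esub> rgam 1 (rgam 0 s))"
          using lin_comp[OF rgam_lin rgam_lin, of 0 1] \<open>1 < q\<close> by (intro lin_scale T_rvs) (simp add: comp_def)
        fix m n assume "m \<in> carrier (space M)" "n \<in> carrier (space N)"
        then show "rgam 0 (rgam 1 (tens m n)) = (-1) \<odot>\<^bsub>T\<^esub> rgam 1 (rgam 0 (tens m n))"
          using \<open>1 < q\<close> GN.gamma_anticommute[of 0 1 n] by (simp add: rgam_tens flip: tens_smult_right)
      qed
      have e0: "e \<odot>\<^bsub>T\<^esub> rgam 0 s = (-1) \<odot>\<^bsub>T\<^esub> s"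
      proof (rule crd_eqI[OF T_rvs])
        show "crd T (e \<odot>\<^bsub>T\<^esub> rgam 0 s) b = crd T ((-1) \<odot>\<^bsub>T\<^esub> s) b" for b
          using arg_cong[OF True, of "\<lambda>t. crd T t b"] sc q r0c[of 0 s] by (simp add: f_def)
      qed (use sc q r0c[of 0 s] in simp_all)
      have "e \<odot>\<^bsub>T\<^esub> rgam 0 ?t = (-1) \<odot>\<^bsub>T\<^esub> rgam 1 (e \<odot>\<^bsub>T\<^esub> rgam 0 s)"
        unfolding anti using \<open>1 < q\<close> sc r0c
        by (simp add: lin_smult[OF rgam_lin] GR.smult_smult mult.commute)
      also have "\<dots> = ?t"
        unfolding e0 using \<open>1 < q\<close> sc r0c[of 1 s] by (simp add: lin_smult[OF rgam_lin] GR.smult_smult)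
      finally have "f ?t = (1 / 2) \<odot>\<^bsub>T\<^esub> (?t \<oplus>\<^bsub>T\<^esub> ?t)" by (simp add: f_def)
      also have "\<dots> = ?t"
        by (rule crd_eqI[OF T_rvs]) (use \<open>1 < q\<close> sc r0c[of 1 s] in auto)
      finally have "f ?t = ?t" .
      moreover have "?t \<noteq> \<zero>\<^bsub>T\<^esub>"
      proof
        assume "?t = \<zero>\<^bsub>T\<^esub>"
        then have "rgam 1 ?t = \<zero>\<^bsub>T\<^esub>" using lin_zero[OF T_rvs T_rvs rgam_lin, of 1] \<open>1 < q\<close> by simp
        then show False using sq s(2) by simp
      qed
      ultimately show ?thesis by (intro bexI[OF _ t]) simp
    next
      case False
      then show ?thesis using s(1) by blast
    qed
    then obtain w where w: "w \<in> W" "f w \<noteq> \<zero>\<^bsub>T\<^esub>" by blast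
    have wc: "w \<in> carrier T" using w Ws subsp_subset by blast
    have fw: "f w \<in> W"
      unfolding f_def by (intro subsp_smult[OF Ws] subsp_add[OF Ws] rgam_stable[OF W] q w)
    let ?Z = "{tens m n0 | m. m \<in> carrier (space M)}"
    have Z: "subsp ?Z T"
      unfolding subsp_def
    proof (intro conjI ballI allI)
      show "\<zero>\<^bsub>T\<^esub> \<in> ?Z" using n0 by (auto intro!: exI[of _ "\<zero>\<^bsub>space M\<^esub>"])
      fix x y a assume x: "x \<in> ?Z"
      then obtain m where m: "x = tens m n0" "m \<in> carrier (space M)" by auto
      have "a \<odot>\<^bsub>T\<^esub> x = tens (a \<odot>\<^bsub>space M\<^esub> m) n0" using m n0 by (simp add: tens_smult_left)
      then show "a \<odot>\<^bsub>T\<^esub> x \<in> ?Z" using m by (metis (mono_tags, lifting) M mem_Collect_eq rvs_smult)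
      assume "y \<in> ?Z"
      then obtain m' where m': "y = tens m' n0" "m' \<in> carrier (space M)" by auto
      have "x \<oplus>\<^bsub>T\<^esub> y = tens (m \<oplus>\<^bsub>space M\<^esub> m') n0" using m m' n0 by (simp add: tens_add_left)
      then show "x \<oplus>\<^bsub>T\<^esub> y \<in> ?Z" using m m' by (metis (mono_tags, lifting) M mem_Collect_eq rvs_add)
    qed (use n0 in auto)
    have "carrier T \<subseteq> {t \<in> carrier T. f t \<in> ?Z}"
    proof (rule tens_generate[OF lin_preimage[OF T_rvs T_rvs f_lin Z]])
      fix m n assume m: "m \<in> carrier (space M)" and n: "n \<in> carrier (space N)"
      obtain z where "(1 / 2) \<odot>\<^bsub>space N\<^esub> (n \<oplus>\<^bsub>space N\<^esub> e \<odot>\<^bsub>space N\<^esub> N.gam 0 n) = l z n0"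
        using line[OF n] by auto
      then have "f (tens m n) = tens (r z m) n0" using m n n0 by (simp add: f_tens tens_balanced)
      then show "tens m n \<in> {t \<in> carrier T. f t \<in> ?Z}" using m n by auto
    qed
    then have "f w \<in> ?Z" using wc by blast
    then obtain m0 where m0: "f w = tens m0 n0" "m0 \<in> carrier (space M)"
      unfolding mem_Collect_eq by (elim exE conjE) (rule that; assumption)
    have "tens m0 n0 \<noteq> \<zero>\<^bsub>T\<^esub>" using w(2) unfolding m0(1) .
    then have nzs: "m0 \<noteq> \<zero>\<^bsub>space M\<^esub>" "n0 \<noteq> \<zero>\<^bsub>space N\<^esub>"
      using tens_zero(1)[OF n0] tens_zero(2)[OF m0(2)] by metis+
    have m0W: "tens m0 n0 \<in> W" using fw unfolding m0(1) .
    have "{m \<in> carrier (space M). tens m n0 \<in> W} = carrier (space M)"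
      by (rule irrD[OF irrM left_stable[OF W n0] _ nzs(1)]) (use m0(2) m0W in simp)
    then have mn: "tens m n0 \<in> W" if "m \<in> carrier (space M)" for m using that by auto
    have "{n \<in> carrier (space N). tens m n \<in> W} = carrier (space N)" if "m \<in> carrier (space M)" for m
      by (rule irrD[OF irrN right_stable[OF W that] _ nzs(2)]) (use mn that n0 in auto)
    then have "carrier T \<subseteq> W" by (intro tens_generate[OF Ws]) auto
    then show ?thesis using subsp_subset[OF Ws] by auto
  qed simp
qed

end

text \<open>The volume element of the tensor product is the product of the two volume elements, because the
  second one is even.\<close>

lemma graded_rep_tensor:
  assumes "rep_pair p q M N r l" "graded_module q N"
  shows "graded_module (p + q) (rep_tensor p q M r N l)"
proof -
  interpret rep_pair p q M N r l by fact
  interpret gN: graded_module q N by fact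
  have N_parity: "parity N (l z n) = l z (parity N n)" if "n \<in> carrier (space N)" for z n
  proof -
    have "op N.gam w (l z n) = l z (op N.gam w n)" if "set w \<subseteq> {..<q}" for w
      using that \<open>n \<in> _\<close> by (induction w) (auto simp: c_l)
    then show ?thesis using that by (simp add: gN.parity_vol atLeast0LessThan)
  qed
  show ?thesis
  proof unfold_locales
    show "4 dvd p + q" using M.dvd4 gN.dvd4 by simp
    fix t assume t: "t \<in> carrier (space RT)"
    have w: "[0..<p + q] = [0..<p] @ map ((+) p) [0..<q]"
    proof -
      have "map ((+) p) [0..<q] = map (\<lambda>i. i + p) [0..<q]" by (rule map_cong) auto
      then show ?thesis using map_add_upt[of p q] upt_add_eq_append[of 0 p q] by (simp add: add.commute)
    qed
    have "tensor_map (space M) r (space N) l (parity M) (parity N) t = op R.gam [0..<p + q] t"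
    proof (rule tens_lin_eq[OF T_rvs tensor_map_lin GR.vol_lin])
      fix m n assume mn: "m \<in> carrier (space M)" "n \<in> carrier (space N)"
      have "op R.gam (map ((+) p) [0..<q]) (tens m n) = tens m (parity N n)"
        using mn gN.even_p by (subst op_right) (auto simp: gN.parity_vol parity_power)
      then have "op R.gam [0..<p + q] (tens m n) = tens (parity M m) (parity N n)"
        unfolding w foldr_append comp_def using mn by (simp add: op_vol_left)
      then show "tensor_map (space M) r (space N) l (parity M) (parity N) (tens m n) = op R.gam [0..<p + q] (tens m n)"
        using mn by (simp add: tensor_map_tens M.parity_lin gN.parity_lin parity_r N_parity)
    qed (use t in \<open>simp_all add: M.parity_lin gN.parity_lin parity_r N_parity\<close>)
    then show "parity RT t = volume (p + q) RT t"
      by (simp add: rep_tensor_def volume_def foldr_map comp_def)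
  qed
qed

section \<open>Tensor powers of graded Clifford modules\<close>

lemma lin_finsum:
  assumes "rvs V" "rvs V'" "lin V V' f" "\<And>i. i \<in> I \<Longrightarrow> g i \<in> carrier V"
  shows "f (finsum V g I) = finsum V' (\<lambda>i. f (g i)) I"
proof -
  interpret V: Module.module class_ring V by (rule rvs_module[OF assms(1)])
  interpret V': Module.module class_ring V' by (rule rvs_module[OF assms(2)])
  show ?thesis
    using assms(4)
  proof (induction I rule: infinite_finite_induct)
    case (insert i I)
    have "f (finsum V g (insert i I)) = f (g i) \<oplus>\<^bsub>V'\<^esub> f (finsum V g I)"
      using insert assms(1) by (subst V.M.finsum_insert) (auto simp: lin_add[OF assms(3)])
    also have "\<dots> = finsum V' (\<lambda>i. f (g i)) (insert i I)"
      using insert assms(2) by (subst V'.M.finsum_insert) (auto simp: lin_closed[OF assms(3)])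
    finally show ?case .
  qed (use lin_zero[OF assms(1-3)] in auto)
qed

lemma finsum_lin:
  assumes "rvs V'" "\<And>i. i \<in> I \<Longrightarrow> lin V V' (f i)"
  shows "lin V V' (\<lambda>t. finsum V' (\<lambda>i. f i t) I)"
  unfolding lin_def
proof (intro conjI ballI allI)
  fix x y a assume x: "x \<in> carrier V"
  have fx: "f i x \<in> carrier V'" if "i \<in> I" for i by (rule lin_closed[OF assms(2)[OF that] x])
  show c: "finsum V' (\<lambda>i. f i x) I \<in> carrier V'" by (rule rvs_finsum[OF assms(1) fx])
  have s: "finsum V' (\<lambda>i. f i (a \<odot>\<^bsub>V\<^esub> x)) I = finsum V' (\<lambda>i. a \<odot>\<^bsub>V'\<^esub> f i x) I"
    by (rule abelian_monoid.finsum_cong'[OF abelian_group.axioms(1)[OF rvs_abelian_group[OF assms(1)]]])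
       (use fx x assms(1) in \<open>auto simp: lin_smult[OF assms(2)]\<close>)
  show "finsum V' (\<lambda>i. f i (a \<odot>\<^bsub>V\<^esub> x)) I = a \<odot>\<^bsub>V'\<^esub> finsum V' (\<lambda>i. f i x) I"
    unfolding s
    by (rule crd_eqI[OF assms(1)]) (simp_all add: assms(1) fx sum_distrib_left)
  assume y: "y \<in> carrier V"
  have fy: "f i y \<in> carrier V'" if "i \<in> I" for i by (rule lin_closed[OF assms(2)[OF that] y])
  have s: "finsum V' (\<lambda>i. f i (x \<oplus>\<^bsub>V\<^esub> y)) I = finsum V' (\<lambda>i. f i x \<oplus>\<^bsub>V'\<^esub> f i y) I"
    by (rule abelian_monoid.finsum_cong'[OF abelian_group.axioms(1)[OF rvs_abelian_group[OF assms(1)]]])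
       (use fx fy x y assms(1) in \<open>auto simp: lin_add[OF assms(2)]\<close>)
  show "finsum V' (\<lambda>i. f i (x \<oplus>\<^bsub>V\<^esub> y)) I = finsum V' (\<lambda>i. f i x) I \<oplus>\<^bsub>V'\<^esub> finsum V' (\<lambda>i. f i y) I"
    unfolding s
    by (rule crd_eqI[OF assms(1)]) (simp_all add: assms(1) fx fy sum.distrib)
qed

locale rep_pow = M: graded_module p M + tensor_pow k "space M"
  for p k and M :: "'a graded_rep"
begin

abbreviation "RP \<equiv> rep_power p k M"

definition blk :: "real vec \<Rightarrow> nat \<Rightarrow> real vec" where
  "blk u j = vec p (\<lambda>m. u $ (p * j + m))"

definition act :: "nat \<Rightarrow> real vec \<Rightarrow> ('a list \<Rightarrow> real) set \<Rightarrow> ('a list \<Rightarrow> real) set" where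
  "act j u = tensor_power_map k (space M)
    (\<lambda>i. if i < j then parity M else if i = j then cmap M u else id)"

text \<open>The sign that an odd operator in position \<open>j\<close> picks up from the factors to its left.\<close>

definition flip :: "nat \<Rightarrow> 'a list \<Rightarrow> 'a list" where
  "flip j xs = map (\<lambda>i. if i < j then parity M (xs ! i) else xs ! i) [0..<k]"

lemma space_RP [simp]: "space RP = T"
  by (simp add: rep_power_def)

lemma cmap_RP: "cmap RP u t = (\<Oplus>\<^bsub>T\<^esub>j\<in>{..<k}. act j (blk u j) t)"
  by (simp add: rep_power_def act_def blk_def)

lemma blk_carrier [simp]: "blk u j \<in> carrier_vec p"
  by (simp add: blk_def)

lemma flip_nth [simp]: "i < k \<Longrightarrow> flip j xs ! i = (if i < j then parity M (xs ! i) else xs ! i)"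
  by (simp add: flip_def)

lemma length_flip [simp]: "length (flip j xs) = k"
  by (simp add: flip_def)

lemma tuples_length: "xs \<in> tuples \<Longrightarrow> length xs = k"
  by (simp add: tuples_def)

lemma tuplesI: "length xs = k \<Longrightarrow> (\<And>i. i < k \<Longrightarrow> xs ! i \<in> carrier (space M)) \<Longrightarrow> xs \<in> tuples"
  by (auto simp: tuples_def in_set_conv_nth)

lemma flip_tuples: "xs \<in> tuples \<Longrightarrow> flip j xs \<in> tuples"
  by (rule tuplesI) (auto simp: tuples_nth)

lemma act_lin: "u \<in> carrier_vec p \<Longrightarrow> lin T T (act j u)"
  unfolding act_def by (rule tensor_power_map_lin) (auto simp: M.parity_lin M.c_lin)

lemma act_closed [simp]: "u \<in> carrier_vec p \<Longrightarrow> t \<in> carrier T \<Longrightarrow> act j u t \<in> carrier T"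
  by (rule lin_closed[OF act_lin])

lemma act_tpow:
  assumes "u \<in> carrier_vec p" "xs \<in> tuples" "j < k"
  shows "act j u (tpow xs) = tpow ((flip j xs)[j := cmap M u (xs ! j)])"
proof -
  have "act j u (tpow xs) = tpow (pmap (\<lambda>i. if i < j then parity M else if i = j then cmap M u else id) xs)"
    unfolding act_def
    by (rule tensor_power_map_tpow) (use assms in \<open>auto simp: M.parity_lin M.c_lin\<close>)
  also have "pmap (\<lambda>i. if i < j then parity M else if i = j then cmap M u else id) xs
      = (flip j xs)[j := cmap M u (xs ! j)]"
    by (rule nth_equalityI) (auto simp: nth_list_update assms(3))
  finally show ?thesis .
qed

lemma cmap_RP_lin: "lin T T (cmap RP u)"
  unfolding cmap_RP by (rule finsum_lin[OF T_rvs act_lin]) simp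

lemma act_add:
  assumes "u \<in> carrier_vec p" "v \<in> carrier_vec p" "j < k" "t \<in> carrier T"
  shows "act j (u + v) t = act j u t \<oplus>\<^bsub>T\<^esub> act j v t"
proof (rule tpow_lin_eq[OF T_rvs act_lin lin_oplus[OF T_rvs act_lin act_lin] _ assms(4)])
  fix xs assume xs: "xs \<in> tuples"
  then show "act j (u + v) (tpow xs) = act j u (tpow xs) \<oplus>\<^bsub>T\<^esub> act j v (tpow xs)"
    using assms tuples_nth[OF xs assms(3)] by (simp add: act_tpow M.c_add tpow_add flip_tuples)
qed (use assms in auto)

lemma act_smult:
  assumes "u \<in> carrier_vec p" "j < k" "t \<in> carrier T"
  shows "act j (a \<cdot>\<^sub>v u) t = a \<odot>\<^bsub>T\<^esub> act j u t"
proof (rule tpow_lin_eq[OF T_rvs act_lin lin_scale[OF T_rvs act_lin] _ assms(3)])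
  fix xs assume xs: "xs \<in> tuples"
  then show "act j (a \<cdot>\<^sub>v u) (tpow xs) = a \<odot>\<^bsub>T\<^esub> act j u (tpow xs)"
    using assms tuples_nth[OF xs assms(2)] by (simp add: act_tpow M.c_smult tpow_smult flip_tuples)
qed (use assms in auto)

lemma act_clifford:
  assumes u: "u \<in> carrier_vec p" and v: "v \<in> carrier_vec p" and j: "j < k" and t: "t \<in> carrier T"
  shows "act j u (act j v t) \<oplus>\<^bsub>T\<^esub> act j v (act j u t) = (- 2 * cform u v) \<odot>\<^bsub>T\<^esub> t"
proof (rule tpow_lin_eq[OF T_rvs _ _ _ t])
  show "lin T T (\<lambda>t. act j u (act j v t) \<oplus>\<^bsub>T\<^esub> act j v (act j u t))"
    using lin_comp[OF act_lin[OF u] act_lin[OF v]] lin_comp[OF act_lin[OF v] act_lin[OF u]]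
    by (intro lin_oplus T_rvs) (simp_all add: comp_def)
  show "lin T T (\<lambda>t. (- 2 * cform u v) \<odot>\<^bsub>T\<^esub> t)" by (intro lin_scale T_rvs lin_id)
  fix xs assume xs: "xs \<in> tuples"
  have xj: "xs ! j \<in> carrier (space M)" by (rule tuples_nth[OF xs j])
  have a: "act j u (act j v (tpow xs)) = tpow (xs[j := cmap M u (cmap M v (xs ! j))])"
    if u: "u \<in> carrier_vec p" and v: "v \<in> carrier_vec p" for u v
  proof -
    let ?ys = "(flip j xs)[j := cmap M v (xs ! j)]"
    have ys: "?ys \<in> tuples" using xs xj v by (simp add: tuples_update flip_tuples)
    have "(flip j ?ys)[j := cmap M u (?ys ! j)] = xs[j := cmap M u (cmap M v (xs ! j))]"
      by (rule nth_equalityI)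
         (use xs j tuples_nth[OF xs] in \<open>auto simp: nth_list_update tuples_length\<close>)
    then show ?thesis using act_tpow[OF v xs j] act_tpow[OF u ys j] by simp
  qed
  have "act j u (act j v (tpow xs)) \<oplus>\<^bsub>T\<^esub> act j v (act j u (tpow xs)) =
      tpow (xs[j := cmap M u (cmap M v (xs ! j)) \<oplus>\<^bsub>space M\<^esub> cmap M v (cmap M u (xs ! j))])"
    using a[OF u v] a[OF v u] tpow_add[OF xs j] xj u v by simp
  also have "\<dots> = (- 2 * cform u v) \<odot>\<^bsub>T\<^esub> tpow (xs[j := xs ! j])"
    unfolding M.c_clifford[OF u v xj] by (rule tpow_smult[OF xs j xj])
  finally show "act j u (act j v (tpow xs)) \<oplus>\<^bsub>T\<^esub> act j v (act j u (tpow xs)) = (- 2 * cform u v) \<odot>\<^bsub>T\<^esub> tpow xs"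
    by simp
qed

lemma act_anticommute_less:
  assumes u: "u \<in> carrier_vec p" and v: "v \<in> carrier_vec p" and j: "j < j'" "j' < k" and t: "t \<in> carrier T"
  shows "act j u (act j' v t) = (-1) \<odot>\<^bsub>T\<^esub> act j' v (act j u t)"
proof (rule tpow_lin_eq[OF T_rvs _ _ _ t])
  show "lin T T (\<lambda>t. act j u (act j' v t))"
    using lin_comp[OF act_lin[OF v] act_lin[OF u]] by (simp add: comp_def)
  show "lin T T (\<lambda>t. (-1) \<odot>\<^bsub>T\<^esub> act j' v (act j u t))"
    using lin_comp[OF act_lin[OF u] act_lin[OF v]] by (intro lin_scale T_rvs) (simp add: comp_def)
  fix xs assume xs: "xs \<in> tuples"
  have jk: "j < k" using j by simp
  have xj: "xs ! j \<in> carrier (space M)" "xs ! j' \<in> carrier (space M)"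
    using tuples_nth[OF xs] j by auto
  let ?ys = "(flip j' xs)[j' := cmap M v (xs ! j')]" and ?zs = "(flip j xs)[j := cmap M u (xs ! j)]"
  have ys: "?ys \<in> tuples" and zs: "?zs \<in> tuples"
    using xs xj u v by (simp_all add: tuples_update flip_tuples)
  let ?l = "(flip j' ?zs)[j' := cmap M v (xs ! j')]"
  have l: "?l \<in> tuples" using zs xj v by (simp add: tuples_update flip_tuples)
  have l': "?l[j := parity M (cmap M u (xs ! j))] = ?l"
    by (rule nth_equalityI) (use j in \<open>auto simp: nth_list_update\<close>)
  have "(flip j ?ys)[j := cmap M u (?ys ! j)] = ?l[j := cmap M u (parity M (xs ! j))]"
    by (rule nth_equalityI)
       (use xs j tuples_nth[OF xs] in \<open>auto simp: nth_list_update tuples_length\<close>)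
  then have "act j u (act j' v (tpow xs)) = tpow (?l[j := cmap M u (parity M (xs ! j))])"
    using act_tpow[OF v xs j(2)] act_tpow[OF u ys jk] by simp
  also have "\<dots> = (-1) \<odot>\<^bsub>T\<^esub> tpow (?l[j := parity M (cmap M u (xs ! j))])"
    unfolding M.c_parity[OF u xj(1)] by (rule tpow_smult[OF l jk]) (use u xj in simp)
  also have "tpow (?l[j := parity M (cmap M u (xs ! j))]) = act j' v (act j u (tpow xs))"
    unfolding l' using act_tpow[OF u xs jk] act_tpow[OF v zs j(2)] j by simp
  finally show "act j u (act j' v (tpow xs)) = (-1) \<odot>\<^bsub>T\<^esub> act j' v (act j u (tpow xs))" .
qed

lemma act_anticommute:
  assumes u: "u \<in> carrier_vec p" and v: "v \<in> carrier_vec p" and j: "j < k" "j' < k" "j \<noteq> j'"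
    and t: "t \<in> carrier T"
  shows "crd T (act j u (act j' v t)) b + crd T (act j' v (act j u t)) b = 0"
proof (cases "j < j'")
  case True
  show ?thesis unfolding act_anticommute_less[OF u v True j(2) t] using u v t by simp
next
  case False
  then have "j' < j" using j by simp
  show ?thesis unfolding act_anticommute_less[OF v u \<open>j' < j\<close> j(1) t] using u v t by simp
qed

lemma cform_blk:
  assumes "u \<in> carrier_vec (p * k)" "v \<in> carrier_vec (p * k)"
  shows "cform u v = (\<Sum>j<k. cform (blk u j) (blk v j))"
proof -
  have "u \<bullet> v = (\<Sum>i<k * p. u $ i * v $ i)"
    using assms by (simp add: scalar_prod_def atLeast0LessThan mult.commute)
  also have "\<dots> = (\<Sum>j<k. \<Sum>i\<in>{j * p..<j * p + p}. u $ i * v $ i)"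
    by (rule sum.nat_group[symmetric])
  also have "\<dots> = (\<Sum>j<k. blk u j \<bullet> blk v j)"
  proof (rule sum.cong)
    fix j
    have "(\<Sum>i\<in>{j * p..<j * p + p}. u $ i * v $ i) = (\<Sum>i\<in>{0..<p}. u $ (j * p + i) * v $ (j * p + i))"
      using sum.shift_bounds_nat_ivl[of "\<lambda>i. u $ i * v $ i" 0 "j * p" p] by (simp add: add.commute)
    then show "(\<Sum>i\<in>{j * p..<j * p + p}. u $ i * v $ i) = blk u j \<bullet> blk v j"
      by (simp add: scalar_prod_def blk_def mult.commute)
  qed simp
  finally show ?thesis by (simp add: cform_def sum_negf)
qed

lemma blk_linear:
  assumes "u \<in> carrier_vec (p * k)" "v \<in> carrier_vec (p * k)" "j < k"
  shows "blk (u + v) j = blk u j + blk v j" "blk (a \<cdot>\<^sub>v u) j = a \<cdot>\<^sub>v blk u j"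
proof -
  have "p * j + i < p * k" if "i < p" for i
  proof -
    have "p * j + i < p * j + p" using that by simp
    also have "\<dots> = p * Suc j" by simp
    also have "\<dots> \<le> p * k" using assms(3) by (intro mult_le_mono2) simp
    finally show ?thesis .
  qed
  then show "blk (u + v) j = blk u j + blk v j" "blk (a \<cdot>\<^sub>v u) j = a \<cdot>\<^sub>v blk u j"
    using assms by (auto simp: blk_def)
qed

lemma cmap_RP_crd:
  assumes "t \<in> carrier T"
  shows "crd T (cmap RP u (cmap RP v t)) b =
    (\<Sum>j<k. \<Sum>j'<k. crd T (act j (blk u j) (act j' (blk v j') t)) b)"
proof -
  have c: "cmap RP v t \<in> carrier T" by (rule lin_closed[OF cmap_RP_lin assms])
  have "crd T (cmap RP u (cmap RP v t)) b = (\<Sum>j<k. crd T (act j (blk u j) (cmap RP v t)) b)"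
    unfolding cmap_RP[of u] by (rule crd_finsum[OF T_rvs]) (use c in simp)
  also have "\<dots> = (\<Sum>j<k. \<Sum>j'<k. crd T (act j (blk u j) (act j' (blk v j') t)) b)"
  proof (rule sum.cong)
    fix j
    have "act j (blk u j) (cmap RP v t) = (\<Oplus>\<^bsub>T\<^esub>j'\<in>{..<k}. act j (blk u j) (act j' (blk v j') t))"
      unfolding cmap_RP by (rule lin_finsum[OF T_rvs T_rvs act_lin]) (use assms in simp_all)
    then show "crd T (act j (blk u j) (cmap RP v t)) b = (\<Sum>j'<k. crd T (act j (blk u j) (act j' (blk v j') t)) b)"
      using assms by simp
  qed simp
  finally show ?thesis .
qed

lemma clifford_RP: "clifford_map (p * k) RP"
  unfolding clifford_map_def clifford_condition_def space_RP
proof (intro conjI ballI allI)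
  fix v w :: "real vec" and t and a :: real assume v: "v \<in> carrier_vec (p * k)"
  show "linear_map class_ring T T (cmap RP v)"
    by (simp add: linear_map_iff_lin cmap_RP_lin)
  assume t: "t \<in> carrier T"
  have c: "cmap RP u s \<in> carrier T" if "s \<in> carrier T" for u s by (rule lin_closed[OF cmap_RP_lin that])
  have cc: "crd T (cmap RP u t) b = (\<Sum>j<k. crd T (act j (blk u j) t) b)" for u b
    unfolding cmap_RP by (rule crd_finsum[OF T_rvs]) (use t in simp)
  show "cmap RP (a \<cdot>\<^sub>v v) t = a \<odot>\<^bsub>T\<^esub> cmap RP v t"
  proof (rule crd_eqI[OF T_rvs])
    show "crd T (cmap RP (a \<cdot>\<^sub>v v) t) b = crd T (a \<odot>\<^bsub>T\<^esub> cmap RP v t) b" for b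
      using t c[OF t] by (simp add: cc sum_distrib_left blk_linear[OF v v] act_smult)
  qed (use t c in auto)
  assume w: "w \<in> carrier_vec (p * k)"
  show "cmap RP (v + w) t = cmap RP v t \<oplus>\<^bsub>T\<^esub> cmap RP w t"
  proof (rule crd_eqI[OF T_rvs])
    show "crd T (cmap RP (v + w) t) b = crd T (cmap RP v t \<oplus>\<^bsub>T\<^esub> cmap RP w t) b" for b
      using t c[OF t] by (simp add: cc sum.distrib blk_linear[OF v w] act_add)
  qed (use t c in auto)
  show "cmap RP v (cmap RP w t) \<oplus>\<^bsub>T\<^esub> cmap RP w (cmap RP v t) = (- 2 * cform v w) \<odot>\<^bsub>T\<^esub> t"
  proof (rule crd_eqI[OF T_rvs])
    fix b
    let ?a = "\<lambda>j j'. crd T (act j (blk v j) (act j' (blk w j') t)) b"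
    let ?b = "\<lambda>j j'. crd T (act j (blk w j) (act j' (blk v j') t)) b"
    have ab: "?a j j' + ?b j' j = (if j = j' then (- 2 * cform (blk v j) (blk w j)) * crd T t b else 0)"
      if "j < k" "j' < k" for j j'
    proof (cases "j = j'")
      case True
      show ?thesis
        using arg_cong[OF act_clifford[of "blk v j" "blk w j" j t], of "\<lambda>t. crd T t b"] that t True
        by simp
    next
      case False
      then show ?thesis using act_anticommute[of "blk v j" "blk w j'" j j' t b] that t by simp
    qed
    have "crd T (cmap RP v (cmap RP w t) \<oplus>\<^bsub>T\<^esub> cmap RP w (cmap RP v t)) b =
        (\<Sum>j<k. \<Sum>j'<k. ?a j j') + (\<Sum>j<k. \<Sum>j'<k. ?b j j')"
      using t c by (simp add: cmap_RP_crd)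
    also have "(\<Sum>j<k. \<Sum>j'<k. ?b j j') = (\<Sum>j<k. \<Sum>j'<k. ?b j' j)"
      by (rule sum.swap)
    also have "(\<Sum>j<k. \<Sum>j'<k. ?a j j') + (\<Sum>j<k. \<Sum>j'<k. ?b j' j) =
        (\<Sum>j<k. \<Sum>j'<k. ?a j j' + ?b j' j)"
      by (simp add: sum.distrib)
    also have "\<dots> = (\<Sum>j<k. \<Sum>j'<k. if j = j' then (- 2 * cform (blk v j) (blk w j)) * crd T t b else 0)"
      by (intro sum.cong) (auto simp: ab)
    also have "\<dots> = (- 2 * cform v w) * crd T t b"
      unfolding cform_blk[OF v w] by (simp add: sum_distrib_left sum_distrib_right sum_negf)
    also have "\<dots> = crd T ((- 2 * cform v w) \<odot>\<^bsub>T\<^esub> t) b"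
      using t by simp
    finally show "crd T (cmap RP v (cmap RP w t) \<oplus>\<^bsub>T\<^esub> cmap RP w (cmap RP v t)) b = \<dots>" .
  qed (use t c in auto)
qed simp_all

sublocale R: clifford_module "p * k" RP
  by unfold_locales (rule clifford_RP)

sublocale GR: gamma_system "p * k" T R.gam
  using R.gamma_system by simp

lemma act_zero: "j < k \<Longrightarrow> t \<in> carrier T \<Longrightarrow> act j (0\<^sub>v p) t = \<zero>\<^bsub>T\<^esub>"
proof -
  assume "j < k" "t \<in> carrier T"
  then have "act j (0 \<cdot>\<^sub>v 0\<^sub>v p) t = 0 \<odot>\<^bsub>T\<^esub> act j (0\<^sub>v p) t" by (intro act_smult) auto
  moreover have "0 \<cdot>\<^sub>v (0\<^sub>v p :: real vec) = 0\<^sub>v p" by auto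
  ultimately show ?thesis using \<open>t \<in> carrier T\<close> by simp
qed

lemma gam_block:
  assumes "j < k" "i < p" "t \<in> carrier T"
  shows "R.gam (p * j + i) t = act j (unit_vec p i) t"
proof -
  have b: "blk (unit_vec (p * k) (p * j + i)) j' = (if j' = j then unit_vec p i else 0\<^sub>v p)" if "j' < k" for j'
  proof (rule eq_vecI)
    fix m assume m: "m < dim_vec (if j' = j then unit_vec p i else 0\<^sub>v p :: real vec)"
    then have m: "m < p" by (simp split: if_splits)
    have "p * j' + m < p * k"
    proof -
      have "p * j' + m < p * Suc j'" using m by simp
      also have "\<dots> \<le> p * k" using that by (intro mult_le_mono2) simp
      finally show ?thesis .
    qed
    moreover have "p * j' + m = p * j + i \<longleftrightarrow> j' = j \<and> m = i"
    proof
      assume eq: "p * j' + m = p * j + i"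
      have "(p * j' + m) div p = j'" "(p * j + i) div p = j" using m assms by auto
      then have "j' = j" using eq by simp
      then show "j' = j \<and> m = i" using eq by simp
    qed simp
    ultimately show "blk (unit_vec (p * k) (p * j + i)) j' $ m = (if j' = j then unit_vec p i else 0\<^sub>v p) $ m"
      using m by (auto simp: blk_def unit_vec_def)
  qed (auto simp: blk_def)
  show ?thesis
  proof (rule crd_eqI[OF T_rvs])
    fix x
    have "crd T (cmap RP (unit_vec (p * k) (p * j + i)) t) x =
        (\<Sum>j'<k. crd T (act j' (blk (unit_vec (p * k) (p * j + i)) j') t) x)"
      unfolding cmap_RP by (rule crd_finsum[OF T_rvs]) (use assms in simp)
    also have "\<dots> = (\<Sum>j'<k. if j' = j then crd T (act j (unit_vec p i) t) x else 0)"
      by (rule sum.cong) (auto simp: b act_zero assms(3))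
    also have "\<dots> = crd T (act j (unit_vec p i) t) x" using assms(1) by simp
    finally show "crd T (R.gam (p * j + i) t) x = \<dots>" .
  qed (use assms lin_closed[OF cmap_RP_lin] in simp_all)
qed

lemma op_block:
  assumes "j < k" "set w \<subseteq> {..<p}" "xs \<in> tuples"
  shows "op R.gam (map ((+) (p * j)) w) (tpow xs) =
    tpow ((if even (length w) then xs else flip j xs)[j := op M.gam w (xs ! j)])"
  using assms(2)
proof (induction w)
  case (Cons i w)
  let ?ys = "(if even (length w) then xs else flip j xs)[j := op M.gam w (xs ! j)]"
  have xj: "xs ! j \<in> carrier (space M)" by (rule tuples_nth[OF assms(3,1)])
  have c: "op M.gam w (xs ! j) \<in> carrier (space M)" using Cons.prems xj by simp
  have ys: "?ys \<in> tuples" using assms(3) c by (auto intro!: tuples_update flip_tuples)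
  have "op R.gam (map ((+) (p * j)) (i # w)) (tpow xs) = act j (unit_vec p i) (tpow ?ys)"
    using Cons gam_block[OF assms(1), of i "tpow ?ys"] ys by simp
  also have "\<dots> = tpow ((flip j ?ys)[j := M.gam i (?ys ! j)])"
    using act_tpow[OF _ ys assms(1)] by simp
  also have "(flip j ?ys)[j := M.gam i (?ys ! j)] =
      (if even (length (i # w)) then xs else flip j xs)[j := op M.gam (i # w) (xs ! j)]"
    by (rule nth_equalityI)
       (use assms tuples_nth[OF assms(3)] in \<open>auto simp: nth_list_update tuples_length\<close>)
  finally show ?case .
qed (use assms in simp)

lemma op_volume: "j \<le> k \<Longrightarrow> xs \<in> tuples \<Longrightarrow> op R.gam [0..<p * j] (tpow xs) = tpow (flip j xs)"
proof (induction j arbitrary: xs)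
  case 0
  have "flip 0 xs = xs" using 0 by (auto simp: flip_def tuples_length intro: nth_equalityI)
  then show ?case by simp
next
  case (Suc j)
  have w: "[0..<p * Suc j] = [0..<p * j] @ map ((+) (p * j)) [0..<p]"
  proof -
    have "map ((+) (p * j)) [0..<p] = map (\<lambda>i. i + p * j) [0..<p]" by (rule map_cong) auto
    then show ?thesis
      using map_add_upt[of "p * j" p] upt_add_eq_append[of 0 "p * j" p] by (simp add: add.commute)
  qed
  have xj: "xs ! j \<in> carrier (space M)" using tuples_nth[OF Suc.prems(2)] Suc.prems(1) by simp
  have "op R.gam (map ((+) (p * j)) [0..<p]) (tpow xs) = tpow (xs[j := parity M (xs ! j)])"
    using Suc.prems M.even_p xj by (subst op_block) (auto simp: M.parity_vol)
  moreover have "xs[j := parity M (xs ! j)] \<in> tuples"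
    using Suc.prems xj by (intro tuples_update) auto
  ultimately have "op R.gam [0..<p * Suc j] (tpow xs) = tpow (flip j (xs[j := parity M (xs ! j)]))"
    unfolding w foldr_append comp_def using Suc by simp
  also have "flip j (xs[j := parity M (xs ! j)]) = flip (Suc j) xs"
    by (rule nth_equalityI) (use Suc.prems in \<open>auto simp: nth_list_update tuples_length less_Suc_eq\<close>)
  finally show ?case .
qed

lemma graded_RP: "graded_module (p * k) RP"
proof unfold_locales
  show "4 dvd p * k" using M.dvd4 by simp
  fix t assume t: "t \<in> carrier (space RP)"
  have "tensor_power_map k (space M) (\<lambda>_. parity M) t = op R.gam [0..<p * k] t"
  proof (rule tpow_lin_eq[OF T_rvs tensor_power_map_lin GR.vol_lin])
    fix xs assume xs: "xs \<in> tuples"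
    have "tensor_power_map k (space M) (\<lambda>_. parity M) (tpow xs) = tpow (pmap (\<lambda>_. parity M) xs)"
      by (rule tensor_power_map_tpow[OF _ xs]) (rule M.parity_lin)
    also have "pmap (\<lambda>_. parity M) xs = flip k xs" by (simp add: flip_def)
    finally show "tensor_power_map k (space M) (\<lambda>_. parity M) (tpow xs) = op R.gam [0..<p * k] (tpow xs)"
      using op_volume[OF _ xs] by simp
  qed (use t in \<open>simp_all add: M.parity_lin\<close>)
  then show "parity RP t = volume (p * k) RP t"
    by (simp add: rep_power_def volume_def foldr_map comp_def)
qed

text \<open>The \<open>k\<close>-th power of a minimal vector \<open>y\<close> of \<open>M\<close> is minimal, since a code word lies in
  one block and acts on the corresponding factor alone. It generates: by irreducibility of \<open>M\<close> the
  entries \<open>y\<close> can be replaced by arbitrary vectors, one position after the other.\<close>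

lemma irr_power:
  assumes p: "p = 8" and irrM: "irr p (space M) M.gam"
  shows "irr (p * k) T R.gam"
proof -
  obtain s where "s \<in> carrier (space M)" "s \<noteq> \<zero>\<^bsub>space M\<^esub>" using irr_nonzero[OF irrM V] .
  then have "\<exists>y\<in>carrier (space M). y \<noteq> \<zero>\<^bsub>space M\<^esub> \<and> (\<forall>u\<in>set (code 1). op M.gam u y = y)"
    using p by (intro M.G.code_fixed_exists[OF _ M.G.stable_carrier]) auto
  then obtain y where y: "y \<in> carrier (space M)" "y \<noteq> \<zero>\<^bsub>space M\<^esub>" "\<forall>u\<in>set (code 1). op M.gam u y = y"
    by blast
  let ?z = "replicate k y"
  have z: "?z \<in> tuples" using y by (auto simp: tuples_def)
  obtain b where b: "crd (space M) y b \<noteq> 0" using nonzero_functional[OF V y(1,2)] .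
  have zn: "tpow ?z \<noteq> \<zero>\<^bsub>T\<^esub>"
    by (rule tpow_nonzero[of "\<lambda>x. crd (space M) x b"]) (use z b in auto)
  have fixed: "op R.gam u (tpow ?z) = tpow ?z" if u0: "u \<in> set (code k)" for u
  proof -
    obtain j u' where u: "j < k" "u' \<in> set hamming" "u = shift j u'" using u0 by (auto simp: set_code)
    have "shift 0 u' = u'" by (simp add: shift_def map_idI)
    then have c: "u' \<in> set (code 1)" using u(2) by (force simp: set_code)
    have "length u' = 4" "set u' \<subseteq> {..<8}" using code_words[OF c] by auto
    then have "op R.gam (map ((+) (p * j)) u') (tpow ?z) = tpow (?z[j := op M.gam u' (?z ! j)])"
      using op_block[OF u(1) _ z, of u'] p by simp
    also have "op M.gam u' (?z ! j) = ?z ! j" using y(3) c u(1) by simp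
    also have "?z[j := ?z ! j] = ?z" by simp
    finally show ?thesis using u p by (simp add: shift_def)
  qed
  define W where "W = GR.cyc (tpow ?z)"
  have W: "stable (p * k) T R.gam W" unfolding W_def by (rule GR.cyc_stable) (use z in simp)
  then have Ws: "subsp W T" by (simp add: stable_def)
  have zW: "tpow ?z \<in> W" unfolding W_def by (rule GR.cyc_self)
  \<comment> \<open>Tensors whose entries from position \<open>j\<close> on are \<open>y\<close>, by induction on \<open>j\<close>.\<close>
  have all: "tpow xs \<in> W" if "j \<le> k" "xs \<in> tuples" "\<forall>i<k. j \<le> i \<longrightarrow> xs ! i = y" for j xs
    using that
  proof (induction j arbitrary: xs)
    case 0
    then have "xs = ?z" by (auto simp: tuples_length intro: nth_equalityI)
    then show ?case using zW by simp
  next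
    case (Suc j)
    have j: "j < k" using Suc.prems by simp
    let ?A = "{x \<in> carrier (space M). \<forall>ys. ys \<in> tuples \<and> (\<forall>i<k. j \<le> i \<longrightarrow> ys ! i = y) \<longrightarrow> tpow (ys[j := x]) \<in> W}"
    have "stable p (space M) M.gam ?A"
      unfolding stable_def
    proof (intro conjI allI impI ballI)
      have "subsp {x \<in> carrier (space M). tpow (ys[j := x]) \<in> W} (space M)" if "ys \<in> tuples" for ys
        by (rule lin_preimage[OF V T_rvs tpow_lin[OF that j] Ws])
      then show "subsp ?A (space M)" by (auto simp: subsp_def)
      fix i x assume i: "i < p" and x: "x \<in> ?A"
      have xc: "x \<in> carrier (space M)" using x by simp
      have "tpow (ys[j := M.gam i x]) \<in> W" if ys: "ys \<in> tuples" "\<forall>i<k. j \<le> i \<longrightarrow> ys ! i = y" for ys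
      proof -
        \<comment> \<open>The generator introduces the signs of \<open>flip j\<close>; starting from a tensor that has them
          already, they cancel.\<close>
        let ?ys = "(flip j ys)[j := x]"
        have "flip j ys \<in> tuples" "\<forall>i<k. j \<le> i \<longrightarrow> flip j ys ! i = y"
          using ys by (auto simp: flip_tuples)
        then have yW: "tpow ?ys \<in> W" using x by blast
        have yt: "?ys \<in> tuples" using ys xc by (intro tuples_update flip_tuples)
        have "p * j + i < p * k"
        proof -
          have "p * j + i < p * Suc j" using i by simp
          also have "\<dots> \<le> p * k" using j by (intro mult_le_mono2) simp
          finally show ?thesis .
        qed
        then have "R.gam (p * j + i) (tpow ?ys) \<in> W" using W yW by (simp add: stable_def)
        also have "R.gam (p * j + i) (tpow ?ys) = tpow ((flip j ?ys)[j := M.gam i (?ys ! j)])"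
          using gam_block[OF j i] act_tpow[OF _ yt j] yt by simp
        also have "(flip j ?ys)[j := M.gam i (?ys ! j)] = ys[j := M.gam i x]"
          by (rule nth_equalityI)
             (use ys j tuples_nth[OF ys(1)] in \<open>auto simp: nth_list_update tuples_length\<close>)
        finally show ?thesis .
      qed
      then show "M.gam i x \<in> ?A" using xc i by simp
    qed
    moreover have "y \<in> ?A"
    proof -
      have "tpow (ys[j := y]) \<in> W" if ys: "ys \<in> tuples" "\<forall>i<k. j \<le> i \<longrightarrow> ys ! i = y" for ys
      proof -
        have "ys[j := y] = ys" using ys(2) j by (metis list_update_id order_refl)
        then show ?thesis using Suc.IH[of ys] ys j by simp
      qed
      then show ?thesis using y by simp
    qed
    ultimately have A: "?A = carrier (space M)" by (rule irrD[OF irrM _ _ y(2)])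
    have "xs ! j \<in> ?A" unfolding A by (rule tuples_nth[OF Suc.prems(2) j])
    moreover have "xs[j := y] \<in> tuples" "\<forall>i<k. j \<le> i \<longrightarrow> xs[j := y] ! i = y"
      using Suc.prems y j by (auto simp: tuples_update nth_list_update tuples_length)
    ultimately have "tpow (xs[j := y, j := xs ! j]) \<in> W" by blast
    then show ?case by simp
  qed
  have "carrier T \<subseteq> W"
    by (rule tpow_generate[OF Ws]) (rule all[of k]; simp)
  then have "GR.cyc (tpow ?z) = carrier T" using subsp_subset[OF Ws] by (auto simp: W_def)
  then show ?thesis
    using p z zn fixed by (intro GR.cyclic_minimal_irr[of k "tpow ?z"]) auto
qed

end

section \<open>Quaternion-valued functionals\<close>

lemma quat_sel [simp]:
  "qRe 0 = 0" "qI 0 = 0" "qJ 0 = 0" "qK 0 = 0"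
  "qRe 1 = 1" "qI 1 = 0" "qJ 1 = 0" "qK 1 = 0"
  "qRe (p + q) = qRe p + qRe q" "qI (p + q) = qI p + qI q"
  "qJ (p + q) = qJ p + qJ q" "qK (p + q) = qK p + qK q"
  "qRe (a *\<^sub>R p) = a * qRe p" "qI (a *\<^sub>R p) = a * qI p"
  "qJ (a *\<^sub>R p) = a * qJ p" "qK (a *\<^sub>R p) = a * qK p"
  by (simp_all add: zero_quat_def one_quat_def plus_quat_def scaleR_quat_def)

lemma quat_mult_sel [simp]:
  "qRe (p * q) = qRe p * qRe q - qI p * qI q - qJ p * qJ q - qK p * qK q"
  "qI (p * q) = qRe p * qI q + qI p * qRe q + qJ p * qK q - qK p * qJ q"
  "qJ (p * q) = qRe p * qJ q - qI p * qK q + qJ p * qRe q + qK p * qI q"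
  "qK (p * q) = qRe p * qK q + qI p * qJ q - qJ p * qI q + qK p * qRe q"
  by (simp_all add: times_quat_def)

lemma quat_eqI: "qRe p = qRe q \<Longrightarrow> qI p = qI q \<Longrightarrow> qJ p = qJ q \<Longrightarrow> qK p = qK q \<Longrightarrow> p = q"
  by (rule quat.expand) simp

definition qcnj :: "quat \<Rightarrow> quat" where
  "qcnj q = Quat (qRe q) (- qI q) (- qJ q) (- qK q)"

lemma qcnj_sel [simp]:
  "qRe (qcnj q) = qRe q" "qI (qcnj q) = - qI q" "qJ (qcnj q) = - qJ q" "qK (qcnj q) = - qK q"
  by (simp_all add: qcnj_def)

lemma qcnj_simps:
  "qcnj (p + q) = qcnj p + qcnj q" "qcnj (a *\<^sub>R p) = a *\<^sub>R qcnj p" "qcnj 1 = 1"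
  "qcnj (p * q) = qcnj q * qcnj p" "qcnj (qcnj p) = p"
  by (rule quat_eqI; simp add: algebra_simps)+

lemma qcnj_mult_self: "qcnj p * p = ((qRe p)\<^sup>2 + (qI p)\<^sup>2 + (qJ p)\<^sup>2 + (qK p)\<^sup>2) *\<^sub>R 1"
  by (rule quat_eqI) (simp_all add: power2_eq_square)

lemma quat_no_zero_divisors:
  fixes p q :: quat assumes "p \<noteq> 0" "q \<noteq> 0" shows "p * q \<noteq> 0"
proof
  assume "p * q = 0"
  then have "qcnj p * (p * q) = 0" by simp
  then have "((qRe p)\<^sup>2 + (qI p)\<^sup>2 + (qJ p)\<^sup>2 + (qK p)\<^sup>2) *\<^sub>R q = 0"
    by (simp add: qcnj_mult_self flip: mult.assoc)
  then have "(qRe p)\<^sup>2 + (qI p)\<^sup>2 + (qJ p)\<^sup>2 + (qK p)\<^sup>2 = 0" using assms(2) by simp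
  then have "qRe p = 0 \<and> qI p = 0 \<and> qJ p = 0 \<and> qK p = 0" by (simp add: add_nonneg_eq_0_iff)
  then have "p = 0" by (intro quat_eqI) auto
  then show False using assms(1) by simp
qed

lemma quat_basis: "q = qRe q *\<^sub>R 1 + qI q *\<^sub>R Quat 0 1 0 0 + qJ q *\<^sub>R Quat 0 0 1 0 + qK q *\<^sub>R Quat 0 0 0 1"
  by (rule quat_eqI) simp_all

text \<open>A real functional \<open>f\<close> extends to the right \<open>\<H>\<close>-linear functional
  \<open>\<alpha> x = f x - f (x i) i - f (x j) j - f (x k) k\<close>, whose real part is \<open>f\<close>.\<close>

lemma right_quat_functional:
  fixes R :: "quat \<Rightarrow> 'a \<Rightarrow> 'a"
  assumes V: "rvs V" and R: "\<And>q. lin V V (R q)"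
    and R1: "\<And>x. x \<in> carrier V \<Longrightarrow> R 1 x = x"
    and Radd: "\<And>p q x. x \<in> carrier V \<Longrightarrow> R (p + q) x = R p x \<oplus>\<^bsub>V\<^esub> R q x"
    and Rsc: "\<And>a q x. x \<in> carrier V \<Longrightarrow> R (a *\<^sub>R q) x = a \<odot>\<^bsub>V\<^esub> R q x"
    and Rmult: "\<And>p q x. x \<in> carrier V \<Longrightarrow> R (p * q) x = R q (R p x)"
    and x0: "x0 \<in> carrier V" "x0 \<noteq> \<zero>\<^bsub>V\<^esub>"
  obtains \<alpha> :: "'a \<Rightarrow> quat" where
    "\<And>x y. x \<in> carrier V \<Longrightarrow> y \<in> carrier V \<Longrightarrow> \<alpha> (x \<oplus>\<^bsub>V\<^esub> y) = \<alpha> x + \<alpha> y"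
    "\<And>a x. x \<in> carrier V \<Longrightarrow> \<alpha> (a \<odot>\<^bsub>V\<^esub> x) = a *\<^sub>R \<alpha> x"
    "\<And>q x. x \<in> carrier V \<Longrightarrow> \<alpha> (R q x) = \<alpha> x * q"
    "\<alpha> x0 \<noteq> 0"
proof -
  obtain b where b: "crd V x0 b \<noteq> 0" using nonzero_functional[OF V x0] .
  let ?i = "Quat 0 1 0 0" and ?j = "Quat 0 0 1 0" and ?k = "Quat 0 0 0 1"
  define f where "f x = crd V x b" for x
  define \<alpha> where "\<alpha> x = Quat (f x) (- f (R ?i x)) (- f (R ?j x)) (- f (R ?k x))" for x
  have Rc [simp]: "R q x \<in> carrier V" if "x \<in> carrier V" for q x by (rule lin_closed[OF R that])
  have fR: "f (R q x) = qRe q * f x + qI q * f (R ?i x) + qJ q * f (R ?j x) + qK q * f (R ?k x)"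
    if x: "x \<in> carrier V" for q x
    using x V by (subst quat_basis[of q]) (simp add: f_def Radd Rsc R1)
  show ?thesis
  proof
    show "\<alpha> (x \<oplus>\<^bsub>V\<^esub> y) = \<alpha> x + \<alpha> y" if "x \<in> carrier V" "y \<in> carrier V" for x y
      using that V by (intro quat_eqI) (simp_all add: \<alpha>_def f_def lin_add[OF R])
    show "\<alpha> (a \<odot>\<^bsub>V\<^esub> x) = a *\<^sub>R \<alpha> x" if "x \<in> carrier V" for a x
      using that V by (intro quat_eqI) (simp_all add: \<alpha>_def f_def lin_smult[OF R])
    show "\<alpha> (R q x) = \<alpha> x * q" if x: "x \<in> carrier V" for q x
    proof -
      have "f (R u (R q x)) = f (R (q * u) x)" for u using x by (simp add: Rmult)
      then show ?thesis
        using fR[OF x, of q] fR[OF x, of "q * ?i"] fR[OF x, of "q * ?j"] fR[OF x, of "q * ?k"]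
        by (intro quat_eqI) (simp_all add: \<alpha>_def algebra_simps)
    qed
    have "qRe (\<alpha> x0) \<noteq> 0" using b by (simp add: \<alpha>_def f_def)
    then show "\<alpha> x0 \<noteq> 0" by auto
  qed
qed

text \<open>Conjugation turns a left action into a right one, and a right linear functional into a left linear
  one.\<close>

lemma left_quat_functional:
  fixes L :: "quat \<Rightarrow> 'a \<Rightarrow> 'a"
  assumes V: "rvs V" and L: "\<And>q. lin V V (L q)"
    and L1: "\<And>x. x \<in> carrier V \<Longrightarrow> L 1 x = x"
    and Ladd: "\<And>p q x. x \<in> carrier V \<Longrightarrow> L (p + q) x = L p x \<oplus>\<^bsub>V\<^esub> L q x"
    and Lsc: "\<And>a q x. x \<in> carrier V \<Longrightarrow> L (a *\<^sub>R q) x = a \<odot>\<^bsub>V\<^esub> L q x"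
    and Lmult: "\<And>p q x. x \<in> carrier V \<Longrightarrow> L (p * q) x = L p (L q x)"
    and x0: "x0 \<in> carrier V" "x0 \<noteq> \<zero>\<^bsub>V\<^esub>"
  obtains \<beta> :: "'a \<Rightarrow> quat" where
    "\<And>x y. x \<in> carrier V \<Longrightarrow> y \<in> carrier V \<Longrightarrow> \<beta> (x \<oplus>\<^bsub>V\<^esub> y) = \<beta> x + \<beta> y"
    "\<And>a x. x \<in> carrier V \<Longrightarrow> \<beta> (a \<odot>\<^bsub>V\<^esub> x) = a *\<^sub>R \<beta> x"
    "\<And>q x. x \<in> carrier V \<Longrightarrow> \<beta> (L q x) = q * \<beta> x"
    "\<beta> x0 \<noteq> 0"
proof (rule right_quat_functional[of V "\<lambda>q. L (qcnj q)" x0])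
  fix \<alpha> :: "'a \<Rightarrow> quat"
  assume \<alpha>: "\<And>x y. x \<in> carrier V \<Longrightarrow> y \<in> carrier V \<Longrightarrow> \<alpha> (x \<oplus>\<^bsub>V\<^esub> y) = \<alpha> x + \<alpha> y"
    "\<And>a x. x \<in> carrier V \<Longrightarrow> \<alpha> (a \<odot>\<^bsub>V\<^esub> x) = a *\<^sub>R \<alpha> x"
    "\<And>q x. x \<in> carrier V \<Longrightarrow> \<alpha> (L (qcnj q) x) = \<alpha> x * q"
    "\<alpha> x0 \<noteq> 0"
  show thesis
  proof (rule that[of "\<lambda>x. qcnj (\<alpha> x)"])
    show "qcnj (\<alpha> (L q x)) = q * qcnj (\<alpha> x)" if "x \<in> carrier V" for q x
      using \<alpha>(3)[OF that, of "qcnj q"] by (simp add: qcnj_simps)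
    have "qcnj (qcnj (\<alpha> x0)) \<noteq> 0" using \<alpha>(4) by (simp add: qcnj_simps)
    moreover have "qcnj 0 = 0" by (rule quat_eqI) simp_all
    ultimately show "qcnj (\<alpha> x0) \<noteq> 0" by metis
  qed (simp_all add: \<alpha> qcnj_simps)
qed (simp_all add: V L L1 Ladd Lsc Lmult x0 qcnj_simps)

text \<open>With \<open>J = \<iota> i\<close>, a real functional \<open>f\<close> extends to
  \<open>\<beta> x = f x - f (i x) J\<close>, which is linear over \<open>\<complex>\<close> acting on \<open>\<H>\<close> through
  \<open>\<iota>\<close>.\<close>

lemma complex_quat_functional:
  fixes L :: "complex \<Rightarrow> 'a \<Rightarrow> 'a" and \<iota> :: "complex \<Rightarrow> quat"
  assumes V: "rvs V" and L: "\<And>q. lin V V (L q)"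
    and L1: "\<And>x. x \<in> carrier V \<Longrightarrow> L 1 x = x"
    and Ladd: "\<And>p q x. x \<in> carrier V \<Longrightarrow> L (p + q) x = L p x \<oplus>\<^bsub>V\<^esub> L q x"
    and Lsc: "\<And>a q x. x \<in> carrier V \<Longrightarrow> L (a *\<^sub>R q) x = a \<odot>\<^bsub>V\<^esub> L q x"
    and Lmult: "\<And>p q x. x \<in> carrier V \<Longrightarrow> L (p * q) x = L p (L q x)"
    and \<iota>: "real_algebra_hom \<iota>"
    and x0: "x0 \<in> carrier V" "x0 \<noteq> \<zero>\<^bsub>V\<^esub>"
  obtains \<beta> :: "'a \<Rightarrow> quat" where
    "\<And>x y. x \<in> carrier V \<Longrightarrow> y \<in> carrier V \<Longrightarrow> \<beta> (x \<oplus>\<^bsub>V\<^esub> y) = \<beta> x + \<beta> y"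
    "\<And>a x. x \<in> carrier V \<Longrightarrow> \<beta> (a \<odot>\<^bsub>V\<^esub> x) = a *\<^sub>R \<beta> x"
    "\<And>z x. x \<in> carrier V \<Longrightarrow> \<beta> (L z x) = \<iota> z * \<beta> x"
    "\<exists>x\<in>carrier V. \<beta> x \<noteq> 0"
proof -
  obtain b where b: "crd V x0 b \<noteq> 0" using nonzero_functional[OF V x0] .
  define f where "f x = crd V x b" for x
  define J where "J = \<iota> \<i>"
  define \<beta> where "\<beta> x = f x *\<^sub>R 1 - f (L \<i> x) *\<^sub>R J" for x
  have lin: "linear \<iota>" and i1: "\<iota> 1 = 1" and im: "\<And>p q. \<iota> (p * q) = \<iota> p * \<iota> q"
    using \<iota> by (auto simp: real_algebra_hom_def)
  have z: "z = Re z *\<^sub>R 1 + Im z *\<^sub>R \<i>" for z :: complex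
    by (simp add: complex_eq_iff)
  have \<iota>z: "\<iota> z = Re z *\<^sub>R 1 + Im z *\<^sub>R J" for z
    by (subst z) (simp add: linear_add[OF lin] linear_scale[OF lin] i1 J_def)
  have JJ: "J * J = - 1"
  proof -
    have "J * J = \<iota> (\<i> * \<i>)" by (simp only: J_def im)
    also have "\<dots> = - \<iota> 1" using linear_neg[OF lin, of 1] by simp
    finally show ?thesis by (simp add: i1)
  qed
  have Lc [simp]: "L q x \<in> carrier V" if "x \<in> carrier V" for q x by (rule lin_closed[OF L that])
  have fL: "f (L z x) = Re z * f x + Im z * f (L \<i> x)" if x: "x \<in> carrier V" for z x
  proof -
    have "L z x = Re z \<odot>\<^bsub>V\<^esub> x \<oplus>\<^bsub>V\<^esub> Im z \<odot>\<^bsub>V\<^esub> L \<i> x"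
      by (subst z[of z]) (simp only: Ladd[OF x] Lsc[OF x] L1[OF x])
    then show ?thesis using x V by (simp add: f_def)
  qed
  show ?thesis
  proof
    show "\<beta> (x \<oplus>\<^bsub>V\<^esub> y) = \<beta> x + \<beta> y" if "x \<in> carrier V" "y \<in> carrier V" for x y
      using that V by (simp add: \<beta>_def f_def lin_add[OF L] algebra_simps)
    show "\<beta> (a \<odot>\<^bsub>V\<^esub> x) = a *\<^sub>R \<beta> x" if "x \<in> carrier V" for a x
      using that V by (simp add: \<beta>_def f_def lin_smult[OF L] algebra_simps)
    show "\<beta> (L z x) = \<iota> z * \<beta> x" if x: "x \<in> carrier V" for z x
    proof -
      have "f (L \<i> (L z x)) = f (L (\<i> * z) x)" using x by (simp add: Lmult)
      also have "\<dots> = - Im z * f x + Re z * f (L \<i> x)" using fL[OF x, of "\<i> * z"] by simp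
      finally have "\<beta> (L z x) = (Re z * f x + Im z * f (L \<i> x)) *\<^sub>R 1 - (- Im z * f x + Re z * f (L \<i> x)) *\<^sub>R J"
        by (simp add: \<beta>_def fL[OF x, of z])
      also have "\<dots> = \<iota> z * \<beta> x"
        by (simp add: \<iota>z \<beta>_def algebra_simps JJ)
      finally show ?thesis .
    qed
    show "\<exists>x\<in>carrier V. \<beta> x \<noteq> 0"
    proof (rule ccontr)
      assume "\<not> ?thesis"
      then have 0: "\<beta> x0 = 0" using x0 by blast
      then have eq: "f x0 *\<^sub>R 1 = f (L \<i> x0) *\<^sub>R J" by (simp add: \<beta>_def)
      have "(f x0 * f x0) *\<^sub>R (1 :: quat) = (f x0 *\<^sub>R 1) * (f x0 *\<^sub>R 1)" by simp
      also have "\<dots> = - ((f (L \<i> x0) * f (L \<i> x0)) *\<^sub>R 1)" unfolding eq by (simp add: JJ)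
      finally have "qRe ((f x0 * f x0) *\<^sub>R 1 + (f (L \<i> x0) * f (L \<i> x0)) *\<^sub>R 1) = 0" by simp
      then have "(f x0)\<^sup>2 + (f (L \<i> x0))\<^sup>2 = 0" by (simp add: power2_eq_square)
      then have "f x0 = 0" by (simp add: add_nonneg_eq_0_iff)
      then show False using b by (simp add: f_def)
    qed
  qed
qed

text \<open>The map \<open>(m, n) \<mapsto> \<alpha> m * \<beta> n\<close> is bilinear and balanced, and \<open>\<H>\<close> has no zero
  divisors.\<close>

lemma (in tensor_pair) carrier_nonzero_quat:
  fixes \<alpha> :: "'m \<Rightarrow> quat" and \<beta> :: "'n \<Rightarrow> quat"
  assumes "\<And>x y. x \<in> carrier M \<Longrightarrow> y \<in> carrier M \<Longrightarrow> \<alpha> (x \<oplus>\<^bsub>M\<^esub> y) = \<alpha> x + \<alpha> y"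
    "\<And>a x. x \<in> carrier M \<Longrightarrow> \<alpha> (a \<odot>\<^bsub>M\<^esub> x) = a *\<^sub>R \<alpha> x"
    "\<And>x y. x \<in> carrier N \<Longrightarrow> y \<in> carrier N \<Longrightarrow> \<beta> (x \<oplus>\<^bsub>N\<^esub> y) = \<beta> x + \<beta> y"
    "\<And>a x. x \<in> carrier N \<Longrightarrow> \<beta> (a \<odot>\<^bsub>N\<^esub> x) = a *\<^sub>R \<beta> x"
    "\<And>q m n. m \<in> carrier M \<Longrightarrow> n \<in> carrier N \<Longrightarrow> \<alpha> (r q m) * \<beta> n = \<alpha> m * \<beta> (l q n)"
    and "m \<in> carrier M" "\<alpha> m \<noteq> 0" "n \<in> carrier N" "\<beta> n \<noteq> 0"
  shows "carrier T \<noteq> {\<zero>\<^bsub>T\<^esub>}"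
proof -
  have "tens m n \<noteq> \<zero>\<^bsub>T\<^esub>"
    by (rule tens_nonzero[of "\<lambda>m n. \<alpha> m * \<beta> n"])
       (simp_all add: assms distrib_left distrib_right quat_no_zero_divisors)
  then show ?thesis using tens_closed[OF assms(6,8)] by blast
qed

lemma tensor_real_nonzero:
  assumes "rvs M" "rvs N" "carrier M \<noteq> {\<zero>\<^bsub>M\<^esub>}" "carrier N \<noteq> {\<zero>\<^bsub>N\<^esub>}"
  shows "carrier (tensor M (smult M) N (smult N)) \<noteq> {\<zero>\<^bsub>tensor M (smult M) N (smult N)\<^esub>}"
proof -
  interpret tensor_pair M "smult M" N "smult N" by (rule tensor_pair.intro) (simp_all add: assms)
  obtain m where m: "m \<in> carrier M" "m \<noteq> \<zero>\<^bsub>M\<^esub>"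
    using assms(3) rvs_zero[OF assms(1)] by blast
  obtain n where n: "n \<in> carrier N" "n \<noteq> \<zero>\<^bsub>N\<^esub>"
    using assms(4) rvs_zero[OF assms(2)] by blast
  note mn = m n
  obtain a b where ab: "crd M m a \<noteq> 0" "crd N n b \<noteq> 0"
    using nonzero_functional[OF assms(1) mn(1,2)] nonzero_functional[OF assms(2) mn(3,4)] by metis
  have "tens m n \<noteq> \<zero>\<^bsub>T\<^esub>"
    by (rule tens_nonzero[of "\<lambda>m n. crd M m a * crd N n b"]) (use mn ab in \<open>simp_all add: distrib_left distrib_right\<close>)
  then show ?thesis using tens_closed[OF mn(1,3)] by blast
qed

section \<open>The sign of the volume element in odd dimensions\<close>

lemma gamma_system_mono:
  assumes "gamma_system n V \<gamma>" "m \<le> n" shows "gamma_system m V \<gamma>"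
proof -
  interpret G: gamma_system n V \<gamma> by fact
  show ?thesis
  proof (rule gamma_system.intro[OF G.rvs])
    fix i j s assume i: "i < m"
    then have i': "i < n" using assms(2) by simp
    show "lin V V (\<gamma> i)" by (rule G.gamma_lin[OF i'])
    assume s: "s \<in> carrier V"
    show "\<gamma> i (\<gamma> i s) = s" by (rule G.gamma_square[OF i' s])
    assume "j < m" "i \<noteq> j"
    then show "\<gamma> i (\<gamma> j s) = (-1) \<odot>\<^bsub>V\<^esub> \<gamma> j (\<gamma> i s)"
      using assms(2) by (intro G.gamma_anticommute i' s) simp
  qed
qed

definition last_sign :: "nat \<Rightarrow> (real, 'a) module \<Rightarrow> (nat \<Rightarrow> 'a \<Rightarrow> 'a) \<Rightarrow> real \<Rightarrow> bool" where
  "last_sign p V \<gamma> \<delta> \<longleftrightarrow> (\<forall>t\<in>carrier V. \<gamma> p t = \<delta> \<odot>\<^bsub>V\<^esub> op \<gamma> [0..<p] t)"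

text \<open>The operator \<open>C\<close>, the last generator times the volume element of the others, commutes with all
  generators and is an involution. Its \<open>+1\<close> eigenspace is a stable subspace.\<close>

lemma last_sign_exists:
  assumes "gamma_system (p + 1) V \<gamma>" and irr: "irr (p + 1) V \<gamma>" and p: "4 dvd p"
  shows "\<exists>\<delta>\<in>{1, -1}. last_sign p V \<gamma> \<delta>"
proof -
  interpret N: gamma_system "p + 1" V \<gamma> by fact
  interpret P: gamma_system p V \<gamma> by (rule gamma_system_mono[OF assms(1)]) simp
  have ep: "even p" using p by (auto elim: dvdE)
  have sub: "set [0..<p] \<subseteq> {..<p + 1}" by auto
  define C where "C t = \<gamma> p (P.vol t)" for t
  have Clin: "lin V V C"
    using lin_comp[OF P.vol_lin N.gamma_lin[of p]] by (simp add: comp_def C_def[abs_def])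
  have Cc [simp]: "C t \<in> carrier V" if "t \<in> carrier V" for t by (rule lin_closed[OF Clin that])
  have comm: "\<gamma> i (C t) = C (\<gamma> i t)" if i: "i < p + 1" and t: "t \<in> carrier V" for i t
  proof (cases "i = p")
    case True
    have "\<gamma> p (P.vol t) = P.vol (\<gamma> p t)"
      using N.gamma_op[OF _ sub, of p t] ep t by (simp add: count_list_upt)
    then show ?thesis by (simp add: True C_def)
  next
    case False
    then have ip: "i < p" using i by simp
    have "\<gamma> i (C t) = (-1) \<odot>\<^bsub>V\<^esub> \<gamma> p (\<gamma> i (P.vol t))"
      unfolding C_def by (rule N.gamma_anticommute) (use i t False in auto)
    also have "\<gamma> i (P.vol t) = (-1) \<odot>\<^bsub>V\<^esub> P.vol (\<gamma> i t)" by (rule P.gamma_vol[OF ep ip t])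
    finally show ?thesis
      using t ip by (simp add: C_def N.gamma_smult N.smult_smult)
  qed
  have CC: "C (C t) = t" if t: "t \<in> carrier V" for t
  proof -
    have "P.vol (\<gamma> p (P.vol t)) = \<gamma> p (P.vol (P.vol t))"
      using N.gamma_op[OF _ sub, of p "P.vol t"] ep t by (simp add: count_list_upt)
    then show ?thesis using P.vol_square[OF p t] t by (simp add: C_def N.gamma_square)
  qed
  have Cvol: "C (P.vol t) = \<gamma> p t" if "t \<in> carrier V" for t
    using P.vol_square[OF p that] by (simp add: C_def)
  let ?W = "{t \<in> carrier V. C t = t}"
  have W: "stable (p + 1) V \<gamma> ?W"
    using lin_kernel_eq[OF N.rvs N.rvs Clin lin_id(2)] by (auto simp: stable_def comm[symmetric])
  show ?thesis
  proof (cases "?W = {\<zero>\<^bsub>V\<^esub>}")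
    case True
    have "C t = (-1) \<odot>\<^bsub>V\<^esub> t" if t: "t \<in> carrier V" for t
    proof (rule crd_eqI[OF N.rvs])
      have "C (t \<oplus>\<^bsub>V\<^esub> C t) = t \<oplus>\<^bsub>V\<^esub> C t"
        using lin_add[OF Clin t, of "C t"] t by (auto simp: CC intro!: crd_eqI[OF N.rvs])
      then have "t \<oplus>\<^bsub>V\<^esub> C t \<in> ?W" using t by simp
      then have eq: "t \<oplus>\<^bsub>V\<^esub> C t = \<zero>\<^bsub>V\<^esub>" unfolding True by simp
      show "crd V (C t) b = crd V ((-1) \<odot>\<^bsub>V\<^esub> t) b" for b
        using arg_cong[OF eq, of "\<lambda>t. crd V t b"] t by simp
    qed (use t in auto)
    then have "last_sign p V \<gamma> (-1)"
      using Cvol by (auto simp: last_sign_def)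
    then show ?thesis by blast
  next
    case False
    then have "?W = carrier V" using irr W unfolding irr_def by blast
    then have "C t = t" if "t \<in> carrier V" for t using that by blast
    then have "last_sign p V \<gamma> 1" using Cvol by (auto simp: last_sign_def)
    then show ?thesis by blast
  qed
qed

lemma last_sign_irr:
  assumes "irr (p + 1) V \<gamma>" "gamma_system (p + 1) V \<gamma>" "last_sign p V \<gamma> \<delta>"
  shows "irr p V \<gamma>"
proof -
  interpret P: gamma_system p V \<gamma> by (rule gamma_system_mono[OF assms(2)]) simp
  have "stable (p + 1) V \<gamma> W" if W: "stable p V \<gamma> W" for W
  proof -
    have Ws: "subsp W V" using W by (simp add: stable_def)
    have "\<gamma> p s \<in> W" if s: "s \<in> W" for s
    proof -
      have "op \<gamma> [0..<p] s \<in> W" by (rule stable_op[OF W _ s]) auto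
      moreover have "s \<in> carrier V" using s subsp_subset[OF Ws] by auto
      ultimately show ?thesis using assms(3) subsp_smult[OF Ws] by (simp add: last_sign_def)
    qed
    then show ?thesis using W by (auto simp: stable_def less_Suc_eq)
  qed
  then show ?thesis using assms(1) unfolding irr_def by blast
qed

text \<open>The last generator is a multiple of the volume element of the others, so the two systems remain
  irreducible without it, and an isomorphism for the first \<open>p\<close> generators respects the last one.\<close>

lemma last_sign_iso:
  assumes "gamma_system (p + 1) V \<gamma>" "gamma_system (p + 1) V' \<gamma>'"
    and "irr (p + 1) V \<gamma>" "irr (p + 1) V' \<gamma>'" "last_sign p V \<gamma> \<delta>" "last_sign p V' \<gamma>' \<delta>"
    and p: "p = 8 * k \<or> p = 8 * k + 4"
  shows "\<exists>T. intertwines (p + 1) V \<gamma> V' \<gamma>' T \<and> bij_betw T (carrier V) (carrier V')"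
proof -
  have G: "gamma_system p V \<gamma>" "gamma_system p V' \<gamma>'"
    using gamma_system_mono[OF assms(1)] gamma_system_mono[OF assms(2)] by auto
  have irr: "irr p V \<gamma>" "irr p V' \<gamma>'" by (rule last_sign_irr; fact)+
  have fixed: "\<exists>z. gamma_system.fixed U g (stab p k 1) z \<and> z \<noteq> \<zero>\<^bsub>U\<^esub>"
    if G: "gamma_system p U g" and irr: "irr p U g" for U :: "(real, 'x) module" and g
  proof -
    interpret gamma_system p U g by fact
    obtain s where s: "s \<in> carrier U" "s \<noteq> \<zero>\<^bsub>U\<^esub>" using irr_nonzero[OF irr rvs] .
    show ?thesis
      using p
    proof
      assume p: "p = 8 * k"
      have "\<exists>z\<in>carrier U. z \<noteq> \<zero>\<^bsub>U\<^esub> \<and> (\<forall>u\<in>set (code k). op g u z = z)"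
        using p s by (intro code_fixed_exists[OF _ stable_carrier]) auto
      then obtain z where "z \<in> carrier U" "z \<noteq> \<zero>\<^bsub>U\<^esub>" "\<forall>u\<in>set (code k). op g u z = z" by blast
      then show ?thesis using fixed_stab_iff[of k 1 z] p by auto
    next
      assume "p = 8 * k + 4"
      then have "\<exists>z\<in>carrier U. z \<noteq> \<zero>\<^bsub>U\<^esub> \<and> fixed (stab p k 1) z"
        using s by (intro code_gamma_fixed_exists[OF _ stable_carrier]) auto
      then show ?thesis by blast
    qed
  qed
  obtain x where x: "gamma_system.fixed V \<gamma> (stab p k 1) x" "x \<noteq> \<zero>\<^bsub>V\<^esub>"
    using fixed[OF G(1) irr(1)] by blast
  obtain x' where x': "gamma_system.fixed V' \<gamma>' (stab p k 1) x'" "x' \<noteq> \<zero>\<^bsub>V'\<^esub>"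
    using fixed[OF G(2) irr(2)] by blast
  have "8 * k \<le> p" "p \<le> 8 * k + 4" using p by auto
  then obtain T where T: "intertwines p V \<gamma> V' \<gamma>' T" "bij_betw T (carrier V) (carrier V')"
    using minimal_vector_iso[OF G irr _ _ _ x x'] by auto
  have lin: "lin V V' T" using T(1) by (simp add: intertwines_def)
  interpret P: gamma_system p V \<gamma> by (rule G(1))
  have "T (\<gamma> p s) = \<gamma>' p (T s)" if s: "s \<in> carrier V" for s
  proof -
    have "T (\<gamma> p s) = \<delta> \<odot>\<^bsub>V'\<^esub> T (P.vol s)"
      using assms(5) s by (simp add: last_sign_def lin_smult[OF lin])
    also have "T (P.vol s) = op \<gamma>' [0..<p] (T s)"
      by (rule intertwines_op[OF T(1) G(1) _ s]) auto
    finally show ?thesis using assms(6) lin_closed[OF lin s] by (simp add: last_sign_def)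
  qed
  then have "intertwines (p + 1) V \<gamma> V' \<gamma>' T"
    using T(1) by (auto simp: intertwines_def less_Suc_eq)
  then show ?thesis using T(2) by blast
qed

lemma last_sign_not_iso:
  assumes "gamma_system (p + 1) V \<gamma>" "gamma_system (p + 1) V' \<gamma>'"
    and irr: "irr (p + 1) V \<gamma>" and s: "last_sign p V \<gamma> \<delta>" "last_sign p V' \<gamma>' (- \<delta>)" and \<delta>: "\<delta> \<noteq> 0"
    and T: "intertwines (p + 1) V \<gamma> V' \<gamma>' T" "bij_betw T (carrier V) (carrier V')"
  shows False
proof -
  interpret P: gamma_system p V \<gamma> by (rule gamma_system_mono[OF assms(1)]) simp
  interpret P': gamma_system p V' \<gamma>' by (rule gamma_system_mono[OF assms(2)]) simp
  have lin: "lin V V' T" using T by (simp add: intertwines_def)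
  obtain t where t: "t \<in> carrier V" "t \<noteq> \<zero>\<^bsub>V\<^esub>" using irr_nonzero[OF irr P.rvs] .
  have Tt: "T t \<in> carrier V'" by (rule lin_closed[OF lin t(1)])
  have "intertwines p V \<gamma> V' \<gamma>' T" using T by (simp add: intertwines_def)
  then have vol: "T (P.vol t) = P'.vol (T t)"
    by (rule intertwines_op[OF _ P.gamma_system_axioms _ t(1)]) auto
  have "\<delta> \<odot>\<^bsub>V'\<^esub> P'.vol (T t) = T (\<gamma> p t)"
    using s(1) t(1) vol by (simp add: last_sign_def lin_smult[OF lin])
  also have "\<dots> = (- \<delta>) \<odot>\<^bsub>V'\<^esub> P'.vol (T t)"
    using T(1) t(1) s(2) Tt by (simp add: intertwines_def last_sign_def)
  finally have eq: "\<delta> \<odot>\<^bsub>V'\<^esub> P'.vol (T t) = (- \<delta>) \<odot>\<^bsub>V'\<^esub> P'.vol (T t)" .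
  have "P'.vol (T t) = \<zero>\<^bsub>V'\<^esub>"
  proof (rule crd_eqI[OF P'.rvs])
    show "crd V' (P'.vol (T t)) b = crd V' \<zero>\<^bsub>V'\<^esub> b" for b
      using arg_cong[OF eq, of "\<lambda>t. crd V' t b"] Tt \<delta> by simp
  qed (use Tt in auto)
  then have "T t = \<zero>\<^bsub>V'\<^esub>" using P'.op_eq_zero_iff[of "[0..<p]" "T t"] Tt by (auto simp: subset_iff)
  then have "T t = T \<zero>\<^bsub>V\<^esub>" using lin_zero[OF P.rvs P'.rvs lin] by simp
  then show False using T(2) t by (auto simp: bij_betw_def inj_on_def)
qed

section \<open>The spinor modules\<close>

lemma clifford_module_ungraded: "clifford_module n N \<Longrightarrow> clifford_module n (ungraded N)"
  by (simp add: clifford_module_def clifford_map_def clifford_condition_def ungraded_def)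

lemma clifford_module_neg:
  assumes "clifford_module n N" shows "clifford_module n (neg_rep N)"
proof -
  interpret N: clifford_module n N by fact
  have neg: "cmap (neg_rep N) v s = (-1) \<odot>\<^bsub>N.V\<^esub> cmap N v s" if "v \<in> carrier_vec n" "s \<in> carrier N.V" for v s
    using that by (simp add: neg_rep_def)
  have sp: "space (neg_rep N) = N.V" by (simp add: neg_rep_def)
  show ?thesis
    unfolding clifford_module_def clifford_map_def clifford_condition_def sp
  proof (intro conjI ballI allI)
    fix v w :: "real vec" and s and a :: real assume v: "v \<in> carrier_vec n"
    have "lin N.V N.V (\<lambda>s. (-1) \<odot>\<^bsub>N.V\<^esub> cmap N v s)" by (intro lin_scale N.V N.c_lin v)
    then have "lin N.V N.V (cmap (neg_rep N) v)" using v by (simp add: lin_def neg)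
    then show "linear_map class_ring N.V N.V (cmap (neg_rep N) v)" by (simp add: linear_map_iff_lin)
    assume s: "s \<in> carrier N.V"
    show "cmap (neg_rep N) (a \<cdot>\<^sub>v v) s = a \<odot>\<^bsub>N.V\<^esub> cmap (neg_rep N) v s"
      using v s by (simp add: neg N.c_smult rvs_smult_smult)
    assume w: "w \<in> carrier_vec n"
    show "cmap (neg_rep N) (v + w) s = cmap (neg_rep N) v s \<oplus>\<^bsub>N.V\<^esub> cmap (neg_rep N) w s"
      using v w s by (simp add: neg N.c_add rvs_r_distr)
    have "cmap (neg_rep N) v (cmap (neg_rep N) w s) = cmap N v (cmap N w s)"
      if "v \<in> carrier_vec n" "w \<in> carrier_vec n" for v w
      using that s by (simp add: neg lin_smult[OF N.c_lin] rvs_smult_smult)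
    then show "cmap (neg_rep N) v (cmap (neg_rep N) w s) \<oplus>\<^bsub>N.V\<^esub> cmap (neg_rep N) w (cmap (neg_rep N) v s)
        = (- 2 * cform v w) \<odot>\<^bsub>N.V\<^esub> s"
      using N.c_clifford[OF v w s] v w by simp
  qed simp
qed

lemma rep_pair_real:
  assumes "graded_module p M" "clifford_module q N"
  shows "rep_pair p q M N (smult (space M)) (smult (space N))"
proof -
  interpret M: graded_module p M by fact
  interpret N: clifford_module q N by fact
  show ?thesis
    by (intro rep_pair.intro assms tensor_pair.intro rep_pair_axioms.intro)
       (simp_all add: lin_smult[OF M.c_lin] lin_smult[OF N.c_lin])
qed

lemma irr_carrier: "irr n V \<gamma> \<Longrightarrow> carrier V \<noteq> {\<zero>\<^bsub>V\<^esub>}"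
  by (simp add: irr_def)

locale intertwiner_algebra = clifford_module n S for n :: nat and S :: "'a rep" +
  fixes \<phi> :: "'k::real_algebra_1 \<Rightarrow> 'a \<Rightarrow> 'a"
  assumes irr: "irr n V gam" and iso: "intertwiner_algebra_iso n S \<phi>"
begin

sublocale G: gamma_system n V gam
  by (rule gamma_system)

lemma intertwines_phi: "intertwines n V gam V gam (\<phi> q)"
  using iso intertwiners_iff[OF clifford_module_axioms clifford_module_axioms, of "\<phi> q"]
  by (simp add: intertwiner_algebra_iso_def Let_def)

lemma phi_lin: "lin V V (\<phi> q)"
  using intertwines_phi[of q] by (simp add: intertwines_def)

lemma phi_closed [simp]: "s \<in> carrier V \<Longrightarrow> \<phi> q s \<in> carrier V"
  by (rule lin_closed[OF phi_lin])

lemma c_phi: "v \<in> carrier_vec n \<Longrightarrow> s \<in> carrier V \<Longrightarrow> c v (\<phi> q s) = \<phi> q (c v s)"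
  using intertwines_cmap[OF clifford_module_axioms clifford_module_axioms intertwines_phi, of v s q] by simp

lemma phi_all:
  assumes "intertwines n V gam V gam T"
  shows "\<exists>q. \<forall>s\<in>carrier V. T s = \<phi> q s"
proof -
  have "T \<in> intertwiners n V (Cl_act S) V (Cl_act S)"
    using intertwiners_iff[OF clifford_module_axioms clifford_module_axioms, of T] assms by simp
  then have "\<exists>!q. \<forall>s\<in>carrier V. T s = \<phi> q s"
    using iso unfolding intertwiner_algebra_iso_def Let_def by simp
  then show ?thesis by (rule ex1_implies_ex)
qed

lemma phi_algebra:
  assumes "s \<in> carrier V"
  shows "\<phi> 1 s = s" "\<phi> (a *\<^sub>R q) s = a \<odot>\<^bsub>V\<^esub> \<phi> q s"
    "\<phi> (p + q) s = \<phi> p s \<oplus>\<^bsub>V\<^esub> \<phi> q s" "\<phi> (p * q) s = \<phi> p (\<phi> q s)"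
  using iso assms by (simp_all add: intertwiner_algebra_iso_def Let_def)

text \<open>For \<open>2 \<le> n \<le> 4\<close> the minimal vectors are the vectors fixed by the first generator, and any two
  nonzero ones are carried to each other by an automorphism of the irreducible module, that is, by an
  intertwiner.\<close>

lemma eigenline:
  assumes n: "1 < n" "n \<le> 4"
  shows "\<exists>s0\<in>carrier V. s0 \<noteq> \<zero>\<^bsub>V\<^esub> \<and>
    (\<forall>s\<in>carrier V. \<exists>q. (1 / 2) \<odot>\<^bsub>V\<^esub> (s \<oplus>\<^bsub>V\<^esub> 1 \<odot>\<^bsub>V\<^esub> gam 0 s) = \<phi> q s0)"
proof -
  obtain s where "s \<in> carrier V" "s \<noteq> \<zero>\<^bsub>V\<^esub>" using irr_nonzero[OF irr V] .
  then have "\<exists>s\<in>carrier V. s \<noteq> \<zero>\<^bsub>V\<^esub> \<and> G.fixed (stab n 0 1) s"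
    using n by (intro G.code_gamma_fixed_exists[OF _ G.stable_carrier]) auto
  then obtain s0 where s0: "s0 \<in> carrier V" "s0 \<noteq> \<zero>\<^bsub>V\<^esub>" "G.fixed (stab n 0 1) s0" by blast
  have "\<exists>q. (1 / 2) \<odot>\<^bsub>V\<^esub> (s \<oplus>\<^bsub>V\<^esub> 1 \<odot>\<^bsub>V\<^esub> gam 0 s) = \<phi> q s0" if s: "s \<in> carrier V" for s
  proof -
    let ?t = "(1 / 2) \<odot>\<^bsub>V\<^esub> (s \<oplus>\<^bsub>V\<^esub> 1 \<odot>\<^bsub>V\<^esub> gam 0 s)"
    have g: "gam 0 s \<in> carrier V" by (rule G.gamma_closed) (use n s in auto)
    have t: "?t \<in> carrier V" using s g by simp
    have l: "lin V V (gam 0)" by (rule G.gamma_lin) (use n in simp)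
    have gg: "gam 0 (gam 0 s) = s" by (rule G.gamma_square) (use n s in auto)
    have "1 \<odot>\<^bsub>V\<^esub> gam 0 ?t = ?t"
    proof (rule crd_eqI[OF V])
      have "gam 0 ?t = (1 / 2) \<odot>\<^bsub>V\<^esub> (gam 0 s \<oplus>\<^bsub>V\<^esub> 1 \<odot>\<^bsub>V\<^esub> s)"
        using s g gg by (simp only: lin_smult[OF l] lin_add[OF l] rvs_add[OF V] rvs_smult[OF V])
      then show "crd V (1 \<odot>\<^bsub>V\<^esub> gam 0 ?t) b = crd V ?t b" for b
        using s g by (simp add: add.commute)
    qed (use t g s n lin_closed[OF l] in auto)
    then have tf: "G.fixed (stab n 0 1) ?t" using t G.fixed_stab_iff[of 0 1 ?t] by simp
    show ?thesis
    proof (cases "?t = \<zero>\<^bsub>V\<^esub>")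
      case True
      have "\<phi> (0 *\<^sub>R 1) s0 = \<zero>\<^bsub>V\<^esub>" unfolding phi_algebra(2)[OF s0(1)] using s0(1) by simp
      then show ?thesis using True by metis
    next
      case False
      obtain T where "intertwines n V gam V gam T" "T s0 = ?t"
        using minimal_vector_iso[OF gamma_system gamma_system irr irr _ _ _ s0(3,2) tf False] n by auto
      then show ?thesis using phi_all[of T] s0(1) by metis
    qed
  qed
  then show ?thesis using s0 by blast
qed

end

text \<open>The generator of the second factor acts as the scalar \<open>e\<close>, so on the tensor product the last
  generator is \<open>e\<close> times the grading of the first factor, which is its volume element.\<close>

lemma tensor_line:
  assumes q1: "q = 1" and Q: "graded_module p Q" and irrQ: "irr p (space Q) (\<lambda>i. cmap Q (unit_vec p i))"
    and N: "clifford_module q N"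
    and z: "z \<in> carrier (space N)" "z \<noteq> \<zero>\<^bsub>space N\<^esub>" and e: "e \<in> {1, -1}"
    and line: "\<And>s. s \<in> carrier (space N) \<Longrightarrow> cmap N (unit_vec q 0) s = e \<odot>\<^bsub>space N\<^esub> s"
      "\<And>s. s \<in> carrier (space N) \<Longrightarrow> \<exists>a. s = a \<odot>\<^bsub>space N\<^esub> z"
  shows "irreducible_rep (p + q) (rep_tensor_real p q Q N)"
    and "last_sign p (space (rep_tensor_real p q Q N)) (\<lambda>i. cmap (rep_tensor_real p q Q N) (unit_vec (p + q) i)) e"
proof -
  interpret P: rep_pair p q Q N "smult (space Q)" "smult (space N)" by (rule rep_pair_real[OF Q N])
  have RT: "rep_tensor_real p q Q N = P.RT" by (simp add: rep_tensor_real_def)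
  have irrN: "irr q (space N) P.N.gam"
    unfolding irr_def
  proof (intro conjI allI impI)
    show "carrier (space N) \<noteq> {\<zero>\<^bsub>space N\<^esub>}" using z by blast
    fix W assume W: "stable q (space N) P.N.gam W"
    then have Ws: "subsp W (space N)" by (simp add: stable_def)
    show "W = {\<zero>\<^bsub>space N\<^esub>} \<or> W = carrier (space N)"
    proof (cases "W = {\<zero>\<^bsub>space N\<^esub>}")
      case False
      then obtain s where s: "s \<in> W" "s \<noteq> \<zero>\<^bsub>space N\<^esub>" using subsp_zero[OF Ws] by auto
      have "s \<in> carrier (space N)" using s(1) subsp_subset[OF Ws] by blast
      then obtain a where a: "s = a \<odot>\<^bsub>space N\<^esub> z" using line(2) by blast
      then have "a \<noteq> 0" using s z by auto
      then have zW: "z \<in> W" using subsp_smult_iff[OF P.N Ws z(1)] s(1) a by simp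
      have "carrier (space N) \<subseteq> W"
      proof
        fix t assume "t \<in> carrier (space N)"
        then obtain a where "t = a \<odot>\<^bsub>space N\<^esub> z" using line(2) by blast
        then show "t \<in> W" using subsp_smult[OF Ws zW] by simp
      qed
      then show ?thesis using subsp_subset[OF Ws] by auto
    qed simp
  qed
  have q0: "0 < q" using q1 by simp
  have ee: "e * e = 1" using e by auto
  have fixed: "e \<odot>\<^bsub>space N\<^esub> P.N.gam 0 s = s" if "s \<in> carrier (space N)" for s
    using that ee by (simp add: line(1) rvs_smult_smult)
  have nz: "carrier P.T \<noteq> {\<zero>\<^bsub>P.T\<^esub>}"
    by (rule tensor_real_nonzero[OF P.M P.N irr_carrier[OF irrQ] irr_carrier[OF irrN]])
  have "irr (p + q) P.T P.R.gam"
  proof (rule P.irr_right[OF irrQ irrN _ z(1) e _ _ nz])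
    fix s assume s: "s \<in> carrier (space N)"
    have "(1 / 2) \<odot>\<^bsub>space N\<^esub> (s \<oplus>\<^bsub>space N\<^esub> s) = s" by (rule crd_eqI[OF P.N]) (use s in auto)
    then show "\<exists>a. (1 / 2) \<odot>\<^bsub>space N\<^esub> (s \<oplus>\<^bsub>space N\<^esub> e \<odot>\<^bsub>space N\<^esub> P.N.gam 0 s) = a \<odot>\<^bsub>space N\<^esub> z"
      using fixed[OF s] line(2)[OF s] by simp
  qed (use fixed q1 in simp_all)
  then show "irreducible_rep (p + q) (rep_tensor_real p q Q N)"
    unfolding RT P.R.irreducible_iff by simp
  have "P.R.gam p t = e \<odot>\<^bsub>P.T\<^esub> op P.R.gam [0..<p] t" if t: "t \<in> carrier P.T" for t
  proof (rule P.tens_lin_eq[OF P.T_rvs _ _ _ t])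
    show "lin P.T P.T (P.R.gam p)" by (rule P.GR.gamma_lin) (simp add: q1)
    show "lin P.T P.T (\<lambda>t. e \<odot>\<^bsub>P.T\<^esub> op P.R.gam [0..<p] t)"
      by (intro lin_scale P.T_rvs P.GR.op_lin) auto
    fix m s assume m: "m \<in> carrier (space Q)" and s: "s \<in> carrier (space N)"
    show "P.R.gam p (P.tens m s) = e \<odot>\<^bsub>P.T\<^esub> op P.R.gam [0..<p] (P.tens m s)"
      using P.gam_right[of 0 m s] q0 m s by (simp add: line(1) P.op_vol_left P.tens_smult_right)
  qed
  then show "last_sign p (space (rep_tensor_real p q Q N))
      (\<lambda>i. cmap (rep_tensor_real p q Q N) (unit_vec (p + q) i)) e"
    unfolding RT by (simp add: last_sign_def)
qed

text \<open>An irreducible module in dimension \<open>p + 1\<close> is determined by the sign of its last generator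
  against the volume element of the others, and the two choices for the second factor realise both
  signs.\<close>

lemma two_irreducibles:
  fixes S :: "'b rep" and N :: "'t rep" and Q :: "'q graded_rep"
  assumes Q: "graded_module p Q" and irrQ: "irr p (space Q) (\<lambda>i. cmap Q (unit_vec p i))"
    and p: "p = 8 * k \<or> p = 8 * k + 4" and S: "irreducible_rep 1 S"
  defines "X \<equiv> \<lambda>N. rep_tensor_real p 1 Q (ungraded N)"
  shows "irreducible_rep (p + 1) (X S)" "irreducible_rep (p + 1) (X (neg_rep S))"
    "\<not> isomorphic_reps (p + 1) (X (neg_rep S)) (X S)"
    "irreducible_rep (p + 1) N \<Longrightarrow>
      isomorphic_reps (p + 1) N (X S) \<or> isomorphic_reps (p + 1) N (X (neg_rep S))"
proof -
  have cS: "clifford_module 1 S" by (rule irreducible_rep_clifford[OF S])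
  interpret S: clifford_module 1 S by (rule cS)
  have irrS: "irr 1 S.V S.gam" using S S.irreducible_iff by simp
  obtain z e where z: "z \<in> carrier S.V" "z \<noteq> \<zero>\<^bsub>S.V\<^esub>" "e \<in> {1, -1}"
    and line: "\<forall>s\<in>carrier S.V. S.gam 0 s = e \<odot>\<^bsub>S.V\<^esub> s \<and> (\<exists>a. s = a \<odot>\<^bsub>S.V\<^esub> z)"
    using gamma_system.irr_1_line[OF S.gamma_system _ irrS] by auto
  have sp: "space (ungraded S) = S.V" "space (ungraded (neg_rep S)) = S.V"
    by (simp_all add: ungraded_def neg_rep_def)
  have c1: "clifford_module 1 (ungraded S)" by (rule clifford_module_ungraded[OF cS])
  have c2: "clifford_module 1 (ungraded (neg_rep S))"
    by (rule clifford_module_ungraded[OF clifford_module_neg[OF cS]])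
  have g1: "cmap (ungraded S) (unit_vec 1 0) s = e \<odot>\<^bsub>S.V\<^esub> s" if "s \<in> carrier S.V" for s
    using line that by (simp add: ungraded_def)
  have g2: "cmap (ungraded (neg_rep S)) (unit_vec 1 0) s = (- e) \<odot>\<^bsub>S.V\<^esub> s" if "s \<in> carrier S.V" for s
    using line that by (simp add: ungraded_def neg_rep_def rvs_smult_smult)
  have e2: "- e \<in> {1, -1}" using z(3) by auto
  note t1 = tensor_line[OF refl Q irrQ c1, unfolded sp, OF z(1,2,3) g1]
  note t2 = tensor_line[OF refl Q irrQ c2, unfolded sp, OF z(1,2) e2 g2]
  have l1: "irreducible_rep (p + 1) (X S)"
    and s1: "last_sign p (space (X S)) (\<lambda>i. cmap (X S) (unit_vec (p + 1) i)) e"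
    using t1 line unfolding X_def by blast+
  have l2: "irreducible_rep (p + 1) (X (neg_rep S))"
    and s2: "last_sign p (space (X (neg_rep S))) (\<lambda>i. cmap (X (neg_rep S)) (unit_vec (p + 1) i)) (- e)"
    using t2 line unfolding X_def by blast+
  show "irreducible_rep (p + 1) (X S)" "irreducible_rep (p + 1) (X (neg_rep S))" by fact+
  have cX1: "clifford_module (p + 1) (X S)" by (rule irreducible_rep_clifford[OF l1])
  have cX2: "clifford_module (p + 1) (X (neg_rep S))" by (rule irreducible_rep_clifford[OF l2])
  note irrX1 = l1[unfolded clifford_module.irreducible_iff[OF cX1]]
    and irrX2 = l2[unfolded clifford_module.irreducible_iff[OF cX2]]
  note gX1 = clifford_module.gamma_system[OF cX1] and gX2 = clifford_module.gamma_system[OF cX2]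
  have e0: "- e \<noteq> 0" using z(3) by auto
  show "\<not> isomorphic_reps (p + 1) (X (neg_rep S)) (X S)"
    unfolding isomorphic_reps_iff[OF cX2 cX1]
    using last_sign_not_iso[OF gX2 gX1 irrX2 s2 _ e0] s1 by auto
  assume N: "irreducible_rep (p + 1) N"
  have cN: "clifford_module (p + 1) N" by (rule irreducible_rep_clifford[OF N])
  note gN = clifford_module.gamma_system[OF cN]
    and irrN = N[unfolded clifford_module.irreducible_iff[OF cN]]
  have "4 dvd p" using Q by (simp add: graded_module_def graded_module_axioms_def)
  then obtain \<delta> where \<delta>: "\<delta> \<in> {1, -1}"
    and sN: "last_sign p (space N) (\<lambda>i. cmap N (unit_vec (p + 1) i)) \<delta>"
    using last_sign_exists[OF gN irrN] by blast
  have "\<delta> = e \<or> \<delta> = - e" using \<delta> z(3) by auto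
  then show "isomorphic_reps (p + 1) N (X S) \<or> isomorphic_reps (p + 1) N (X (neg_rep S))"
  proof
    assume "\<delta> = e"
    then show ?thesis
      unfolding isomorphic_reps_iff[OF cN cX1]
      using last_sign_iso[OF gN gX1 irrN irrX1 sN _ p] s1 by blast
  next
    assume "\<delta> = - e"
    then show ?thesis
      unfolding isomorphic_reps_iff[OF cN cX2]
      using last_sign_iso[OF gN gX2 irrN irrX2 sN _ p] s2 by blast
  qed
qed

lemma irreducible_tensor_left:
  assumes M: "graded_module p M" and p: "p = 8 * k" and irrM: "irr p (space M) (\<lambda>i. cmap M (unit_vec p i))"
    and N: "clifford_module q N" and irrN: "irr q (space N) (\<lambda>i. cmap N (unit_vec q i))"
  shows "irreducible_rep (p + q) (rep_tensor_real p q M N)"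
proof -
  interpret P: rep_pair p q M N "smult (space M)" "smult (space N)" by (rule rep_pair_real[OF M N])
  have "irr (p + q) P.T P.R.gam"
    by (rule P.irr_left[OF p irrM irrN])
       (rule tensor_real_nonzero[OF P.M P.N irr_carrier[OF irrM] irr_carrier[OF irrN]])
  then show ?thesis unfolding rep_tensor_real_def P.R.irreducible_iff by simp
qed

lemma graded_module_real:
  assumes "graded_module p M" "graded_module q N"
  shows "graded_module (p + q) (rep_tensor_real p q M N)"
  unfolding rep_tensor_real_def
  by (rule graded_rep_tensor[OF rep_pair_real assms(2)])
     (use assms in \<open>simp_all add: graded_module_def\<close>)

lemma ungraded_simps [simp]: "space (ungraded N) = space N" "cmap (ungraded N) = cmap N"
  by (simp_all add: ungraded_def)

text \<open>An action on the second factor of a tensor product over \<open>\<real>\<close> that commutes with the Clifford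
  map of that factor induces one on the tensor product, which again commutes with the Clifford map.\<close>

locale right_action = P: rep_pair p q M N "smult (space M)" "smult (space N)"
  for p q :: nat and M :: "'m graded_rep" and N :: "'n graded_rep" +
  fixes R :: "'k::real_algebra_1 \<Rightarrow> 'n \<Rightarrow> 'n"
  assumes R_lin: "lin (space N) (space N) (R z)"
    and R_c: "\<lbrakk>v \<in> carrier_vec q; n \<in> carrier (space N)\<rbrakk> \<Longrightarrow> cmap N v (R z n) = R z (cmap N v n)"
    and R_one: "n \<in> carrier (space N) \<Longrightarrow> R 1 n = n"
    and R_scale: "n \<in> carrier (space N) \<Longrightarrow> R (a *\<^sub>R z) n = a \<odot>\<^bsub>space N\<^esub> R z n"
    and R_add: "n \<in> carrier (space N) \<Longrightarrow> R (y + z) n = R y n \<oplus>\<^bsub>space N\<^esub> R z n"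
    and R_mult: "n \<in> carrier (space N) \<Longrightarrow> R (y * z) n = R z (R y n)"
begin

abbreviation "act z \<equiv> tensor_map (space M) (smult (space M)) (space N) (smult (space N)) id (R z)"
abbreviation "Q \<equiv> rep_tensor_real p q M N"

lemma Q_eq: "Q = P.RT"
  by (simp add: rep_tensor_real_def)

lemma R_closed [simp]: "n \<in> carrier (space N) \<Longrightarrow> R z n \<in> carrier (space N)"
  by (rule lin_closed[OF R_lin])

lemma act_T_lin: "lin P.T P.T (act z)"
  by (rule P.tensor_map_lin[OF lin_id(1) _ R_lin]) (simp_all add: lin_smult[OF R_lin])

lemma act_tens: "\<lbrakk>m \<in> carrier (space M); n \<in> carrier (space N)\<rbrakk> \<Longrightarrow> act z (P.tens m n) = P.tens m (R z n)"
  by (subst P.tensor_map_tens[OF lin_id(1) _ R_lin]) (simp_all add: lin_smult[OF R_lin])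

lemma act_lin: "lin (space Q) (space Q) (act z)"
  unfolding Q_eq P.space_RT by (rule act_T_lin)

lemma lin_compose: "lin P.T P.T f \<Longrightarrow> lin P.T P.T g \<Longrightarrow> lin P.T P.T (\<lambda>t. f (g t))"
  using lin_comp[of P.T P.T g P.T f] by (simp add: comp_def)

lemma act_c:
  assumes v: "v \<in> carrier_vec (p + q)" and t: "t \<in> carrier (space Q)"
  shows "cmap Q v (act z t) = act z (cmap Q v t)"
  unfolding Q_eq
proof (rule P.tens_lin_eq[where f = "\<lambda>t. cmap P.RT v (act z t)" and g = "\<lambda>t. act z (cmap P.RT v t)", OF P.T_rvs])
  show "t \<in> carrier P.T" using t unfolding Q_eq P.space_RT .
  show "lin P.T P.T (\<lambda>t. cmap P.RT v (act z t))"
    by (rule lin_compose[OF P.cmap_RT_lin act_T_lin])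
  show "lin P.T P.T (\<lambda>t. act z (cmap P.RT v t))"
    by (rule lin_compose[OF act_T_lin P.cmap_RT_lin])
  fix m n assume mn: "m \<in> carrier (space M)" "n \<in> carrier (space N)"
  show "cmap P.RT v (act z (P.tens m n)) = act z (cmap P.RT v (P.tens m n))"
    using mn v by (simp add: act_tens P.cmap_RT_tens lin_add[OF act_T_lin] R_c)
qed

lemma act_algebra:
  assumes "t \<in> carrier (space Q)"
  shows "act 1 t = t" "act (a *\<^sub>R z) t = a \<odot>\<^bsub>space Q\<^esub> act z t"
    "act (y + z) t = act y t \<oplus>\<^bsub>space Q\<^esub> act z t" "act (y * z) t = act z (act y t)"
proof -
  have t: "t \<in> carrier P.T" using assms unfolding Q_eq P.space_RT .
  show "act 1 t = t"
    by (rule P.tens_lin_eq[OF P.T_rvs act_T_lin lin_id(2) _ t]) (simp add: act_tens R_one)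
  show "act (a *\<^sub>R z) t = a \<odot>\<^bsub>space Q\<^esub> act z t"
    unfolding Q_eq P.space_RT
    by (rule P.tens_lin_eq[OF P.T_rvs act_T_lin lin_scale[OF P.T_rvs act_T_lin] _ t])
       (simp add: act_tens R_scale P.tens_smult_right)
  show "act (y + z) t = act y t \<oplus>\<^bsub>space Q\<^esub> act z t"
    unfolding Q_eq P.space_RT
    by (rule P.tens_lin_eq[OF P.T_rvs act_T_lin lin_oplus[OF P.T_rvs act_T_lin act_T_lin] _ t])
       (simp add: act_tens R_add P.tens_add_right)
  show "act (y * z) t = act z (act y t)"
    by (rule P.tens_lin_eq[OF P.T_rvs act_T_lin lin_compose[OF act_T_lin act_T_lin] _ t])
       (simp add: act_tens R_mult)
qed

end

text \<open>The module for \<open>n = 4\<close> with its left \<open>\<H>\<close>-action \<open>\<phi>\<close>; the anti-automorphism \<open>\<sigma>\<close>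
  makes a right action of it.\<close>

locale spinor4 = S: intertwiner_algebra 4 S \<phi> for S :: "'d rep" and \<phi> :: "quat \<Rightarrow> 'd \<Rightarrow> 'd" +
  fixes \<sigma> :: "quat \<Rightarrow> quat"
  assumes sigma: "anti_automorphism \<sigma>"
begin

abbreviation "M4 \<equiv> graded_by_volume 4 S"
abbreviation "rt \<equiv> \<lambda>q. \<phi> (\<sigma> q)"
abbreviation "spin8 \<equiv> S8 M4 rt \<phi>"
abbreviation "spin8k k \<equiv> S8k k M4 rt \<phi>"
abbreviation "spin8k4 k \<equiv> S8k_plus k 4 M4 rt \<phi> M4"
abbreviation "rtk k \<equiv> right_H_action k M4 rt \<phi>"

lemma M4_simps [simp]: "space M4 = S.V" "cmap M4 = cmap S" "parity M4 = volume 4 S"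
  by (simp_all add: graded_by_volume_def)

lemma volume_M4: "volume 4 M4 = volume 4 S"
  by (simp add: volume_def)

lemma M4: "graded_module 4 M4"
proof -
  have "clifford_map 4 M4"
    using S.clifford_map by (simp add: clifford_map_def clifford_condition_def)
  then show ?thesis by (simp add: volume_M4 graded_module_iff)
qed

lemma rt_algebra:
  assumes "s \<in> carrier S.V"
  shows "rt 1 s = s" "rt (a *\<^sub>R q) s = a \<odot>\<^bsub>S.V\<^esub> rt q s"
    "rt (p + q) s = rt p s \<oplus>\<^bsub>S.V\<^esub> rt q s" "rt (p * q) s = rt q (rt p s)"
  using sigma assms
  by (simp_all add: anti_automorphism_def linear_add linear_scale S.phi_algebra)

text \<open>By \<open>eigenline\<close>, the first generator of the second factor projects it onto a line over
  \<open>\<H>\<close>.\<close>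

lemma spin8: "graded_module 8 spin8" "irr 8 (space spin8) (\<lambda>i. cmap spin8 (unit_vec 8 i))"
proof -
  interpret M4: graded_module 4 M4 by (rule M4)
  have P: "rep_pair 4 4 M4 M4 rt \<phi>"
    by (intro rep_pair.intro M4 M4.clifford_module_axioms tensor_pair.intro rep_pair_axioms.intro)
       (simp_all add: S.c_phi)
  interpret P: rep_pair 4 4 M4 M4 rt \<phi> by (rule P)
  have "graded_module (4 + 4) spin8" unfolding S8_def by (rule graded_rep_tensor[OF P M4])
  then show "graded_module 8 spin8" by simp
  obtain s0 where s0: "s0 \<in> carrier S.V" "s0 \<noteq> \<zero>\<^bsub>S.V\<^esub>"
    and line: "\<forall>s\<in>carrier S.V. \<exists>q. (1 / 2) \<odot>\<^bsub>S.V\<^esub> (s \<oplus>\<^bsub>S.V\<^esub> 1 \<odot>\<^bsub>S.V\<^esub> S.gam 0 s) = \<phi> q s0"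
    using S.eigenline by auto
  have nz: "carrier P.T \<noteq> {\<zero>\<^bsub>P.T\<^esub>}"
  proof -
    obtain \<alpha> :: "'d \<Rightarrow> quat" where \<alpha>:
      "\<And>x y. x \<in> carrier S.V \<Longrightarrow> y \<in> carrier S.V \<Longrightarrow> \<alpha> (x \<oplus>\<^bsub>S.V\<^esub> y) = \<alpha> x + \<alpha> y"
      "\<And>a x. x \<in> carrier S.V \<Longrightarrow> \<alpha> (a \<odot>\<^bsub>S.V\<^esub> x) = a *\<^sub>R \<alpha> x"
      "\<And>q x. x \<in> carrier S.V \<Longrightarrow> \<alpha> (rt q x) = \<alpha> x * q" "\<alpha> s0 \<noteq> 0"
      by (rule right_quat_functional[OF S.V S.phi_lin rt_algebra(1,3,2,4) s0]) blast+
    obtain \<beta> :: "'d \<Rightarrow> quat" where \<beta>: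
      "\<And>x y. x \<in> carrier S.V \<Longrightarrow> y \<in> carrier S.V \<Longrightarrow> \<beta> (x \<oplus>\<^bsub>S.V\<^esub> y) = \<beta> x + \<beta> y"
      "\<And>a x. x \<in> carrier S.V \<Longrightarrow> \<beta> (a \<odot>\<^bsub>S.V\<^esub> x) = a *\<^sub>R \<beta> x"
      "\<And>q x. x \<in> carrier S.V \<Longrightarrow> \<beta> (\<phi> q x) = q * \<beta> x" "\<beta> s0 \<noteq> 0"
      by (rule left_quat_functional[OF S.V S.phi_lin S.phi_algebra(1,3,2,4) s0]) blast+
    show ?thesis
      by (rule P.carrier_nonzero_quat[of \<alpha> \<beta> s0 s0])
         (use s0 in \<open>simp_all add: \<alpha> \<beta> mult.assoc\<close>)
  qed
  have "irr (4 + 4) P.T P.R.gam"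
    by (rule P.irr_right[OF _ _ _ _ _ _ _ nz, of s0 1]) (use S.irr s0 line in simp_all)
  then show "irr 8 (space spin8) (\<lambda>i. cmap spin8 (unit_vec 8 i))" by (simp add: S8_def)
qed

lemma spin8k: "graded_module (8 * k) (spin8k k)"
    "irr (8 * k) (space (spin8k k)) (\<lambda>i. cmap (spin8k k) (unit_vec (8 * k) i))"
proof -
  interpret S8: graded_module 8 spin8 by (rule spin8)
  interpret P: rep_pow 8 k spin8
    by (intro rep_pow.intro spin8 tensor_pow.intro S8.V)
  show "graded_module (8 * k) (spin8k k)" unfolding S8k_def by (rule P.graded_RP)
  show "irr (8 * k) (space (spin8k k)) (\<lambda>i. cmap (spin8k k) (unit_vec (8 * k) i))"
    unfolding S8k_def using P.irr_power[OF refl spin8(2)] by simp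
qed

lemma spin8k_plus:
  assumes "clifford_module q N" "irr q (space N) (\<lambda>i. cmap N (unit_vec q i))"
  shows "irreducible_rep (8 * k + q) (S8k_plus k q M4 rt \<phi> N)"
  unfolding S8k_plus_def by (rule irreducible_tensor_left[OF spin8k(1) refl spin8k(2) assms])

lemma spin8k4: "graded_module (8 * k + 4) (spin8k4 k)"
    "irreducible_rep (8 * k + 4) (spin8k4 k)"
    "irr (8 * k + 4) (space (spin8k4 k)) (\<lambda>i. cmap (spin8k4 k) (unit_vec (8 * k + 4) i))"
proof -
  show "graded_module (8 * k + 4) (spin8k4 k)"
    unfolding S8k_plus_def by (rule graded_module_real[OF spin8k(1) M4])
  then interpret Q: graded_module "8 * k + 4" "spin8k4 k" .
  have "clifford_module 4 M4" using M4 by (simp add: graded_module_def)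
  then show "irreducible_rep (8 * k + 4) (spin8k4 k)"
    by (rule spin8k_plus) (simp add: S.irr)
  then show "irr (8 * k + 4) (space (spin8k4 k)) (\<lambda>i. cmap (spin8k4 k) (unit_vec (8 * k + 4) i))"
    unfolding Q.irreducible_iff .
qed

lemma rtk:
  shows rtk_lin: "lin (space (spin8k4 k)) (space (spin8k4 k)) (rtk k q)"
    and rtk_c: "v \<in> carrier_vec (8 * k + 4) \<Longrightarrow> t \<in> carrier (space (spin8k4 k)) \<Longrightarrow>
      cmap (spin8k4 k) v (rtk k q t) = rtk k q (cmap (spin8k4 k) v t)"
    and rtk_algebra: "t \<in> carrier (space (spin8k4 k)) \<Longrightarrow> rtk k 1 t = t"
      "t \<in> carrier (space (spin8k4 k)) \<Longrightarrow> rtk k (a *\<^sub>R q) t = a \<odot>\<^bsub>space (spin8k4 k)\<^esub> rtk k q t"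
      "t \<in> carrier (space (spin8k4 k)) \<Longrightarrow> rtk k (p + q) t = rtk k p t \<oplus>\<^bsub>space (spin8k4 k)\<^esub> rtk k q t"
      "t \<in> carrier (space (spin8k4 k)) \<Longrightarrow> rtk k (p * q) t = rtk k q (rtk k p t)"
proof -
  interpret M4: graded_module 4 M4 by (rule M4)
  have A: "right_action (8 * k) 4 (spin8k k) M4 rt"
  proof (intro right_action.intro right_action_axioms.intro rep_pair_real spin8k(1) M4.clifford_module_axioms)
    show "lin (space M4) (space M4) (rt q)" for q by (simp add: S.phi_lin)
  qed (simp_all add: S.c_phi rt_algebra)
  have Q: "rep_tensor_real (8 * k) 4 (spin8k k) M4 = spin8k4 k" by (simp add: S8k_plus_def)
  note fold = right_H_action_def Q[symmetric]
  show "lin (space (spin8k4 k)) (space (spin8k4 k)) (rtk k q)"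
    unfolding fold by (rule right_action.act_lin[OF A])
  show "rtk k 1 t = t" if "t \<in> carrier (space (spin8k4 k))"
    using that unfolding fold by (rule right_action.act_algebra[OF A])
  show "rtk k (a *\<^sub>R q) t = a \<odot>\<^bsub>space (spin8k4 k)\<^esub> rtk k q t" if "t \<in> carrier (space (spin8k4 k))"
    using that unfolding fold by (rule right_action.act_algebra[OF A])
  show "rtk k (p + q) t = rtk k p t \<oplus>\<^bsub>space (spin8k4 k)\<^esub> rtk k q t" if "t \<in> carrier (space (spin8k4 k))"
    using that unfolding fold by (rule right_action.act_algebra[OF A])
  show "rtk k (p * q) t = rtk k q (rtk k p t)" if "t \<in> carrier (space (spin8k4 k))"
    using that unfolding fold by (rule right_action.act_algebra[OF A])
  show "cmap (spin8k4 k) v (rtk k q t) = rtk k q (cmap (spin8k4 k) v t)"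
    if "v \<in> carrier_vec (8 * k + 4)" "t \<in> carrier (space (spin8k4 k))"
    using that unfolding fold by (rule right_action.act_c[OF A])
qed

text \<open>The intertwiner algebra of the second factor is \<open>\<real>\<close>, so its eigenline is a real line, as
  required for a tensor product over \<open>\<real>\<close>.\<close>

lemma spin8k6:
  fixes \<phi>2 :: "real \<Rightarrow> 'b \<Rightarrow> 'b"
  assumes "intertwiner_algebra 2 S2 \<phi>2"
  shows "irreducible_rep (8 * k + 4 + 2) (S8k4_plus k 2 M4 rt \<phi> (ungraded S2))"
proof -
  interpret S2: intertwiner_algebra 2 S2 \<phi>2 by fact
  interpret P: rep_pair "8 * k + 4" 2 "spin8k4 k" "ungraded S2" "smult (space (spin8k4 k))" "smult (space (ungraded S2))"
    by (rule rep_pair_real[OF spin8k4(1) clifford_module_ungraded[OF S2.clifford_module_axioms]])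
  have RT: "S8k4_plus k 2 M4 rt \<phi> (ungraded S2) = P.RT"
    by (simp add: S8k4_plus_def rep_tensor_real_def)
  obtain s0 where s0: "s0 \<in> carrier S2.V"
    and line: "\<forall>s\<in>carrier S2.V. \<exists>q. (1 / 2) \<odot>\<^bsub>S2.V\<^esub> (s \<oplus>\<^bsub>S2.V\<^esub> 1 \<odot>\<^bsub>S2.V\<^esub> S2.gam 0 s) = \<phi>2 q s0"
    using S2.eigenline by auto
  have phi: "\<phi>2 q s0 = q \<odot>\<^bsub>S2.V\<^esub> s0" for q
    using S2.phi_algebra(2)[OF s0, of q 1] S2.phi_algebra(1)[OF s0] by simp
  have irr2: "irr 2 (space (ungraded S2)) P.N.gam" using S2.irr by simp
  have nz: "carrier P.T \<noteq> {\<zero>\<^bsub>P.T\<^esub>}"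
    by (rule tensor_real_nonzero[OF P.M P.N irr_carrier[OF spin8k4(3)] irr_carrier[OF irr2]])
  have "irr (8 * k + 4 + 2) P.T P.R.gam"
    by (rule P.irr_right[OF spin8k4(3) irr2 _ _ _ _ _ nz, of s0 1]) (use s0 line phi in simp_all)
  then show ?thesis unfolding RT P.R.irreducible_iff P.space_RT .
qed

text \<open>The eigenline of the second factor is a line over its intertwiner algebra \<open>\<complex>\<close>, the algebra
  of the tensor product.\<close>

lemma spin8k7:
  fixes \<phi>3 :: "complex \<Rightarrow> 'c \<Rightarrow> 'c"
  assumes "intertwiner_algebra 3 S3 \<phi>3" and \<iota>: "real_algebra_hom \<iota>"
  shows "irreducible_rep (8 * k + 4 + 3) (S8k7 k M4 rt \<phi> \<iota> (ungraded S3) \<phi>3)"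
proof -
  interpret S3: intertwiner_algebra 3 S3 \<phi>3 by fact
  interpret Q: graded_module "8 * k + 4" "spin8k4 k" by (rule spin8k4)
  have P: "rep_pair (8 * k + 4) 3 (spin8k4 k) (ungraded S3) (\<lambda>z. rtk k (\<iota> z)) \<phi>3"
    by (intro rep_pair.intro spin8k4(1) clifford_module_ungraded[OF S3.clifford_module_axioms]
          tensor_pair.intro rep_pair_axioms.intro)
       (simp_all add: S3.c_phi rtk_c lin_closed[OF rtk_lin])
  interpret P: rep_pair "8 * k + 4" 3 "spin8k4 k" "ungraded S3" "\<lambda>z. rtk k (\<iota> z)" \<phi>3 by (rule P)
  have RT: "S8k7 k M4 rt \<phi> \<iota> (ungraded S3) \<phi>3 = P.RT" by (simp add: S8k7_def)
  obtain s0 where s0: "s0 \<in> carrier S3.V" "s0 \<noteq> \<zero>\<^bsub>S3.V\<^esub>"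
    and line: "\<forall>s\<in>carrier S3.V. \<exists>q. (1 / 2) \<odot>\<^bsub>S3.V\<^esub> (s \<oplus>\<^bsub>S3.V\<^esub> 1 \<odot>\<^bsub>S3.V\<^esub> S3.gam 0 s) = \<phi>3 q s0"
    using S3.eigenline by auto
  have irr3: "irr 3 (space (ungraded S3)) P.N.gam" using S3.irr by simp
  have nz: "carrier P.T \<noteq> {\<zero>\<^bsub>P.T\<^esub>}"
  proof -
    let ?Q = "space (spin8k4 k)"
    obtain t0 where t0: "t0 \<in> carrier ?Q" "t0 \<noteq> \<zero>\<^bsub>?Q\<^esub>" using irr_nonzero[OF spin8k4(3) Q.V] .
    obtain \<alpha> :: "_ \<Rightarrow> quat" where \<alpha>:
      "\<And>x y. x \<in> carrier ?Q \<Longrightarrow> y \<in> carrier ?Q \<Longrightarrow> \<alpha> (x \<oplus>\<^bsub>?Q\<^esub> y) = \<alpha> x + \<alpha> y"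
      "\<And>a x. x \<in> carrier ?Q \<Longrightarrow> \<alpha> (a \<odot>\<^bsub>?Q\<^esub> x) = a *\<^sub>R \<alpha> x"
      "\<And>q x. x \<in> carrier ?Q \<Longrightarrow> \<alpha> (rtk k q x) = \<alpha> x * q" "\<alpha> t0 \<noteq> 0"
      by (rule right_quat_functional[OF Q.V rtk_lin rtk_algebra(1,3,2,4) t0]) blast+
    obtain \<beta> :: "'c \<Rightarrow> quat" where \<beta>:
      "\<And>x y. x \<in> carrier S3.V \<Longrightarrow> y \<in> carrier S3.V \<Longrightarrow> \<beta> (x \<oplus>\<^bsub>S3.V\<^esub> y) = \<beta> x + \<beta> y"
      "\<And>a x. x \<in> carrier S3.V \<Longrightarrow> \<beta> (a \<odot>\<^bsub>S3.V\<^esub> x) = a *\<^sub>R \<beta> x"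
      "\<And>z x. x \<in> carrier S3.V \<Longrightarrow> \<beta> (\<phi>3 z x) = \<iota> z * \<beta> x" "\<exists>x\<in>carrier S3.V. \<beta> x \<noteq> 0"
      by (rule complex_quat_functional[OF S3.V S3.phi_lin S3.phi_algebra(1,3,2,4) \<iota> s0]) blast+
    obtain u where u: "u \<in> carrier S3.V" "\<beta> u \<noteq> 0" using \<beta>(4) by blast
    show ?thesis
      by (rule P.carrier_nonzero_quat[of \<alpha> \<beta> t0 u])
         (use t0 u in \<open>simp_all add: \<alpha> \<beta> mult.assoc\<close>)
  qed
  have "irr (8 * k + 4 + 3) P.T P.R.gam"
    by (rule P.irr_right[OF spin8k4(3) irr3 _ _ _ _ _ nz, of s0 1]) (use s0 line in simp_all)
  then show ?thesis unfolding RT P.R.irreducible_iff P.space_RT .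
qed

end

lemma intertwiner_algebraI:
  assumes "irreducible_rep n S" "intertwiner_algebra_iso n S \<phi>"
  shows "intertwiner_algebra n S \<phi>"
proof -
  interpret clifford_module n S by (rule irreducible_rep_clifford[OF assms(1)])
  show ?thesis
    by (intro intertwiner_algebra.intro clifford_module_axioms intertwiner_algebra_axioms.intro assms(2))
       (use assms(1) irreducible_iff in simp)
qed

lemma graded_irreducible:
  assumes "graded_module n Q" "irr n (space Q) (\<lambda>i. cmap Q (unit_vec n i))"
  shows "irreducible_rep n Q"
proof -
  interpret graded_module n Q by (rule assms)
  show ?thesis using assms(2) irreducible_iff by simp
qed

theorem mainTheorem12:
  fixes S1 :: "'a rep" and S2 :: "'b rep" and S3 :: "'c rep" and S4 :: "'d rep"
    and \<phi>1 :: "real \<Rightarrow> 'a \<Rightarrow> 'a" and \<phi>2 :: "real \<Rightarrow> 'b \<Rightarrow> 'b"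
    and \<phi>3 :: "complex \<Rightarrow> 'c \<Rightarrow> 'c" and \<phi>4 :: "quat \<Rightarrow> 'd \<Rightarrow> 'd"
    and \<sigma> :: "quat \<Rightarrow> quat" and \<iota> :: "complex \<Rightarrow> quat"
  assumes "irreducible_rep 1 S1" "irreducible_rep 2 S2"
    and "irreducible_rep 3 S3" "irreducible_rep 4 S4"
    and "intertwiner_algebra_iso 1 S1 \<phi>1" "intertwiner_algebra_iso 2 S2 \<phi>2"
    and "intertwiner_algebra_iso 3 S3 \<phi>3" "intertwiner_algebra_iso 4 S4 \<phi>4"
    and "anti_automorphism \<sigma>" and "real_algebra_hom \<iota>"
  shows
    "let M = graded_by_volume 4 S4; r = (\<lambda>q. \<phi>4 (\<sigma> q)); l = \<phi>4;
         S8k1 = (\<lambda>k N. S8k_plus k 1 M r l (ungraded N));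
         S8k5 = (\<lambda>k N. S8k4_plus k 1 M r l (ungraded N))
     in irreducible_rep 8 (S8 M r l) \<and>
       (\<forall>k\<ge>1. irreducible_rep (8 * k) (S8k k M r l)) \<and>
       (\<forall>k.
         irreducible_rep (8 * k + 1) (S8k1 k S1) \<and>
         irreducible_rep (8 * k + 2) (S8k_plus k 2 M r l (ungraded S2)) \<and>
         irreducible_rep (8 * k + 3) (S8k_plus k 3 M r l (ungraded S3)) \<and>
         irreducible_rep (8 * k + 4) (S8k_plus k 4 M r l M) \<and>
         irreducible_rep (8 * k + 5) (S8k5 k S1) \<and>
         irreducible_rep (8 * k + 6) (S8k4_plus k 2 M r l (ungraded S2)) \<and>
         irreducible_rep (8 * k + 7) (S8k7 k M r l \<iota> (ungraded S3) \<phi>3)) \<and>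
       (\<forall>k.
         irreducible_rep (8 * k + 1) (S8k1 k (neg_rep S1)) \<and>
         \<not> isomorphic_reps (8 * k + 1) (S8k1 k (neg_rep S1)) (S8k1 k S1) \<and>
         (\<forall>N :: 't rep. irreducible_rep (8 * k + 1) N \<longrightarrow>
           isomorphic_reps (8 * k + 1) N (S8k1 k S1) \<or>
           isomorphic_reps (8 * k + 1) N (S8k1 k (neg_rep S1))) \<and>
         irreducible_rep (8 * k + 5) (S8k5 k (neg_rep S1)) \<and>
         \<not> isomorphic_reps (8 * k + 5) (S8k5 k (neg_rep S1)) (S8k5 k S1) \<and>
         (\<forall>N :: 't rep. irreducible_rep (8 * k + 5) N \<longrightarrow>
           isomorphic_reps (8 * k + 5) N (S8k5 k S1) \<or>
           isomorphic_reps (8 * k + 5) N (S8k5 k (neg_rep S1))))"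
proof -
  have A2: "intertwiner_algebra 2 S2 \<phi>2" and A3: "intertwiner_algebra 3 S3 \<phi>3"
    and A4: "intertwiner_algebra 4 S4 \<phi>4"
    by (rule intertwiner_algebraI; fact)+
  interpret A2: intertwiner_algebra 2 S2 \<phi>2 by (rule A2)
  interpret A3: intertwiner_algebra 3 S3 \<phi>3 by (rule A3)
  interpret A4: spinor4 S4 \<phi>4 \<sigma>
    by (intro spinor4.intro A4 spinor4_axioms.intro assms(9))
  let ?M = "graded_by_volume 4 S4" and ?r = "\<lambda>q. \<phi>4 (\<sigma> q)"
  have five: "8 * k + 4 + 1 = 8 * k + 5" and six: "8 * k + 4 + 2 = 8 * k + 6"
    and seven: "8 * k + 4 + 3 = 8 * k + 7" for k :: nat by simp_all
  have i8: "irreducible_rep 8 (S8 ?M ?r \<phi>4)" by (rule graded_irreducible[OF A4.spin8])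
  have i8k: "irreducible_rep (8 * k) (S8k k ?M ?r \<phi>4)" for k by (rule graded_irreducible[OF A4.spin8k])
  have i2: "irreducible_rep (8 * k + 2) (S8k_plus k 2 ?M ?r \<phi>4 (ungraded S2))" for k
    by (rule A4.spin8k_plus[OF clifford_module_ungraded[OF A2.clifford_module_axioms]]) (simp add: A2.irr)
  have i3: "irreducible_rep (8 * k + 3) (S8k_plus k 3 ?M ?r \<phi>4 (ungraded S3))" for k
    by (rule A4.spin8k_plus[OF clifford_module_ungraded[OF A3.clifford_module_axioms]]) (simp add: A3.irr)
  have i4: "irreducible_rep (8 * k + 4) (S8k_plus k 4 ?M ?r \<phi>4 ?M)" for k
    by (rule A4.spin8k4(2))
  have i6: "irreducible_rep (8 * k + 6) (S8k4_plus k 2 ?M ?r \<phi>4 (ungraded S2))" for k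
    using A4.spin8k6[OF A2, of k] unfolding six .
  have i7: "irreducible_rep (8 * k + 7) (S8k7 k ?M ?r \<phi>4 \<iota> (ungraded S3) \<phi>3)" for k
    using A4.spin8k7[OF A3 assms(10), of k] unfolding seven .
  note i1 = two_irreducibles[OF A4.spin8k disjI1[OF refl] assms(1), folded S8k_plus_def]
  note i5 = two_irreducibles[OF A4.spin8k4(1,3) disjI2[OF refl] assms(1), folded S8k4_plus_def]
  show ?thesis
    unfolding Let_def
    by (intro conjI allI impI i8 i8k i1 i2 i3 i4 i5[unfolded five] i6 i7)
qed

end
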